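(* Let $\mathcal P=\langle S\mid r_1,r_2,\dots\rangle$ be a $C'(\frac1{24})$ presentation defining a group $G$. Then $\mathcal{TC}(\mathcal P)\subset\mathcal H(G)$. Moreover, if $\mathcal P$ is uniformly power-free, then $\mathcal{TC}(\mathcal P)\subset\mathcal{AH}(G)$.
   Context: Small cancellation. $S$ is a set (not necessarily finite), $F(S)$ the free group on $S$, $R=\{r_1,r_2,\dots\}\subset F(S)$ a (finite or countably infinite) set of cyclically reduced words, and $G=F(S)/\langle\!\langle R\rangle\!\rangle$. It is assumed that every $s\in S$ appears in some $r_i$. Let $\overline R$ be the set of all reduced cyclic conjugates of the $r_i$ and of their inverses. A word $u$ is an initial subword of $r$ if $r=ut$ with $|r|_S=|u|_S+|t|_S$. A piece is a word which is an initial subword of at least two distinct elements of $\overline R$. $\mathcal P$ is $C'(\lambda)$ if $|u|_S<\lambda|r|_S$ whenever a piece $u$ is an initial subword of $r\in\overline R$. Generating sets. For generating sets $X,Y$ of $G$ (possibly infinite; word lengths $|\cdot|_X$ are taken with respect to $X\cup X^{-1}$), $X\preceq Y$ means $\sup_{y\in Y}|y|_X<\infty$; $X\sim Y$ means $X\preceq Y$ and $Y\preceq X$; $[X]$ is the equivalence class, and $\preceq$ induces a partial order on classes. $\Gamma(G,X)$ is the Cayley graph with respect to $X$. $\mathcal H(G)$ is the set of classes $[X]$ such that $\Gamma(G,X)$ is (Gromov) hyperbolic, and $\mathcal{AH}(G)$ is the set of $[X]\in\mathcal H(G)$ such that the action of $G$ on $\Gamma(G,X)$ is acylindrical. An isometric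 action of $G$ on a metric space $Z$ is acylindrical if for every $\varepsilon>0$ there are $M,N\ge0$ such that for all $x,y\in Z$ with $d(x,y)\ge M$ at most $N$ elements $g\in G$ satisfy $d(x,gx)\le\varepsilon$ and $d(y,gy)\le\varepsilon$. Thin cones. $L\subset F(S)$ is the union of $S$ and the set of all initial subwords of elements of $\overline R$. $P^4$ is the set of words in $L$ which are a product of at most 4 pieces. For each $i$ let $C_i$ be an oriented cycle of length $|r_i|_S$ labelled by $r_i$. For a subset $X$ with $S\cup P^4\subseteq X\subseteq L$ let $X_i$ be the set of elements of $X$ which are subwords of cyclic conjugates of $r_i^{\pm1}$, and let $C_i^X$ be the graph obtained from $C_i$ by adding, for each $x\in X_i^{\pm1}$, an edge between the initial and terminal vertices of every subpath of $C_i$ labelled by $x$. The poset of thin cones $\mathcal{TC}(\mathcal P)$ is the set of classes $[X]$ of generating sets of $G$ having a representative (the image in $G$ of) $X$ with $S\cup P^4\subseteq X\subseteq L$ such that there is a constant $\delta\ge0$ for which every $C_i^X$ is $\delta$-hyperbolic; it is ordered by $\preceq$. $\mathcal P$ is uniformly power-free if there is some $n$ such that $x^n\notin L$ for all $x\in F(S)\setminus\{1\}$. *)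

theory Defs
  imports
    "HOL-Algebra.Generated_Groups"
    "HOL-Library.Sublist"
    "HOL-Library.Countable_Set"
    "HOL-Library.Extended_Nat"
    "Graph_Theory.Digraph"
begin

section \<open>Free groups and presentations\<close>

text \<open>The letter \<open>(s, True)\<close> stands for the generator \<open>s\<close>, the letter \<open>(s, False)\<close> for its
  inverse.  Elements of the free group are the reduced words, so the word length on the free
  group with respect to its basis is \<^term>\<open>length\<close>.\<close>

type_synonym 's word = "('s \<times> bool) list"

fun linv :: "'s \<times> bool \<Rightarrow> 's \<times> bool" where
  "linv (s, b) = (s, \<not> b)"

definition winv :: "'s word \<Rightarrow> 's word" where
  "winv w = map linv (rev w)"

definition reduced :: "'s word \<Rightarrow> bool" where
  "reduced w \<longleftrightarrow> successively (\<lambda>a b. b \<noteq> linv a) w"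

fun cancel_cons :: "'s \<times> bool \<Rightarrow> 's word \<Rightarrow> 's word" where
  "cancel_cons a [] = [a]"
| "cancel_cons a (b # w) = (if b = linv a then w else a # b # w)"

definition reduce :: "'s word \<Rightarrow> 's word" where
  "reduce w = foldr cancel_cons w []"

definition free_group :: "'s set \<Rightarrow> 's word monoid" where
  "free_group S =
     \<lparr>carrier = {w. reduced w \<and> fst ` set w \<subseteq> S}, monoid.mult = (\<lambda>u v. reduce (u @ v)), one = []\<rparr>"

definition cyclically_reduced :: "'s word \<Rightarrow> bool" where
  "cyclically_reduced w \<longleftrightarrow> reduced w \<and> (w \<noteq> [] \<longrightarrow> hd w \<noteq> linv (last w))"

definition presentation :: "'s set \<Rightarrow> 's word set \<Rightarrow> bool" where
  "presentation S R \<longleftrightarrow>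
     R \<subseteq> carrier (free_group S) \<and> countable R \<and> (\<forall>r\<in>R. cyclically_reduced r) \<and>
     (\<forall>s\<in>S. \<exists>r\<in>R. s \<in> fst ` set r)"

definition normal_closure :: "('g, 'b) monoid_scheme \<Rightarrow> 'g set \<Rightarrow> 'g set" where
  "normal_closure G A = (\<lambda>N. N \<lhd> G) hull A"

definition presented_group :: "'s set \<Rightarrow> 's word set \<Rightarrow> 's word set monoid" where
  "presented_group S R = free_group S Mod normal_closure (free_group S) R"

definition word_image :: "'s set \<Rightarrow> 's word set \<Rightarrow> 's word \<Rightarrow> 's word set" where
  "word_image S R w = normal_closure (free_group S) R #>\<^bsub>free_group S\<^esub> w"

subsection \<open>The free group is a group\<close>

lemma linv_linv [simp]: "linv (linv a) = a"
  by (cases a) auto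

lemma linv_neq [simp]: "linv a \<noteq> a" "a \<noteq> linv a"
  by (cases a; auto)+

lemma reduced_Nil [simp]: "reduced []"
  by (simp add: reduced_def)

lemma reduced_Cons: "reduced (a # w) \<longleftrightarrow> reduced w \<and> (w = [] \<or> hd w \<noteq> linv a)"
  by (cases w) (auto simp: reduced_def)

lemma reduced_cancel_cons [simp]: "reduced w \<Longrightarrow> reduced (cancel_cons a w)"
  by (cases w) (auto simp: reduced_Cons)

lemma cancel_cons_linv: "reduced w \<Longrightarrow> cancel_cons (linv a) (cancel_cons a w) = w"
  by (cases w; cases "tl w") (auto simp: reduced_Cons)

lemma reduced_foldr [simp]: "reduced w \<Longrightarrow> reduced (foldr cancel_cons u w)"
  by (induction u) auto

lemma foldr_cancel_cons:
  "reduced w \<Longrightarrow> foldr cancel_cons (cancel_cons a u) w = cancel_cons a (foldr cancel_cons u w)"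
  by (cases u) (auto simp: cancel_cons_linv[of _ "linv a", simplified])

lemma reduced_reduce [simp]: "reduced (reduce w)"
  by (simp add: reduce_def)

lemma foldr_reduce: "reduced w \<Longrightarrow> foldr cancel_cons (reduce u) w = foldr cancel_cons u w"
  unfolding reduce_def by (induction u) (auto simp: foldr_cancel_cons)

lemma reduce_reduced: "reduced w \<Longrightarrow> reduce w = w"
proof (induction w)
  case (Cons a w)
  then show ?case by (cases w) (auto simp: reduce_def reduced_Cons)
qed (simp add: reduce_def)

lemma set_reduce: "set (reduce w) \<subseteq> set w"
proof (induction w)
  case (Cons a w)
  have "set (cancel_cons a v) \<subseteq> insert a (set v)" for v
    by (cases v) auto
  with Cons show ?case by (fastforce simp: reduce_def)
qed (simp add: reduce_def)

lemma reduce_append: "reduce (u @ v) = foldr cancel_cons u (reduce v)"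
  by (simp add: reduce_def)

lemma reduce_append_reduce:
  "reduce (reduce u @ v) = reduce (u @ v)" "reduce (u @ reduce v) = reduce (u @ v)"
  by (simp_all add: reduce_append foldr_reduce reduce_reduced)

lemma reduced_winv: "reduced w \<Longrightarrow> reduced (winv w)"
  by (auto simp: reduced_def winv_def successively_map intro: successively_mono)

lemma reduce_winv: "reduce (winv w @ w) = []"
proof (induction w)
  case (Cons a w)
  have "reduce (winv (a # w) @ a # w) =
      foldr cancel_cons (winv w) (cancel_cons (linv a) (cancel_cons a (reduce w)))"
    by (simp add: winv_def reduce_def)
  with Cons show ?case by (simp add: cancel_cons_linv reduce_append)
qed (simp add: winv_def reduce_def)

lemma group_free_group: "group (free_group S)"
proof (rule groupI)
  fix u v assume uv: "u \<in> carrier (free_group S)" "v \<in> carrier (free_group S)"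
  then show "u \<otimes>\<^bsub>free_group S\<^esub> v \<in> carrier (free_group S)"
    using set_reduce[of "u @ v"] by (fastforce simp: free_group_def)
  fix w assume "w \<in> carrier (free_group S)"
  with uv show "(u \<otimes>\<^bsub>free_group S\<^esub> v) \<otimes>\<^bsub>free_group S\<^esub> w =
      u \<otimes>\<^bsub>free_group S\<^esub> (v \<otimes>\<^bsub>free_group S\<^esub> w)"
    by (simp add: free_group_def reduce_append_reduce)
next
  fix u assume u: "u \<in> carrier (free_group S)"
  have [simp]: "fst (linv a) = fst a" for a :: "'a \<times> bool"
    by (cases a) auto
  from u have "winv u \<in> carrier (free_group S)"
    using reduced_winv[of u] by (auto simp: free_group_def winv_def image_image)
  then show "\<exists>v\<in>carrier (free_group S). v \<otimes>\<^bsub>free_group S\<^esub> u = \<one>\<^bsub>free_group S\<^esub>"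
    by (intro bexI[of _ "winv u"]) (auto simp: free_group_def reduce_winv)
qed (auto simp: free_group_def reduce_reduced)

section \<open>Small cancellation\<close>

definition sym_relators :: "'s word set \<Rightarrow> 's word set" where
  "sym_relators R = {w. reduced w \<and> (\<exists>r\<in>R. \<exists>k. w = rotate k r \<or> w = rotate k (winv r))}"

definition initial_subword :: "'s set \<Rightarrow> 's word \<Rightarrow> 's word \<Rightarrow> bool" where
  "initial_subword S u r \<longleftrightarrow>
     u \<in> carrier (free_group S) \<and>
     (\<exists>t\<in>carrier (free_group S). r = u \<otimes>\<^bsub>free_group S\<^esub> t \<and> length r = length u + length t)"

definition piece :: "'s set \<Rightarrow> 's word set \<Rightarrow> 's word \<Rightarrow> bool" where
  "piece S R u \<longleftrightarrow>
     (\<exists>r\<in>sym_relators R. \<exists>r'\<in>sym_relators R. r \<noteq> r' \<and> initial_subword S u r \<and> initial_subword S u r')"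

definition small_cancellation :: "'s set \<Rightarrow> 's word set \<Rightarrow> real \<Rightarrow> bool" where
  "small_cancellation S R c \<longleftrightarrow>
     (\<forall>u. \<forall>r\<in>sym_relators R.
        piece S R u \<and> initial_subword S u r \<longrightarrow> real (length u) < c * real (length r))"

definition basis_words :: "'s set \<Rightarrow> 's word set" where
  "basis_words S = {[(s, True)] | s. s \<in> S}"

definition rel_prefixes :: "'s set \<Rightarrow> 's word set \<Rightarrow> 's word set" where
  "rel_prefixes S R = basis_words S \<union> {u. \<exists>r\<in>sym_relators R. initial_subword S u r}"

definition four_pieces :: "'s set \<Rightarrow> 's word set \<Rightarrow> 's word set" where
  "four_pieces S R =
     {w \<in> rel_prefixes S R. \<exists>us. length us \<le> 4 \<and> (\<forall>u\<in>set us. piece S R u) \<and>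
        w = foldr (\<otimes>\<^bsub>free_group S\<^esub>) us \<one>\<^bsub>free_group S\<^esub>}"

definition uniformly_power_free :: "'s set \<Rightarrow> 's word set \<Rightarrow> bool" where
  "uniformly_power_free S R \<longleftrightarrow>
     (\<exists>n::nat. \<forall>x\<in>carrier (free_group S) - {\<one>\<^bsub>free_group S\<^esub>}.
        x [^]\<^bsub>free_group S\<^esub> n \<notin> rel_prefixes S R)"

section \<open>Graphs as metric spaces\<close>

text \<open>Graphs are undirected multigraphs, with loops allowed: each arc of the \<^typ>\<open>('v, 'e) pre_digraph\<close>
  is one edge, which may be traversed in both directions.\<close>

definition vertex_dist :: "('v, 'e) pre_digraph \<Rightarrow> 'v \<Rightarrow> 'v \<Rightarrow> nat" where
  "vertex_dist \<Gamma> u v = (LEAST n. (u, v) \<in> (arcs_ends \<Gamma> \<union> (arcs_ends \<Gamma>)\<inverse>) ^^ n)"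

text \<open>Geometric realization with edges of length 1: \<open>Inner e t\<close> with \<open>0 < t < 1\<close> is the
  point of the edge \<open>e\<close> at distance \<open>t\<close> from the tail of \<open>e\<close>, measured along \<open>e\<close>.\<close>

datatype ('v, 'e) gpoint = Vertex 'v | Inner 'e real

definition realization :: "('v, 'e) pre_digraph \<Rightarrow> ('v, 'e) gpoint set" where
  "realization \<Gamma> = Vertex ` verts \<Gamma> \<union> {Inner e t | e t. e \<in> arcs \<Gamma> \<and> 0 < t \<and> t < 1}"

fun exits :: "('v, 'e) pre_digraph \<Rightarrow> ('v, 'e) gpoint \<Rightarrow> ('v \<times> real) set" where
  "exits \<Gamma> (Vertex v) = {(v, 0)}"
| "exits \<Gamma> (Inner e t) = {(tail \<Gamma> e, t), (head \<Gamma> e, 1 - t)}"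

fun direct_lengths :: "('v, 'e) gpoint \<Rightarrow> ('v, 'e) gpoint \<Rightarrow> real set" where
  "direct_lengths (Inner e s) (Inner f t) = (if e = f then {\<bar>s - t\<bar>} else {})"
| "direct_lengths p q = {}"

text \<open>The path metric of a connected graph: a shortest path either stays inside one edge or runs
  through vertices \<open>u\<close> and \<open>v\<close>, where \<open>u\<close> is an endpoint of the edge of \<open>p\<close> (or is \<open>p\<close>)
  and \<open>v\<close> is an endpoint of the edge of \<open>q\<close> (or is \<open>q\<close>).\<close>

definition graph_dist :: "('v, 'e) pre_digraph \<Rightarrow> ('v, 'e) gpoint \<Rightarrow> ('v, 'e) gpoint \<Rightarrow> real" where
  "graph_dist \<Gamma> p q =
     Min (direct_lengths p q \<union>
          {a + real (vertex_dist \<Gamma> u v) + b | u a v b. (u, a) \<in> exits \<Gamma> p \<and> (v, b) \<in> exits \<Gamma> q})"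

definition gromov_product :: "('p \<Rightarrow> 'p \<Rightarrow> real) \<Rightarrow> 'p \<Rightarrow> 'p \<Rightarrow> 'p \<Rightarrow> real" where
  "gromov_product d w x y = (d x w + d y w - d x y) / 2"

definition delta_hyperbolic :: "real \<Rightarrow> 'p set \<Rightarrow> ('p \<Rightarrow> 'p \<Rightarrow> real) \<Rightarrow> bool" where
  "delta_hyperbolic \<delta> Z d \<longleftrightarrow>
     (\<forall>w\<in>Z. \<forall>x\<in>Z. \<forall>y\<in>Z. \<forall>z\<in>Z.
        gromov_product d w x z \<ge> min (gromov_product d w x y) (gromov_product d w y z) - \<delta>)"

definition hyperbolic :: "'p set \<Rightarrow> ('p \<Rightarrow> 'p \<Rightarrow> real) \<Rightarrow> bool" where
  "hyperbolic Z d \<longleftrightarrow> (\<exists>\<delta>\<ge>0. delta_hyperbolic \<delta> Z d)"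

definition acylindrical ::
  "('g, 'b) monoid_scheme \<Rightarrow> ('g \<Rightarrow> 'p \<Rightarrow> 'p) \<Rightarrow> 'p set \<Rightarrow> ('p \<Rightarrow> 'p \<Rightarrow> real) \<Rightarrow> bool" where
  "acylindrical G \<phi> Z d \<longleftrightarrow>
     (\<forall>\<epsilon>>0. \<exists>M\<ge>0. \<exists>N::nat. \<forall>x\<in>Z. \<forall>y\<in>Z. d x y \<ge> M \<longrightarrow>
        finite {g \<in> carrier G. d x (\<phi> g x) \<le> \<epsilon> \<and> d y (\<phi> g y) \<le> \<epsilon>} \<and>
        card {g \<in> carrier G. d x (\<phi> g x) \<le> \<epsilon> \<and> d y (\<phi> g y) \<le> \<epsilon>} \<le> N)"

section \<open>Hyperbolic and acylindrically hyperbolic structures\<close>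

definition generating_set :: "('g, 'b) monoid_scheme \<Rightarrow> 'g set \<Rightarrow> bool" where
  "generating_set G X \<longleftrightarrow> X \<subseteq> carrier G \<and> generate G X = carrier G"

definition word_length :: "('g, 'b) monoid_scheme \<Rightarrow> 'g set \<Rightarrow> 'g \<Rightarrow> enat" where
  "word_length G X g =
     Inf {enat (length xs) | xs.
            set xs \<subseteq> X \<union> m_inv G ` X \<and> foldr (\<otimes>\<^bsub>G\<^esub>) xs \<one>\<^bsub>G\<^esub> = g}"

definition gen_le :: "('g, 'b) monoid_scheme \<Rightarrow> 'g set \<Rightarrow> 'g set \<Rightarrow> bool" where
  "gen_le G X Y \<longleftrightarrow> (SUP y\<in>Y. word_length G X y) < \<infinity>"

definition gen_class :: "('g, 'b) monoid_scheme \<Rightarrow> 'g set \<Rightarrow> 'g set set" where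
  "gen_class G X = {Y. generating_set G Y \<and> gen_le G X Y \<and> gen_le G Y X}"

definition cayley_graph :: "('g, 'b) monoid_scheme \<Rightarrow> 'g set \<Rightarrow> ('g, 'g \<times> 'g) pre_digraph" where
  "cayley_graph G X =
     \<lparr>verts = carrier G, arcs = carrier G \<times> X, tail = fst, head = (\<lambda>(g, x). g \<otimes>\<^bsub>G\<^esub> x)\<rparr>"

fun cayley_action ::
  "('g, 'b) monoid_scheme \<Rightarrow> 'g \<Rightarrow> ('g, 'g \<times> 'g) gpoint \<Rightarrow> ('g, 'g \<times> 'g) gpoint" where
  "cayley_action G g (Vertex h) = Vertex (g \<otimes>\<^bsub>G\<^esub> h)"
| "cayley_action G g (Inner (h, x) t) = Inner (g \<otimes>\<^bsub>G\<^esub> h, x) t"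

definition hyperbolic_cayley :: "('g, 'b) monoid_scheme \<Rightarrow> 'g set \<Rightarrow> bool" where
  "hyperbolic_cayley G X \<longleftrightarrow>
     hyperbolic (realization (cayley_graph G X)) (graph_dist (cayley_graph G X))"

definition acylindrical_cayley :: "('g, 'b) monoid_scheme \<Rightarrow> 'g set \<Rightarrow> bool" where
  "acylindrical_cayley G X \<longleftrightarrow>
     acylindrical G (cayley_action G) (realization (cayley_graph G X)) (graph_dist (cayley_graph G X))"

definition hyperbolic_structures :: "('g, 'b) monoid_scheme \<Rightarrow> 'g set set set" where
  "hyperbolic_structures G =
     {gen_class G X | X. generating_set G X \<and> hyperbolic_cayley G X}"

definition acyl_hyperbolic_structures :: "('g, 'b) monoid_scheme \<Rightarrow> 'g set set set" where
  "acyl_hyperbolic_structures G =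
     {gen_class G X | X. generating_set G X \<and> hyperbolic_cayley G X \<and> acylindrical_cayley G X}"

section \<open>Thin cones\<close>

text \<open>The cycle labelled by \<open>r\<close> has vertices \<open>0, \<dots>, length r - 1\<close>, and its edge from \<open>j\<close> to
  \<open>(j + 1) mod length r\<close> is labelled by \<open>r ! j\<close>; traversed backwards, it reads the inverse letter.
  \<open>subpath r j x k\<close>: some path in the cycle from \<open>j\<close> to \<open>k\<close> is labelled by \<open>x\<close>.\<close>

definition cycle_step :: "'s word \<Rightarrow> nat \<Rightarrow> 's \<times> bool \<Rightarrow> nat \<Rightarrow> bool" where
  "cycle_step r j a k \<longleftrightarrow>
     j < length r \<and> k < length r \<and>
     (k = Suc j mod length r \<and> a = r ! j \<or> j = Suc k mod length r \<and> a = linv (r ! k))"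

fun subpath :: "'s word \<Rightarrow> nat \<Rightarrow> 's word \<Rightarrow> nat \<Rightarrow> bool" where
  "subpath r j [] k \<longleftrightarrow> j < length r \<and> k = j"
| "subpath r j (a # x) k \<longleftrightarrow> (\<exists>l. cycle_step r j a l \<and> subpath r l x k)"

definition relator_subwords :: "'s word set \<Rightarrow> 's word \<Rightarrow> 's word set" where
  "relator_subwords X r = {x \<in> X. \<exists>k. sublist x (rotate k r) \<or> sublist x (rotate k (winv r))}"

text \<open>\<open>Inl j\<close> is the edge of the original cycle starting at \<open>j\<close>; \<open>Inr (j, x, k)\<close> is the edge added
  for a subpath from \<open>j\<close> to \<open>k\<close> labelled by \<open>x\<close>.\<close>

definition cone_graph ::
  "'s word set \<Rightarrow> 's word \<Rightarrow> (nat, nat + nat \<times> 's word \<times> nat) pre_digraph" where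
  "cone_graph X r =
     \<lparr>verts = {..<length r},
      arcs = Inl ` {..<length r} \<union>
        Inr ` {(j, x, k). x \<in> relator_subwords X r \<union> winv ` relator_subwords X r \<and> subpath r j x k},
      tail = case_sum (\<lambda>j. j) (\<lambda>(j, x, k). j),
      head = case_sum (\<lambda>j. Suc j mod length r) (\<lambda>(j, x, k). k)\<rparr>"

definition thin_cones :: "'s set \<Rightarrow> 's word set \<Rightarrow> 's word set set set set" where
  "thin_cones S R =
     {gen_class (presented_group S R) (word_image S R ` X) | X.
        basis_words S \<union> four_pieces S R \<subseteq> X \<and> X \<subseteq> rel_prefixes S R \<and>
        (\<exists>\<delta>\<ge>0. \<forall>r\<in>R. delta_hyperbolic \<delta> (realization (cone_graph X r)) (graph_dist (cone_graph X r)))}"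

end

theory Submission
  imports Defs
begin

text \<open>
  Everything rests on one consequence of the cancellation hypothesis, Greendlinger's lemma: a
  nonempty reduced word which is trivial in the group contains more than 7/8 of a relator.  It is
  obtained without diagrams, by building a labelled graph in stages: wherever a relator cannot be
  read yet, an arc that closes it up is attached, and a reduced path that leaves a stage and
  returns to it has to run along most of a relator.

  A closed path composed of arcs of translated relator cycles can be contracted by repeatedly
  replacing several arcs on one cycle by a single one.  Hence the value of a cochain on such a path
  is bounded linearly in the number of arcs as soon as the cochain is controlled on each single
  cycle and does not distinguish two cycles along a common piece.  For cochains which are small on
  the short loops of the Cayley graph, the control on single cycles is the hyperbolicity of the
  cones.  The resulting linear isoperimetric inequality makes geodesic triangles thin.

  For acylindricity, write \<open>h\<close> as a product of as few arcs as possible.  If \<open>g\<close> moves both \<open>1\<close> and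
  \<open>h\<close> by a bounded amount, then \<open>g\<close> maps the cycle of one arc to the cycle of another one, or the
  two translates of the word of \<open>h\<close> coincide except near their ends.  Power-freeness bounds the
  number of \<open>g\<close> of both kinds: too many of them would produce a periodic subword of a relator.  A
  word with few arcs contains an arc that is long in the Cayley graph, and the cochain given by the
  distance from one of its ends shows that \<open>g\<close> is of the first kind.
\<close>

section \<open>Greendlinger's lemma\<close>

text \<open>There may be infinitely many relators of unbounded length, and a generator may stand for
  a long part of a relator. Hence neither letters nor areas are usable measures, and everything is
  counted in arcs: words of at most half a relator, however long. The linear inequality is used in
  dual form. Instead of filling a loop one bounds an antisymmetric function of steps on it, and
  gluing cycles along a piece then only means that the function takes the same value there. The
  hyperbolicity of a cone enters as the same inequality for steps inside one cycle. The constant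
  1/24 is spent several times. A relator that does not close can be read along at most two pieces,
  so new arcs exceed 22/24, and a path can turn off an arc only within one more piece: 21/24 = 7/8.
  In a product of as few arcs as possible, half a relator and a piece at each end give at most
  14/24. These two numbers leave a margin of 7/24, from which the thresholds 1/6 = 4/24 and 1/8 =
  3/24 of the acylindricity proof are taken.\<close>

lemma winv_Nil [simp]: "winv [] = []" by (simp add: winv_def)
lemma winv_append: "winv (u @ v) = winv v @ winv u" by (simp add: winv_def)
lemma winv_Cons: "winv (a # u) = winv u @ [linv a]" by (simp add: winv_def)
lemma winv_winv [simp]: "winv (winv u) = u" by (simp add: winv_def rev_map[symmetric] map_idI)
lemma length_winv [simp]: "length (winv u) = length u" by (simp add: winv_def)
lemma winv_eq_Nil [simp]: "winv u = [] \<longleftrightarrow> u = []" by (simp add: winv_def)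

lemma nth_winv: "i < length u \<Longrightarrow> winv u ! i = linv (u ! (length u - Suc i))"
  by (simp add: winv_def rev_nth)

lemma hd_winv: "u \<noteq> [] \<Longrightarrow> hd (winv u) = linv (last u)"
  by (simp add: winv_def hd_map hd_rev)

lemma reduced_nth: "reduced w \<longleftrightarrow> (\<forall>i. Suc i < length w \<longrightarrow> w ! Suc i \<noteq> linv (w ! i))"
  by (simp add: reduced_def successively_conv_nth)

lemma reduced_append:
  "reduced (u @ v) \<longleftrightarrow> reduced u \<and> reduced v \<and> (u = [] \<or> v = [] \<or> hd v \<noteq> linv (last u))"
  by (auto simp: reduced_def successively_append_iff)

text \<open>At its centre an odd word would have a letter equal to its own inverse, and an even word
  a letter followed by its inverse. This keeps a new arc from being confused with its own
  reversal.\<close>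

lemma winv_neq:
  assumes "reduced w" "w \<noteq> []" shows "winv w \<noteq> w"
proof
  assume eq: "winv w = w"
  let ?n = "length w"
  show False
  proof (cases "odd ?n")
    case True
    then have "?n - Suc (?n div 2) = ?n div 2" "?n div 2 < ?n" by presburger+
    then have "w ! (?n div 2) = linv (w ! (?n div 2))" using nth_winv[of "?n div 2" w] eq by simp
    then show False using linv_neq(2)[of "w ! (?n div 2)"] by simp
  next
    case False
    define i where "i = ?n div 2 - 1"
    have "?n \<noteq> 0" using assms(2) by simp
    with False have i: "Suc i < ?n" "?n - Suc (Suc i) = i"
      unfolding i_def by presburger+
    then have "w ! (Suc i) = linv (w ! i)"
      using nth_winv[of "Suc i" w] eq by simp
    then show False using assms(1) i(1) by (simp add: reduced_nth)
  qed
qed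

section \<open>Folded labelled graphs and their stages\<close>

fun path :: "('v \<times> 's \<times> 'v) set \<Rightarrow> 'v \<Rightarrow> 's list \<Rightarrow> 'v \<Rightarrow> bool" where
  "path E u [] v \<longleftrightarrow> u = v"
| "path E u (a # x) v \<longleftrightarrow> (\<exists>t. (u, a, t) \<in> E \<and> path E t x v)"

lemma path_append: "path E u (x @ y) v \<longleftrightarrow> (\<exists>t. path E u x t \<and> path E t y v)"
  by (induction x arbitrary: u) auto

lemma path_mono: "path E u x v \<Longrightarrow> E \<subseteq> E' \<Longrightarrow> path E' u x v"
  by (induction x arbitrary: u) auto

text \<open>Folded labelled graphs in the sense of Stallings: together the two axioms make the
  reading of a word deterministic forwards and backwards.\<close>

locale sym_det =
  fixes E :: "('v \<times> ('s \<times> bool) \<times> 'v) set"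
  assumes sym: "(u, a, v) \<in> E \<Longrightarrow> (v, linv a, u) \<in> E"
    and det: "(u, a, v) \<in> E \<Longrightarrow> (u, a, v') \<in> E \<Longrightarrow> v = v'"
begin

lemma path_det: "path E u x v \<Longrightarrow> path E u x v' \<Longrightarrow> v = v'"
  by (induction x arbitrary: u) (auto dest: det)

lemma path_winv: "path E u x v \<Longrightarrow> path E v (winv x) u"
proof (induction x arbitrary: u)
  case (Cons a x)
  then show ?case by (auto simp: winv_Cons path_append intro: sym)
qed simp

lemma path_det_back: "path E u x v \<Longrightarrow> path E u' x v \<Longrightarrow> u = u'"
  using path_det path_winv by metis

end

text \<open>\<open>sc\<close> is the cancellation hypothesis with pieces eliminated. Closure under
  rotation turns any common subword of two cyclic relators into a common prefix, to which
  \<open>sc\<close> applies.\<close>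

locale relators =
  fixes Q :: "'s word set"
  assumes red: "r \<in> Q \<Longrightarrow> reduced r"
    and ne: "r \<in> Q \<Longrightarrow> r \<noteq> []"
    and rot1: "r \<in> Q \<Longrightarrow> rotate1 r \<in> Q"
    and winv_mem: "r \<in> Q \<Longrightarrow> winv r \<in> Q"
    and sc: "r \<in> Q \<Longrightarrow> r' \<in> Q \<Longrightarrow> r \<noteq> r' \<Longrightarrow> k \<le> length r \<Longrightarrow> k \<le> length r' \<Longrightarrow>
      take k r = take k r' \<Longrightarrow> 24 * k < length r"
begin

lemma rot: "r \<in> Q \<Longrightarrow> rotate k r \<in> Q"
  by (induction k) (auto simp: rot1)

lemma rot_split: "u @ v \<in> Q \<Longrightarrow> v @ u \<in> Q"
  using rot[of "u @ v" "length u"] by (simp add: rotate_append)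

end

text \<open>\<open>tree\<close> names every vertex by a word that can be read from the root, so no
  separate supply of fresh vertices is needed. \<open>small\<close> is the invariant of the
  construction; its 1/12 = 2/24 leaves room for two pieces.\<close>

locale stage = relators Q + sym_det E
  for Q :: "'s word set" and E :: "('s word \<times> ('s \<times> bool) \<times> 's word) set" +
  fixes V :: "'s word set"
  assumes nilV: "[] \<in> V"
    and E_V: "(u, a, v) \<in> E \<Longrightarrow> u \<in> V"
    and tree: "u @ [a] \<in> V \<Longrightarrow> (u, a, u @ [a]) \<in> E"
    and small: "path E u y v \<Longrightarrow> y = take (length y) r \<Longrightarrow> length y \<le> length r \<Longrightarrow> r \<in> Q \<Longrightarrow>
      \<not> path E u r u \<Longrightarrow> 12 * length y < length r"

text \<open>An exit is a vertex \<open>v\<close> at which the relator \<open>r\<close> cannot be started.  The longest final segment of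
  \<open>r\<close> that can be read up to \<open>v\<close> starts at \<open>far\<close>, and the first \<open>jump\<close> letters of \<open>r\<close> become a new arc
  from \<open>v\<close> to \<open>far\<close>, along which \<open>partner\<close> is the relator read from the other end.  Both ends describe the
  same arc, so its vertices are named after the nearer end; \<open>main\<close> breaks the tie in the middle.\<close>

definition is_exit :: "'s word set \<Rightarrow> ('v \<times> ('s \<times> bool) \<times> 'v) set \<Rightarrow> 'v set \<Rightarrow> 'v \<Rightarrow> 's word \<Rightarrow> bool" where
  "is_exit Q E V v r \<longleftrightarrow> v \<in> V \<and> r \<in> Q \<and> (\<forall>t. (v, hd r, t) \<notin> E)"

definition jump :: "('v \<times> ('s \<times> bool) \<times> 'v) set \<Rightarrow> 'v \<Rightarrow> 's word \<Rightarrow> nat" where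
  "jump E v r = (LEAST j. \<exists>v'. path E v' (drop j r) v)"

definition far :: "('v \<times> ('s \<times> bool) \<times> 'v) set \<Rightarrow> 'v \<Rightarrow> 's word \<Rightarrow> 'v" where
  "far E v r = (THE v'. path E v' (drop (jump E v r) r) v)"

definition partner :: "('v \<times> ('s \<times> bool) \<times> 'v) set \<Rightarrow> 'v \<Rightarrow> 's word \<Rightarrow> 's word" where
  "partner E v r = winv (take (jump E v r) r) @ winv (drop (jump E v r) r)"

definition main :: "('v \<times> ('s \<times> bool) \<times> 'v) set \<Rightarrow> 'v \<Rightarrow> 's word \<Rightarrow> bool" where
  "main E v r \<longleftrightarrow> (v, r) = (SOME p. p = (v, r) \<or> p = (far E v r, partner E v r))"

definition half :: "('v \<times> ('s \<times> bool) \<times> 'v) set \<Rightarrow> 'v \<Rightarrow> 's word \<Rightarrow> nat" where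
  "half E v r = (if even (jump E v r) \<and> main E v r then jump E v r div 2 else (jump E v r - 1) div 2)"

definition node :: "('s word \<times> ('s \<times> bool) \<times> 's word) set \<Rightarrow> 's word \<Rightarrow> 's word \<Rightarrow> nat \<Rightarrow> 's word" where
  "node E v r i = (if i \<le> half E v r then v @ take i r else far E v r @ take (jump E v r - i) (partner E v r))"

text \<open>Since nodes are words, arcs that leave one vertex with a common piece share the nodes of
  that piece: the extension is folded as it is defined, without a quotient.\<close>

definition extE where
  "extE Q E V = E \<union> {(node E v r i, r ! i, node E v r (Suc i)) | v r i. is_exit Q E V v r \<and> i < jump E v r}"

definition extV where
  "extV Q E V = V \<union> {node E v r i | v r i. is_exit Q E V v r \<and> i \<le> jump E v r}"

section \<open>Adjoining the missing arcs to a stage\<close>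

context stage
begin

abbreviation "exit_at v r \<equiv> is_exit Q E V v r"
abbreviation "J v r \<equiv> jump E v r"
abbreviation "F v r \<equiv> far E v r"
abbreviation "P v r \<equiv> partner E v r"
abbreviation "H v r \<equiv> half E v r"
abbreviation "N v r i \<equiv> node E v r i"

lemma E_V2: "(u, a, v) \<in> E \<Longrightarrow> v \<in> V"
  using E_V sym by blast

lemma path_V: "path E u x v \<Longrightarrow> u \<in> V \<Longrightarrow> v \<in> V"
  by (induction x arbitrary: u) (auto dest: E_V2)

lemma path_V_back: "path E u x v \<Longrightarrow> v \<in> V \<Longrightarrow> u \<in> V"
  using path_V path_winv by blast

lemma prefix_closed: "u @ x \<in> V \<Longrightarrow> u \<in> V"
proof (induction x rule: rev_induct)
  case (snoc a x)
  then show ?case using tree[of "u @ x" a] E_V by auto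
qed simp

lemma jump_le: "J v r \<le> length r"
  unfolding jump_def by (rule Least_le) auto

lemma far_path: "path E (F v r) (drop (J v r) r) v"
proof -
  have "\<exists>v'. path E v' (drop (J v r) r) v"
    unfolding jump_def by (rule LeastI[of _ "length r"]) auto
  then have "\<exists>!v'. path E v' (drop (J v r) r) v" using path_det_back by blast
  then show ?thesis unfolding far_def by (rule theI')
qed

lemma far_eqI: "path E v' (drop (J v r) r) v \<Longrightarrow> F v r = v'"
  using far_path path_det_back by blast

lemma is_exit_no_path: "exit_at v r \<Longrightarrow> 0 < k \<Longrightarrow> \<not> path E v (take k r) t"
  using ne by (cases r; cases k) (auto simp: is_exit_def)

text \<open>The rotation of \<open>r\<close> that starts at \<open>far\<close> cannot close there,
  since it would have to leave \<open>v\<close> along \<open>hd r\<close>. So \<open>small\<close>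
  bounds the segment that is already present.\<close>

lemma jump_big: assumes "exit_at v r" shows "12 * (length r - J v r) < length r"
proof -
  have rQ: "r \<in> Q" using assms by (simp add: is_exit_def)
  let ?r = "drop (J v r) r @ take (J v r) r"
  have r: "?r \<in> Q" using rot_split[of "take (J v r) r" "drop (J v r) r"] rQ by simp
  have "\<not> path E (F v r) ?r (F v r)"
  proof
    assume a: "path E (F v r) ?r (F v r)"
    then obtain t where t: "path E (F v r) (drop (J v r) r) t" "path E t (take (J v r) r) (F v r)"
      by (auto simp: path_append)
    then have tv: "t = v" using far_path path_det by blast
    show False
    proof (cases "J v r = 0")
      case True
      then have "path E (F v r) r (F v r)" using a by simp
      moreover have "F v r = v" using True t(2) tv by simp
      ultimately show False using is_exit_no_path[OF assms, of "length r" v] ne rQ by auto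
    next
      case False
      then show False using is_exit_no_path[OF assms] t(2) tv by blast
    qed
  qed
  then show ?thesis using small[OF far_path, of v r ?r] r jump_le by simp
qed

lemma jump_big': "exit_at v r \<Longrightarrow> 11 * length r < 12 * J v r"
  using jump_big[of v r] jump_le[of v r] by (simp add: diff_mult_distrib2 less_diff_conv2)

lemma jump_pos: "exit_at v r \<Longrightarrow> 0 < J v r"
  using jump_big[of v r] by auto

lemma P_mem: "exit_at v r \<Longrightarrow> P v r \<in> Q"
proof -
  assume "exit_at v r"
  then have "winv r \<in> Q" by (simp add: is_exit_def winv_mem)
  then show ?thesis unfolding partner_def
    using rot_split[of "winv (drop (J v r) r)" "winv (take (J v r) r)"]
    by (metis append_take_drop_id winv_append)
qed

lemma length_P [simp]: "length (P v r) = length r"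
  using jump_le by (simp add: partner_def)

lemma P_nth: "exit_at v r \<Longrightarrow> k < J v r \<Longrightarrow> P v r ! k = linv (r ! (J v r - Suc k))"
  using jump_le[of v r] by (simp add: partner_def nth_append nth_winv)

lemma F_V: "exit_at v r \<Longrightarrow> F v r \<in> V"
  using far_path path_V_back by (metis is_exit_def)

lemma hd_P: "exit_at v r \<Longrightarrow> hd (P v r) = linv (r ! (J v r - 1))"
  using P_nth[of v r 0] jump_pos[of v r] P_mem[of v r] ne by (metis One_nat_def hd_conv_nth)

text \<open>If the last letter of the arc could be read backwards at \<open>far\<close>, a longer
  final segment of \<open>r\<close> would end at \<open>v\<close>, against the minimality of
  \<open>jump\<close>.\<close>

lemma partner_ex: assumes "exit_at v r" shows "exit_at (F v r) (P v r)"
proof -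
  have "(F v r, hd (P v r), t) \<notin> E" for t
  proof
    assume "(F v r, hd (P v r), t) \<in> E"
    then have e: "(t, r ! (J v r - 1), F v r) \<in> E" using sym hd_P[OF assms] by fastforce
    have "drop (J v r - 1) r = r ! (J v r - 1) # drop (J v r) r"
      using jump_pos[OF assms] jump_le[of v r] by (metis Cons_nth_drop_Suc One_nat_def Suc_pred Suc_le_lessD)
    then have "path E t (drop (J v r - 1) r) v" using e far_path by auto
    then have "J v r \<le> J v r - 1" unfolding jump_def by (intro Least_le) blast
    then show False using jump_pos[OF assms] by simp
  qed
  then show ?thesis using assms F_V P_mem by (auto simp: is_exit_def)
qed

text \<open>A longer readable final segment of the partner would, read backwards, start
  \<open>r\<close> at the exit \<open>v\<close>. So the construction is symmetric in the two ends of
  an arc.\<close>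

lemma jump_partner: assumes "exit_at v r" shows "J (F v r) (P v r) = J v r"
proof -
  have len: "length (winv (take (J v r) r)) = J v r" using jump_le[of v r] by simp
  have "path E v (drop (J v r) (P v r)) (F v r)"
    using far_path[of v r] len by (simp add: partner_def path_winv)
  moreover have "J v r \<le> j" if "path E v' (drop j (P v r)) (F v r)" for j v'
  proof (rule ccontr)
    assume "\<not> J v r \<le> j"
    then have j: "j < J v r" by simp
    have "drop j (P v r) = drop j (winv (take (J v r) r)) @ winv (drop (J v r) r)"
      using j len by (simp add: partner_def)
    then obtain t where t: "path E v' (drop j (winv (take (J v r) r))) t" "path E t (winv (drop (J v r) r)) (F v r)"
      using \<open>path E v' (drop j (P v r)) (F v r)\<close> by (auto simp: path_append)
    then have "t = v" using far_path path_det_back path_winv by blast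
    have "drop j (winv (take (J v r) r)) = winv (take (J v r - j) r)"
      using j jump_le[of v r] by (simp add: winv_def drop_map drop_rev min_def)
    then have "path E v (take (J v r - j) r) v'" using t(1) path_winv \<open>t = v\<close> by fastforce
    then show False using is_exit_no_path[OF assms, of "J v r - j"] j by simp
  qed
  ultimately show ?thesis unfolding jump_def[of E "F v r"] by (intro Least_equality) auto
qed

lemma far_partner: assumes "exit_at v r" shows "F (F v r) (P v r) = v"
proof (rule far_eqI)
  show "path E v (drop (J (F v r) (P v r)) (P v r)) (F v r)"
    using far_path[of v r] jump_le[of v r] jump_partner[OF assms] by (simp add: partner_def path_winv)
qed

lemma P_partner: assumes "exit_at v r" shows "P (F v r) (P v r) = r"
  unfolding partner_def[of E "F v r"] jump_partner[OF assms]
  using jump_le[of v r] by (simp add: partner_def)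

lemma P_neq: assumes "exit_at v r" shows "P v r \<noteq> r"
proof
  assume "P v r = r"
  then have "winv (take (J v r) r) = take (J v r) r"
    unfolding partner_def by (metis append_eq_conv_conj append_take_drop_id length_winv jump_le length_take min.absorb2)
  moreover have "reduced (take (J v r) r)"
    using assms red by (metis append_take_drop_id is_exit_def reduced_append)
  moreover have "take (J v r) r \<noteq> []" using jump_pos[OF assms] ne assms by (auto simp: is_exit_def)
  ultimately show False using winv_neq by blast
qed

text \<open>Seen from either end the predicate under \<open>SOME\<close> describes the same pair, so
  the same end is selected; the ends differ by \<open>P_neq\<close>.\<close>

lemma main_partner: assumes "exit_at v r" shows "main E (F v r) (P v r) \<longleftrightarrow> \<not> main E v r"
proof -
  let ?p = "SOME p. p = (v, r) \<or> p = (F v r, P v r)"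
  have "?p = (v, r) \<or> ?p = (F v r, P v r)" by (rule someI_ex) blast
  moreover have "(SOME p. p = (F v r, P v r) \<or> p = (v, r)) = ?p" by (simp add: disj_commute)
  ultimately show ?thesis
    using P_neq[OF assms] by (auto simp: main_def far_partner[OF assms] P_partner[OF assms])
qed

text \<open>An arc has \<open>J v r + 1\<close> nodes, and the ends name one more than their
  \<open>half\<close> each, so every node is named from exactly one end.\<close>

lemma half_sum: assumes "exit_at v r" shows "H v r + H (F v r) (P v r) = J v r - 1"
  using main_partner[OF assms] jump_pos[OF assms]
  by (cases "even (J v r)") (auto simp: half_def jump_partner[OF assms] elim!: evenE oddE)

lemma half_big: "2 * H v r + 2 \<ge> J v r"
  by (cases "even (J v r)") (auto simp: half_def elim!: evenE oddE)

lemma half_less: "exit_at v r \<Longrightarrow> H v r < J v r"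
  using half_sum[of v r] jump_pos[of v r] by simp

lemma node_partner:
  assumes "exit_at v r" "i \<le> J v r"
  shows "N (F v r) (P v r) i = N v r (J v r - i)"
  using assms half_sum[OF assms(1)] jump_pos[OF assms(1)]
  by (auto simp: node_def jump_partner far_partner P_partner)

lemma node_0 [simp]: "N v r 0 = v" by (simp add: node_def)

lemma node_J: "exit_at v r \<Longrightarrow> N v r (J v r) = F v r"
  using half_less[of v r] by (simp add: node_def)

text \<open>\<open>V\<close> is closed under prefixes, so such a name would put
  \<open>v @ [hd r]\<close> into \<open>V\<close>, and by \<open>tree\<close> an edge with the
  missing label at \<open>v\<close> into \<open>E\<close>.\<close>

lemma stem_notin: assumes "exit_at v r" "0 < i" shows "v @ take i r \<notin> V"
proof
  assume a: "v @ take i r \<in> V"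
  obtain a r0 where r: "r = a # r0" using assms ne by (cases r) (auto simp: is_exit_def)
  then have "take i r = a # take (i - 1) r0" using assms by (cases i) auto
  then have "v @ [a] \<in> V" using a prefix_closed[of "v @ [a]" "take (i - 1) r0"] by simp
  then show False using tree[of v a] assms r by (auto simp: is_exit_def)
qed

lemma node_notin: assumes "exit_at v r" "0 < i" "i < J v r" shows "N v r i \<notin> V"
  using assms stem_notin[OF assms(1)] stem_notin[OF partner_ex[OF assms(1)], of "J v r - i"]
  by (auto simp: node_def)

text \<open>By \<open>stem_notin\<close>, \<open>v\<close> is recovered from the name as its longest
  prefix in \<open>V\<close>.\<close>

lemma coding:
  assumes "exit_at v r" "exit_at v' r'" "v @ take i r = v' @ take i' r'" "i \<le> length r" "i' \<le> length r'"
  shows "v = v' \<and> i = i' \<and> take i r = take i r'"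
proof -
  have vv: "v = v'" if tt: "exit_at v r" "exit_at v' r'" "v @ take i r = v' @ take i' r'" "length v \<le> length v'"
    for v v' r r' i i'
  proof (rule ccontr)
    assume "v \<noteq> v'"
    obtain y where y: "v' = v @ y" "take i r = y @ take i' r'"
      using tt(3,4) by (metis append_eq_append_conv_if append_eq_conv_conj)
    then have "y \<noteq> []" using \<open>v \<noteq> v'\<close> by auto
    have "y = take (length y) r" using y(2) by (metis append_eq_conv_conj min_def take_all_iff take_take linorder_le_cases length_take)
    then have "v @ take (length y) r \<in> V" using y(1) tt(2) by (simp add: is_exit_def)
    then show False using stem_notin[OF tt(1)] \<open>y \<noteq> []\<close> by auto
  qed
  have "v = v'" using vv[OF assms(1-3)] vv[OF assms(2,1) assms(3)[symmetric]]
    by (cases "length v \<le> length v'") auto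
  moreover have "i = i'" using assms(3-5) calculation by (metis same_append_eq length_take min.absorb2)
  ultimately show ?thesis using assms(3) by simp
qed

text \<open>Each of the two nodes is named from the start (\<open>s\<close>) or from the destination
  (\<open>d\<close>) of its arc; in all four combinations \<open>coding\<close> compares the
  names.\<close>

lemma node_eq:
  assumes "exit_at v1 r1" "exit_at v2 r2" "i1 \<le> J v1 r1" "i2 \<le> J v2 r2" "N v1 r1 i1 = N v2 r2 i2"
  obtains (ss) "i1 \<le> H v1 r1" "i2 \<le> H v2 r2" "v1 = v2" "i1 = i2" "take i1 r1 = take i1 r2"
    | (sd) "i1 \<le> H v1 r1" "H v2 r2 < i2" "v1 = F v2 r2" "i1 = J v2 r2 - i2" "take i1 r1 = take i1 (P v2 r2)"
    | (ds) "H v1 r1 < i1" "i2 \<le> H v2 r2" "F v1 r1 = v2" "i2 = J v1 r1 - i1" "take i2 (P v1 r1) = take i2 r2"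
    | (dd) "H v1 r1 < i1" "H v2 r2 < i2" "F v1 r1 = F v2 r2" "J v1 r1 - i1 = J v2 r2 - i2"
        "take (J v1 r1 - i1) (P v1 r1) = take (J v1 r1 - i1) (P v2 r2)"
proof -
  note l1 = jump_le[of v1 r1] and l2 = jump_le[of v2 r2]
  note p1 = partner_ex[OF assms(1)] and p2 = partner_ex[OF assms(2)]
  consider "i1 \<le> H v1 r1" "i2 \<le> H v2 r2" | "i1 \<le> H v1 r1" "H v2 r2 < i2"
    | "H v1 r1 < i1" "i2 \<le> H v2 r2" | "H v1 r1 < i1" "H v2 r2 < i2" by linarith
  then show thesis
  proof cases
    case 1
    then have e: "v1 @ take i1 r1 = v2 @ take i2 r2" using assms(5) by (simp add: node_def)
    have "i1 \<le> length r1" "i2 \<le> length r2" using assms l1 l2 by linarith+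
    note c = coding[OF assms(1,2) e this]
    show ?thesis by (rule ss) (use 1 c in auto)
  next
    case 2
    then have e: "v1 @ take i1 r1 = F v2 r2 @ take (J v2 r2 - i2) (P v2 r2)"
      using assms(5) by (simp add: node_def)
    have "i1 \<le> length r1" "J v2 r2 - i2 \<le> length (P v2 r2)" using assms l1 l2 by auto
    note c = coding[OF assms(1) p2 e this]
    show ?thesis by (rule sd) (use 2 c in auto)
  next
    case 3
    then have e: "F v1 r1 @ take (J v1 r1 - i1) (P v1 r1) = v2 @ take i2 r2"
      using assms(5) by (simp add: node_def)
    have "J v1 r1 - i1 \<le> length (P v1 r1)" "i2 \<le> length r2" using assms l1 l2 by auto
    note c = coding[OF p1 assms(2) e this]
    show ?thesis by (rule ds) (use 3 c in auto)
  next
    case 4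
    then have e: "F v1 r1 @ take (J v1 r1 - i1) (P v1 r1) = F v2 r2 @ take (J v2 r2 - i2) (P v2 r2)"
      using assms(5) by (simp add: node_def)
    have "J v1 r1 - i1 \<le> length (P v1 r1)" "J v2 r2 - i2 \<le> length (P v2 r2)" using assms l1 l2 by auto
    note c = coding[OF p1 p2 e this]
    show ?thesis by (rule dd) (use 4 c in auto)
  qed
qed

lemma half_len:
  assumes "exit_at v r" "0 < k" "24 * k < length r"
  shows "k < H v r"
  using jump_big'[OF assms(1)] half_big[of v r] assms(2,3) by linarith

text \<open>Half of an arc covers more than 11/24 of the relator, far more than a piece: arcs of
  different relators have separated before the naming changes ends.\<close>

lemma half_full:
  assumes "exit_at v r" "r' \<in> Q" "r \<noteq> r'" "Suc (H v r) \<le> length r'"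
  shows "take (Suc (H v r)) r \<noteq> take (Suc (H v r)) r'"
proof
  assume eq: "take (Suc (H v r)) r = take (Suc (H v r)) r'"
  have "Suc (H v r) \<le> length r" using half_less[OF assms(1)] jump_le[of v r] by simp
  then have "24 * Suc (H v r) < length r"
    using sc[of r r' "Suc (H v r)"] assms eq by (simp add: is_exit_def)
  moreover have "12 * J v r \<le> 24 * Suc (H v r)" using half_big[of v r] by simp
  ultimately have "11 * length r < length r" using jump_big'[OF assms(1)] by linarith
  then show False by simp
qed

lemma extE_cases:
  assumes "(u, a, w) \<in> extE Q E V"
  obtains "(u, a, w) \<in> E"
  | v r i where "exit_at v r" "i < J v r" "u = N v r i" "a = r ! i" "w = N v r (Suc i)"
  using assms by (auto simp: extE_def)

lemma arcI: "exit_at v r \<Longrightarrow> i < J v r \<Longrightarrow> (N v r i, r ! i, N v r (Suc i)) \<in> extE Q E V"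
  by (auto simp: extE_def)

lemma ext_sym: assumes "(u, a, w) \<in> extE Q E V" shows "(w, linv a, u) \<in> extE Q E V"
  using assms
proof (cases rule: extE_cases)
  case 1
  then show ?thesis using sym by (auto simp: extE_def)
next
  case (2 v r i)
  let ?k = "J v r - Suc i"
  have k: "?k < J (F v r) (P v r)" "?k \<le> J v r" "Suc ?k \<le> J v r" "?k < J v r"
    "J v r - ?k = Suc i" "J v r - Suc ?k = i" "J v r - Suc ?k = i"
    using 2 by (auto simp: jump_partner)
  have "(N (F v r) (P v r) ?k, P v r ! ?k, N (F v r) (P v r) (Suc ?k)) \<in> extE Q E V"
    using arcI[OF partner_ex[OF 2(1)] k(1)] .
  then show ?thesis
    using node_partner[OF 2(1) k(2)] node_partner[OF 2(1) k(3)] P_nth[OF 2(1) k(4)] k 2 by simp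
qed

lemma nth_less_len: "exit_at v r \<Longrightarrow> i < J v r \<Longrightarrow> i < length r"
  using jump_le[of v r] by simp

text \<open>Folding could fail only where two arcs run together. Named from their starts they share
  a piece, which ends before the halfway point; named from their destinations they stay together;
  named from opposite ends they would make a relator backtrack.\<close>

lemma ext_det: assumes "(u, a, w) \<in> extE Q E V" "(u, a, w') \<in> extE Q E V" shows "w = w'"
proof -
  \<comment> \<open>An interior node is not in \<open>V\<close>, and for \<open>i = 0\<close> the
    arc starts with a letter that is missing at its exit.\<close>
  have mix: False if "(u, a, w) \<in> E" "exit_at v r" "i < J v r" "u = N v r i" "a = r ! i" for w v r i
  proof -
    have "i = 0" using that node_notin[of v r i] E_V by blast
    then show False using that ne by (auto simp: is_exit_def hd_conv_nth)
  qed
  show ?thesis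
    using assms(1)
  proof (cases rule: extE_cases)
    case 1
    from assms(2) show ?thesis
    proof (cases rule: extE_cases)
      case 11: 1
      then show ?thesis using 1 det by blast
    next
      case (2 v r i)
      then show ?thesis using mix 1 by blast
    qed
  next
    case (2 v1 r1 i1)
    note a1 = 2
    from assms(2) show ?thesis
    proof (cases rule: extE_cases)
      case 1
      then show ?thesis using mix 2 by blast
    next
      case (2 v2 r2 i2)
      have Q12: "r1 \<in> Q" "r2 \<in> Q" using a1 2 by (auto simp: is_exit_def)
      have eq: "N v1 r1 i1 = N v2 r2 i2" using a1 2 by simp
      have le: "i1 \<le> J v1 r1" "i2 \<le> J v2 r2" using a1 2 by auto
      have lens: "i1 < length r1" "i2 < length r2" using nth_less_len a1 2 by auto
      have lett: "r1 ! i1 = r2 ! i2" using a1 2 by simp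
      show ?thesis
        using a1(1) 2(1) le eq
      proof (cases rule: node_eq)
        case ss
        have t: "take (Suc i1) r1 = take (Suc i1) r2"
          using ss lens lett by (simp add: take_Suc_conv_app_nth)
        show ?thesis
        proof (cases "r1 = r2")
          case True
          then show ?thesis using a1 2 ss by simp
        next
          case False
          have "Suc i1 \<noteq> Suc (H v1 r1)" "Suc i2 \<noteq> Suc (H v2 r2)"
            using half_full[OF a1(1) Q12(2) False] half_full[OF 2(1) Q12(1)] False t lens ss by auto
          then show ?thesis using a1 2 ss t by (simp add: node_def)
        qed
      next
        case sd
        have i: "0 < i1" using sd 2 by simp
        have "r1 ! (i1 - 1) = P v2 r2 ! (i1 - 1)"
          using sd i by (metis Suc_pred' lessI nth_take)
        also have "\<dots> = linv (r2 ! i2)" using sd i P_nth[OF 2(1), of "i1 - 1"] 2 by simp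
        finally have "r1 ! Suc (i1 - 1) = linv (r1 ! (i1 - 1))" using lett i by simp
        then show ?thesis using red[OF Q12(1), unfolded reduced_nth, rule_format, of "i1 - 1"] i lens by simp
      next
        case ds
        have i: "0 < i2" using ds a1 by simp
        have "r2 ! (i2 - 1) = P v1 r1 ! (i2 - 1)"
          using ds i by (metis Suc_pred' lessI nth_take)
        also have "\<dots> = linv (r1 ! i1)" using ds i P_nth[OF a1(1), of "i2 - 1"] a1 by simp
        finally have "r2 ! Suc (i2 - 1) = linv (r2 ! (i2 - 1))" using lett i by simp
        then show ?thesis using red[OF Q12(2), unfolded reduced_nth, rule_format, of "i2 - 1"] i lens by simp
      next
        case dd
        have *: "J v1 r1 - Suc i1 = J v2 r2 - Suc i2" using dd a1 2 by simp
        have "take (J v1 r1 - Suc i1) (P v1 r1) = take (J v1 r1 - Suc i1) (P v2 r2)"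
          using arg_cong[OF dd(5), of "take (J v1 r1 - Suc i1)"] by (simp add: min_absorb1 diff_le_mono2)
        then show ?thesis using a1 2 dd * by (simp add: node_def)
      qed
    qed
  qed
qed

sublocale ext: sym_det "extE Q E V"
  using ext_sym ext_det by unfold_locales

lemma extV_node: "exit_at v r \<Longrightarrow> i \<le> J v r \<Longrightarrow> N v r i \<in> extV Q E V"
  by (auto simp: extV_def)

lemma ext_E_V: "(u, a, w) \<in> extE Q E V \<Longrightarrow> u \<in> extV Q E V"
  by (erule extE_cases) (auto simp: extV_node, auto simp: extV_def dest: E_V)

lemma ext_tree: assumes "u @ [a] \<in> extV Q E V" shows "(u, a, u @ [a]) \<in> extE Q E V"
proof -
  have stem: "(u, a, u @ [a]) \<in> extE Q E V" if "exit_at v r" "i \<le> H v r" "u @ [a] = v @ take i r" for v r i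
  proof (cases i)
    case 0
    then have "u @ [a] \<in> V" using that by (simp add: is_exit_def)
    then show ?thesis using tree[of u a] by (simp add: extE_def)
  next
    case (Suc k)
    have k: "k < J v r" "k < length r" using that Suc half_less[OF that(1)] jump_le[of v r] by auto
    then have "u = N v r k" "a = r ! k" "u @ [a] = N v r (Suc k)"
      using that Suc by (auto simp: node_def take_Suc_conv_app_nth)
    then show ?thesis using arcI[OF that(1) k(1)] by simp
  qed
  from assms consider "u @ [a] \<in> V" | v r i where "exit_at v r" "i \<le> J v r" "u @ [a] = N v r i"
    by (auto simp: extV_def)
  then show ?thesis
  proof cases
    case 1
    then show ?thesis using tree[of u a] by (simp add: extE_def)
  next
    case 2
    show ?thesis
    proof (cases "i \<le> H v r")
      case True
      then show ?thesis using 2 stem by (simp add: node_def)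
    next
      case False
      then have "J v r - i \<le> H (F v r) (P v r)" using half_sum[OF 2(1)] by simp
      then show ?thesis using 2 False stem[OF partner_ex[OF 2(1)], of "J v r - i"] by (simp add: node_def)
    qed
  qed
qed

lemma arc_path: assumes "exit_at v r" "i + k \<le> J v r"
  shows "path (extE Q E V) (N v r i) (take k (drop i r)) (N v r (i + k))"
  using assms(2)
proof (induction k arbitrary: i)
  case (Suc k)
  have "i < length r" using Suc jump_le[of v r] by simp
  then have "drop i r = r ! i # drop (Suc i) r" by (simp add: Cons_nth_drop_Suc)
  then show ?case using Suc.IH[of "Suc i"] Suc.prems arcI[OF assms(1), of i] by auto
qed simp

lemma E_ext: "E \<subseteq> extE Q E V" by (auto simp: extE_def)

lemma arc_closed: assumes "exit_at v r" shows "path (extE Q E V) v r v"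
proof -
  have "path (extE Q E V) v (take (J v r) r) (F v r)"
    using arc_path[OF assms, of 0 "J v r"] node_J[OF assms] by simp
  moreover have "path (extE Q E V) (F v r) (drop (J v r) r) v"
    using path_mono[OF far_path E_ext] .
  ultimately show ?thesis using path_append by (metis append_take_drop_id)
qed

lemma (in sym_det) closed_rotate:
  assumes "path E u x w" "path E w (y @ x) w" shows "path E u (x @ y) u"
proof -
  obtain t where "path E w y t" "path E t x w" using assms(2) path_append by metis
  then show ?thesis using assms(1) path_det_back[of t x w u] path_append by metis
qed

text \<open>Read \<open>r\<close> from \<open>v\<close> as far as possible. Where this stops, the
  rotated relator has an exit and the new arc closes it; if it never stops, \<open>small\<close>
  applied to the whole of \<open>r\<close> forces it to close.\<close>

lemma closed_V: assumes "v \<in> V" "r \<in> Q" shows "path (extE Q E V) v r v"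
proof -
  have "\<exists>k w. k \<le> length r \<and> path E v (take k r) w \<and> (k < length r \<longrightarrow> (\<forall>t. (w, r ! k, t) \<notin> E))"
  proof (rule ccontr)
    assume a: "\<not> ?thesis"
    have "k \<le> length r \<Longrightarrow> \<exists>w. path E v (take k r) w" for k
    proof (induction k)
      case (Suc k)
      then obtain w where w: "path E v (take k r) w" by auto
      then obtain t where "(w, r ! k, t) \<in> E" using a Suc by fastforce
      then have "path E v (take k r @ [r ! k]) t" using w by (auto simp: path_append)
      then show ?case using Suc by (auto simp: take_Suc_conv_app_nth)
    qed (auto intro: exI[of _ v])
    then obtain w where "path E v (take (length r) r) w" by blast
    then have "length r \<le> length r \<and> path E v (take (length r) r) w \<and>
        (length r < length r \<longrightarrow> (\<forall>t. (w, r ! length r, t) \<notin> E))" by simp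
    then show False using a by blast
  qed
  then obtain k w where k: "k \<le> length r" "path E v (take k r) w"
    "k < length r \<Longrightarrow> (\<forall>t. (w, r ! k, t) \<notin> E)" by blast
  show ?thesis
  proof (cases "k < length r")
    case True
    let ?r = "drop k r @ take k r"
    have "?r \<in> Q" using rot_split[of "take k r" "drop k r"] assms by simp
    moreover have "hd ?r = r ! k" using True by (simp add: hd_drop_conv_nth)
    moreover have "w \<in> V" using k(2) assms path_V by blast
    ultimately have "exit_at w ?r" using k(3) True by (simp add: is_exit_def)
    then have "path (extE Q E V) w ?r w" by (rule arc_closed)
    then show ?thesis using ext.closed_rotate[OF path_mono[OF k(2) E_ext]] by fastforce
  next
    case False
    then have "path E v r w" using k by simp
    then have "path E v r v" using small[of v r w r] assms(2) by fastforce
    then show ?thesis by (rule path_mono[OF _ E_ext])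
  qed
qed

text \<open>The ways to go on from an interior node: along a stem that other arcs may share, off
  onto another arc issuing from the far end, or straight on. In the second case the rest of the arc
  is a piece, because the path would backtrack if both arcs carried the same relator.\<close>

lemma arc_step:
  assumes "exit_at v r" "0 < i" "i < J v r" "exit_at v2 r2" "i2 < J v2 r2" "N v r i = N v2 r2 i2"
    and nlast: "r2 ! i2 \<noteq> linv (r ! (i - 1))"
  obtains (stem) "i \<le> H v r" "v2 = v" "i2 = i" "i \<le> H v2 r2" "take i r2 = take i r"
    | (turn) "H v r < i" "v2 = F v r" "i2 = J v r - i" "take i2 r2 = take i2 (P v r)" "0 < i2" "i2 < H v2 r2"
        "24 * i2 < length r" "24 * i2 < length r2" "N v2 r2 i2 = v2 @ take i2 r2"
    | (straight) "H v r < i" "r2 ! i2 = r ! i" "N v2 r2 (Suc i2) = N v r (Suc i)"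
proof -
  have len: "i < length r" "i2 < length r2" using assms nth_less_len by blast+
  have le: "i \<le> J v r" "i2 \<le> J v2 r2" using assms by auto
  show thesis
    using assms(1,4) le assms(6)
  proof (cases rule: node_eq)
    case ss
    show ?thesis by (rule stem) (use ss in auto)
  next
    case sd
    have "r ! (i - 1) = take i r ! (i - 1)" using assms(2) by simp
    also have "\<dots> = P v2 r2 ! (i - 1)" unfolding sd(5) using assms(2) by simp
    also have "\<dots> = linv (r2 ! i2)" using sd P_nth[OF assms(4), of "i - 1"] assms(2,5) by simp
    finally show ?thesis using nlast by simp
  next
    case ds
    let ?k = "J v r - i"
    have pk: "P v r ! ?k = linv (r ! (i - 1))" using P_nth[OF assms(1), of ?k] assms(2,3) by simp
    have neq: "r2 \<noteq> P v r" using pk nlast ds by auto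
    have mem: "r2 \<in> Q" "P v r \<in> Q" using assms(4) P_mem[OF assms(1)] by (auto simp: is_exit_def)
    have l: "i2 \<le> length r2" "i2 \<le> length (P v r)" using ds(4) len(2) jump_le[of v r] by auto
    have b: "24 * i2 < length r2" "24 * i2 < length r"
      using sc[OF mem neq l] sc[OF mem(2,1) neq[symmetric] l(2,1)] ds(5) by simp_all
    have pos: "0 < i2" using ds(4) assms(3) by simp
    then have "i2 < H v2 r2" using half_len[OF assms(4)] b by blast
    then show ?thesis by (intro turn) (use ds b pos in \<open>simp_all add: node_def\<close>)
  next
    case dd
    let ?k = "J v r - i"
    have ix: "J v2 r2 - Suc (?k - 1) = i2" "?k - 1 < J v2 r2" "?k - 1 < ?k"
      "J v r - Suc (?k - 1) = i" "?k - 1 < J v r" "J v r - Suc i = ?k - 1" "J v2 r2 - Suc i2 = ?k - 1"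
      using dd(4) assms(3,5) by linarith+
    have "P v2 r2 ! (?k - 1) = linv (r2 ! i2)" using P_nth[OF assms(4) ix(2)] unfolding ix(1) .
    moreover have "P v2 r2 ! (?k - 1) = P v r ! (?k - 1)"
      using arg_cong[OF dd(5), of "\<lambda>w. w ! (?k - 1)"] ix(3) by (simp only: nth_take)
    moreover have "P v r ! (?k - 1) = linv (r ! i)" using P_nth[OF assms(1) ix(5)] unfolding ix(4) .
    ultimately have "linv (linv (r2 ! i2)) = linv (linv (r ! i))" by simp
    then have ai: "r2 ! i2 = r ! i" by (simp only: linv_linv)
    have "N v2 r2 (Suc i2) = N v r (Suc i)"
      using ext_det arcI[OF assms(1,3)] arcI[OF assms(4,5)] assms(6) ai by metis
    then show ?thesis using straight dd ai by blast
  qed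
qed

lemma arc_edge:
  assumes "(t, a, w) \<in> extE Q E V" "t \<notin> V"
  obtains v r i where "exit_at v r" "i < J v r" "t = N v r i" "a = r ! i" "w = N v r (Suc i)"
  using assms(1) by (rule extE_cases) (use assms(2) E_V that in blast)+

text \<open>The path follows one relator until it reaches the far end or turns off inside the final
  piece, which leaves more than 11/12 - 1/24. As long as it is in a shared stem the relator may
  still be exchanged, so the induction generalizes over \<open>r\<close>.\<close>

lemma excursion:
  assumes "path (extE Q E V) (N v r i) x w" "w \<in> V" "exit_at v r" "0 < i" "i \<le> J v r" "reduced (take i r @ x)"
  shows "\<exists>r' n. r' \<in> Q \<and> prefix (take n r') (take i r @ x) \<and> n \<le> length r' \<and> 7 * length r' < 8 * n"
  using assms
proof (induction x arbitrary: r i)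
  case Nil
  then have "i = J v r" using node_notin[of v r i] by fastforce
  then show ?case using Nil jump_big'[of v r] jump_le[of v r] by (intro exI[of _ r] exI[of _ i]) (auto simp: is_exit_def)
next
  case (Cons a x)
  have len: "i \<le> length r" using Cons jump_le[of v r] by simp
  have rQ: "r \<in> Q" using Cons by (simp add: is_exit_def)
  show ?case
  proof (cases "i = J v r")
    case True
    then show ?thesis using Cons.prems jump_big'[of v r] jump_le[of v r] rQ
      by (intro exI[of _ r] exI[of _ i]) auto
  next
    case False
    then have i: "i < J v r" using Cons by simp
    obtain t where t: "(N v r i, a, t) \<in> extE Q E V" "path (extE Q E V) t x w" using Cons.prems by auto
    obtain v2 r2 i2 where a2: "exit_at v2 r2" "i2 < J v2 r2" "N v r i = N v2 r2 i2" "a = r2 ! i2"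
      "t = N v2 r2 (Suc i2)" using arc_edge[OF t(1) node_notin[OF Cons.prems(3,4) i]] .
    have lst: "last (take i r) = r ! (i - 1)" "take i r \<noteq> []"
      using Cons.prems(4) len ne[OF rQ] by (auto simp: last_conv_nth min_absorb2)
    have nlast: "r2 ! i2 \<noteq> linv (r ! (i - 1))"
      using Cons.prems(6) lst a2(4) by (auto simp: reduced_append)
    show ?thesis
      using Cons.prems(3,4) i a2(1-3) nlast
    proof (cases rule: arc_step)
      case stem
      have tk: "take (Suc i2) r2 = take i r @ [a]"
        using stem a2 nth_less_len[OF a2(1,2)] by (simp add: take_Suc_conv_app_nth)
      then have e: "take i r @ a # x = take (Suc i2) r2 @ x" by simp
      have "exit_at v r2" using a2 stem by simp
      moreover have "reduced (take (Suc i2) r2 @ x)" using Cons.prems(6) unfolding e .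
      ultimately show ?thesis unfolding e using Cons.IH[of r2 "Suc i2"] Cons.prems(2) a2 t(2) stem by simp
    next
      case turn
      have "7 * length r < 8 * i" using jump_big'[OF Cons.prems(3)] i turn by linarith
      then show ?thesis using len rQ by (intro exI[of _ r] exI[of _ i]) auto
    next
      case straight
      have "take (Suc i) r = take i r @ [a]"
        using straight a2 i nth_less_len[OF Cons.prems(3)] by (simp add: take_Suc_conv_app_nth)
      then show ?thesis using Cons.IH[of r "Suc i"] Cons.prems t(2) i straight a2 by simp
    qed
  qed
qed

text \<open>The first new edge leaves \<open>V\<close>, and the path has to come back; this is an
  excursion.\<close>

lemma ext_chunk:
  assumes "path (extE Q E V) v x w" "v \<in> V" "w \<in> V" "reduced x" "\<not> path E v x w"
  shows "\<exists>r n. r \<in> Q \<and> sublist (take n r) x \<and> n \<le> length r \<and> 7 * length r < 8 * n"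
  using assms
proof (induction x arbitrary: v)
  case (Cons a x)
  obtain t where t: "(v, a, t) \<in> extE Q E V" "path (extE Q E V) t x w" using Cons.prems by auto
  from t(1) show ?case
  proof (cases rule: extE_cases)
    case 1
    then have "t \<in> V" "\<not> path E t x w" using E_V2 Cons.prems by auto
    then obtain r n where rn: "r \<in> Q" "sublist (take n r) x" "n \<le> length r" "7 * length r < 8 * n"
      using Cons.IH[OF t(2)] Cons.prems by (auto simp: reduced_Cons)
    then have "sublist (take n r) (a # x)" by (simp add: sublist_Cons_right)
    then show ?thesis using rn by auto
  next
    case (2 v' r i)
    have i0: "i = 0" using 2 node_notin[of v' r i] Cons.prems(2) by auto
    have "take 1 r = [a]" using 2 i0 ne by (cases r) (auto simp: is_exit_def)
    then have ax: "a # x = take 1 r @ x" by simp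
    have "path (extE Q E V) (N v' r 1) x w" "1 \<le> J v' r" using 2 i0 t(2) jump_pos[OF 2(1)] by auto
    note exc = excursion[OF this(1) Cons.prems(3) 2(1) zero_less_one this(2) Cons.prems(4)[unfolded ax], folded ax]
    then obtain r' n where rn: "r' \<in> Q" "prefix (take n r') (a # x)" "n \<le> length r'" "7 * length r' < 8 * n"
      using exc by auto
    then have "sublist (take n r') (a # x)" by (intro prefix_imp_sublist)
    then show ?thesis using rn by auto
  qed
qed simp

text \<open>A visit to \<open>V\<close> would close \<open>\<rho>\<close> by
  \<open>closed_V\<close>, so the path lives in the interiors of new arcs. It can turn from one arc
  to another only once and thus consists of at most two pieces.\<close>

lemma ext_small:
  assumes p: "path (extE Q E V) u y w" and y: "y = take (length y) \<rho>" "length y \<le> length \<rho>"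
    and \<rho>: "\<rho> \<in> Q" "\<not> path (extE Q E V) u \<rho> u"
  shows "12 * length y < length \<rho>"
proof -
  let ?E = "extE Q E V"
  have rotQ: "drop (length x) \<rho> @ x \<in> Q \<and> \<rho> = x @ drop (length x) \<rho>" if "prefix x y" for x
  proof -
    have "x = take (length x) \<rho>" using that y(1) by (metis prefix_def append_eq_conv_conj prefix_order.trans take_is_prefix)
    then show ?thesis using rot_split[of x "drop (length x) \<rho>"] \<rho>(1) by (metis append_take_drop_id)
  qed
  have notV: "t \<notin> V" if "prefix x y" "path ?E u x t" for x t
  proof
    assume "t \<in> V"
    then have "path ?E t (drop (length x) \<rho> @ x) t" using closed_V rotQ that by blast
    then show False using ext.closed_rotate[OF that(2)] rotQ[OF that(1)] \<rho>(2) by metis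
  qed
  \<comment> \<open>A stretch along one arc is a piece: if the two rotated relators were equal, the
    closed cycle of the arc would close \<open>\<rho>\<close> at \<open>u\<close>.\<close>
  have bound: "24 * k < length r \<and> 24 * k < length \<rho>"
    if bp: "prefix (x @ take k (drop i r)) y" "path ?E u x (N v r i)" "exit_at v r" "i + k \<le> J v r" for x k i v r
  proof -
    have px: "prefix x y" using bp(1) by (metis prefix_def append.assoc)
    note R = rotQ[OF px]
    let ?\<rho> = "drop (length x) \<rho> @ x" and ?r = "drop i r @ take i r"
    have lk: "k \<le> length (drop i r)" using bp(4) jump_le[of v r] by simp
    have "prefix (x @ take k (drop i r)) \<rho>" using bp(1) y(1) by (metis prefix_order.trans take_is_prefix)
    then have "prefix (take k (drop i r)) (drop (length x) \<rho>)" using R by (metis same_prefix_prefix)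
    then obtain z where z: "drop (length x) \<rho> = take k (drop i r) @ z" by (auto simp: prefix_def)
    then have t: "take k ?\<rho> = take k ?r" "k \<le> length ?\<rho>" "k \<le> length ?r" using lk by auto
    have rQ: "?r \<in> Q" using rot_split[of "take i r" "drop i r"] bp(3) by (simp add: is_exit_def)
    have "?\<rho> \<noteq> ?r"
    proof
      assume eq: "?\<rho> = ?r"
      have "path ?E v (take i r) (N v r i)" using arc_path[OF bp(3), of 0 i] bp(4) by simp
      moreover obtain t where "path ?E v (take i r) t" "path ?E t (drop i r) v"
        using arc_closed[OF bp(3)] path_append by (metis append_take_drop_id)
      ultimately have "path ?E (N v r i) ?r (N v r i)" using ext.path_det path_append by metis
      then have "path ?E u (x @ drop (length x) \<rho>) u" using ext.closed_rotate[OF bp(2)] eq by metis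
      then show False using R \<rho>(2) by simp
    qed
    moreover have "length ?\<rho> = length \<rho>" using R by (metis length_append add.commute)
    moreover have "length ?r = length r" using lk by auto
    ultimately show ?thesis using sc[of ?\<rho> ?r k] sc[of ?r ?\<rho> k] t R rQ by metis
  qed
  \<comment> \<open>\<open>S1\<close>: the word read so far runs along a single arc.
    \<open>S2\<close>: it runs along one arc, turns, and continues on a second arc that it entered
    \<open>k\<close> steps after the start and on which it is still in the first half.\<close>
  define S1 where "S1 x t \<longleftrightarrow> (\<exists>v r i. exit_at v r \<and> i + length x \<le> J v r \<and> u = N v r i \<and>
      t = N v r (i + length x) \<and> x = take (length x) (drop i r) \<and> x \<noteq> [])" for x t
  define S2 where "S2 x t \<longleftrightarrow> (\<exists>xa xb v r k. x = xa @ xb \<and> xb \<noteq> [] \<and> S1 xa (v @ take k r) \<and> path ?E u xa (v @ take k r) \<and>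
      exit_at v r \<and> 0 < k \<and> k + length xb \<le> H v r \<and> t = v @ take (k + length xb) r \<and>
      xb = take (length xb) (drop k r) \<and> 24 * k < length r)" for x t
  have S1I: "S1 x t" if "exit_at v r" "i + length x \<le> J v r" "u = N v r i" "t = N v r (i + length x)"
    "x = take (length x) (drop i r)" "x \<noteq> []" for x t v r i
    unfolding S1_def using that by blast
  have S2I: "S2 (xa @ xb) t" if "xb \<noteq> []" "S1 xa (v @ take k r)" "path ?E u xa (v @ take k r)"
      "exit_at v r" "0 < k" "k + length xb \<le> H v r" "t = v @ take (k + length xb) r"
      "xb = take (length xb) (drop k r)" "24 * k < length r" for xa xb t v r k
    unfolding S2_def using that by blast
  have red_y: "reduced y" using y(1) red[OF \<rho>(1)] by (metis append_take_drop_id reduced_append)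
  have shape: "x = [] \<or> S1 x t \<or> S2 x t" if "prefix x y" "path ?E u x t" for x t
    using that
  proof (induction x arbitrary: t rule: rev_induct)
    case (snoc a x)
    have px: "prefix x y" using snoc.prems(1) by (metis prefix_def append.assoc)
    obtain s where s: "path ?E u x s" "(s, a, t) \<in> ?E" using snoc.prems(2) by (auto simp: path_append)
    have nV: "s \<notin> V" "t \<notin> V" using notV px s(1) snoc.prems by blast+
    obtain v2 r2 i2 where a2: "exit_at v2 r2" "i2 < J v2 r2" "s = N v2 r2 i2" "a = r2 ! i2" "t = N v2 r2 (Suc i2)"
      using arc_edge[OF s(2) nV(1)] .
    have len2: "i2 < length r2" using nth_less_len a2 by blast
    have "reduced (x @ [a])" using snoc.prems(1) red_y unfolding prefix_def using reduced_append by blast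
    then have rd: "x \<noteq> [] \<Longrightarrow> a \<noteq> linv (last x)" by (auto simp: reduced_append)
    consider "x = []" | "S1 x s" | "S2 x s" using snoc.IH[OF px s(1)] by blast
    then show ?case
    proof cases
      case 1
      have "S1 [a] t"
        by (rule S1I[of v2 r2 i2]) (use a2 s(1) 1 len2 in \<open>auto simp: take_Suc_conv_app_nth\<close>)
      then show ?thesis using 1 by simp
    next
      case 2
      then obtain v r i where sr: "exit_at v r" "i + length x \<le> J v r" "u = N v r i" "s = N v r (i + length x)"
        "x = take (length x) (drop i r)" "x \<noteq> []" unfolding S1_def by blast
      let ?I = "i + length x"
      have I: "0 < ?I" "?I < J v r"
        using sr nV(1) node_J[OF sr(1)] F_V[OF sr(1)] by (auto simp: le_less)
      have lx: "Suc 0 \<le> length x" using sr(6) by (cases x) auto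
      have "last x = x ! (length x - 1)" using sr(6) by (simp add: last_conv_nth)
      also have "\<dots> = r ! (?I - 1)" using sr(6) I jump_le[of v r] by (subst sr(5)) (simp add: nth_take Nat.add_diff_assoc[OF lx])
      finally have nl: "r2 ! i2 \<noteq> linv (r ! (?I - 1))" using rd[OF sr(6)] a2(4) by metis
      show ?thesis
        using sr(1) I a2(1,2) trans[OF sr(4)[symmetric] a2(3)] nl
      proof (cases rule: arc_step)
        case stem
        have i: "i \<le> H v r" "i \<le> H v2 r2" using stem by auto
        have e: "take i r2 = take i r" using arg_cong[OF stem(5), of "take i"] by simp
        have "x = drop i (take ?I r)" using sr(5) by (metis drop_take add_diff_cancel_left')
        then have "x = drop i (take ?I r2)" using stem(5) by simp
        then have "x = take (length x) (drop i r2)" by (metis drop_take add_diff_cancel_left')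
        then have xs: "x @ [a] = take (length (x @ [a])) (drop i r2)"
          using a2(4) stem(3) len2 by (simp add: take_Suc_conv_app_nth)
        have u: "u = N v2 r2 i" using sr(3) i e stem(2) by (simp add: node_def)
        have t: "t = N v2 r2 (i + length (x @ [a]))" "i + length (x @ [a]) \<le> J v2 r2"
          using a2(2,5) stem(3) by simp_all
        show ?thesis using S1I[OF a2(1) t(2) u t(1) xs] by simp
      next
        case turn
        have xr: "S1 x (v2 @ take i2 r2)" "path ?E u x (v2 @ take i2 r2)"
          using 2 s(1) a2(3) turn(9) by auto
        have "t = v2 @ take (Suc i2) r2" using a2(5) turn by (simp add: node_def)
        moreover have "[a] = take (length [a]) (drop i2 r2)"
          using a2(4) len2 by (simp add: take_Suc_conv_app_nth)
        ultimately have "S2 (x @ [a]) t"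
          using S2I[of "[a]" x v2 i2 r2 t] xr a2(1) turn(5,6,8) by simp
        then show ?thesis by simp
      next
        case straight
        have xs: "x @ [a] = take (length (x @ [a])) (drop i r)"
          using sr(5)[symmetric] straight a2(4) I jump_le[of v r] by (simp add: take_Suc_conv_app_nth)
        have t: "t = N v r (i + length (x @ [a]))" "i + length (x @ [a]) \<le> J v r"
          using a2(5) straight(3) I by simp_all
        show ?thesis using S1I[OF sr(1) t(2) sr(3) t(1) xs] by simp
      qed
    next
      case 3
      then obtain xa xb v r k where sr: "x = xa @ xb" "xb \<noteq> []" "S1 xa (v @ take k r)" "path ?E u xa (v @ take k r)"
        "exit_at v r" "0 < k" "k + length xb \<le> H v r" "s = v @ take (k + length xb) r"
        "xb = take (length xb) (drop k r)" "24 * k < length r" unfolding S2_def by blast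
      let ?K = "k + length xb"
      have K: "0 < ?K" "?K < J v r" "s = N v r ?K" using sr half_less[OF sr(5)] by (auto simp: node_def)
      have lx: "Suc 0 \<le> length xb" using sr(2) by (cases xb) auto
      have "last x = xb ! (length xb - 1)" using sr(1) last_conv_nth[OF sr(2)] last_appendR[OF sr(2)] by metis
      also have "\<dots> = r ! (?K - 1)" using sr(2) K jump_le[of v r] by (subst sr(9)) (simp add: nth_take Nat.add_diff_assoc[OF lx])
      finally have nl: "r2 ! i2 \<noteq> linv (r ! (?K - 1))" using rd sr(1,2) a2(4) by (metis append_is_Nil_conv)
      show ?thesis
        using sr(5) K(1,2) a2(1,2) trans[OF K(3)[symmetric] a2(3)] nl
      proof (cases rule: arc_step)
        case stem
        have e: "take k r2 = take k r" using arg_cong[OF stem(5), of "take k"] by simp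
        have "xb = drop k (take ?K r)" using sr(9) by (metis drop_take add_diff_cancel_left')
        then have "xb = drop k (take ?K r2)" using stem(5) by simp
        then have xb: "xb = take (length xb) (drop k r2)" by (metis drop_take add_diff_cancel_left')
        then have xa: "xb @ [a] = take (length (xb @ [a])) (drop k r2)"
          using a2(4) stem(3) len2 by (simp add: take_Suc_conv_app_nth)
        have k2: "24 * k < length r2"
        proof (cases "r = r2")
          case False
          have "?K \<le> length r2" "?K \<le> length r" using len2 stem(3) K(2) jump_le[of v r] by auto
          then show ?thesis using sc[of r2 r ?K] False a2(1) sr(5) stem(5) by (simp add: is_exit_def)
        qed (use sr in simp)
        \<comment> \<open>To leave the first half the path would have to pass the middle, but both
          the part of the arc before the entry and the part read on it are pieces, together less
          than 1/12.\<close>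
        have "?K < H v2 r2"
        proof (rule ccontr)
          assume "\<not> ?K < H v2 r2"
          then have KH: "?K = H v2 r2" using stem by simp
          have nd: "N v2 r2 k = v @ take k r" using KH stem(2) e by (simp add: node_def)
          have pp: "prefix (xa @ take (length (xb @ [a])) (drop k r2)) y"
            using snoc.prems(1) unfolding xa[symmetric] sr(1) by simp
          have "24 * length (xb @ [a]) < length r2"
            using bound[OF pp _ a2(1)] sr(4) nd a2(2) stem(3) by simp
          then have "24 * (H v2 r2 + 1) < 2 * length r2" using k2 KH by simp
          moreover have "12 * J v2 r2 \<le> 24 * (H v2 r2 + 1)" using half_big[of v2 r2] by simp
          ultimately have "11 * length r2 < 2 * length r2" using jump_big'[OF a2(1)] by linarith
          then show False by simp
        qed
        then have t: "t = v2 @ take (k + length (xb @ [a])) r2" "k + length (xb @ [a]) \<le> H v2 r2"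
          using a2(5) stem(3) by (auto simp: node_def)
        have "S1 xa (v2 @ take k r2)" "path ?E u xa (v2 @ take k r2)" using sr(3,4) e stem(2) by simp_all
        from S2I[OF _ this a2(1) sr(6) t(2,1) xa k2] show ?thesis using sr(1) by simp
      qed (use sr(7) in simp_all)
    qed
  qed simp
  consider "y = []" | "S1 y w" | "S2 y w" using shape[OF prefix_order.refl p] by blast
  then show ?thesis
  proof cases
    case 1
    then show ?thesis using ne[OF \<rho>(1)] by simp
  next
    case 2
    then obtain v r i where "exit_at v r" "i + length y \<le> J v r" "u = N v r i" "y = take (length y) (drop i r)"
      unfolding S1_def by blast
    then show ?thesis using bound[of "[]" "length y" i r v] by simp
  next
    case 3
    then obtain xa xb v r k where sr: "y = xa @ xb" "S1 xa (v @ take k r)" "path ?E u xa (v @ take k r)"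
      "exit_at v r" "k + length xb \<le> H v r" "xb = take (length xb) (drop k r)" unfolding S2_def by blast
    from sr(2) obtain v1 r1 i1 where s1: "exit_at v1 r1" "i1 + length xa \<le> J v1 r1" "u = N v1 r1 i1"
      "xa = take (length xa) (drop i1 r1)" unfolding S1_def by blast
    have "24 * length xa < length \<rho>" using bound[of "[]" "length xa" i1 r1 v1] s1 sr(1) by (simp add: prefix_def)
    moreover have "24 * length xb < length \<rho>"
      using bound[of xa "length xb" k r v] sr half_less[OF sr(4)] by (simp add: node_def)
    ultimately show ?thesis using sr(1) by simp
  qed
qed

lemma ext_stage: "stage Q (extE Q E V) (extV Q E V)"
proof unfold_locales
  show "[] \<in> extV Q E V" using nilV by (simp add: extV_def)
qed (use ext_E_V ext_tree ext_small in blast)+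

end

section \<open>The union of all stages and Greendlinger's lemma\<close>

fun stages :: "'s word set \<Rightarrow> nat \<Rightarrow> ('s word \<times> ('s \<times> bool) \<times> 's word) set \<times> 's word set" where
  "stages Q 0 = ({}, {[]})"
| "stages Q (Suc k) = (case stages Q k of (E, V) \<Rightarrow> (extE Q E V, extV Q E V))"

context relators
begin

abbreviation "E\<^sub>k k \<equiv> fst (stages Q k)"
abbreviation "V\<^sub>k k \<equiv> snd (stages Q k)"

definition Einf where "Einf = (\<Union>k. E\<^sub>k k)"
definition Vinf where "Vinf = (\<Union>k. V\<^sub>k k)"

lemma E_Suc: "E\<^sub>k (Suc k) = extE Q (E\<^sub>k k) (V\<^sub>k k)" and V_Suc: "V\<^sub>k (Suc k) = extV Q (E\<^sub>k k) (V\<^sub>k k)"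
  by (simp_all add: case_prod_beta)

lemma stage_k: "stage Q (E\<^sub>k k) (V\<^sub>k k)"
proof (induction k)
  case 0
  have *: "path {} u y v \<longleftrightarrow> y = [] \<and> u = v" for u v :: "'s word" and y :: "'s word"
    by (cases y) auto
  show ?case by unfold_locales (use ne in \<open>auto simp: *\<close>)
next
  case (Suc k)
  then show ?case using stage.ext_stage unfolding E_Suc V_Suc by blast
qed

lemma E_mono: "i \<le> j \<Longrightarrow> E\<^sub>k i \<subseteq> E\<^sub>k j"
  by (rule lift_Suc_mono_le) (auto simp: E_Suc extE_def simp del: stages.simps)

lemma V_mono: "i \<le> j \<Longrightarrow> V\<^sub>k i \<subseteq> V\<^sub>k j"
  by (rule lift_Suc_mono_le) (auto simp: V_Suc extV_def simp del: stages.simps)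

sublocale inf: sym_det Einf
proof
  show "(v, linv a, u) \<in> Einf" if "(u, a, v) \<in> Einf" for u a v
    using that sym_det.sym[OF stage.axioms(2)[OF stage_k]] unfolding Einf_def by blast
  show "v = v'" if a: "(u, a, v) \<in> Einf" "(u, a, v') \<in> Einf" for u a v v'
  proof -
    obtain i j where "(u, a, v) \<in> E\<^sub>k i" "(u, a, v') \<in> E\<^sub>k j" using a unfolding Einf_def by blast
    then have "(u, a, v) \<in> E\<^sub>k (max i j)" "(u, a, v') \<in> E\<^sub>k (max i j)"
      using E_mono[of i "max i j"] E_mono[of j "max i j"] by auto
    then show ?thesis using sym_det.det[OF stage.axioms(2)[OF stage_k]] by blast
  qed
qed

lemma nil_Vinf: "[] \<in> Vinf"
  unfolding Vinf_def by (intro UN_I[of 0]) auto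

lemma closed_Vinf: assumes "v \<in> Vinf" "r \<in> Q" shows "path Einf v r v"
proof -
  obtain k where "v \<in> V\<^sub>k k" using assms by (auto simp: Vinf_def)
  then have "path (E\<^sub>k (Suc k)) v r v"
    unfolding E_Suc by (rule stage.closed_V[OF stage_k _ assms(2)])
  then show ?thesis by (rule path_mono) (unfold Einf_def, blast)
qed

lemma Einf_Vinf: assumes "(u, a, v) \<in> Einf" shows "v \<in> Vinf"
proof -
  obtain k where "(u, a, v) \<in> E\<^sub>k k" using assms by (auto simp: Einf_def)
  then have "v \<in> V\<^sub>k k" by (rule stage.E_V2[OF stage_k])
  then show ?thesis by (auto simp: Vinf_def)
qed

lemma path_Vinf: "path Einf u x v \<Longrightarrow> u \<in> Vinf \<Longrightarrow> v \<in> Vinf"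
  by (induction x arbitrary: u) (auto dest: Einf_Vinf)

lemma complete_Vinf: assumes "v \<in> Vinf" "a \<in> \<Union> (set ` Q)" shows "\<exists>t. (v, a, t) \<in> Einf"
proof -
  obtain r where r: "r \<in> Q" "a \<in> set r" using assms by blast
  then obtain x y where "r = x @ a # y" by (auto simp: in_set_conv_decomp)
  then have "a # y @ x \<in> Q" using rot_split[of x "a # y"] r by simp
  then have "path Einf v (a # y @ x) v" by (rule closed_Vinf[OF assms(1)])
  then show ?thesis by auto
qed

lemma path_total: "v \<in> Vinf \<Longrightarrow> set x \<subseteq> \<Union> (set ` Q) \<Longrightarrow> \<exists>t. path Einf v x t"
proof (induction x arbitrary: v)
  case (Cons a x)
  then obtain t where t: "(v, a, t) \<in> Einf" using complete_Vinf[of v a] by auto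
  then obtain t' where "path Einf t x t'" using Cons.IH[OF Einf_Vinf[OF t]] Cons.prems(2) by auto
  then have "path Einf v (a # x) t'" using t by auto
  then show ?case by blast
qed auto

lemma (in sym_det) path_reduce: "path E u x v \<Longrightarrow> path E u (reduce x) v"
proof (induction x arbitrary: u)
  case (Cons a x)
  then obtain t where t: "(u, a, t) \<in> E" "path E t (reduce x) v" by auto
  show ?case
  proof (cases "reduce x")
    case y: (Cons b y)
    have e: "reduce (a # x) = (if b = linv a then y else a # b # y)" using y by (simp add: reduce_def)
    show ?thesis
    proof (cases "b = linv a")
      case True
      then obtain t' where t': "(t, linv a, t') \<in> E" "path E t' y v" using t(2) y by auto
      then have "t' = u" using det[OF sym[OF t(1)]] by blast
      then show ?thesis using e True t' by simp
    next
      case False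
      then show ?thesis using e t y by auto
    qed
  qed (use t in \<open>auto simp: reduce_def\<close>)
qed (simp add: reduce_def)

text \<open>In the first stage where \<open>w\<close> closes up it uses new arcs, since it does not
  close in the stage before; \<open>ext_chunk\<close> then finds the relator.\<close>

theorem Greendlinger:
  assumes "path Einf [] w []" "reduced w" "w \<noteq> []"
  shows "\<exists>r n. r \<in> Q \<and> sublist (take n r) w \<and> n \<le> length r \<and> 7 * length r < 8 * n"
proof -
  have is_exit: "\<exists>k. path (E\<^sub>k k) u w v" if "path Einf u w v" for u v and w :: "'s word"
    using that
  proof (induction w arbitrary: u)
    case (Cons a w)
    then obtain t i j where t: "(u, a, t) \<in> E\<^sub>k i" "path (E\<^sub>k j) t w v"
      by (fastforce simp: Einf_def)
    then have "(u, a, t) \<in> E\<^sub>k (max i j)" "path (E\<^sub>k (max i j)) t w v"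
      using E_mono[of i "max i j"] path_mono[OF _ E_mono[of j "max i j"]] by auto
    then show ?case by auto
  qed simp
  define k where "k = (LEAST k. path (E\<^sub>k k) [] w [])"
  have k: "path (E\<^sub>k k) [] w []" unfolding k_def using is_exit[OF assms(1)] by (rule LeastI_ex)
  have "k \<noteq> 0"
  proof
    assume "k = 0"
    then show False using k assms(3) by (cases w) auto
  qed
  then obtain m where m: "k = Suc m" by (cases k) auto
  have "\<not> path (E\<^sub>k m) [] w []" using not_less_Least[of m "\<lambda>k. path (E\<^sub>k k) [] w []"] m k_def by auto
  moreover have "[] \<in> V\<^sub>k m" using V_mono[of 0 m] by auto
  ultimately show ?thesis
    using stage.ext_chunk[OF stage_k[of m], of "[]" w "[]"] k assms(2) unfolding m E_Suc by blast
qed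

end

section \<open>Arcs of relator cycles and the filling inequality\<close>

lemma concat_split_left:
  "concat us = x @ w \<Longrightarrow> w \<noteq> [] \<Longrightarrow>
   \<exists>as u bs x' u'. us = as @ [u] @ bs \<and> u = x' @ u' \<and> u' \<noteq> [] \<and> x = concat as @ x' \<and> w = u' @ concat bs"
proof (induction us arbitrary: x)
  case (Cons v us)
  show ?case
  proof (cases "length x < length v")
    case True
    then obtain u' where "v = x @ u'" "u' \<noteq> []" "w = u' @ concat us"
      using Cons.prems(1) by (auto simp: append_eq_append_conv2)
    then show ?thesis by (intro exI[of _ "[]"] exI[of _ v] exI[of _ us] exI[of _ x] exI[of _ u']) simp
  next
    case False
    then obtain x' where x': "x = v @ x'" "concat us = x' @ w"
      using Cons.prems(1) by (auto simp: append_eq_append_conv2)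
    from Cons.IH[OF x'(2) Cons.prems(2)] obtain as u bs y u' where
      "us = as @ [u] @ bs" "u = y @ u'" "u' \<noteq> []" "x' = concat as @ y" "w = u' @ concat bs" by blast
    then show ?thesis using x'(1)
      by (intro exI[of _ "v # as"] exI[of _ u] exI[of _ bs] exI[of _ y] exI[of _ u']) simp
  qed
qed simp

lemma concat_split_right:
  "concat us = w @ y \<Longrightarrow> w \<noteq> [] \<Longrightarrow>
   \<exists>ms v bs z y'. us = ms @ [v] @ bs \<and> v = z @ y' \<and> z \<noteq> [] \<and> w = concat ms @ z \<and> y = y' @ concat bs"
proof (induction us arbitrary: w)
  case (Cons v us)
  show ?case
  proof (cases "length w \<le> length v")
    case True
    then obtain y' where "v = w @ y'" "y = y' @ concat us"
      using Cons.prems(1) by (auto simp: append_eq_append_conv2)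
    then show ?thesis using Cons.prems(2)
      by (intro exI[of _ "[]"] exI[of _ v] exI[of _ us] exI[of _ w] exI[of _ y']) simp
  next
    case False
    then obtain w' where w': "w = v @ w'" "concat us = w' @ y" "w' \<noteq> []"
      using Cons.prems(1) by (auto simp: append_eq_append_conv2)
    from Cons.IH[OF w'(2,3)] obtain ms u bs z y' where
      "us = ms @ [u] @ bs" "u = z @ y'" "z \<noteq> []" "w' = concat ms @ z" "y = y' @ concat bs" by blast
    then show ?thesis using w'(1)
      by (intro exI[of _ "v # ms"] exI[of _ u] exI[of _ bs] exI[of _ z] exI[of _ y']) simp
  qed
qed simp

lemma concat_overlap:
  assumes "concat us = x @ c @ y" "c \<noteq> []"
  obtains (one) as u bs x' y' where "us = as @ [u] @ bs" "u = x' @ c @ y'" "x = concat as @ x'" "y = y' @ concat bs"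
  | (many) as u ms v bs x' z0 z1 y' where "us = as @ [u] @ ms @ [v] @ bs" "u = x' @ z0" "v = z1 @ y'"
      "c = z0 @ concat ms @ z1" "z0 \<noteq> []" "z1 \<noteq> []" "x = concat as @ x'" "y = y' @ concat bs"
proof -
  from concat_split_left[OF assms(1)] assms(2) obtain as u bs x' u' where
    1: "us = as @ [u] @ bs" "u = x' @ u'" "u' \<noteq> []" "x = concat as @ x'" "c @ y = u' @ concat bs" by auto
  show thesis
  proof (cases "length c \<le> length u'")
    case True
    then obtain y' where "u' = c @ y'" "y = y' @ concat bs" using 1(5) by (auto simp: append_eq_append_conv2)
    then show ?thesis using one 1 by blast
  next
    case False
    then obtain c' where c': "c = u' @ c'" "c' \<noteq> []" "concat bs = c' @ y"
      using 1(5) by (auto simp: append_eq_append_conv2)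
    from concat_split_right[OF c'(3,2)] obtain ms v bs' z y' where
      "bs = ms @ [v] @ bs'" "v = z @ y'" "z \<noteq> []" "c' = concat ms @ z" "y = y' @ concat bs'" by blast
    then show ?thesis using many[of as u ms v bs' x' u' z y'] 1 c' by simp
  qed
qed

text \<open>Junctions where two nonempty factors cancel. An empty factor hides the cancellation
  between its neighbours, so empty factors must be gone before \<open>dirty us = 0\<close> says that
  the concatenation is reduced.\<close>

fun dirty :: "'s word list \<Rightarrow> nat" where
  "dirty (u # v # us) = (if u \<noteq> [] \<and> v \<noteq> [] \<and> hd v = linv (last u) then 1 else 0) + dirty (v # us)"
| "dirty us = 0"

lemma dirty_append: "dirty xs + dirty ys \<le> dirty (xs @ ys) \<and> dirty (xs @ ys) \<le> dirty xs + dirty ys + 1"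
proof (induction xs rule: dirty.induct)
  case ("2_2" v)
  then show ?case by (cases ys) auto
qed auto

lemma dirty_replace: "dirty (xs @ m # zs) \<le> dirty (xs @ ms @ zs) + 2"
proof -
  have "dirty (xs @ m # zs) \<le> dirty xs + dirty ([m] @ zs) + 1" using dirty_append[of xs "m # zs"] by simp
  also have "dirty ([m] @ zs) \<le> dirty zs + 1" using dirty_append[of "[m]" zs] by simp
  finally show ?thesis using dirty_append[of xs "ms @ zs"] dirty_append[of ms zs] by linarith
qed

text \<open>Maximality of \<open>z\<close> cleans this junction. The outer junctions keep their
  letters or get an empty factor, so none of them becomes dirty.\<close>

lemma dirty_trim:
  assumes "u \<noteq> []" "v \<noteq> []" "hd v = linv (last u)"
    and "u = u' @ z" "v = winv z @ v'" "z \<noteq> []" "u' = [] \<or> v' = [] \<or> hd v' \<noteq> linv (last u')"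
  shows "dirty (xs @ u' # v' # ys) < dirty (xs @ u # v # ys)"
proof -
  have l: "dirty (xs @ u' # zs) \<le> dirty (xs @ u # []) + dirty (u' # zs)" for zs
  proof (induction xs rule: dirty.induct)
    case ("2_2" w)
    then show ?case using assms by auto
  qed auto
  have r: "dirty (v' # ys) \<le> dirty (v # ys)" using assms by (cases ys) auto
  have c: "dirty (xs @ u # zs) = dirty (xs @ [u]) + dirty (u # zs)" for zs
    by (induction xs rule: dirty.induct) auto
  have "dirty (u' # v' # ys) = dirty (v' # ys)" using assms by auto
  then show ?thesis using l[of "v' # ys"] c[of "v # ys"] r assms(1-3) by simp
qed

lemma reduced_concat:
  "(\<And>u. u \<in> set us \<Longrightarrow> reduced u \<and> u \<noteq> []) \<Longrightarrow> dirty us = 0 \<Longrightarrow> reduced (concat us)"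
proof (induction us rule: dirty.induct)
  case (1 u v us)
  have "reduced (concat (v # us))" using 1 by (auto split: if_splits)
  moreover have "v \<noteq> []" "u \<noteq> []" "hd v \<noteq> linv (last u)" "reduced u" using 1 by (auto split: if_splits)
  ultimately show ?case by (auto simp: reduced_append)
qed auto

lemma dirty_pos: "dirty us \<noteq> 0 \<Longrightarrow> \<exists>xs u v ys. us = xs @ u # v # ys \<and> u \<noteq> [] \<and> v \<noteq> [] \<and> hd v = linv (last u)"
proof (induction us rule: dirty.induct)
  case (1 u v us)
  show ?case
  proof (cases "u \<noteq> [] \<and> v \<noteq> [] \<and> hd v = linv (last u)")
    case True
    then show ?thesis by (intro exI[of _ "[]"] exI[of _ u] exI[of _ v] exI[of _ us]) auto
  next
    case False
    then obtain xs u' v' ys where "v # us = xs @ u' # v' # ys \<and> u' \<noteq> [] \<and> v' \<noteq> [] \<and> hd v' = linv (last u')"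
      using 1 by auto
    then show ?thesis by (intro exI[of _ "u # xs"] exI[of _ u'] exI[of _ v'] exI[of _ ys]) auto
  qed
qed auto

lemma max_cancel:
  assumes "u \<noteq> []" "v \<noteq> []" "hd v = linv (last u)"
  obtains u' z v' where "u = u' @ z" "v = winv z @ v'" "z \<noteq> []" "u' = [] \<or> v' = [] \<or> hd v' \<noteq> linv (last u')"
  using assms
proof (induction v arbitrary: u thesis)
  case (Cons a v)
  have u: "u = butlast u @ [linv a]" using Cons.prems by (metis append_butlast_last_id linv_linv list.sel(1))
  show ?case
  proof (cases "butlast u \<noteq> [] \<and> v \<noteq> [] \<and> hd v = linv (last (butlast u))")
    case True
    then obtain u' z v' where "butlast u = u' @ z" "v = winv z @ v'" "z \<noteq> []"
      "u' = [] \<or> v' = [] \<or> hd v' \<noteq> linv (last u')"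
      using Cons.IH[of "butlast u"] by blast
    then show ?thesis using Cons.prems(1)[of u' "z @ [linv a]" v'] u by (simp add: winv_append winv_Cons)
  next
    case False
    then have "butlast u = [] \<or> v = [] \<or> hd v \<noteq> linv (last (butlast u))" by blast
    from Cons.prems(1)[OF u _ _ this] show ?thesis by (simp add: winv_Cons)
  qed
qed simp

section \<open>Translated relator cycles\<close>

locale scg = relators Q + group G for Q :: "'s word set" and G (structure) +
  fixes el :: "'s \<times> bool \<Rightarrow> 'g" and S :: "'s set"
  assumes el_closed [simp]: "el a \<in> carrier G"
    and el_linv: "el (linv a) = inv (el a)"
begin

lemma inv_cancel [simp]:
  "x \<in> carrier G \<Longrightarrow> y \<in> carrier G \<Longrightarrow> x \<otimes> (inv x \<otimes> y) = y"
  "x \<in> carrier G \<Longrightarrow> y \<in> carrier G \<Longrightarrow> inv x \<otimes> (x \<otimes> y) = y"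
  by (simp_all add: m_assoc[symmetric])

fun e :: "'s word \<Rightarrow> 'g" where
  "e [] = \<one>"
| "e (a # w) = el a \<otimes> e w"

lemma e_closed [simp]: "e w \<in> carrier G"
  by (induction w) auto

lemma e_append [simp]: "e (u @ v) = e u \<otimes> e v"
  by (induction u) (auto simp: m_assoc)

lemma e_winv [simp]: "e (winv u) = inv (e u)"
  by (induction u) (auto simp: winv_Cons el_linv inv_mult_group)

text \<open>A pair \<open>(g, r)\<close> stands for the closed path labelled \<open>r\<close> from
  \<open>g\<close>. Moving the base point along it, or reversing it, gives the same cycle;
  \<open>cyc\<close> is the resulting class.\<close>

inductive same :: "'g \<Rightarrow> 's word \<Rightarrow> 'g \<Rightarrow> 's word \<Rightarrow> bool" for g r where
  refl: "same g r g r"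
| rot: "same g r h (a # x) \<Longrightarrow> same g r (h \<otimes> el a) (x @ [a])"
| inv: "same g r h x \<Longrightarrow> same g r h (winv x)"

lemma same_trans: "same h x k y \<Longrightarrow> same g r h x \<Longrightarrow> same g r k y"
  by (induction rule: same.induct) (auto intro: same.intros)

lemma same_closed: "same g r h x \<Longrightarrow> g \<in> carrier G \<Longrightarrow> h \<in> carrier G"
  by (induction rule: same.induct) auto

lemma same_sym: "same g r h x \<Longrightarrow> g \<in> carrier G \<Longrightarrow> same h x g r"
proof (induction rule: same.induct)
  case (rot h a x)
  have hc: "h \<in> carrier G" using same_closed rot by blast
  have "same (h \<otimes> el a) (x @ [a]) (h \<otimes> el a) (winv (x @ [a]))" by (intro same.intros)
  then have "same (h \<otimes> el a) (x @ [a]) (h \<otimes> el a \<otimes> el (linv a)) (winv x @ [linv a])"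
    by (intro same.rot) (simp add: winv_append winv_Cons)
  then have "same (h \<otimes> el a) (x @ [a]) h (winv (a # x))"
    using hc by (simp add: winv_Cons el_linv m_assoc)
  then have "same (h \<otimes> el a) (x @ [a]) h (a # x)" using same.inv by fastforce
  then show ?case using same_trans rot by blast
next
  case (inv h x)
  have "same h (winv x) h x" using same.inv[OF same.refl[of h "winv x"]] by simp
  then show ?case using same_trans inv by blast
qed (rule same.refl)

definition cyc :: "'g \<Rightarrow> 's word \<Rightarrow> ('g \<times> 's word) set" where
  "cyc g r = {(h, x). same g r h x}"

lemma cyc_eq_iff: "g \<in> carrier G \<Longrightarrow> h \<in> carrier G \<Longrightarrow> cyc g r = cyc h x \<longleftrightarrow> same g r h x"
  unfolding cyc_def using same_trans same_sym same.refl by blast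

lemma same_take: "same g r (g \<otimes> e (take k r)) (drop k r @ take k r)" if "g \<in> carrier G"
proof (induction k)
  case (Suc k)
  show ?case
  proof (cases "k < length r")
    case True
    then have "drop k r = r ! k # drop (Suc k) r" by (simp add: Cons_nth_drop_Suc)
    then have "same g r (g \<otimes> e (take k r) \<otimes> el (r ! k)) ((drop (Suc k) r @ take k r) @ [r ! k])"
      using Suc by (intro same.rot) simp
    then show ?thesis using True that by (simp add: take_Suc_conv_app_nth m_assoc)
  qed (use Suc in simp)
qed (use that in \<open>simp add: same.refl\<close>)

lemma cyc_take: "g \<in> carrier G \<Longrightarrow> cyc (g \<otimes> e (take k r)) (drop k r @ take k r) = cyc g r"
  using same_take by (subst cyc_eq_iff) (auto intro: same_sym)

lemma cyc_split: "g \<in> carrier G \<Longrightarrow> cyc (g \<otimes> e u) (v @ u) = cyc g (u @ v)"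
  using cyc_take[of g "length u" "u @ v"] by simp

lemma cyc_winv: "g \<in> carrier G \<Longrightarrow> cyc g (winv r) = cyc g r"
  using same.inv[OF same.refl] same_sym by (subst cyc_eq_iff) auto

end

locale scg_rel = scg Q G el S
  for Q :: "'s word set" and G (structure) and el :: "'s \<times> bool \<Rightarrow> 'g" and S +
  assumes e_rel: "r \<in> Q \<Longrightarrow> e r = \<one>"
    and Q_S: "r \<in> Q \<Longrightarrow> fst ` set r \<subseteq> S"
    and GL: "fst ` set w \<subseteq> S \<Longrightarrow> reduced w \<Longrightarrow> w \<noteq> [] \<Longrightarrow> e w = \<one> \<Longrightarrow>
      \<exists>r n. r \<in> Q \<and> sublist (take n r) w \<and> n \<le> length r \<and> 7 * length r < 8 * n"
begin

text \<open>The two ways between two points of a relator cycle have equal value, so half a relator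
  suffices to join any two points of it.\<close>

lemma e_take_compl: "r \<in> Q \<Longrightarrow> k \<le> length r \<Longrightarrow> e (take (length r - k) (winv r)) = e (take k r)"
proof -
  assume r: "r \<in> Q" "k \<le> length r"
  have "take (length r - k) (winv r) = winv (drop k r)"
    using r by (metis append_take_drop_id append_eq_conv_conj length_drop length_winv winv_append)
  moreover have "e (take k r) \<otimes> e (drop k r) = \<one>" using e_rel[OF r(1)] e_append by (metis append_take_drop_id)
  ultimately show ?thesis by (metis e_closed e_winv inv_equality inv_inv inv_closed)
qed

lemma same_normal: "same g r h x \<Longrightarrow> g \<in> carrier G \<Longrightarrow> r \<in> Q \<Longrightarrow>
  \<exists>k<length r. h = g \<otimes> e (take k r) \<and> (x = drop k r @ take k r \<or> x = winv (drop k r @ take k r))"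
proof (induction rule: same.induct)
  case refl
  then show ?case using ne[of r] by (intro exI[of _ 0]) auto
next
  case (rot h a x)
  then obtain k where k: "k < length r" "h = g \<otimes> e (take k r)"
    "a # x = drop k r @ take k r \<or> a # x = winv (drop k r @ take k r)" by blast
  from k(3) show ?case
  proof
    assume ax: "a # x = drop k r @ take k r"
    have dk: "drop k r = r ! k # drop (Suc k) r" using k by (simp add: Cons_nth_drop_Suc)
    have a: "a = r ! k" "x = drop (Suc k) r @ take k r" using ax dk by auto
    have tk: "take (Suc k) r = take k r @ [r ! k]" using k by (simp add: take_Suc_conv_app_nth)
    show ?case
    proof (cases "Suc k < length r")
      case True
      then show ?thesis using a tk k rot by (intro exI[of _ "Suc k"]) (simp add: m_assoc)
    next
      case False
      then have "Suc k = length r" using k by simp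
      then have "take (Suc k) r = r" "drop (Suc k) r = []" by auto
      then have "e (take k r) \<otimes> el (r ! k) = \<one>" "x @ [a] = r" using tk e_rel[OF rot(4)] a by (metis e_append e.simps r_one el_closed, simp)
      then show ?thesis using ne[OF rot(4)] k a rot by (intro exI[of _ 0]) (simp add: m_assoc)
    qed
  next
    assume ax: "a # x = winv (drop k r @ take k r)"
    show ?case
    proof (cases k)
      case 0
      define m where "m = length r - 1"
      have m: "Suc m = length r" "m < length r" using k 0 m_def by auto
      have rm: "r = take m r @ [r ! m]" using m by (metis lessI take_Suc_conv_app_nth take_all_iff le_refl)
      then have "winv r = linv (r ! m) # winv (take m r)" by (metis winv_append winv_Cons winv_Nil append_Nil append_Cons)
      then have a: "a = linv (r ! m)" "x = winv (take m r)" using ax 0 by auto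
      have "e (take m r) \<otimes> el (r ! m) = \<one>" using rm e_rel[OF rot(4)] by (metis e_append e.simps r_one el_closed)
      then have "e (take m r) = el a" using a by (simp add: el_linv inv_equality[symmetric] inv_equality)
      moreover have "x @ [a] = winv (drop m r @ take m r)"
        using a m by (simp add: winv_append winv_Cons flip: Cons_nth_drop_Suc)
      ultimately show ?thesis using m k 0 rot by (intro exI[of _ m]) simp
    next
      case (Suc m)
      have tk: "take k r = take m r @ [r ! m]" using k Suc by (simp add: take_Suc_conv_app_nth)
      have a: "a = linv (r ! m)" "x = winv (drop k r @ take m r)"
        using ax tk by (auto simp: winv_append winv_Cons)
      have "drop m r = r ! m # drop k r" using k Suc by (simp add: Cons_nth_drop_Suc)
      then have "x @ [a] = winv (drop m r @ take m r)" using a by (simp add: winv_append winv_Cons)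
      moreover have "h \<otimes> el a = g \<otimes> e (take m r)" using k(2) tk a rot(3) by (simp add: el_linv m_assoc)
      ultimately show ?thesis using k Suc by (intro exI[of _ m]) simp
    qed
  qed
next
  case (inv h x)
  then show ?case by auto
qed

lemma short_arc:
  assumes "p \<in> carrier G" "q \<in> carrier G" "r \<in> Q" "cyc p r = cyc q x"
  obtains u r' where "r' \<in> Q" "u = take (length u) r'" "2 * length u \<le> length r'" "q = p \<otimes> e u" "cyc p r' = cyc p r"
proof -
  have "same p r q x" using assms cyc_eq_iff by blast
  then obtain k where k: "k < length r" "q = p \<otimes> e (take k r)" using same_normal assms by blast
  show thesis
  proof (cases "2 * k \<le> length r")
    case True
    then show ?thesis using that[of r "take k r"] k assms by simp
  next
    case False
    then show ?thesis
      using that[of "winv r" "take (length r - k) (winv r)"] k assms e_take_compl[of r k] winv_mem cyc_winv by simp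
  qed
qed

end

section \<open>Parts of relators in products of arcs\<close>

abbreviation "label xs \<equiv> concat (map fst xs)"

lemma map_fst_split:
  assumes "map fst xs = as0 @ u # bs0"
  obtains as r bs where "xs = as @ (u, r) # bs" "map fst as = as0" "map fst bs = bs0"
  using assms by (auto simp: map_eq_append_conv map_eq_Cons_conv)

context scg_rel
begin

definition arc :: "'s word \<Rightarrow> 's word \<Rightarrow> bool" where
  "arc u r \<longleftrightarrow> r \<in> Q \<and> u = take (length u) r \<and> 2 * length u \<le> length r"

text \<open>An arc counts as lying on \<open>c\<close> also if only its word can be read along
  \<open>c\<close> from its starting point; if its own cycle is a different one, the word is then a
  piece.\<close>

fun on_cycle :: "('g \<times> 's word) set \<Rightarrow> 'g \<Rightarrow> ('s word \<times> 's word) list \<Rightarrow> bool" where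
  "on_cycle c p [] \<longleftrightarrow> True"
| "on_cycle c p ((u, r) # ys) \<longleftrightarrow> (cyc p r = c \<or>
    (\<exists>\<rho>\<in>Q. cyc p \<rho> = c \<and> length u \<le> length \<rho> \<and> u = take (length u) \<rho>)) \<and> on_cycle c (p \<otimes> e u) ys"

lemma on_cycle_append: "p \<in> carrier G \<Longrightarrow> on_cycle c p (ys @ zs) \<longleftrightarrow> on_cycle c p ys \<and> on_cycle c (p \<otimes> e (label ys)) zs"
  by (induction ys arbitrary: p) (auto simp: m_assoc)

lemma arc_Q: "arc u r \<Longrightarrow> r \<in> Q" by (simp add: arc_def)

lemma rot_take: "\<rho> \<in> Q \<Longrightarrow> drop k \<rho> @ take k \<rho> \<in> Q"
  using rot_split[of "take k \<rho>" "drop k \<rho>"] by simp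

lemma on_cycle_sub: "p \<in> carrier G \<Longrightarrow> \<rho> \<in> Q \<Longrightarrow> prefix (label ys) \<rho> \<Longrightarrow> on_cycle (cyc p \<rho>) p ys"
proof (induction ys arbitrary: p \<rho>)
  case (Cons y ys)
  obtain u r where y: "y = (u, r)" by force
  let ?\<rho> = "drop (length u) \<rho> @ take (length u) \<rho>"
  obtain z where z: "\<rho> = u @ label ys @ z" using Cons.prems y by (auto simp: prefix_def)
  then have u: "take (length u) \<rho> = u" "length u \<le> length \<rho>" by auto
  have "cyc (p \<otimes> e u) ?\<rho> = cyc p \<rho>" using cyc_take[OF Cons.prems(1), of "length u" \<rho>] u by simp
  moreover have "on_cycle (cyc (p \<otimes> e u) ?\<rho>) (p \<otimes> e u) ys"
  proof (rule Cons.IH)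
    show "?\<rho> \<in> Q" using rot_take[OF Cons.prems(2)] .
    show "prefix (label ys) ?\<rho>" using z by simp
  qed (use Cons.prems in simp)
  ultimately show ?case using Cons.prems y u by auto
qed simp

lemma sc_prefix:
  assumes "r \<in> Q" "\<rho> \<in> Q" "r \<noteq> \<rho>" "prefix z r" "prefix z \<rho>"
  shows "24 * length z < length \<rho>"
proof -
  obtain a b where "r = z @ a" "\<rho> = z @ b" using assms by (auto simp: prefix_def)
  then show ?thesis using sc[of \<rho> r "length z"] assms by simp
qed

lemma arc_split: "arc (x @ z) r \<Longrightarrow> prefix z (drop (length x) r @ take (length x) r)"
proof -
  assume "arc (x @ z) r"
  then obtain y where "r = x @ z @ y" unfolding arc_def by (metis append_take_drop_id append.assoc)
  then show ?thesis by simp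
qed

lemma arc_prefix: "arc u r \<Longrightarrow> prefix u r"
  unfolding arc_def by (metis take_is_prefix)

text \<open>Compare the relator of every arc that meets the chunk with the cycle of
  \<open>\<rho>\<close>: if they differ, the common part is a piece. The arcs strictly inside the
  chunk can be read along that cycle, so two of them, or one of them beside an end arc with the
  right relator, form a \<open>block\<close>. Otherwise either one arc has the right relator and the
  rest are pieces (\<open>single\<close>), or the chunk consists of at most three pieces or lies
  within one arc (\<open>short\<close>).\<close>

lemma chunk_cases:
  assumes arcs: "\<forall>(u, r)\<in>set xs. arc u r"
    and c: "label xs = x @ take n \<rho> @ y" and \<rho>: "\<rho> \<in> Q" "0 < n" "n \<le> length \<rho>" and p: "p \<in> carrier G"
  obtains (short) "2 * n \<le> length \<rho>"
  | (block) as ys bs \<rho>' where "xs = as @ ys @ bs" "2 \<le> length ys" "\<rho>' \<in> Q"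
      "on_cycle (cyc (p \<otimes> e (label as)) \<rho>') (p \<otimes> e (label as)) ys"
  | (single) as u r bs x' w y' z0 z1 where "xs = as @ [(u, r)] @ bs" "u = x' @ w @ y'"
      "take n \<rho> = z0 @ w @ z1" "x @ z0 = label as @ x'" "z1 @ y = y' @ label bs"
      "z0 \<noteq> [] \<Longrightarrow> x' = [] \<and> (\<exists>as' u0 r0 x0. as = as' @ [(u0, r0)] \<and> u0 = x0 @ z0)"
      "z1 \<noteq> [] \<Longrightarrow> y' = [] \<and> (\<exists>bs' u1 r1 y1. bs = (u1, r1) # bs' \<and> u1 = z1 @ y1)"
      "24 * length z0 < length \<rho>" "24 * length z1 < length \<rho>"
      "drop (length x') r @ take (length x') r = drop (length z0) \<rho> @ take (length z0) \<rho>"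
proof -
  define c0 where "c0 = take n \<rho>"
  have c0: "c0 \<noteq> []" "length c0 = n" "prefix c0 \<rho>" using \<rho> by (auto simp: c0_def take_is_prefix)
  from c have "concat (map fst xs) = x @ c0 @ y" by (simp add: c0_def)
  then show thesis using c0(1)
  proof (cases rule: concat_overlap)
    case (one as0 u bs0 x' y')
    then obtain as r bs where xs: "xs = as @ [(u, r)] @ bs"
      by (auto simp: map_eq_append_conv)
    then have a: "arc u r" using arcs by auto
    let ?r = "drop (length x') r @ take (length x') r"
    have pr: "prefix c0 ?r"
      using arc_split[of x' "c0 @ y'" r] a one(2) by (auto simp: prefix_def)
    have rQ: "?r \<in> Q" using rot_take arc_Q[OF a] .
    show ?thesis
    proof (cases "?r = \<rho>")
      case True
      then have "length \<rho> = length r" by auto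
      then show ?thesis using short a one(2) c0 by (auto simp: arc_def)
    next
      case False
      then show ?thesis using short sc_prefix[OF rQ \<rho>(1) _ pr c0(3)] c0 by simp
    qed
  next
    case (many as0 u ms0 v bs0 x' z0 z1 y')
    obtain as ru ts where ts: "xs = as @ (u, ru) # ts" "map fst as = as0" "map fst ts = ms0 @ v # bs0"
      using many(1) by (auto elim: map_fst_split)
    obtain ms rv bs where bs: "ts = ms @ (v, rv) # bs" "map fst ms = ms0" "map fst bs = bs0"
      using ts(3) by (rule map_fst_split)
    have xs: "xs = as @ [(u, ru)] @ ms @ [(v, rv)] @ bs"
      and wds: "concat as0 = label as" "concat ms0 = label ms" "concat bs0 = label bs"
      using ts bs by auto
    have a: "arc u ru" "arc v rv" "\<And>m r. (m, r) \<in> set ms \<Longrightarrow> arc m r" using arcs xs by auto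
    let ?pu = "p \<otimes> e (label as)"
    let ?r = "drop (length x') ru @ take (length x') ru"
    let ?\<rho>1 = "drop (length z0) \<rho> @ take (length z0) \<rho>"
    let ?j = "length (z0 @ label ms)"
    let ?\<rho>2 = "drop ?j \<rho> @ take ?j \<rho>"
    have c0e: "c0 = z0 @ label ms @ z1" using many wds by simp
    obtain \<rho>' where \<rho>e: "\<rho> = z0 @ label ms @ z1 @ \<rho>'" using c0(3) c0e by (auto simp: prefix_def)
    have QQ: "?r \<in> Q" "?\<rho>1 \<in> Q" "?\<rho>2 \<in> Q" using rot_take \<rho>(1) arc_Q[OF a(1)] by auto
    have pu: "?pu \<in> carrier G" using p by simp
    have u_small: "24 * length z0 < length \<rho>" if "?r \<noteq> \<rho>"
      using sc_prefix[OF QQ(1) \<rho>(1) that] arc_split[of x' z0 ru] a(1) many(2) \<rho>e by (simp add: prefix_def)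
    have v_small: "24 * length z1 < length \<rho>" if "rv \<noteq> ?\<rho>2"
    proof -
      have "prefix z1 rv" using arc_prefix[OF a(2)] many(3) by (auto simp: prefix_def)
      moreover have "prefix z1 ?\<rho>2" using \<rho>e by simp
      moreover have "length ?\<rho>2 = length \<rho>" using \<rho>e by simp
      ultimately show ?thesis using sc_prefix[OF arc_Q[OF a(2)] QQ(3) that] by simp
    qed
    have cu: "cyc ?pu ru = cyc (?pu \<otimes> e u) ?\<rho>1" if "?r = \<rho>"
    proof -
      have "take (length x') ru = x'" using arc_prefix[OF a(1)] many(2) by (auto simp: prefix_def)
      then have "cyc ?pu ru = cyc (?pu \<otimes> e x') \<rho>"
        using cyc_take[OF pu, of "length x'" ru] that by simp
      also have "\<dots> = cyc (?pu \<otimes> e x' \<otimes> e z0) ?\<rho>1"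
        using cyc_take[of "?pu \<otimes> e x'" "length z0" \<rho>] pu \<rho>e by simp
      finally show ?thesis using many(2) p by (simp add: m_assoc)
    qed
    have cv: "cyc (?pu \<otimes> e u) ?\<rho>1 = cyc (?pu \<otimes> e u \<otimes> e (label ms)) ?\<rho>2"
      using cyc_take[of "?pu \<otimes> e u" "length (label ms)" ?\<rho>1] pu \<rho>e by (simp add: m_assoc)
    have cms: "on_cycle (cyc (?pu \<otimes> e u) ?\<rho>1) (?pu \<otimes> e u) ms"
      by (rule on_cycle_sub) (use pu QQ \<rho>e in auto)
    have n: "n = length z0 + length (label ms) + length z1" using c0 c0e by simp
    have blk_u: ?thesis if "?r = \<rho>" "ms \<noteq> []"
    proof (rule block[of as "(u, ru) # ms" "(v, rv) # bs" ru])
      show "on_cycle (cyc ?pu ru) ?pu ((u, ru) # ms)" using cms cu[OF that(1)] by simp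
      show "2 \<le> length ((u, ru) # ms)" using that(2) by (cases ms) auto
    qed (use xs arc_Q a in auto)
    have blk_v: ?thesis if "rv = ?\<rho>2" "ms \<noteq> []"
    proof (rule block[of "as @ [(u, ru)]" "ms @ [(v, rv)]" bs ?\<rho>1])
      show "2 \<le> length (ms @ [(v, rv)])" using that(2) by (cases ms) auto
      have "p \<otimes> e (label (as @ [(u, ru)])) = ?pu \<otimes> e u" using p by (simp add: m_assoc)
      then show "on_cycle (cyc (p \<otimes> e (label (as @ [(u, ru)]))) ?\<rho>1) (p \<otimes> e (label (as @ [(u, ru)]))) (ms @ [(v, rv)])"
        using cms cv that(1) pu by (simp add: on_cycle_append)
    qed (use xs QQ in auto)
    show ?thesis
    proof (cases "2 \<le> length ms")
      case True
      show ?thesis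
      proof (rule block[of "as @ [(u, ru)]" ms "(v, rv) # bs" ?\<rho>1])
        have "p \<otimes> e (label (as @ [(u, ru)])) = ?pu \<otimes> e u" using p by (simp add: m_assoc)
        then show "on_cycle (cyc (p \<otimes> e (label (as @ [(u, ru)]))) ?\<rho>1) (p \<otimes> e (label (as @ [(u, ru)]))) ms"
          using cms by simp
      qed (use xs QQ True in auto)
    next
      case False
      then consider "ms = []" | m rm where "ms = [(m, rm)]"
        by (cases ms; cases "tl ms") auto
      then show ?thesis
      proof cases
        case 1
        show ?thesis
        proof (cases "?r = \<rho>")
          case uE: True
          show ?thesis
          proof (cases "rv = ?\<rho>2")
            case True
            show ?thesis
            proof (rule block[of as "[(u, ru), (v, rv)]" bs ru])
              show "on_cycle (cyc ?pu ru) ?pu [(u, ru), (v, rv)]"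
                using cu[OF uE] cv True 1 p by (simp add: m_assoc)
            qed (use xs 1 arc_Q a in auto)
          next
            case False
            show ?thesis
              by (rule single[of as u ru "(v, rv) # bs" x' z0 "[]" "[]" z1])
                (use xs 1 many wds c0e c0_def v_small[OF False] uE ne[OF \<rho>(1)] in auto)
          qed
        next
          case uE: False
          show ?thesis
          proof (cases "rv = ?\<rho>2")
            case True
            show ?thesis
              by (rule single[of "as @ [(u, ru)]" v rv bs "[]" z1 y' z0 "[]"])
                (use xs 1 many wds c0e c0_def u_small[OF uE] True ne[OF \<rho>(1)] in auto)
          next
            case False
            show ?thesis by (rule short) (use n 1 u_small[OF uE] v_small[OF False] in simp)
          qed
        qed
      next
        case 2
        show ?thesis
        proof (cases "?r = \<rho> \<or> rv = ?\<rho>2")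
          case True
          then show ?thesis using blk_u blk_v 2 by auto
        next
          case False
          have am: "arc m rm" using a(3) 2 by simp
          show ?thesis
          proof (cases "rm = ?\<rho>1")
            case True
            show ?thesis
              by (rule single[of "as @ [(u, ru)]" m rm "(v, rv) # bs" "[]" m "[]" z0 z1])
                (use xs 2 many wds c0e c0_def u_small v_small False True in auto)
          next
            case rm: False
            have "prefix m ?\<rho>1" using \<rho>e 2 by simp
            moreover have "length ?\<rho>1 = length \<rho>" using \<rho>e by simp
            ultimately have "24 * length m < length \<rho>"
              using sc_prefix[OF arc_Q[OF am] QQ(2) rm arc_prefix[OF am]] by simp
            then show ?thesis using short n 2 u_small v_small False by simp
          qed
        qed
      qed
    qed
  qed
qed

text \<open>The arc contributes at most 12/24 and each end less than 1/24.\<close>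

lemma single_bound:
  assumes "arc u r" "u = x' @ w @ y'" "length r = length \<rho>" "take n \<rho> = z0 @ w @ z1" "n \<le> length \<rho>"
    "24 * length z0 < length \<rho>" "24 * length z1 < length \<rho>"
  shows "24 * n < 14 * length \<rho>"
proof -
  have "n = length z0 + length w + length z1" using arg_cong[OF assms(4), of length] assms(5) by simp
  then show ?thesis using assms by (simp add: arc_def)
qed

text \<open>7/8 exceeds both 1/2 and 14/24, so of the three cases only the block remains.\<close>

corollary chunk_block:
  assumes arcs: "\<forall>(u, r)\<in>set xs. arc u r"
    and c: "sublist (take n \<rho>) (label xs)" and \<rho>: "\<rho> \<in> Q" "n \<le> length \<rho>" "7 * length \<rho> < 8 * n" and p: "p \<in> carrier G"
  obtains as ys bs \<rho>' where "xs = as @ ys @ bs" "2 \<le> length ys" "\<rho>' \<in> Q"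
      "on_cycle (cyc (p \<otimes> e (label as)) \<rho>') (p \<otimes> e (label as)) ys"
proof -
  have n0: "0 < n" using \<rho>(3) by simp
  obtain x y where xy: "label xs = x @ take n \<rho> @ y" using c by (auto simp: sublist_def)
  show thesis
  proof (cases rule: chunk_cases[OF arcs xy \<rho>(1) n0 \<rho>(2) p])

    case 1
    then show ?thesis using \<rho>(3) n0 by linarith
  next
    case (2 as ys bs \<rho>')
    then show ?thesis using that by blast
  next
    case (3 as u r bs x' w y' z0 z1)
    have "arc u r" using arcs 3(1) by auto
    moreover have "length r = length \<rho>" using arg_cong[OF 3(10), of length] by simp
    ultimately have "24 * n < 14 * length \<rho>" using single_bound 3(2,3,8,9) \<rho>(2) by blast
    then show ?thesis using \<rho>(3) by linarith
  qed
qed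

lemma on_cycle_ends_on:
  assumes "p \<in> carrier G" "on_cycle c p ys" "ys \<noteq> []" "\<And>u r. (u, r) \<in> set ys \<Longrightarrow> arc u r"
  shows "\<exists>r x. r \<in> Q \<and> c = cyc p r \<and> c = cyc (p \<otimes> e (label ys)) x"
  using assms
proof (induction ys arbitrary: p)
  case (Cons y ys)
  obtain u r where y: "y = (u, r)" by force
  have a: "arc u r" using Cons.prems(4) y by simp
  obtain \<rho> where \<rho>: "\<rho> \<in> Q" "c = cyc p \<rho>" "prefix u \<rho>"
  proof -
    have "cyc p r = c \<or> (\<exists>\<rho>\<in>Q. cyc p \<rho> = c \<and> u = take (length u) \<rho>)" using Cons.prems(2) y by auto
    then show thesis using that arc_prefix[OF a] arc_Q[OF a] by (metis take_is_prefix)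
  qed
  then obtain z where z: "\<rho> = u @ z" by (auto simp: prefix_def)
  have e: "c = cyc (p \<otimes> e u) (z @ u)" using cyc_split[OF Cons.prems(1)] \<rho>(2) z by simp
  show ?case
  proof (cases "ys = []")
    case True
    then show ?thesis using \<rho> e y Cons.prems(1) by auto
  next
    case False
    then obtain x where "c = cyc (p \<otimes> e u \<otimes> e (label ys)) x"
      using Cons.IH[of "p \<otimes> e u"] Cons.prems y by auto
    then show ?thesis using \<rho> y Cons.prems(1) by (auto simp: m_assoc)
  qed
qed simp

end

section \<open>Cochains on relator cycles and the filling inequality\<close>

inductive seq :: "('c \<Rightarrow> 'g \<Rightarrow> 'g \<Rightarrow> real) \<Rightarrow> ('c \<Rightarrow> 'g \<Rightarrow> 'g \<Rightarrow> bool) \<Rightarrow> 'c \<Rightarrow> 'g \<Rightarrow> 'g \<Rightarrow> real \<Rightarrow> nat \<Rightarrow> bool"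
  for \<omega> A c p where
  refl: "seq \<omega> A c p p 0 0"
| step: "seq \<omega> A c p q t l \<Longrightarrow> A c q q' \<Longrightarrow> seq \<omega> A c p q' (t + \<omega> c q q') (Suc l)"

lemma seq_trans: "seq \<omega> A c q s t' l' \<Longrightarrow> seq \<omega> A c p q t l \<Longrightarrow> seq \<omega> A c p s (t + t') (l + l')"
proof (induction rule: seq.induct)
  case (step q' t' l' q'')
  then show ?case using seq.step[of \<omega> A c p q' "t + t'" "l + l'" q''] by (simp add: add.assoc)
qed simp

lemma seq_single: "A c p q \<Longrightarrow> seq \<omega> A c p q (\<omega> c p q) 1"
  using seq.step[OF seq.refl] by fastforce

text \<open>\<open>\<omega>\<close> is a cochain that may depend on the cycle in which a step is
  taken; \<open>A\<close> tells which steps are admissible. \<open>piece\<close> allows a step to be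
  moved to another cycle, and \<open>cell\<close> is the isoperimetric inequality inside one
  cycle.\<close>

locale filling = scg_rel Q G el S
  for Q :: "'s word set" and G (structure) and el :: "'s \<times> bool \<Rightarrow> 'g" and S +
  fixes \<omega> :: "('g \<times> 's word) set \<Rightarrow> 'g \<Rightarrow> 'g \<Rightarrow> real" and A and K :: real
  assumes antisym: "\<omega> c p q = - \<omega> c q p"
    and A_sym: "A c p q \<Longrightarrow> A c q p"
    and piece: "r1 \<in> Q \<Longrightarrow> r2 \<in> Q \<Longrightarrow> p \<in> carrier G \<Longrightarrow> cyc p r1 \<noteq> cyc p r2 \<Longrightarrow> u \<noteq> [] \<Longrightarrow>
      prefix u r1 \<Longrightarrow> prefix u r2 \<Longrightarrow>
      A (cyc p r1) p (p \<otimes> e u) \<and> A (cyc p r2) p (p \<otimes> e u) \<and>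
      \<omega> (cyc p r1) p (p \<otimes> e u) = \<omega> (cyc p r2) p (p \<otimes> e u)"
    and cell: "p \<in> carrier G \<Longrightarrow> r \<in> Q \<Longrightarrow> seq \<omega> A (cyc p r) p p t l \<Longrightarrow> \<bar>t\<bar> \<le> K * real l"
    and K: "0 \<le> K"
begin

abbreviation "sq \<equiv> seq \<omega> A"
abbreviation "ar x \<equiv> (fst x, fst (snd x))"
abbreviation "val x \<equiv> fst (snd (snd x))"
abbreviation "len x \<equiv> snd (snd (snd x))"

text \<open>A record \<open>(u, r, t, l)\<close> is an arc \<open>u\<close> of \<open>r\<close> together with the value \<open>t\<close> and the number \<open>l\<close> of steps of
  a sequence in the cycle of \<open>r\<close> that joins the ends of \<open>u\<close>.\<close>

fun valid :: "'g \<Rightarrow> ('s word \<times> 's word \<times> real \<times> nat) list \<Rightarrow> bool" where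
  "valid g [] \<longleftrightarrow> True"
| "valid g ((u, r, t, l) # xs) \<longleftrightarrow> arc u r \<and> sq (cyc g r) g (g \<otimes> e u) t l \<and> valid (g \<otimes> e u) xs"

lemma valid_append: "g \<in> carrier G \<Longrightarrow> valid g (xs @ ys) \<longleftrightarrow> valid g xs \<and> valid (g \<otimes> e (label xs)) ys"
  by (induction xs arbitrary: g) (auto simp: m_assoc)

lemma valid_arc: "valid g xs \<Longrightarrow> (u, r, t, l) \<in> set xs \<Longrightarrow> arc u r"
  by (induction g xs rule: valid.induct) auto

text \<open>A record on a different cycle is closed up by one step along the piece, which
  \<open>cell\<close> bounds by \<open>K * (l + 1)\<close>, and replaced by that one step in
  \<open>c\<close>. Hence the surplus of 2 per arc.\<close>

lemma block_seq:
  assumes "p \<in> carrier G" "valid p ys" "on_cycle c p (map ar ys)"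
  shows "\<exists>t l. sq c p (p \<otimes> e (label ys)) t l \<and>
    \<bar>sum_list (map val ys) - t\<bar> + K * l \<le> K * (sum_list (map len ys) + 2 * length ys)"
  using assms
proof (induction ys arbitrary: p)
  case Nil
  then show ?case using seq.refl by fastforce
next
  case (Cons y ys)
  obtain u r t l where y: "y = (u, r, t, l)" by (cases y) auto
  note pc = Cons.prems(1)
  have v: "arc u r" "sq (cyc p r) p (p \<otimes> e u) t l" "valid (p \<otimes> e u) ys" using Cons.prems(2) y by auto
  obtain t' l' where IH: "sq c (p \<otimes> e u) (p \<otimes> e u \<otimes> e (label ys)) t' l'"
    "\<bar>sum_list (map val ys) - t'\<bar> + K * l' \<le> K * (sum_list (map len ys) + 2 * length ys)"
    using Cons.IH[of "p \<otimes> e u"] Cons.prems v(3) y by auto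
  have "\<exists>t0 l0. sq c p (p \<otimes> e u) t0 l0 \<and> \<bar>t - t0\<bar> + K * real l0 \<le> K * (real l + 2)"
  proof (cases "cyc p r = c")
    case True
    then show ?thesis using v(2) K by (intro exI[of _ t] exI[of _ l]) (auto intro: mult_left_mono)
  next
    case False
    then obtain \<rho> where \<rho>: "\<rho> \<in> Q" "cyc p \<rho> = c" "u = take (length u) \<rho>"
      using Cons.prems(3) y by auto
    show ?thesis
    proof (cases "u = []")
      case True
      then have "\<bar>t\<bar> \<le> K * real l" using cell[OF pc arc_Q[OF v(1)]] v(2) pc by simp
      moreover have "sq c p (p \<otimes> e u) 0 0" using seq.refl[of \<omega> A c p] True pc by simp
      ultimately show ?thesis using K by (intro exI[of _ 0] exI[of _ "0::nat"]) (auto simp: algebra_simps)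
    next
      case ne: False
      let ?q = "p \<otimes> e u"
      have pr: "prefix u \<rho>" using \<rho>(3) by (metis take_is_prefix)
      note pp = piece[OF arc_Q[OF v(1)] \<rho>(1) pc False[folded \<rho>(2)] ne arc_prefix[OF v(1)] pr]
      have "sq (cyc p r) p p (t + \<omega> (cyc p r) ?q p) (Suc l)"
        using v(2) pp A_sym by (intro seq.step) blast+
      then have "\<bar>t + \<omega> (cyc p r) ?q p\<bar> \<le> K * real (Suc l)" by (rule cell[OF pc arc_Q[OF v(1)]])
      moreover have "\<omega> (cyc p r) ?q p = - \<omega> c p ?q" using pp antisym[of "cyc p r" ?q p] \<rho>(2) by simp
      moreover have "sq c p ?q (\<omega> c p ?q) 1" using pp \<rho>(2) by (intro seq_single) blast
      ultimately show ?thesis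
        by (intro exI[of _ "\<omega> c p ?q"] exI[of _ "1::nat"]) (auto simp: algebra_simps)
    qed
  qed
  then obtain t0 l0 where 0: "sq c p (p \<otimes> e u) t0 l0" "\<bar>t - t0\<bar> + K * real l0 \<le> K * (real l + 2)" by blast
  have "sq c p (p \<otimes> e (label (y # ys))) (t0 + t') (l0 + l')"
    using seq_trans[OF IH(1) 0(1)] y pc by (simp add: m_assoc)
  moreover have "\<bar>sum_list (map val (y # ys)) - (t0 + t')\<bar> + K * real (l0 + l')
      \<le> K * (sum_list (map len (y # ys)) + 2 * length (y # ys))"
    using IH(2) 0(2) y by (auto simp: algebra_simps)
  ultimately show ?case by blast
qed

text \<open>Replacing two or more arcs by a single one creates at most two dirty junctions.\<close>

definition potential :: "('s word \<times> 's word \<times> real \<times> nat) list \<Rightarrow> nat" where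
  "potential xs = 8 * length xs + 2 * dirty (map fst xs)"

text \<open>Merging m >= 2 arcs lowers the potential by 8(m - 1) and raises it by at most 4 for two
  dirty junctions. The net loss is at least 2m, which pays for the surplus in
  \<open>block_seq\<close>; this is where the weight 8 comes from.\<close>

lemma replace_block:
  assumes g: "g \<in> carrier G" and v: "valid g (as @ ys @ bs)" and ys: "2 \<le> length ys"
    and c: "on_cycle c (g \<otimes> e (label as)) (map ar ys)"
  shows "\<exists>y. valid g (as @ [y] @ bs) \<and> e (label (as @ [y] @ bs)) = e (label (as @ ys @ bs)) \<and>
    potential (as @ [y] @ bs) < potential (as @ ys @ bs) \<and>
    \<bar>sum_list (map val ys) - val y\<bar> + K * (real (len y) + potential (as @ [y] @ bs))
      \<le> K * (real (sum_list (map len ys)) + potential (as @ ys @ bs))"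
proof -
  let ?p = "g \<otimes> e (label as)"
  have p: "?p \<in> carrier G" using g by simp
  have vs: "valid g as" "valid ?p ys" "valid (?p \<otimes> e (label ys)) bs"
    using v g by (auto simp: valid_append)
  obtain t l where tl: "sq c ?p (?p \<otimes> e (label ys)) t l"
    "\<bar>sum_list (map val ys) - t\<bar> + K * l \<le> K * (sum_list (map len ys) + 2 * length ys)"
    using block_seq[OF p vs(2) c] by blast
  have "\<And>u r. (u, r) \<in> set (map ar ys) \<Longrightarrow> arc u r" using valid_arc[OF vs(2)] by auto
  moreover have "map ar ys \<noteq> []" using ys by auto
  ultimately obtain r x where rx: "r \<in> Q" "c = cyc ?p r" "c = cyc (?p \<otimes> e (label (map ar ys))) x"
    using on_cycle_ends_on[OF p c] by blast
  have wy: "label (map ar ys) = label ys" by (simp add: comp_def)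
  obtain u r' where u: "r' \<in> Q" "u = take (length u) r'" "2 * length u \<le> length r'"
      "?p \<otimes> e (label ys) = ?p \<otimes> e u" "cyc ?p r' = cyc ?p r"
  proof -
    have q: "?p \<otimes> e (label ys) \<in> carrier G" using p by simp
    have c: "cyc ?p r = cyc (?p \<otimes> e (label ys)) x" using rx(2,3) wy by metis
    show thesis by (rule short_arc[OF p q rx(1) c]) (rule that)
  qed
  let ?y = "(u, r', t, l)"
  have eu: "e u = e (label ys)" using u(4) p by simp
  have "valid g (as @ [?y] @ bs)" using vs tl(1) u rx g by (simp add: valid_append arc_def)
  moreover have "e (label (as @ [?y] @ bs)) = e (label (as @ ys @ bs))" using eu by simp
  moreover have P: "potential (as @ [?y] @ bs) + 2 * length ys \<le> potential (as @ ys @ bs)"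
    using dirty_replace[of "map fst as" u "map fst bs" "map fst ys"] ys by (simp add: potential_def)
  moreover have "\<bar>sum_list (map val ys) - t\<bar> + K * (real l + potential (as @ [?y] @ bs))
      \<le> K * (real (sum_list (map len ys)) + potential (as @ ys @ bs))"
  proof -
    have "K * (real (sum_list (map len ys)) + 2 * length ys + potential (as @ [?y] @ bs)) \<le>
      K * (real (sum_list (map len ys)) + potential (as @ ys @ bs))"
      using P K by (intro mult_left_mono) (auto simp flip: of_nat_add of_nat_mult)
    then show ?thesis using tl(2) by (simp add: algebra_simps)
  qed
  ultimately show ?thesis using ys by (intro exI[of _ ?y]) auto
qed

text \<open>Induction on the potential. An empty arc carries a closed sequence, which
  \<open>cell\<close> bounds, and is dropped. A dirty junction is merged if both arcs lie on one
  cycle and trimmed otherwise. With neither present the label is reduced, and Greendlinger's lemma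
  provides a block.\<close>

theorem filling:
  assumes "g \<in> carrier G" "valid g xs" "e (label xs) = \<one>"
  shows "\<bar>sum_list (map val xs)\<bar> \<le> K * (real (sum_list (map len xs)) + real (potential xs))"
  using assms(2,3)
proof (induction "potential xs" arbitrary: xs rule: less_induct)
  case less
  note g = assms(1)
  have arcs: "arc u r" if "(u, r, t, l) \<in> set xs" for u r t l using valid_arc[OF less.prems(1) that] .
  have block: ?case if bk: "xs = as @ ys @ bs" "2 \<le> length ys" "on_cycle c (g \<otimes> e (label as)) (map ar ys)" for as ys bs c
  proof -
    obtain y where y: "valid g (as @ [y] @ bs)" "e (label (as @ [y] @ bs)) = e (label (as @ ys @ bs))"
      "potential (as @ [y] @ bs) < potential (as @ ys @ bs)"
      "\<bar>sum_list (map val ys) - val y\<bar> + K * (real (len y) + potential (as @ [y] @ bs))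
        \<le> K * (real (sum_list (map len ys)) + potential (as @ ys @ bs))"
      using replace_block[OF g _ bk(2,3), of bs] less.prems bk(1) by blast
    have "\<bar>sum_list (map val (as @ [y] @ bs))\<bar>
        \<le> K * (real (sum_list (map len (as @ [y] @ bs))) + real (potential (as @ [y] @ bs)))"
      using less.hyps[of "as @ [y] @ bs"] y(1-3) less.prems(2) bk(1) by simp
    then show ?thesis using y(4) bk(1) by (simp add: algebra_simps)
  qed
  consider (empty) as r t l bs where "xs = as @ ([], r, t, l) # bs"
    | (dirty) "\<forall>x\<in>set xs. fst x \<noteq> []" "dirty (map fst xs) \<noteq> 0"
    | (clean) "\<forall>x\<in>set xs. fst x \<noteq> []" "dirty (map fst xs) = 0"
    by (metis (no_types) prod.collapse split_list)
  then show ?case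
  proof cases
    case empty
    have v: "valid g as" "arc [] r" "sq (cyc (g \<otimes> e (label as)) r) (g \<otimes> e (label as)) (g \<otimes> e (label as)) t l"
      "valid (g \<otimes> e (label as)) bs"
      using less.prems(1) empty g by (auto simp: valid_append)
    have t: "\<bar>t\<bar> \<le> K * real l" using cell[OF _ arc_Q[OF v(2)] v(3)] g by simp
    have P: "potential (as @ bs) < potential xs"
      using dirty_append[of "map fst as" "map fst bs"] dirty_append[of "map fst as" "[] # map fst bs"]
        dirty_append[of "[[]]" "map fst bs"] by (simp add: potential_def empty)
    have "\<bar>sum_list (map val (as @ bs))\<bar> \<le> K * (real (sum_list (map len (as @ bs))) + real (potential (as @ bs)))"
      by (rule less.hyps[OF P]) (use v less.prems(2) empty g in \<open>auto simp: valid_append\<close>)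
    moreover have "K * real (potential (as @ bs)) \<le> K * real (potential xs)" using P K by (intro mult_left_mono) auto
    ultimately show ?thesis using t empty by (simp add: algebra_simps)
  next
    case dirty
    obtain as0 u v bs0 where "map fst xs = as0 @ u # v # bs0" and uv: "u \<noteq> []" "v \<noteq> []" "hd v = linv (last u)"
      using dirty_pos[OF dirty(2)] by blast
    then obtain as x ts where 1: "xs = as @ (u, x) # ts" "map fst ts = v # bs0"
      by (metis map_fst_split)
    then obtain y bs where 2: "ts = (v, y) # bs" by auto
    obtain r1 t1 l1 r2 t2 l2 where x: "x = (r1, t1, l1)" "y = (r2, t2, l2)" by (cases x; cases y) auto
    have xs: "xs = as @ [(u, r1, t1, l1), (v, r2, t2, l2)] @ bs" using 1 2 x by simp
    let ?p = "g \<otimes> e (label as)" and ?q = "g \<otimes> e (label as) \<otimes> e u"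
    have val: "valid g as" "arc u r1" "arc v r2" "sq (cyc ?p r1) ?p ?q t1 l1" "sq (cyc ?q r2) ?q (?q \<otimes> e v) t2 l2"
      "valid (?q \<otimes> e v) bs"
      using less.prems(1) xs g by (auto simp: valid_append m_assoc)
    show ?thesis
    proof (cases "cyc ?p r1 = cyc ?q r2")
      case True
      then show ?thesis using block[OF xs, of "cyc ?p r1"] by simp
    next
      case False
      \<comment> \<open>The cancelled word \<open>z\<close> is a piece of two different cycles. One
        step along it is added in each of them; the two values cancel, and the two extra steps are
        paid by the weight 2 of the junction.\<close>
      obtain u' z v' where z: "u = u' @ z" "v = winv z @ v'" "z \<noteq> []"
        "u' = [] \<or> v' = [] \<or> hd v' \<noteq> linv (last u')"
        using max_cancel[OF uv] .
      let ?m = "?p \<otimes> e u'"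
      have pc: "?p \<in> carrier G" "?q \<in> carrier G" "?m \<in> carrier G" using g by auto
      have qm: "?q = ?m \<otimes> e z" "?m = ?q \<otimes> e (winv z)" using z(1) g by (auto simp: m_assoc)
      obtain y1 where y1: "r1 = u' @ z @ y1"
        using arc_prefix[OF val(2)] z(1) by (auto simp: prefix_def)
      obtain y2 where y2: "r2 = winv z @ v' @ y2"
        using arc_prefix[OF val(3)] z(2) by (auto simp: prefix_def)
      \<comment> \<open>\<open>r1\<close> read backwards from the junction, so that it starts with
        \<open>winv z\<close> as \<open>r2\<close> does.\<close>
      define \<rho>1 where "\<rho>1 = winv ((y1 @ u') @ z)"
      have \<rho>1: "\<rho>1 \<in> Q" unfolding \<rho>1_def
        using arc_Q[OF val(2)] y1 rot_split[of "u' @ z" y1] winv_mem[of "(y1 @ u') @ z"] by simp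
      have c1: "cyc ?q \<rho>1 = cyc ?p r1"
        unfolding \<rho>1_def using cyc_winv[OF pc(2), of "y1 @ u @ []"] cyc_split[OF pc(1), of u y1] y1 z(1) by simp
      have pp: "A (cyc ?p r1) ?q ?m" "A (cyc ?q r2) ?q ?m" "\<omega> (cyc ?p r1) ?q ?m = \<omega> (cyc ?q r2) ?q ?m"
        using piece[OF \<rho>1 arc_Q[OF val(3)] pc(2), of "winv z"] c1 False z(3) y2 qm(2)
        by (auto simp: \<rho>1_def winv_append)
      define r2' where "r2' = v' @ y2 @ winv z"
      have r2': "r2' \<in> Q" "cyc ?m r2' = cyc ?q r2"
        using rot_split[of "winv z" "v' @ y2"] arc_Q[OF val(3)] y2 cyc_split[OF pc(2), of "winv z" "v' @ y2"] qm(2)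
        by (auto simp: r2'_def)
      define t1' where "t1' = t1 + \<omega> (cyc ?p r1) ?q ?m"
      define t2' where "t2' = \<omega> (cyc ?q r2) ?m ?q + t2"
      let ?ys = "as @ [(u', r1, t1', Suc l1), (v', r2', t2', Suc l2)] @ bs"
      have s1: "sq (cyc ?p r1) ?p ?m t1' (Suc l1)" unfolding t1'_def using val(4) pp by (intro seq.step)
      have s2: "sq (cyc ?m r2') ?m (?q \<otimes> e v) t2' (Suc l2)"
      proof -
        have "sq (cyc ?q r2) ?m ?q (\<omega> (cyc ?q r2) ?m ?q) 1" by (rule seq_single) (rule A_sym[OF pp(2)])
        from seq_trans[OF val(5) this] show ?thesis unfolding t2'_def r2'(2) by simp
      qed
      have mv: "?m \<otimes> e v' = ?q \<otimes> e v" using z qm(1) g by (simp add: m_assoc)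
      have a: "arc u' r1" "arc v' r2'"
        using val(2,3) y1 y2 z r2' by (auto simp: arc_def r2'_def)
      have "valid g ?ys" using val s1 s2 a mv g by (auto simp: valid_append)
      moreover have "e (label ?ys) = \<one>"
      proof -
        have "?m \<otimes> e v' \<otimes> e (label bs) = g"
          using less.prems(2) xs g mv by (simp add: m_assoc)
        then show ?thesis using g by (simp add: m_assoc)
      qed
      moreover have P: "potential ?ys + 2 \<le> potential xs"
        using dirty_trim[OF uv z, of "map fst as" "map fst bs"] by (simp add: potential_def xs)
      ultimately have b1: "\<bar>sum_list (map val ?ys)\<bar> \<le> K * (real (sum_list (map len ?ys)) + real (potential ?ys))"
        by (intro less.hyps) auto
      have b2: "sum_list (map val ?ys) = sum_list (map val xs)"
        using pp(3) antisym[of "cyc ?q r2" ?m ?q] by (simp add: xs t1'_def t2'_def)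
      have b3: "real (sum_list (map len ?ys)) + real (potential ?ys) \<le> real (sum_list (map len xs)) + real (potential xs)"
        using P by (simp add: xs)
      show ?thesis using b1 mult_left_mono[OF b3 K] unfolding b2 by linarith
    qed
  next
    case clean
    have "reduced (label xs)"
    proof (rule reduced_concat[OF _ clean(2)])
      fix u assume "u \<in> set (map fst xs)"
      then obtain r t l where "(u, r, t, l) \<in> set xs" by auto
      then have "arc u r" "u \<noteq> []" using arcs clean(1) by auto
      then show "reduced u \<and> u \<noteq> []"
        using arc_prefix red[OF arc_Q] by (metis prefix_def reduced_append)
    qed
    show ?thesis
    proof (cases "xs = []")
      case True
      then show ?thesis using K by simp
    next
      case False
      then have "label xs \<noteq> []" using clean(1) by (cases xs) auto
      moreover have "fst ` set (label xs) \<subseteq> S"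
      proof -
        have "fst ` set u \<subseteq> S" if "(u, r, t, l) \<in> set xs" for u r t l
          using Q_S[OF arc_Q[OF arcs[OF that]]] set_mono_prefix[OF arc_prefix[OF arcs[OF that]]] by auto
        then show ?thesis by fastforce
      qed
      ultimately obtain \<rho> n where \<rho>: "\<rho> \<in> Q" "sublist (take n \<rho>) (label xs)" "n \<le> length \<rho>" "7 * length \<rho> < 8 * n"
        using GL[OF _ \<open>reduced (label xs)\<close>] less.prems(2) by blast
      have w: "label (map ar ys) = label ys" for ys :: "('s word \<times> 's word \<times> real \<times> nat) list"
        by (simp add: comp_def)
      have arcs': "\<forall>(u, r)\<in>set (map ar xs). arc u r" using arcs by auto
      obtain as0 ys0 bs0 \<rho>' where b: "map ar xs = as0 @ ys0 @ bs0" "2 \<le> length ys0" "\<rho>' \<in> Q"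
        "on_cycle (cyc (g \<otimes> e (label as0)) \<rho>') (g \<otimes> e (label as0)) ys0"
      proof -
        have "sublist (take n \<rho>) (label (map ar xs))" using \<rho>(2) w by simp
        from chunk_block[OF arcs' this \<rho>(1,3,4) g] that show thesis by blast
      qed
      obtain as ts where 1: "xs = as @ ts" "as0 = map ar as" "map ar ts = ys0 @ bs0"
        using iffD1[OF map_eq_append_conv b(1)] by (elim exE conjE) simp
      obtain ys bs where 2: "ts = ys @ bs" "ys0 = map ar ys"
        using iffD1[OF map_eq_append_conv 1(3)] by (elim exE conjE) simp
      have "xs = as @ ys @ bs" "as0 = map ar as" "ys0 = map ar ys" using 1 2 by auto
      then show ?thesis using block[of as ys bs] b(2,4) w by simp
    qed
  qed
qed

end

section \<open>Isoperimetric inequalities and thin triangles\<close>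

inductive walk :: "('v \<Rightarrow> 'v \<Rightarrow> bool) \<Rightarrow> ('v \<Rightarrow> 'v \<Rightarrow> real) \<Rightarrow> ('v \<Rightarrow> bool) \<Rightarrow> 'v \<Rightarrow> 'v \<Rightarrow> real \<Rightarrow> nat \<Rightarrow> bool"
  for R \<omega> P x where
  refl: "P x \<Longrightarrow> walk R \<omega> P x x 0 0"
| step: "walk R \<omega> P x y t n \<Longrightarrow> R y z \<Longrightarrow> P z \<Longrightarrow> walk R \<omega> P x z (t + \<omega> y z) (Suc n)"

lemma walk_trans: "walk R \<omega> P y z t' n' \<Longrightarrow> walk R \<omega> P x y t n \<Longrightarrow> walk R \<omega> P x z (t + t') (n + n')"
proof (induction rule: walk.induct)
  case (step u t' n' v)
  then show ?case using walk.step[of R \<omega> P x u "t + t'" "n + n'" v] by (simp add: add.assoc)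
qed simp

lemma walk_ends: "walk R \<omega> P x y t n \<Longrightarrow> P x \<and> P y"
  by (induction rule: walk.induct) auto

lemma walk_mono: "walk R \<omega> P x y t n \<Longrightarrow> (\<And>v. P v \<Longrightarrow> P' v) \<Longrightarrow> walk R \<omega> P' x y t n"
  by (induction rule: walk.induct) (auto intro: walk.intros)

lemma walk_rev:
  assumes "walk R \<omega> P x y t n" "\<And>u v. R u v \<Longrightarrow> R v u" "\<And>u v. \<omega> u v = - \<omega> v u"
  shows "walk R \<omega> P y x (- t) n"
  using assms(1)
proof (induction rule: walk.induct)
  case (step y t n z)
  have "P y" using walk_ends step(1) by metis
  then have "walk R \<omega> P z y (0 + \<omega> z y) (Suc 0)"
    using step assms(2) by (intro walk.step walk.refl)
  from walk_trans[OF step(4) this] show ?case using assms(3)[of z y] by (simp add: add.commute)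
qed (simp add: walk.refl)

lemma walk_fun:
  "walk R \<omega> P x y t n \<Longrightarrow> \<exists>p. p 0 = x \<and> p n = y \<and> (\<forall>i\<le>n. P (p i)) \<and> (\<forall>i<n. R (p i) (p (Suc i))) \<and>
     t = (\<Sum>i<n. \<omega> (p i) (p (Suc i)))"
proof (induction rule: walk.induct)
  case refl
  then show ?case by (intro exI[of _ "\<lambda>_. x"]) auto
next
  case (step y t n z)
  then obtain p where p: "p 0 = x" "p n = y" "\<forall>i\<le>n. P (p i)" "\<forall>i<n. R (p i) (p (Suc i))"
     "t = (\<Sum>i<n. \<omega> (p i) (p (Suc i)))" by blast
  have s: "(\<Sum>i<n. \<omega> ((p(Suc n := z)) i) ((p(Suc n := z)) (Suc i))) = t"
    unfolding p(5) by (rule sum.cong) auto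
  show ?case
    by (rule exI[of _ "p(Suc n := z)"]) (use p step s in \<open>auto simp: less_Suc_eq le_Suc_eq\<close>)
qed

lemma fun_walk:
  assumes "\<forall>i\<le>n. P (p i)" "\<forall>i<n. R (p i) (p (Suc i))" "i \<le> j" "j \<le> n"
  shows "walk R \<omega> P (p i) (p j) (\<Sum>l=i..<j. \<omega> (p l) (p (Suc l))) (j - i)"
  using assms(3,4)
proof (induction j)
  case 0
  then show ?case using assms(1) walk.refl[of P "p 0" R \<omega>] by simp
next
  case (Suc j)
  show ?case
  proof (cases "i = Suc j")
    case True
    then show ?thesis using assms(1) Suc walk.refl[of P "p i" R \<omega>] by simp
  next
    case False
    then have "walk R \<omega> P (p i) (p j) (\<Sum>l=i..<j. \<omega> (p l) (p (Suc l))) (j - i)" using Suc by simp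
    then show ?thesis
      using walk.step[of R \<omega> P "p i" "p j" _ "j - i" "p (Suc j)"] assms(1,2) Suc False
      by (simp add: Suc_diff_le)
  qed
qed

locale dgeo =
  fixes V :: "'v set" and d :: "'v \<Rightarrow> 'v \<Rightarrow> nat"
  assumes d_self [simp]: "x \<in> V \<Longrightarrow> d x x = 0"
    and d_eq: "x \<in> V \<Longrightarrow> y \<in> V \<Longrightarrow> d x y = 0 \<Longrightarrow> x = y"
    and d_sym: "x \<in> V \<Longrightarrow> y \<in> V \<Longrightarrow> d x y = d y x"
    and d_tri: "x \<in> V \<Longrightarrow> y \<in> V \<Longrightarrow> z \<in> V \<Longrightarrow> d x z \<le> d x y + d y z"
    and d_step: "x \<in> V \<Longrightarrow> y \<in> V \<Longrightarrow> d x y = Suc n \<Longrightarrow> \<exists>z\<in>V. d x z = n \<and> d z y = 1"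
begin

text \<open>Distance 0 is included, so walks may pause; an antisymmetric cochain vanishes on such
  steps.\<close>

definition adj where "adj x y \<longleftrightarrow> x \<in> V \<and> y \<in> V \<and> d x y \<le> 1"

lemma adj_sym: "adj x y \<Longrightarrow> adj y x"
  using d_sym by (auto simp: adj_def)

abbreviation wk where "wk \<omega> P \<equiv> walk adj \<omega> (\<lambda>v. v \<in> V \<and> P v)"

definition geodesic :: "(nat \<Rightarrow> 'v) \<Rightarrow> nat \<Rightarrow> bool" where
  "geodesic p n \<longleftrightarrow> (\<forall>i\<le>n. p i \<in> V) \<and> (\<forall>i\<le>n. \<forall>j\<le>n. d (p i) (p j) = (i - j) + (j - i))"

lemma geodesic_exists: "x \<in> V \<Longrightarrow> y \<in> V \<Longrightarrow> \<exists>p. geodesic p (d x y) \<and> p 0 = x \<and> p (d x y) = y"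
proof (induction "d x y" arbitrary: y)
  case 0
  then have "x = y" using d_eq by simp
  then show ?case using 0 by (intro exI[of _ "\<lambda>_. x"]) (auto simp: geodesic_def)
next
  case (Suc n)
  then obtain z where z: "z \<in> V" "d x z = n" "d z y = 1" using d_step[of x y n] by auto
  then obtain p where p: "geodesic p n" "p 0 = x" "p n = z" using Suc.hyps(1)[of z] Suc by auto
  have dy: "d (p i) y = Suc n - i" if "i \<le> n" for i
  proof -
    have pi: "p i \<in> V" "d (p i) z = n - i" "d x (p i) = i" using p that by (auto simp: geodesic_def)
    have "d (p i) y \<le> Suc n - i" using d_tri[of "p i" z y] pi z Suc.prems that by simp
    moreover have "Suc n \<le> i + d (p i) y" using d_tri[of x "p i" y] pi Suc by simp
    ultimately show ?thesis by simp
  qed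
  let ?p = "p(Suc n := y)"
  have "geodesic ?p (Suc n)"
    unfolding geodesic_def using p(1) dy Suc.prems d_sym by (auto simp: geodesic_def le_Suc_eq)
  then show ?case using p(2) Suc(2) by (intro exI[of _ ?p]) auto
qed

lemma adj_V: "adj u v \<Longrightarrow> v \<in> V"
  by (simp add: adj_def)

lemma geodesic_adj: "geodesic p n \<Longrightarrow> Suc i \<le> n \<Longrightarrow> adj (p i) (p (Suc i))"
  by (simp add: geodesic_def adj_def)

lemma geodesic_rev: "geodesic p n \<Longrightarrow> geodesic (\<lambda>i. p (n - i)) n"
  unfolding geodesic_def by auto

lemma geodesic_sub: "geodesic p n \<Longrightarrow> i + m \<le> n \<Longrightarrow> geodesic (\<lambda>l. p (i + l)) m"
  unfolding geodesic_def by auto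

lemma geodesic_walk:
  assumes "geodesic p n" "i \<le> n" "j \<le> n" "\<And>l. min i j \<le> l \<Longrightarrow> l \<le> max i j \<Longrightarrow> P (p l)" "\<And>u v. \<omega> u v = - \<omega> v u"
  shows "\<exists>t. wk \<omega> P (p i) (p j) t (d (p i) (p j))"
proof -
  have 1: "\<exists>t. wk \<omega> P (p i) (p j) t (j - i)"
    if "i \<le> j" "j \<le> n" "\<And>l. i \<le> l \<Longrightarrow> l \<le> j \<Longrightarrow> P (p l)" for i j
    using that
  proof (induction j)
    case 0
    then show ?case using assms(1) by (auto intro!: exI walk.refl simp: geodesic_def)
  next
    case (Suc j)
    show ?case
    proof (cases "i = Suc j")
      case True
      then show ?thesis using assms(1) Suc by (auto intro!: exI walk.refl simp: geodesic_def)
    next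
      case False
      then obtain t where "wk \<omega> P (p i) (p j) t (j - i)" using Suc by auto
      then have "wk \<omega> P (p i) (p (Suc j)) (t + \<omega> (p j) (p (Suc j))) (Suc (j - i))"
        using assms(1) Suc False by (intro walk.step) (auto simp: geodesic_def adj_def)
      then show ?thesis using False Suc by (auto simp: Suc_diff_le)
    qed
  qed
  show ?thesis
  proof (cases "i \<le> j")
    case True
    then show ?thesis using 1[of i j] assms by (simp add: geodesic_def min_def max_def)
  next
    case False
    then obtain t where "wk \<omega> P (p j) (p i) t (i - j)" using 1[of j i] assms by (auto simp: min_def max_def)
    from walk_rev[OF this adj_sym assms(5)] show ?thesis using False assms(1-3) by (auto simp: geodesic_def)
  qed
qed

lemma seg_walk:
  assumes "x \<in> V" "y \<in> V" "\<And>v. v \<in> V \<Longrightarrow> d x v \<le> d x y \<Longrightarrow> P v" "\<And>u v. \<omega> u v = - \<omega> v u"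
  shows "\<exists>t. wk \<omega> P x y t (d x y)"
proof -
  define n where "n = d x y"
  obtain p where p: "geodesic p n" "p 0 = x" "p n = y" using geodesic_exists[OF assms(1,2)] unfolding n_def by blast
  have "P (p l)" if "l \<le> n" for l
  proof (rule assms(3))
    have "d (p 0) (p l) = l" "p l \<in> V" using p(1) that by (auto simp: geodesic_def)
    then show "p l \<in> V" "d x (p l) \<le> d x y" using that p(2) n_def by auto
  qed
  then have "\<exists>t. wk \<omega> P (p 0) (p n) t (d (p 0) (p n))" by (intro geodesic_walk[OF p(1) _ _ _ assms(4)]) auto
  then show ?thesis unfolding p(2,3) .
qed

lemma d_lip: assumes "adj u v" "a \<in> V" shows "\<bar>real (d a u) - real (d a v)\<bar> \<le> 1"
proof -
  have "d a u \<le> d a v + d v u" "d a v \<le> d a u + d u v" "d u v \<le> 1" "d v u \<le> 1"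
    using d_tri[of a v u] d_tri[of a u v] d_sym[of u v] assms by (auto simp: adj_def)
  then show ?thesis by linarith
qed

text \<open>The linear isoperimetric inequality in dual form: a filling of a loop by
  \<open>K * n\<close> loops of length at most \<open>b\<close> would yield this bound for every
  cochain that is at most 1 on those loops.\<close>

definition isoperimetric :: "nat \<Rightarrow> real \<Rightarrow> bool" where
  "isoperimetric b K \<longleftrightarrow> (\<forall>\<omega>. (\<forall>u v. \<omega> u v = - \<omega> v u) \<longrightarrow>
     (\<forall>x t n. wk \<omega> (\<lambda>_. True) x x t n \<longrightarrow> n \<le> b \<longrightarrow> \<bar>t\<bar> \<le> 1) \<longrightarrow>
     (\<forall>x t n. wk \<omega> (\<lambda>_. True) x x t n \<longrightarrow> \<bar>t\<bar> \<le> K * real n))"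

lemma isoperimetric_scaled:
  assumes "isoperimetric b K" "\<And>u v. \<omega> u v = - \<omega> v u" "0 < C"
    and "\<And>x t n. wk \<omega> (\<lambda>_. True) x x t n \<Longrightarrow> n \<le> b \<Longrightarrow> \<bar>t\<bar> \<le> C"
    and w: "wk \<omega> (\<lambda>_. True) x x t n"
  shows "\<bar>t\<bar> \<le> C * (K * real n)"
proof -
  let ?\<omega> = "\<lambda>u v. \<omega> u v / C"
  have sc: "wk ?\<omega> (\<lambda>_. True) x y (t / C) n" if "wk \<omega> (\<lambda>_. True) x y t n" for x y t n
    using that
  proof (induction rule: walk.induct)
    case (step y t n z)
    from walk.step[OF step(4,2,3)] show ?case by (simp add: add_divide_distrib)
  qed (simp add: walk.refl)
  have cs: "wk \<omega> (\<lambda>_. True) x y (t * C) n" if "wk ?\<omega> (\<lambda>_. True) x y t n" for x y t n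
    using that
  proof (induction rule: walk.induct)
    case (step y t n z)
    from walk.step[OF step(4,2,3)] show ?case using assms(3) by (simp add: algebra_simps)
  qed (simp add: walk.refl)
  have short: "\<bar>t\<bar> \<le> 1" if "wk ?\<omega> (\<lambda>_. True) x x t n" "n \<le> b" for x t n
    using assms(4)[OF cs[OF that(1)] that(2)] assms(3) by (simp add: abs_mult)
  have anti: "?\<omega> u v = - ?\<omega> v u" for u v by (subst assms(2)) simp
  have "\<bar>t / C\<bar> \<le> K * real n"
    using assms(1)[unfolded isoperimetric_def, rule_format, of ?\<omega>, OF anti short sc[OF w]] by simp
  then show ?thesis using assms(3) by (simp add: field_simps)
qed

text \<open>The weight \<open>max 0 (D - d m \<cdot>)\<close> times the differential of \<open>d a \<cdot>\<close> is a cochain with bounded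
  value on short loops that collects \<open>D\<^sup>2\<close> along a geodesic through \<open>m\<close>.\<close>

lemma rectangle:
  assumes isoperimetric: "isoperimetric b K" and b: "1 \<le> b" and V: "a \<in> V" "m \<in> V" "c \<in> V"
    and D: "d a m = D" "d m c = D" "d a c = 2 * D"
    and bk: "\<And>\<omega>. (\<And>u v. \<omega> u v = - \<omega> v u) \<Longrightarrow> \<exists>t. wk \<omega> (\<lambda>v. D \<le> d m v) c a t n"
  shows "real D * real D \<le> real b * real b * (K * real (2 * D + n))"
proof -
  define g where "g v = max 0 (real D - real (d m v))" for v
  define f where "f v = real (d a v)" for v
  define \<omega> where "\<omega> u v = (g u + g v) / 2 * (f v - f u)" for u v
  have anti: "\<omega> u v = - \<omega> v u" for u v unfolding \<omega>_def
    by (metis add.commute minus_diff_eq mult_minus_right)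
  have gl: "\<bar>g u - g v\<bar> \<le> 1" "\<bar>f u - f v\<bar> \<le> 1" if "adj u v" for u v
    using d_lip[OF that V(2)] d_lip[OF that V(1)] by (auto simp: g_def f_def)
  have est: "\<bar>t - g x * (f y - f x)\<bar> \<le> real n * real n \<and> \<bar>g y - g x\<bar> \<le> real n"
    if "wk \<omega> (\<lambda>_. True) x y t n" for x y t n
    using that
  proof (induction rule: walk.induct)
    case (step y t n z)
    have a: "\<bar>g z - g y\<bar> \<le> 1" "\<bar>f z - f y\<bar> \<le> 1" using gl[of y z] step(2) by (auto simp: abs_minus_commute)
    have h: "\<bar>(g y + g z) / 2 - g x\<bar> \<le> real n + 1 / 2"
      using conjunct2[OF step.IH] a(1) unfolding abs_le_iff by (simp add: field_simps)
    have "\<bar>(g y + g z) / 2 - g x\<bar> * \<bar>f z - f y\<bar> \<le> (real n + 1 / 2) * 1"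
      using h a(2) by (intro mult_mono) auto
    then have k: "\<bar>((g y + g z) / 2 - g x) * (f z - f y)\<bar> \<le> real n + 1 / 2" by (simp add: abs_mult)
    have e: "t + \<omega> y z - g x * (f z - f x) =
      (t - g x * (f y - f x)) + ((g y + g z) / 2 - g x) * (f z - f y)"
      unfolding \<omega>_def by (simp add: algebra_simps)
    have "\<bar>t + \<omega> y z - g x * (f z - f x)\<bar> \<le> real n * real n + (real n + 1 / 2)"
      unfolding e by (intro order_trans[OF abs_triangle_ineq] add_mono k conjunct1[OF step.IH])
    also have "\<dots> \<le> real (Suc n) * real (Suc n)" by (simp add: algebra_simps)
    finally show ?case using conjunct2[OF step.IH] a(1) by simp
  qed simp
  have short: "\<bar>t\<bar> \<le> real b * real b" if "wk \<omega> (\<lambda>_. True) x x t n" "n \<le> b" for x t n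
  proof -
    have "\<bar>t\<bar> \<le> real n * real n" using est[OF that(1)] by simp
    also have "\<dots> \<le> real b * real b" using that(2) by (intro mult_mono) auto
    finally show ?thesis .
  qed
  have all: "\<bar>t\<bar> \<le> real b * real b * (K * real n)" if "wk \<omega> (\<lambda>_. True) x x t n" for x t n
    using isoperimetric_scaled[OF isoperimetric anti _ short that] b by simp
  obtain p where p: "geodesic p D" "p 0 = a" "p D = m" using geodesic_exists[OF V(1,2)] D by auto
  obtain q where q: "geodesic q D" "q 0 = m" "q D = c" using geodesic_exists[OF V(2,3)] D by auto
  \<comment> \<open>At distance \<open>i\<close> from \<open>a\<close> the weight is
    \<open>i\<close>; averaging it over the ends of each edge makes the sum exactly half a square.
    Behind \<open>m\<close> the weight decreases again and the other half of the square is
    collected.\<close>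
  have up: "wk \<omega> (\<lambda>_. True) a (p i) (real i * real i / 2) i" if "i \<le> D" for i
    using that
  proof (induction i)
    case 0
    then show ?case using walk.refl[of "\<lambda>v. v \<in> V \<and> True" a] V p by simp
  next
    case (Suc i)
    have dd: "d m (p j) = D - j" "d a (p j) = j" if "j \<le> D" for j
      using p that d_sym[of m "p j"] V by (auto simp: geodesic_def)
    have v: "g (p i) = real i" "g (p (Suc i)) = real (Suc i)" "f (p i) = real i" "f (p (Suc i)) = real (Suc i)"
      using dd[of i] dd[of "Suc i"] Suc.prems by (auto simp: g_def f_def of_nat_diff)
    have w: "wk \<omega> (\<lambda>_. True) a (p (Suc i)) (real i * real i / 2 + \<omega> (p i) (p (Suc i))) (Suc i)"
      by (rule walk.step) (use Suc geodesic_adj[OF p(1), of i] adj_V in auto)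
    have "real i * real i / 2 + \<omega> (p i) (p (Suc i)) = real (Suc i) * real (Suc i) / 2"
      unfolding \<omega>_def v by (simp add: field_simps)
    with w show ?case by simp
  qed
  have down: "wk \<omega> (\<lambda>_. True) m (q i) (real D * real i - real i * real i / 2) i" if "i \<le> D" for i
    using that
  proof (induction i)
    case 0
    then show ?case using walk.refl[of "\<lambda>v. v \<in> V \<and> True" m] V q by simp
  next
    case (Suc i)
    have fq: "d a (q i) = D + i" if "i \<le> D" for i
    proof -
      have "q i \<in> V" "d m (q i) = i" "d (q i) c = D - i" using q that by (auto simp: geodesic_def)
      then have "d a (q i) \<le> D + i" "2 * D \<le> d a (q i) + (D - i)"
        using d_tri[of a m "q i"] d_tri[of a "q i" c] D V by auto
      then show ?thesis using that by simp
    qed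
    have gq: "g (q i) = real D - real i" if "i \<le> D" for i using q that by (auto simp: geodesic_def g_def)
    have v: "g (q i) = real D - real i" "g (q (Suc i)) = real D - real (Suc i)"
      "f (q i) = real D + real i" "f (q (Suc i)) = real D + real (Suc i)"
      using Suc.prems fq gq by (auto simp: f_def)
    have w: "wk \<omega> (\<lambda>_. True) m (q (Suc i)) (real D * real i - real i * real i / 2 + \<omega> (q i) (q (Suc i))) (Suc i)"
      by (rule walk.step) (use Suc geodesic_adj[OF q(1), of i] adj_V in auto)
    have "real D * real i - real i * real i / 2 + \<omega> (q i) (q (Suc i)) =
      real D * real (Suc i) - real (Suc i) * real (Suc i) / 2"
      unfolding \<omega>_def v by (simp add: field_simps)
    with w show ?case by simp
  qed
  obtain t where t: "wk \<omega> (\<lambda>v. D \<le> d m v) c a t n" using bk[of \<omega>] anti by blast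
  \<comment> \<open>The way back stays outside the ball, where the weight is 0.\<close>
  have zero: "t' = 0" if "wk \<omega> (\<lambda>v. D \<le> d m v) x y t' n'" for x y t' n'
    using that
  proof (induction rule: walk.induct)
    case (step y t n z)
    have "D \<le> d m y" using walk_ends[OF step(1)] by simp
    then have "g y = 0" "g z = 0" using step by (auto simp: g_def)
    then show ?case using step by (simp add: \<omega>_def)
  qed simp
  have w1: "wk \<omega> (\<lambda>_. True) a c (real D * real D) (2 * D)"
    using walk_trans[OF down[of D] up[of D, unfolded p(3)]] q(3) by (simp add: mult_2)
  have w2: "wk \<omega> (\<lambda>_. True) c a 0 n" using walk_mono[OF t] zero[OF t] by simp
  have "\<bar>0 + real D * real D\<bar> \<le> real b * real b * (K * real (n + 2 * D))"
    using all[OF walk_trans[OF w1 w2]] by simp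
  then show ?thesis by (simp add: add.commute)
qed

section \<open>Thin triangles from the isoperimetric inequality\<close>

definition triangle :: "(nat \<Rightarrow> 'v) \<Rightarrow> nat \<Rightarrow> (nat \<Rightarrow> 'v) \<Rightarrow> nat \<Rightarrow> (nat \<Rightarrow> 'v) \<Rightarrow> nat \<Rightarrow> bool" where
  "triangle p N q M r L \<longleftrightarrow> geodesic p N \<and> geodesic q M \<and> geodesic r L \<and> p 0 = q 0 \<and> p N = r L \<and> q M = r 0"

definition near :: "'v \<Rightarrow> (nat \<Rightarrow> 'v) \<Rightarrow> nat \<Rightarrow> nat \<Rightarrow> bool" where
  "near x q M D \<longleftrightarrow> (\<exists>i\<le>M. d x (q i) \<le> D)"

definition thin :: "nat \<Rightarrow> bool" where
  "thin \<delta> \<longleftrightarrow> (\<forall>p N q M r L t. triangle p N q M r L \<longrightarrow> t \<le> N \<longrightarrow> near (p t) q M \<delta> \<or> near (p t) r L \<delta>)"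

text \<open>Walks carry the value of a cochain. A path whose choice should matter only through its
  length and the ball that it avoids is therefore expressed by quantifying over all
  cochains.\<close>

definition away :: "'v \<Rightarrow> nat \<Rightarrow> 'v \<Rightarrow> 'v \<Rightarrow> nat \<Rightarrow> bool" where
  "away m D x y n \<longleftrightarrow> (\<forall>\<omega>. (\<forall>u v. \<omega> u v = - \<omega> v u) \<longrightarrow> (\<exists>t. wk \<omega> (\<lambda>v. D \<le> d m v) x y t n))"

lemma away_trans: "away m D x y n \<Longrightarrow> away m D y z n' \<Longrightarrow> away m D x z (n + n')"
  unfolding away_def using walk_trans by meson

lemma away_sym: "away m D x y n \<Longrightarrow> away m D y x n"
  unfolding away_def
proof (intro allI impI)
  fix \<omega> :: "'v \<Rightarrow> 'v \<Rightarrow> real"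
  assume a: "\<forall>\<omega>. (\<forall>u v. \<omega> u v = - \<omega> v u) \<longrightarrow> (\<exists>t. wk \<omega> (\<lambda>v. D \<le> d m v) x y t n)" and anti: "\<forall>u v. \<omega> u v = - \<omega> v u"
  then obtain t where t: "wk \<omega> (\<lambda>v. D \<le> d m v) x y t n" by blast
  show "\<exists>t. wk \<omega> (\<lambda>v. D \<le> d m v) y x t n" using walk_rev[OF t adj_sym anti[rule_format]] by blast
qed

lemma away_geo:
  assumes "geodesic p n" "i \<le> n" "j \<le> n" "\<And>l. min i j \<le> l \<Longrightarrow> l \<le> max i j \<Longrightarrow> D \<le> d m (p l)"
  shows "away m D (p i) (p j) (d (p i) (p j))"
  unfolding away_def
proof (intro allI impI)
  fix \<omega> :: "'v \<Rightarrow> 'v \<Rightarrow> real"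
  assume anti: "\<forall>u v. \<omega> u v = - \<omega> v u"
  show "\<exists>t. wk \<omega> (\<lambda>v. D \<le> d m v) (p i) (p j) t (d (p i) (p j))"
    by (rule geodesic_walk[OF assms(1-3), where P = "\<lambda>v. D \<le> d m v"]) (rule assms(4), assumption+, rule anti[rule_format])
qed

lemma away_seg:
  assumes "x \<in> V" "y \<in> V" "m \<in> V" "D + d x y \<le> d m x"
  shows "away m D x y (d x y)"
proof -
  have "D \<le> d m v" if "v \<in> V" "d x v \<le> d x y" for v
  proof -
    have "d m x \<le> d m v + d x v" using d_tri[of m v x] d_sym[of v x] assms that by simp
    then show ?thesis using assms(4) that(2) by linarith
  qed
  note * = this
  show ?thesis unfolding away_def
  proof (intro allI impI)
    fix \<omega> :: "'v \<Rightarrow> 'v \<Rightarrow> real"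
    assume anti: "\<forall>u v. \<omega> u v = - \<omega> v u"
    show "\<exists>t. wk \<omega> (\<lambda>v. D \<le> d m v) x y t (d x y)"
      by (rule seg_walk[OF assms(1,2), where P = "\<lambda>v. D \<le> d m v"]) (rule *, assumption+, rule anti[rule_format])
  qed
qed

text \<open>If the corner \<open>q M\<close> is near, go round it. Otherwise the geodesic between
  the two points cuts off a triangle of no larger perimeter, to which the assumed
  \<open>D\<close>-thinness applies: a point further along \<open>q\<close> is too far from the cut,
  hence close to \<open>r\<close>, and there one changes sides.\<close>

lemma away_cross:
  assumes max: "\<And>p N q M r L t. triangle p N q M r L \<Longrightarrow> N + M + L \<le> n \<Longrightarrow> t \<le> N \<Longrightarrow> near (p t) q M D \<or> near (p t) r L D"
    and T: "triangle p N q M r L" "N + M + L \<le> n" and m: "m \<in> V" and D: "0 < D"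
    and far: "\<And>i. i \<le> M \<Longrightarrow> D \<le> d m (q i)" "\<And>j. j \<le> L \<Longrightarrow> D \<le> d m (r j)"
    and ij: "i \<le> M" "j \<le> L" "d m (q i) \<le> 4 * D" "d (q i) (r j) \<le> 8 * D"
  shows "\<exists>n'\<le>30 * D. away m D (q i) (r j) n'"
proof -
  have g: "geodesic p N" "geodesic q M" "geodesic r L" "p 0 = q 0" "p N = r L" "q M = r 0" using T(1) by (auto simp: triangle_def)
  have V: "\<And>l. l \<le> M \<Longrightarrow> q l \<in> V" "\<And>l. l \<le> L \<Longrightarrow> r l \<in> V" using g by (auto simp: geodesic_def)
  have dq: "d (q k) (q l) = (k - l) + (l - k)" if "k \<le> M" "l \<le> M" for k l using g(2) that by (simp add: geodesic_def)
  have dr: "d (r k) (r l) = (k - l) + (l - k)" if "k \<le> L" "l \<le> L" for k l using g(3) that by (simp add: geodesic_def)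
  define s where "s = d (q i) (r j)"
  obtain \<sigma> where \<sigma>: "geodesic \<sigma> s" "\<sigma> 0 = q i" "\<sigma> s = r j" unfolding s_def using geodesic_exists V ij by blast
  let ?\<beta> = "\<lambda>k. q (i + k)" and ?\<gamma> = "\<lambda>l. r (j - l)"
  have T': "triangle ?\<beta> (M - i) \<sigma> s ?\<gamma> j"
    using geodesic_sub[OF g(2), of i "M - i"] geodesic_rev[OF geodesic_sub[OF g(3), of 0 j]] \<sigma> ij g(6) by (simp add: triangle_def)
  have "s \<le> i + N + (L - j)"
  proof -
    have "d (q i) (r j) \<le> d (q i) (q 0) + d (q 0) (r j)" using d_tri V ij by simp
    moreover have "d (q 0) (r j) \<le> d (q 0) (r L) + d (r L) (r j)" using d_tri V ij by simp
    moreover have "d (q 0) (r L) = N" using g(1,4,5) by (metis geodesic_def diff_zero diff_0_eq_0 add_0 order_refl zero_le)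
    ultimately show ?thesis using dq[of i 0] dr[of L j] ij s_def by simp
  qed
  then have per: "(M - i) + s + j \<le> n" using T(2) ij by linarith
  have along_q: "away m D (q i) (q (i + k)) k" if "i + k \<le> M" for k
  proof -
    have "away m D (q i) (q (i + k)) (d (q i) (q (i + k)))"
      by (rule away_geo[OF g(2)]) (use that ij far in auto)
    then show ?thesis using dq[of i "i + k"] that ij by simp
  qed
  have along_r: "away m D (r k) (r j) (j - k)" if "k \<le> j" for k
  proof -
    have "away m D (r k) (r j) (d (r k) (r j))"
      by (rule away_geo[OF g(3)]) (use that ij far in auto)
    then show ?thesis using dr[of k j] that ij by simp
  qed
  show ?thesis
  proof (cases "M - i \<le> 10 * D")
    case True
    have "d (r 0) (r j) \<le> d (q M) (q i) + d (q i) (r j)" using d_tri[of "q M" "q i" "r j"] V ij g(6) by simp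
    then have "j \<le> M - i + 8 * D" using dr[of 0 j] dq[of M i] ij by simp
    moreover have "away m D (q i) (q M) (M - i)" "away m D (q M) (r j) (j - 0)"
      using along_q[of "M - i"] along_r[of 0] g(6) ij by auto
    then have "away m D (q i) (r j) (M - i + (j - 0))" by (rule away_trans)
    ultimately show ?thesis using True by (intro exI[of _ "M - i + (j - 0)"]) auto
  next
    case False
    \<comment> \<open>More than \<open>D + 8 * D\<close>, which rules out the cut; and at least
      \<open>6 * D\<close> away from \<open>m\<close>, so that a crossing of length \<open>D\<close>
      avoids the ball.\<close>
    let ?k = "10 * D"
    have kM: "i + ?k \<le> M" "?k \<le> M - i" using False ij by auto
    have "\<not> near (?\<beta> ?k) \<sigma> s D"
    proof
      assume "near (?\<beta> ?k) \<sigma> s D"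
      then obtain l where l: "l \<le> s" "d (q (i + ?k)) (\<sigma> l) \<le> D" by (auto simp: near_def)
      have "\<sigma> l \<in> V" "d (\<sigma> l) (q i) = l" using \<sigma>(1) l by (auto simp: geodesic_def \<sigma>(2)[symmetric])
      then have "d (q (i + ?k)) (q i) \<le> D + s" using d_tri[of "q (i + ?k)" "\<sigma> l" "q i"] V kM ij l by simp
      then show False using dq[of "i + ?k" i] kM ij D s_def by simp
    qed
    then have "near (?\<beta> ?k) ?\<gamma> j D" using max[OF T' per kM(2)] by blast
    then obtain l where l: "l \<le> j" "d (q (i + ?k)) (r (j - l)) \<le> D" by (auto simp: near_def)
    let ?u = "q (i + ?k)" and ?w = "r (j - l)"
    have uw: "?u \<in> V" "?w \<in> V" "q i \<in> V" "r j \<in> V" using V kM ij l by auto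
    have "d ?u (q i) \<le> d ?u m + d m (q i)" using d_tri[of ?u m "q i"] uw m by simp
    then have "6 * D \<le> d m ?u" using dq[of "i + ?k" i] kM ij d_sym[of ?u m] uw m by simp
    then have 1: "away m D ?u ?w (d ?u ?w)" using l(2) uw m by (intro away_seg) auto
    have "d ?w (r j) \<le> d ?w ?u + d ?u (r j)" "d ?u (r j) \<le> d ?u (q i) + d (q i) (r j)"
      using d_tri uw by blast+
    then have "l \<le> D + (?k + 8 * D)" using dr[of "j - l" j] dq[of "i + ?k" i] kM ij l d_sym[of ?w ?u] uw by simp
    moreover have "away m D (q i) (r j) (?k + d ?u ?w + (j - (j - l)))"
      using away_trans[OF away_trans[OF along_q[OF kM(1)] 1] along_r[OF diff_le_self]] .
    \<comment> \<open>The three parts have length at most \<open>10 * D\<close>, \<open>D\<close>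
      and \<open>19 * D\<close>.\<close>
    ultimately show ?thesis using l by (intro exI[of _ "?k + d ?u ?w + (j - (j - l))"]) auto
  qed
qed

text \<open>If no triangle of the given perimeter deviates by more than \<open>D\<close>, the detour around the ball of radius
  \<open>D\<close> about \<open>p t\<close> can be cut down to length \<open>O(D)\<close>, whereas it is at least quadratic in \<open>D\<close> by
  \<open>rectangle\<close>.\<close>

lemma thick_bound:
  assumes isoperimetric: "isoperimetric b K" and b: "1 \<le> b" and D: "0 < D"
    and max: "\<And>p N q M r L t. triangle p N q M r L \<Longrightarrow> N + M + L \<le> n \<Longrightarrow> t \<le> N \<Longrightarrow> near (p t) q M D \<or> near (p t) r L D"
    and T: "triangle p N q M r L" "N + M + L \<le> n" and t: "t \<le> N"
    and far: "\<And>i. i \<le> M \<Longrightarrow> D \<le> d (p t) (q i)" "\<And>j. j \<le> L \<Longrightarrow> D \<le> d (p t) (r j)"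
    and K: "0 \<le> K"
  shows "real D \<le> real b * real b * (K * 50)"
proof -
  have g: "geodesic p N" "geodesic q M" "geodesic r L" "p 0 = q 0" "p N = r L" "q M = r 0" using T(1) by (auto simp: triangle_def)
  have V: "\<And>l. l \<le> N \<Longrightarrow> p l \<in> V" "\<And>l. l \<le> M \<Longrightarrow> q l \<in> V" "\<And>l. l \<le> L \<Longrightarrow> r l \<in> V" using g by (auto simp: geodesic_def)
  have dp: "d (p k) (p l) = (k - l) + (l - k)" if "k \<le> N" "l \<le> N" for k l using g(1) that by (simp add: geodesic_def)
  let ?m = "p t"
  have mV: "?m \<in> V" using V t by simp
  have t1: "D \<le> t" using far(1)[of 0] g(4) dp[of t 0] t by simp
  have t2: "t + D \<le> N" using far(2)[of L] g(5) dp[of t N] t by simp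
  define side where "side u \<longleftrightarrow> (\<exists>i\<le>M. u = q i) \<or> (\<exists>j\<le>L. u = r j)" for u
  have exit: "\<exists>u. side u \<and> d (p s) u \<le> D \<and> away ?m D (p s) u (d (p s) u)"
    if st: "s \<le> N" "s = 0 \<or> s = N \<or> d ?m (p s) = 3 * D" for s
  proof (cases "s = 0 \<or> s = N")
    case True
    then have "side (p s)" unfolding side_def using g(4,5) by (metis le_refl le0)
    moreover have "away ?m D (p s) (p s) (d (p s) (p s))"
      using calculation far V mV st(1) by (intro away_seg) (auto simp: side_def)
    ultimately show ?thesis using V st(1) by (intro exI[of _ "p s"]) auto
  next
    case False
    then have s: "d ?m (p s) = 3 * D" using st by simp
    obtain u where u: "side u" "d (p s) u \<le> D"
      using max[OF T st(1)] by (auto simp: near_def side_def)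
    have "away ?m D (p s) u (d (p s) u)" using u s V mV st(1) by (intro away_seg) (auto simp: side_def)
    then show ?thesis using u by blast
  qed
  \<comment> \<open>From distance \<open>3 * D\<close> a step of length \<open>D\<close> to another
    side stays outside the ball. If the side \<open>p\<close> ends earlier, its endpoint already
    lies on another side.\<close>
  define hi where "hi = min (t + 3 * D) N"
  define lo where "lo = t - 3 * D"
  have hi: "hi \<le> N" "t + D \<le> hi" "hi \<le> t + 3 * D" "hi = 0 \<or> hi = N \<or> d ?m (p hi) = 3 * D"
    using t2 dp[of t hi] t by (auto simp: hi_def min_def)
  have lo: "lo \<le> N" "lo \<le> t - D" "t \<le> lo + 3 * D" "lo = 0 \<or> lo = N \<or> d ?m (p lo) = 3 * D"
    using t1 t dp[of t lo] by (auto simp: lo_def)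
  obtain u where u: "side u" "d (p hi) u \<le> D" "away ?m D (p hi) u (d (p hi) u)" using exit[OF hi(1,4)] by blast
  obtain w where w: "side w" "d (p lo) w \<le> D" "away ?m D (p lo) w (d (p lo) w)" using exit[OF lo(1,4)] by blast
  have uV: "u \<in> V" "w \<in> V" using u(1) w(1) V by (auto simp: side_def)
  have mu: "d ?m u \<le> 4 * D" using d_tri[of ?m "p hi" u] dp[of t hi] u(2) hi t V uV by simp
  have mw: "d ?m w \<le> 4 * D" using d_tri[of ?m "p lo" w] dp[of t lo] w(2) lo t V uV by simp
  have uw: "d u w \<le> 8 * D" "d w u \<le> 8 * D" using d_tri[of u ?m w] mu mw d_sym[of u ?m] d_sym[of u w] uV mV by auto
  have cross: "\<exists>n'\<le>30 * D. away ?m D (q i) (r j) n'" if "i \<le> M" "j \<le> L" "d ?m (q i) \<le> 4 * D" "d (q i) (r j) \<le> 8 * D" for i j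
    by (rule away_cross[OF _ T mV D _ _ that]) (rule max, assumption+, (rule far, assumption)+)
  have "\<exists>n'\<le>30 * D. away ?m D u w n'"
  proof -
    consider i j where "i \<le> M" "j \<le> M" "u = q i" "w = q j" | i j where "i \<le> L" "j \<le> L" "u = r i" "w = r j"
      | i j where "i \<le> M" "j \<le> L" "u = q i" "w = r j" | i j where "i \<le> M" "j \<le> L" "w = q i" "u = r j"
      using u(1) w(1) unfolding side_def by blast
    then show ?thesis
    proof cases
      case 1
      then have "away ?m D u w (d u w)" using away_geo[OF g(2) 1(1,2), of D ?m] far(1) by auto
      then show ?thesis using uw by (intro exI[of _ "d u w"]) auto
    next
      case 2
      then have "away ?m D u w (d u w)" using away_geo[OF g(3) 2(1,2), of D ?m] far(2) by auto
      then show ?thesis using uw by (intro exI[of _ "d u w"]) auto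
    next
      case 3
      then show ?thesis using cross mu uw by blast
    next
      case 4
      then obtain n' where "n' \<le> 30 * D" "away ?m D w u n'" using cross[OF 4(1,2)] mw uw by auto
      then show ?thesis using away_sym by blast
    qed
  qed
  then obtain n' where n': "n' \<le> 30 * D" "away ?m D u w n'" by blast
  have a1: "away ?m D (p (t + D)) (p hi) (hi - (t + D))"
  proof -
    have "away ?m D (p (t + D)) (p hi) (d (p (t + D)) (p hi))"
    proof (rule away_geo[OF g(1)])
      fix l assume "min (t + D) hi \<le> l" "l \<le> max (t + D) hi"
      then show "D \<le> d ?m (p l)" using hi t2 dp[of t l] t by simp
    qed (use hi t2 in auto)
    then show ?thesis using dp[of "t + D" hi] hi t2 by simp
  qed
  have a2: "away ?m D (p lo) (p (t - D)) (t - D - lo)"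
  proof -
    have "away ?m D (p lo) (p (t - D)) (d (p lo) (p (t - D)))"
    proof (rule away_geo[OF g(1)])
      fix l assume "min lo (t - D) \<le> l" "l \<le> max lo (t - D)"
      then show "D \<le> d ?m (p l)" using lo t1 dp[of t l] t by simp
    qed (use lo t1 t in auto)
    then show ?thesis using dp[of lo "t - D"] lo t1 t by simp
  qed
  define len where "len = hi - (t + D) + d (p hi) u + n' + d (p lo) w + (t - D - lo)"
  have full: "away ?m D (p (t + D)) (p (t - D)) len"
    unfolding len_def by (intro away_trans[OF _ a2] away_trans[OF _ away_sym[OF w(3)]] away_trans[OF _ n'(2)] away_trans[OF a1 u(3)])
  \<comment> \<open>2 + 1 + 30 + 1 + 2 multiples of \<open>D\<close>. With the \<open>2 * D\<close>
    of the side this makes 38, rounded up to 50 in the conclusion.\<close>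
  have len: "len \<le> 36 * D" unfolding len_def using u(2) w(2) n'(1) hi lo by linarith
  have "real D * real D \<le> real b * real b * (K * real (2 * D + len))"
  proof (rule rectangle[OF isoperimetric b, of "p (t - D)" ?m "p (t + D)"])
    show "\<exists>t'. wk \<omega> (\<lambda>v. D \<le> d ?m v) (p (t + D)) (p (t - D)) t' len" if "\<And>u v. \<omega> u v = - \<omega> v u" for \<omega>
      using full that unfolding away_def by blast
  qed (use V mV t1 t2 t dp[of "t - D" t] dp[of t "t + D"] dp[of "t - D" "t + D"] in auto)
  also have "\<dots> \<le> real b * real b * (K * (50 * real D))"
    using len K by (intro mult_left_mono) auto
  finally have "real D * real D \<le> (real b * real b * (K * 50)) * real D" by (simp add: algebra_simps)
  then show ?thesis using D by simp
qed

text \<open>A worst triangle exists only once the perimeter is bounded, and with it the deviation.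
  The estimate for the worst triangle does not depend on the perimeter.\<close>

theorem isoperimetric_thin:
  assumes isoperimetric: "isoperimetric b K" and b: "1 \<le> b" and K: "0 \<le> K"
  shows "\<exists>\<delta>. thin \<delta>"
proof -
  define \<delta> where "\<delta> = nat \<lceil>real b * real b * (K * 50)\<rceil>"
  have "thin \<delta>"
  proof (rule ccontr)
    assume "\<not> thin \<delta>"
    then obtain p0 N0 q0 M0 r0 L0 t0 where T0: "triangle p0 N0 q0 M0 r0 L0" "t0 \<le> N0"
      "\<not> near (p0 t0) q0 M0 \<delta>" "\<not> near (p0 t0) r0 L0 \<delta>" unfolding thin_def by blast
    define n where "n = N0 + M0 + L0"
    define bad where "bad D \<longleftrightarrow> (\<exists>p N q M r L t. triangle p N q M r L \<and> N + M + L \<le> n \<and> t \<le> N \<and>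
      (\<forall>i\<le>M. D < d (p t) (q i)) \<and> (\<forall>j\<le>L. D < d (p t) (r j)))" for D
    have far: "\<forall>i\<le>M0. \<delta> < d (p0 t0) (q0 i)" "\<forall>j\<le>L0. \<delta> < d (p0 t0) (r0 j)"
      using T0(3,4) unfolding near_def by (meson not_le)+
    have b0: "bad \<delta>" unfolding bad_def
      by (rule exI[of _ p0], rule exI[of _ N0], rule exI[of _ q0], rule exI[of _ M0], rule exI[of _ r0],
          rule exI[of _ L0], rule exI[of _ t0], intro conjI)
        (use T0(1,2) n_def far in simp_all)
    have bnd: "D \<le> n" if bD: "bad D" for D
    proof -
      obtain p N q M r L t where *: "triangle p N q M r L" "N + M + L \<le> n" "t \<le> N" "\<forall>i\<le>M. D < d (p t) (q i)"
        using bD unfolding bad_def by (elim exE conjE) (rule that)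
      then have "D < d (p t) (p 0)" by (auto simp: triangle_def)
      moreover have "d (p t) (p 0) = t" using *(1,3) unfolding triangle_def geodesic_def by (metis add_0 diff_0_eq_0 diff_zero le0 add.right_neutral)
      ultimately show ?thesis using * by simp
    qed
    define D where "D = (GREATEST D. bad D)"
    have D: "bad D" unfolding D_def by (rule GreatestI_nat[of bad \<delta> n]) (use b0 bnd in auto)
    have mx: "D' \<le> D" if "bad D'" for D' unfolding D_def by (rule Greatest_le_nat[of bad _ n]) (use that bnd in auto)
    obtain p N q M r L t where *: "triangle p N q M r L" "N + M + L \<le> n" "t \<le> N"
      "\<forall>i\<le>M. D < d (p t) (q i)" "\<forall>j\<le>L. D < d (p t) (r j)"
      using D unfolding bad_def by (elim exE conjE) (rule that)
    have max: "near (p t) q M (Suc D) \<or> near (p t) r L (Suc D)"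
      if tr: "triangle p N q M r L" "N + M + L \<le> n" "t \<le> N" for p N q M r L t
    proof (rule ccontr)
      assume "\<not> ?thesis"
      then have far: "\<forall>i\<le>M. Suc D < d (p t) (q i)" "\<forall>j\<le>L. Suc D < d (p t) (r j)"
        unfolding near_def by (meson not_le)+
      have "bad (Suc D)" unfolding bad_def
        by (rule exI[of _ p], rule exI[of _ N], rule exI[of _ q], rule exI[of _ M], rule exI[of _ r],
          rule exI[of _ L], rule exI[of _ t], intro conjI tr far)
      then show False using mx by fastforce
    qed
    \<comment> \<open>\<open>Suc D\<close> plays both roles: it bounds the deviation of all
      triangles because \<open>Suc D\<close> is not bad, and the chosen triangle deviates by at
      least \<open>Suc D\<close> because of the strict inequality in \<open>bad D\<close>.\<close>
    have "real (Suc D) \<le> real b * real b * (K * 50)"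
    proof (rule thick_bound[OF isoperimetric b _ _ *(1-3) _ _ K])
      show "near (p t) q M (Suc D) \<or> near (p t) r L (Suc D)"
        if "triangle p N q M r L" "N + M + L \<le> n" "t \<le> N" for p N q M r L t using max[OF that] .
    qed (use *(4,5) in \<open>auto simp: Suc_le_eq\<close>)
    then have "Suc D \<le> \<delta>" unfolding \<delta>_def by linarith
    then show False using mx[OF b0] by simp
  qed
  then show ?thesis by blast
qed

section \<open>From thin triangles to the four-point condition, and back to loops\<close>

abbreviation rd :: "'v \<Rightarrow> 'v \<Rightarrow> real" where "rd x y \<equiv> real (d x y)"

text \<open>Take the last point of \<open>p\<close> that is close to the side from
  \<open>p 0\<close> to \<open>w\<close>. Its successor is close to the other side, so the point is
  close to both; adding the triangle inequalities compares its distance from \<open>w\<close> with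
  the Gromov product.\<close>

lemma thin_center:
  assumes "thin \<delta>" "w \<in> V" "geodesic p N"
  shows "\<exists>t\<le>N. rd w (p t) \<le> gromov_product rd w (p 0) (p N) + 2 * real \<delta> + 1"
proof -
  have V: "\<And>l. l \<le> N \<Longrightarrow> p l \<in> V" using assms(3) by (auto simp: geodesic_def)
  obtain q where q: "geodesic q (d (p 0) w)" "q 0 = p 0" "q (d (p 0) w) = w" using geodesic_exists V assms(2) by blast
  obtain r where r: "geodesic r (d w (p N))" "r 0 = w" "r (d w (p N)) = p N" using geodesic_exists V assms(2) by blast
  define M L where "M = d (p 0) w" and "L = d w (p N)"
  have T: "triangle p N q M r L" using assms(3) q r by (simp add: triangle_def M_def L_def)
  have nr: "near (p t) q M \<delta> \<or> near (p t) r L \<delta>" if "t \<le> N" for t using assms(1) T that unfolding thin_def by blast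
  have n0: "near (p 0) q M \<delta>" using q V by (auto simp: near_def intro!: exI[of _ 0])
  define t where "t = (GREATEST t. t \<le> N \<and> near (p t) q M \<delta>)"
  have t: "t \<le> N \<and> near (p t) q M \<delta>" unfolding t_def by (rule GreatestI_nat[of "\<lambda>t. t \<le> N \<and> near (p t) q M \<delta>" 0 N]) (use n0 in auto)
  have mx: "t' \<le> t" if "t' \<le> N \<and> near (p t') q M \<delta>" for t'
    unfolding t_def by (rule Greatest_le_nat[of "\<lambda>t. t \<le> N \<and> near (p t) q M \<delta>" _ N]) (use that in auto)
  have "near (p t) r L (Suc \<delta>)"
  proof (cases "t = N")
    case True
    then show ?thesis using r V unfolding near_def L_def by (intro exI[of _ "d w (p N)"]) auto
  next
    case False
    then have "\<not> near (p (Suc t)) q M \<delta>" using mx[of "Suc t"] t by auto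
    then obtain j where j: "j \<le> L" "d (p (Suc t)) (r j) \<le> \<delta>" using nr[of "Suc t"] t False by (auto simp: near_def)
    have "r j \<in> V" using r j by (auto simp: geodesic_def L_def)
    then have "d (p t) (r j) \<le> d (p t) (p (Suc t)) + d (p (Suc t)) (r j)" using d_tri V t False by simp
    moreover have "d (p t) (p (Suc t)) = 1" using assms(3) t False by (simp add: geodesic_def)
    ultimately show ?thesis using j by (auto simp: near_def)
  qed
  then obtain j where j: "j \<le> L" "d (p t) (r j) \<le> Suc \<delta>" by (auto simp: near_def)
  obtain i where i: "i \<le> M" "d (p t) (q i) \<le> \<delta>" using t by (auto simp: near_def)
  have W: "q i \<in> V" "r j \<in> V" "p t \<in> V" "p 0 \<in> V" "p N \<in> V" using q r i j V t by (auto simp: geodesic_def M_def L_def)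
  have q1: "d (p 0) (q i) + d (q i) w = d (p 0) w"
  proof -
    have "d (q 0) (q i) = i" "d (q i) (q M) = M - i" using q(1) i M_def by (auto simp: geodesic_def)
    then show ?thesis using q(2,3) i M_def by simp
  qed
  have r1: "d w (r j) + d (r j) (p N) = d w (p N)"
  proof -
    have "d (r 0) (r j) = j" "d (r j) (r L) = L - j" using r(1) j L_def by (auto simp: geodesic_def)
    then show ?thesis using r(2,3) j L_def by simp
  qed
  have p1: "d (p 0) (p t) + d (p t) (p N) = d (p 0) (p N)" using assms(3) t by (auto simp: geodesic_def)
  have "d (p 0) (p t) \<le> d (p 0) (q i) + \<delta>" using d_tri[of "p 0" "q i" "p t"] d_sym[of "q i" "p t"] W i by simp
  moreover have "d w (p t) \<le> d (q i) w + \<delta>" using d_tri[of w "q i" "p t"] d_sym[of "q i" "p t"] d_sym[of w "q i"] W i assms(2) by simp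
  moreover have "d (p t) (p N) \<le> Suc \<delta> + d (r j) (p N)" using d_tri[of "p t" "r j" "p N"] W j by simp
  moreover have "d w (p t) \<le> d w (r j) + Suc \<delta>" using d_tri[of w "r j" "p t"] d_sym[of "r j" "p t"] W j assms(2) by simp
  ultimately have "2 * d w (p t) + d (p 0) (p N) \<le> d (p 0) w + d w (p N) + 4 * \<delta> + 2" using q1 r1 p1 by linarith
  then have "2 * rd w (p t) \<le> rd (p 0) w + rd (p N) w - rd (p 0) (p N) + 4 * real \<delta> + 2"
    using d_sym[of w "p N"] W assms(2) by linarith
  then have "rd w (p t) \<le> gromov_product rd w (p 0) (p N) + 2 * real \<delta> + 1"
    unfolding gromov_product_def by argo
  then show ?thesis using t by blast
qed

lemma gp_le:
  assumes "geodesic p N" "t \<le> N" "w \<in> V"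
  shows "gromov_product rd w (p 0) (p N) \<le> rd w (p t)"
proof -
  have V: "p 0 \<in> V" "p N \<in> V" "p t \<in> V" using assms by (auto simp: geodesic_def)
  have "d (p 0) w \<le> d (p 0) (p t) + d (p t) w" "d (p N) w \<le> d (p N) (p t) + d (p t) w" using d_tri V assms(3) by auto
  moreover have "d (p 0) (p t) + d (p N) (p t) = d (p 0) (p N)" using assms by (auto simp: geodesic_def)
  ultimately show ?thesis using d_sym[of "p t" w] V assms(3) by (simp add: gromov_product_def)
qed

theorem thin_delta_hyperbolic:
  assumes "thin \<delta>"
  shows "delta_hyperbolic (3 * real \<delta> + 1) V rd"
  unfolding delta_hyperbolic_def
proof (intro ballI)
  fix w x y z assume V: "w \<in> V" "x \<in> V" "y \<in> V" "z \<in> V"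
  obtain p where p: "geodesic p (d x z)" "p 0 = x" "p (d x z) = z" using geodesic_exists V by blast
  obtain q where q: "geodesic q (d x y)" "q 0 = x" "q (d x y) = y" using geodesic_exists V by blast
  obtain r where r: "geodesic r (d y z)" "r 0 = y" "r (d y z) = z" using geodesic_exists V by blast
  have T: "triangle p (d x z) q (d x y) r (d y z)" using p q r by (simp add: triangle_def)
  obtain t where t: "t \<le> d x z" "rd w (p t) \<le> gromov_product rd w x z + 2 * real \<delta> + 1"
    using thin_center[OF assms V(1) p(1)] p(2,3) by auto
  have pV: "p t \<in> V" using p t by (simp add: geodesic_def)
  have *: "rd w v \<le> rd w (p t) + real \<delta>" if "v \<in> V" "d (p t) v \<le> \<delta>" for v
    using d_tri[of w "p t" v] that V pV by simp
  have "min (gromov_product rd w x y) (gromov_product rd w y z) \<le> rd w (p t) + real \<delta>"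
  proof (cases "near (p t) q (d x y) \<delta>")
    case True
    then obtain i where i: "i \<le> d x y" "d (p t) (q i) \<le> \<delta>" by (auto simp: near_def)
    then have "gromov_product rd w x y \<le> rd w (q i)" using gp_le[OF q(1) i(1) V(1)] q by simp
    then show ?thesis using *[of "q i"] i q(1) by (simp add: geodesic_def)
  next
    case False
    then have "near (p t) r (d y z) \<delta>" using assms T t unfolding thin_def by blast
    then obtain i where i: "i \<le> d y z" "d (p t) (r i) \<le> \<delta>" by (auto simp: near_def)
    then have "gromov_product rd w y z \<le> rd w (r i)" using gp_le[OF r(1) i(1) V(1)] r by simp
    then show ?thesis using *[of "r i"] i r(1) by (simp add: geodesic_def)
  qed
  then show "min (gromov_product rd w x y) (gromov_product rd w y z) - (3 * real \<delta> + 1) \<le> gromov_product rd w x z"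
    using t by linarith
qed

text \<open>Around the point of a long closed walk that is farthest from its start, hyperbolicity yields a
  shortcut.\<close>

lemma loop_bound:
  assumes hyp: "delta_hyperbolic \<delta> V rd" and k: "2 * \<delta> < real k"
    and anti: "\<And>u v. \<omega> u v = - \<omega> v u"
    and short: "\<And>x t n. wk \<omega> (\<lambda>_. True) x x t n \<Longrightarrow> n \<le> 4 * k \<Longrightarrow> \<bar>t\<bar> \<le> 1"
  shows "wk \<omega> (\<lambda>_. True) x x t n \<Longrightarrow> \<bar>t\<bar> \<le> real n"
proof (induction n arbitrary: x t rule: less_induct)
  case (less n)
  show ?case
  proof (cases "n \<le> 2 * k")
    case True
    show ?thesis
    proof (cases "n = 0")
      case True
      then show ?thesis using less.prems by (auto elim: walk.cases)
    next
      case False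
      then show ?thesis using short[OF less.prems] True by simp
    qed
  next
    case False
    obtain p where p: "p 0 = x" "p n = x" "\<forall>i\<le>n. p i \<in> V" "\<forall>i<n. adj (p i) (p (Suc i))"
      "t = (\<Sum>i<n. \<omega> (p i) (p (Suc i)))" using walk_fun[OF less.prems] by auto
    have xV: "x \<in> V" using p(1) p(3)[rule_format, of 0] by simp
    have partner: "wk \<omega> (\<lambda>_. True) (p i) (p j) (\<Sum>l=i..<j. \<omega> (p l) (p (Suc l))) (j - i)" if "i \<le> j" "j \<le> n" for i j
      using fun_walk[of n "\<lambda>v. v \<in> V \<and> True" p adj i j \<omega>] p(3,4) that by auto
    have pd: "d (p i) (p j) \<le> j - i" if "i \<le> j" "j \<le> n" for i j
      using that
    proof (induction j)
      case (Suc j)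
      show ?case
      proof (cases "i = Suc j")
        case False
        then have "d (p i) (p j) \<le> j - i" using Suc by simp
        moreover have "d (p i) (p (Suc j)) \<le> d (p i) (p j) + d (p j) (p (Suc j))" using d_tri p(3) Suc False by simp
        moreover have "d (p j) (p (Suc j)) \<le> 1" using p(4) Suc by (simp add: adj_def)
        ultimately show ?thesis using False Suc by simp
      qed (use p Suc in simp)
    qed (use p(3) in simp)
    \<comment> \<open>Otherwise every stretch of length at most \<open>2 * k\<close> is geodesic. At
      the point \<open>p i\<close> farthest from \<open>x\<close>, the four-point condition for
      \<open>p (i - k)\<close>, \<open>p i\<close> and \<open>p (i + k)\<close> would give
      \<open>2 * k \<le> k + 2 * \<delta>\<close>.\<close>
    have sc: "\<exists>i j. i < j \<and> j \<le> n \<and> j - i \<le> 2 * k \<and> d (p i) (p j) < j - i"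
    proof (rule ccontr)
      assume no: "\<not> ?thesis"
      have eq: "d (p i) (p j) = j - i" if "i \<le> j" "j \<le> n" "j - i \<le> 2 * k" for i j
      proof (cases "i = j")
        case True
        then show ?thesis using p(3) that by simp
      next
        case False
        then show ?thesis using no pd[OF that(1,2)] that by (metis le_neq_implies_less)
      qed
      obtain i where i: "i \<le> n" "\<forall>j\<le>n. d x (p j) \<le> d x (p i)"
      proof -
        let ?m = "Max ((\<lambda>j. d x (p j)) ` {..n})"
        have "?m \<in> (\<lambda>j. d x (p j)) ` {..n}" by (rule Max_in) auto
        then obtain i where "i \<le> n" "?m = d x (p i)" by (elim imageE) simp
        moreover have "d x (p j) \<le> ?m" if "j \<le> n" for j using that by (intro Max_ge) auto
        ultimately show thesis using that[of i] by simp
      qed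
      have xk: "d x (p k) = k" using eq[of 0 k] False p(1) by simp
      have xnk: "d x (p (n - k)) = k"
        using eq[of "n - k" n] False p(2) d_sym[of x "p (n - k)"] p(3) xV by simp
      have "k \<le> i"
        using i(2)[rule_format, of k] xk pd[of 0 i] i(1) p(1) False by simp
      moreover have "i + k \<le> n"
        using i(2)[rule_format, of "n - k"] xnk pd[of i n] i(1) p(2) d_sym[of x "p i"] p(3) xV False by simp
      ultimately have ik: "k \<le> i" "i + k \<le> n" by auto
      let ?a = "p (i - k)" and ?c = "p (i + k)"
      have V: "x \<in> V" "?a \<in> V" "?c \<in> V" "p i \<in> V" using xV p(3) ik i(1) by auto
      have dd: "d ?a ?c = 2 * k" "d ?a (p i) = k" "d (p i) ?c = k"
        using eq[of "i - k" "i + k"] eq[of "i - k" i] eq[of i "i + k"] ik by auto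
      have "gromov_product rd x ?a ?c \<ge> min (gromov_product rd x ?a (p i)) (gromov_product rd x (p i) ?c) - \<delta>"
        using hyp V unfolding delta_hyperbolic_def by blast
      moreover have "d ?a x \<le> d (p i) x" "d ?c x \<le> d (p i) x"
        using i(2)[rule_format, of "i - k"] i(2)[rule_format, of "i + k"] ik d_sym V by auto
      ultimately have "2 * real k \<le> real k + 2 * \<delta>"
        using dd by (auto simp: gromov_product_def min_def field_simps split: if_splits)
      then show False using k by simp
    qed
    then obtain i j where ij: "i < j" "j \<le> n" "j - i \<le> 2 * k" "d (p i) (p j) < j - i" by blast
    have V: "p i \<in> V" "p j \<in> V" using p ij by auto
    have "\<exists>s. wk \<omega> (\<lambda>_. True) (p i) (p j) s (d (p i) (p j))"
      by (rule seg_walk[OF V TrueI]) (rule anti)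
    then obtain s where s: "wk \<omega> (\<lambda>_. True) (p i) (p j) s (d (p i) (p j))" ..
    define t1 t2 t3 where "t1 = (\<Sum>l=0..<i. \<omega> (p l) (p (Suc l)))" and "t2 = (\<Sum>l=i..<j. \<omega> (p l) (p (Suc l)))"
      and "t3 = (\<Sum>l=j..<n. \<omega> (p l) (p (Suc l)))"
    have tt: "t = t1 + t2 + t3"
      using p(5) ij unfolding t1_def t2_def t3_def by (simp add: sum.atLeastLessThan_concat atLeast0LessThan[symmetric])
    have w1: "wk \<omega> (\<lambda>_. True) x (p i) t1 i" and w2: "wk \<omega> (\<lambda>_. True) (p i) (p j) t2 (j - i)"
      and w3: "wk \<omega> (\<lambda>_. True) (p j) x t3 (n - j)"
      using partner[of 0 i] partner[of i j] partner[of j n] ij p(1,2) unfolding t1_def t2_def t3_def by auto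
    let ?n = "i + d (p i) (p j) + (n - j)"
    have "\<bar>t1 + s + t3\<bar> \<le> real ?n"
      by (rule less.IH) (use ij walk_trans[OF w3 walk_trans[OF s w1]] in auto)
    \<comment> \<open>The loop that is cut off has length at most \<open>4 * k\<close> and costs 1,
      while the remaining loop is shorter by at least 1.\<close>
    moreover have "\<bar>t2 + - s\<bar> \<le> 1"
      by (rule short[OF walk_trans[OF walk_rev[OF s adj_sym anti] w2]]) (use ij in auto)
    moreover have "real ?n + 1 \<le> real n" using ij by linarith
    ultimately show ?thesis unfolding tt by linarith
  qed
qed

end

section \<open>The presented group\<close>

lemma set_winv: "set (winv w) = linv ` set w"
  by (auto simp: winv_def)

lemma fst_linv [simp]: "fst (linv a) = fst a"
  by (cases a) simp

lemma length_cancel_cons: "length (cancel_cons a v) \<le> Suc (length v)"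
  by (cases v) auto

lemma length_reduce: "length (reduce w) \<le> length w"
proof (induction w)
  case (Cons a w)
  then show ?case using length_cancel_cons[of a "reduce w"] by (simp add: reduce_def)
qed (simp add: reduce_def)

lemma reduce_id: "length (reduce w) = length w \<Longrightarrow> reduce w = w"
proof (induction w)
  case (Cons a w)
  have r: "reduce (a # w) = cancel_cons a (reduce w)" by (simp add: reduce_def)
  then have "length (reduce w) = length w"
    using Cons.prems[unfolded r] length_cancel_cons[of a "reduce w"] length_reduce[of w] by simp
  then have "reduce w = w" by (rule Cons.IH)
  then show ?case using r Cons.prems by (cases w) (auto split: if_splits)
qed (simp add: reduce_def)

lemma initial_subword_iff:
  assumes "r \<in> carrier (free_group S)"
  shows "initial_subword S u r \<longleftrightarrow> prefix u r"
proof
  assume "initial_subword S u r"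
  then obtain t where "r = reduce (u @ t)" "length r = length (u @ t)"
    by (auto simp: initial_subword_def free_group_def)
  then show "prefix u r" using reduce_id by (metis prefixI)
next
  assume "prefix u r"
  then obtain t where t: "r = u @ t" by (auto simp: prefix_def)
  then have "reduced u" "reduced t" "reduce (u @ t) = r" "fst ` set u \<subseteq> S" "fst ` set t \<subseteq> S"
    using assms reduced_append reduce_reduced[of r] by (auto simp: free_group_def)
  then show "initial_subword S u r" using t by (auto simp: initial_subword_def free_group_def)
qed

lemma winv_rotate: "\<exists>j. winv (rotate k w) = rotate j (winv w)"
proof -
  have "winv (rotate k w) = winv (take (k mod length w) w) @ winv (drop (k mod length w) w)"
    by (simp add: rotate_drop_take winv_append)
  moreover have "winv w = winv (drop (k mod length w) w) @ winv (take (k mod length w) w)"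
    by (metis append_take_drop_id winv_append)
  ultimately show ?thesis by (metis rotate_append)
qed

lemma cyclically_reduced_rotate1: "cyclically_reduced w \<Longrightarrow> cyclically_reduced (rotate1 w)"
proof (cases w)
  case (Cons a x)
  assume c: "cyclically_reduced w"
  show ?thesis
  proof (cases x rule: rev_cases)
    case (snoc y b)
    have "reduced (a # y @ [b])" "a \<noteq> linv b" using c Cons snoc by (auto simp: cyclically_reduced_def)
    then have "reduced ((y @ [b]) @ [a])" "hd ((y @ [b]) @ [a]) \<noteq> linv a"
      by (auto simp: reduced_Cons reduced_append[of "y @ [b]" "[a]"] hd_append simp del: append.simps append_assoc)
    then show ?thesis using Cons snoc by (auto simp: cyclically_reduced_def)
  qed (use c Cons in simp)
qed simp

lemma cyclically_reduced_rotate: "cyclically_reduced w \<Longrightarrow> cyclically_reduced (rotate k w)"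
  by (induction k) (auto simp: cyclically_reduced_rotate1)

lemma cyclically_reduced_winv: "cyclically_reduced w \<Longrightarrow> cyclically_reduced (winv w)"
proof -
  assume c: "cyclically_reduced w"
  have "hd (winv w) = linv (last w)" "last (winv w) = linv (hd w)" if "w \<noteq> []"
    using that by (auto simp: winv_def hd_map last_map hd_rev last_rev)
  then show ?thesis using c reduced_winv[of w]
    by (cases "w = []") (auto simp: cyclically_reduced_def)
qed

lemma normal_normal_closure:
  assumes "group G" "A \<subseteq> carrier G"
  shows "normal_closure G A \<lhd> G" "A \<subseteq> normal_closure G A"
    and "N \<lhd> G \<Longrightarrow> A \<subseteq> N \<Longrightarrow> normal_closure G A \<subseteq> N"
proof -
  interpret group G by fact
  let ?F = "{N. N \<lhd> G \<and> A \<subseteq> N}"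
  have c: "carrier G \<in> ?F" using assms(2) by (auto intro!: normal_invI simp: subgroup_self)
  have eq: "normal_closure G A = \<Inter> ?F" by (auto simp: normal_closure_def hull_def)
  show "normal_closure G A \<lhd> G"
  proof (rule normal_invI)
    show "subgroup (normal_closure G A) G"
      unfolding eq using c by (intro subgroups_Inter) (auto simp: normal_def)
    show "x \<otimes>\<^bsub>G\<^esub> h \<otimes>\<^bsub>G\<^esub> inv\<^bsub>G\<^esub> x \<in> normal_closure G A" if "x \<in> carrier G" "h \<in> normal_closure G A" for x h
      using that unfolding eq by (auto intro: normal.inv_op_closed2)
  qed
  show "A \<subseteq> normal_closure G A" "N \<lhd> G \<Longrightarrow> A \<subseteq> N \<Longrightarrow> normal_closure G A \<subseteq> N" by (auto simp: eq)
qed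

locale small_pres =
  fixes S :: "'s set" and R :: "'s word set"
  assumes pres: "presentation S R" and small: "small_cancellation S R (1 / 24)"
begin

abbreviation "F \<equiv> free_group S"

abbreviation "N \<equiv> normal_closure F R"

text \<open>The empty word may be a relator. It imposes no relation, and the cycles need nonempty
  labels.\<close>

definition "Q = sym_relators R - {[]}"

lemma R_F: "R \<subseteq> carrier F" using pres by (simp add: presentation_def)

lemma sym_cyc_red: "r \<in> sym_relators R \<Longrightarrow> cyclically_reduced r"
  using pres by (auto simp: presentation_def sym_relators_def intro!: cyclically_reduced_rotate intro: cyclically_reduced_winv)

lemma sym_F: "r \<in> sym_relators R \<Longrightarrow> r \<in> carrier F"
  using R_F by (fastforce simp: sym_relators_def free_group_def set_winv)

lemma sym_relators_iff: "w \<in> sym_relators R \<longleftrightarrow> (\<exists>r\<in>R. \<exists>k. w = rotate k r \<or> w = rotate k (winv r))"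
proof -
  have "reduced (rotate k r)" "reduced (rotate k (winv r))" if "r \<in> R" for k r
    using pres that cyclically_reduced_rotate cyclically_reduced_winv
    unfolding presentation_def cyclically_reduced_def by blast+
  then show ?thesis unfolding sym_relators_def by blast
qed

lemma R_sym: "R \<subseteq> sym_relators R"
  unfolding sym_relators_iff subset_iff by (metis rotate0 id_apply)

lemma sym_winv: "r \<in> sym_relators R \<Longrightarrow> winv r \<in> sym_relators R"
  unfolding sym_relators_iff using winv_rotate by (metis winv_winv)

lemma sym_rotate1: "r \<in> sym_relators R \<Longrightarrow> rotate1 r \<in> sym_relators R"
  unfolding sym_relators_iff by (metis rotate_Suc)

lemma piece_prefix:
  assumes "r \<in> sym_relators R" "r' \<in> sym_relators R" "r \<noteq> r'" "prefix u r" "prefix u r'"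
  shows "piece S R u"
  unfolding piece_def using assms initial_subword_iff sym_F by blast

sublocale relators Q
proof
  fix r assume "r \<in> Q"
  then have r: "r \<in> sym_relators R" "r \<noteq> []" by (auto simp: Q_def)
  show "reduced r" "r \<noteq> []" "rotate1 r \<in> Q" "winv r \<in> Q"
    using r sym_cyc_red[of r] sym_rotate1 sym_winv by (auto simp: Q_def cyclically_reduced_def)
  fix r' k assume "r' \<in> Q"
  then have r': "r' \<in> sym_relators R" by (auto simp: Q_def)
  assume "r \<noteq> r'" "k \<le> length r" "k \<le> length r'" and t: "take k r = take k r'"
  then have "piece S R (take k r)" using piece_prefix[OF r(1) r'] by (metis take_is_prefix)
  moreover have "initial_subword S (take k r) r" using initial_subword_iff[OF sym_F[OF r(1)]] by (simp add: take_is_prefix)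
  ultimately have "real (length (take k r)) < 1 / 24 * real (length r)"
    using small r(1) unfolding small_cancellation_def by blast
  then show "24 * k < length r" using \<open>k \<le> length r\<close> by simp
qed

lemma letters: "fst a \<in> S \<Longrightarrow> \<exists>r\<in>Q. a \<in> set r"
proof -
  assume "fst a \<in> S"
  then obtain r b where r: "r \<in> R" "b \<in> set r" "fst b = fst a" using pres by (auto simp: presentation_def)
  have "r \<in> Q"
    using r R_sym by (auto simp: Q_def)
  moreover have "a = b \<or> a = linv b" using r by (cases a; cases b) auto
  moreover have "linv b \<in> set (winv r)" using r by (simp add: set_winv)
  ultimately show ?thesis using r winv_mem[of r] by blast
qed

text \<open>The words that close at every vertex of the limit graph form a normal subgroup which
  contains \<open>R\<close>. Asking this at every vertex, rather than at the root, makes it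
  invariant under conjugation.\<close>

lemma kernel:
  assumes "w \<in> N"
  shows "path Einf [] w []"
proof -
  interpret F: group F by (rule group_free_group)
  define K where "K = {w \<in> carrier F. \<forall>v\<in>Vinf. path Einf v w v}"
  have mult: "u \<otimes>\<^bsub>F\<^esub> v = reduce (u @ v)" for u v by (simp add: free_group_def)
  have one: "\<one>\<^bsub>F\<^esub> = []" by (simp add: free_group_def)
  have inv: "inv\<^bsub>F\<^esub> u = winv u" if "u \<in> carrier F" for u
  proof (rule F.inv_equality)
    show "winv u \<otimes>\<^bsub>F\<^esub> u = \<one>\<^bsub>F\<^esub>" by (simp add: mult one reduce_winv)
    show "winv u \<in> carrier F" using that reduced_winv by (auto simp: free_group_def set_winv)
  qed (fact that)
  have "K \<lhd> F"
  proof (rule F.normal_invI)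
    show "subgroup K F"
    proof
      show "K \<subseteq> carrier F" by (auto simp: K_def)
      show "\<one>\<^bsub>F\<^esub> \<in> K" using F.one_closed by (simp add: K_def one)
    next
      fix x y assume xy: "x \<in> K" "y \<in> K"
      then have "path Einf v (x @ y) v" if "v \<in> Vinf" for v using that by (auto simp: K_def path_append)
      then show "x \<otimes>\<^bsub>F\<^esub> y \<in> K" using xy inf.path_reduce F.m_closed[of x y] by (auto simp: K_def mult)
      show "inv\<^bsub>F\<^esub> x \<in> K" using xy inv[of x] F.inv_closed[of x] inf.path_winv by (auto simp: K_def)
    qed
    fix x h assume x: "x \<in> carrier F" and h: "h \<in> K"
    have "path Einf v (x @ h @ winv x) v" if v: "v \<in> Vinf" for v
    proof -
      have "set x \<subseteq> \<Union> (set ` Q)" using letters x by (fastforce simp: free_group_def)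
      then obtain t where t: "path Einf v x t" using path_total[OF v] by blast
      then show ?thesis using path_Vinf[OF t v] h inf.path_winv[OF t] by (auto simp: K_def path_append)
    qed
    then have "path Einf v (reduce (x @ h @ winv x)) v" if "v \<in> Vinf" for v using inf.path_reduce that by blast
    moreover have "x \<otimes>\<^bsub>F\<^esub> h \<otimes>\<^bsub>F\<^esub> inv\<^bsub>F\<^esub> x = reduce (x @ h @ winv x)"
      using x by (simp add: mult inv reduce_append_reduce)
    moreover have "x \<otimes>\<^bsub>F\<^esub> h \<otimes>\<^bsub>F\<^esub> inv\<^bsub>F\<^esub> x \<in> carrier F" using x h by (simp add: K_def)
    ultimately show "x \<otimes>\<^bsub>F\<^esub> h \<otimes>\<^bsub>F\<^esub> inv\<^bsub>F\<^esub> x \<in> K" by (simp add: K_def)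
  qed
  moreover have "R \<subseteq> K"
  proof
    fix r assume r: "r \<in> R"
    then have "r \<in> Q \<or> r = []" using R_sym by (auto simp: Q_def)
    then show "r \<in> K" using closed_Vinf R_F r by (auto simp: K_def)
  qed
  ultimately have "N \<subseteq> K" using normal_normal_closure(3)[OF group_free_group R_F] by blast
  then show ?thesis using assms nil_Vinf by (auto simp: K_def)
qed

lemma N_normal: "N \<lhd> F" using normal_normal_closure(1)[OF group_free_group R_F] .

text \<open>Letters outside \<open>S\<close> are sent to the identity so that the evaluation of
  words is total.\<close>

definition el :: "'s \<times> bool \<Rightarrow> 's word set" where
  "el a = (if fst a \<in> S then word_image S R [a] else \<one>\<^bsub>presented_group S R\<^esub>)"

lemma word_image_closed: "w \<in> carrier F \<Longrightarrow> word_image S R w \<in> carrier (presented_group S R)"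
  by (auto simp: word_image_def presented_group_def carrier_FactGroup)

lemma word_image_mult:
  "u \<in> carrier F \<Longrightarrow> v \<in> carrier F \<Longrightarrow>
    word_image S R u \<otimes>\<^bsub>presented_group S R\<^esub> word_image S R v = word_image S R (reduce (u @ v))"
  using normal.rcos_sum[OF N_normal, of u v] unfolding word_image_def presented_group_def by (simp add: FactGroup_def free_group_def)

lemma word_image_Nil: "word_image S R [] = \<one>\<^bsub>presented_group S R\<^esub>"
proof -
  interpret F: group F by (rule group_free_group)
  have "N #>\<^bsub>F\<^esub> \<one>\<^bsub>F\<^esub> = N" by (rule F.coset_mult_one) (use N_normal subgroup.subset normal_imp_subgroup in blast)
  then show ?thesis by (simp add: word_image_def presented_group_def FactGroup_def free_group_def)
qed

lemma word_image_one_iff: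
  assumes "w \<in> carrier F"
  shows "word_image S R w = \<one>\<^bsub>presented_group S R\<^esub> \<longleftrightarrow> w \<in> N"
proof -
  interpret F: group F by (rule group_free_group)
  have s: "subgroup N F" using N_normal normal_imp_subgroup by blast
  have "N #>\<^bsub>F\<^esub> w = N \<longleftrightarrow> w \<in> N"
    using F.coset_join1[OF _ _ s] F.coset_join2[OF _ s] assms subgroup.subset[OF s] by blast
  then show ?thesis by (simp add: word_image_def presented_group_def FactGroup_def)
qed

sublocale scg Q "presented_group S R" el S
proof -
  interpret pg: group "presented_group S R"
    unfolding presented_group_def by (rule normal.factorgroup_is_group[OF N_normal])
  have *: "el (linv a) \<otimes>\<^bsub>presented_group S R\<^esub> el a = \<one>\<^bsub>presented_group S R\<^esub>" for a
  proof (cases "fst a \<in> S")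
    case True
    then have "[a] \<in> carrier F" "[linv a] \<in> carrier F" by (cases a; auto simp: free_group_def reduced_Cons)+
    moreover have "fst (linv a) = fst a" by (cases a) simp
    moreover have "reduce [linv a, a] = []" by (simp add: reduce_def)
    ultimately show ?thesis using True by (simp add: el_def word_image_mult word_image_Nil)
  qed (cases a; simp add: el_def)
  have cl: "el a \<in> carrier (presented_group S R)" for a
    using word_image_closed[of "[a]"] by (simp add: el_def free_group_def reduced_Cons)
  show "scg Q (presented_group S R) el"
    using cl pg.inv_equality[OF * cl cl] by unfold_locales auto
qed

lemma e_word_image: "fst ` set w \<subseteq> S \<Longrightarrow> e w = word_image S R (reduce w)"
proof (induction w)
  case Nil
  then show ?case by (simp add: word_image_Nil reduce_def)
next
  case (Cons a w)
  have "[a] \<in> carrier F" "reduce w \<in> carrier F"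
    using Cons.prems set_reduce[of w] by (fastforce simp: free_group_def reduced_Cons)+
  then have "word_image S R [a] \<otimes>\<^bsub>presented_group S R\<^esub> word_image S R (reduce w) = word_image S R (reduce (a # w))"
    using word_image_mult[of "[a]" "reduce w"] reduce_append_reduce(2)[of "[a]" w] by simp
  moreover have "el a = word_image S R [a]" using Cons.prems by (simp add: el_def)
  ultimately show ?case using Cons by simp
qed

lemma e_carrier: "w \<in> carrier F \<Longrightarrow> e w = word_image S R w"
  using e_word_image[of w] reduce_reduced[of w] by (simp add: free_group_def)

lemma e_relator: "r \<in> sym_relators R \<Longrightarrow> e r = \<one>\<^bsub>presented_group S R\<^esub>"
proof -
  assume "r \<in> sym_relators R"
  then obtain r0 k where r0: "r0 \<in> R" "r = rotate k r0 \<or> r = rotate k (winv r0)" unfolding sym_relators_iff by blast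
  have "r0 \<in> N" using r0 normal_normal_closure(2)[OF group_free_group R_F] by blast
  then have e0: "e r0 = \<one>\<^bsub>presented_group S R\<^esub>" using e_carrier[of r0] word_image_one_iff[of r0] R_F r0 by auto
  have "e (rotate k w) = \<one>\<^bsub>presented_group S R\<^esub>" if "e w = \<one>\<^bsub>presented_group S R\<^esub>" for k w
  proof (induction k)
    case (Suc k)
    then show ?case using inv_comm by (cases "rotate k w") auto
  qed (use that in simp)
  then show ?thesis using r0 e0 by (metis e_winv inv_one)
qed

sublocale scg_rel Q "presented_group S R" el S
proof
  fix r assume r: "r \<in> Q"
  then show "e r = \<one>\<^bsub>presented_group S R\<^esub>" using e_relator by (simp add: Q_def)
  show "fst ` set r \<subseteq> S" using sym_F[of r] r by (simp add: Q_def free_group_def)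
next
  fix w :: "'s word" assume w: "fst ` set w \<subseteq> S" "reduced w" "w \<noteq> []" "e w = \<one>\<^bsub>presented_group S R\<^esub>"
  then have "w \<in> N" using e_carrier[of w] word_image_one_iff[of w] by (simp add: free_group_def)
  then show "\<exists>r n. r \<in> Q \<and> sublist (take n r) w \<and> n \<le> length r \<and> 7 * length r < 8 * n"
    using Greendlinger kernel w by blast
qed

lemma carrier_e: "carrier (presented_group S R) = e ` carrier F"
  using e_carrier by (auto simp: presented_group_def carrier_FactGroup word_image_def)

end

section \<open>Graphs and their realizations\<close>

lemma relpow_sym: "sym T \<Longrightarrow> (x, y) \<in> T ^^ n \<Longrightarrow> (y, x) \<in> T ^^ n"
proof (induction n arbitrary: y)
  case (Suc n)
  then obtain z where "(x, z) \<in> T ^^ n" "(z, y) \<in> T" by auto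
  then have "(y, z) \<in> T ^^ 1" "(z, x) \<in> T ^^ n" using Suc by (auto dest: symD)
  then show ?case using relpow_add[of 1 n T] by auto
qed simp

locale sym_graph =
  fixes V :: "'v set" and T :: "('v \<times> 'v) set" and d :: "'v \<Rightarrow> 'v \<Rightarrow> nat"
  assumes T_sym: "sym T" and T_V: "T \<subseteq> V \<times> V"
    and conn: "x \<in> V \<Longrightarrow> y \<in> V \<Longrightarrow> (x, y) \<in> T\<^sup>*"
    and d_def: "d x y = (LEAST n. (x, y) \<in> T ^^ n)"
begin

lemma d_le: "(x, y) \<in> T ^^ n \<Longrightarrow> d x y \<le> n"
  unfolding d_def by (rule Least_le)

lemma d_mem: "x \<in> V \<Longrightarrow> y \<in> V \<Longrightarrow> (x, y) \<in> T ^^ d x y"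
  unfolding d_def by (rule LeastI_ex) (rule rtrancl_imp_relpow[OF conn])

sublocale dgeo V d
proof
  show self: "d x x = 0" for x using d_le[of x x 0] by simp
  show "x = y" if "x \<in> V" "y \<in> V" "d x y = 0" for x y using d_mem[of x y] that by simp
  have le: "d x y \<le> d y x" if "x \<in> V" "y \<in> V" for x y
    using d_le relpow_sym[OF T_sym d_mem] that by blast
  then show "d x y = d y x" if "x \<in> V" "y \<in> V" for x y using that by (simp add: le_antisym)
  show "d x z \<le> d x y + d y z" if "x \<in> V" "y \<in> V" "z \<in> V" for x y z
    using d_mem[of x y] d_mem[of y z] that by (intro d_le) (auto simp: relpow_add)
  show "\<exists>z\<in>V. d x z = n \<and> d z y = 1" if V: "x \<in> V" "y \<in> V" and n: "d x y = Suc n" for x y n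
  proof -
    obtain z where z: "(x, z) \<in> T ^^ n" "(z, y) \<in> T" using d_mem[OF V] n by auto
    have zV: "z \<in> V" using z T_V by auto
    have 1: "d x z \<le> n" "d z y \<le> 1" using z d_le[of x z n] d_le[of z y 1] by auto
    have "d x y \<le> d x z + d z y"
      using d_mem[OF V(1) zV] d_mem[OF zV V(2)] by (intro d_le) (auto simp: relpow_add)
    then show ?thesis using 1 n zV by (intro bexI[of _ z]) auto
  qed
qed

lemma d_le1_iff: "x \<in> V \<Longrightarrow> y \<in> V \<Longrightarrow> d x y \<le> 1 \<longleftrightarrow> x = y \<or> (x, y) \<in> T"
proof
  assume V: "x \<in> V" "y \<in> V" and "d x y \<le> 1"
  then consider "d x y = 0" | "d x y = 1" by linarith
  then show "x = y \<or> (x, y) \<in> T" using d_mem[OF V] by cases auto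
next
  assume "x \<in> V" "y \<in> V" "x = y \<or> (x, y) \<in> T"
  then show "d x y \<le> 1" using d_le[of x y 1] by auto
qed

end

fun near_vertex :: "('v, 'e) pre_digraph \<Rightarrow> ('v, 'e) gpoint \<Rightarrow> 'v" where
  "near_vertex \<Gamma> (Vertex v) = v"
| "near_vertex \<Gamma> (Inner e t) = tail \<Gamma> e"

locale conn_graph =
  fixes \<Gamma> :: "('v, 'e) pre_digraph"
  assumes ends: "e \<in> arcs \<Gamma> \<Longrightarrow> tail \<Gamma> e \<in> verts \<Gamma> \<and> head \<Gamma> e \<in> verts \<Gamma>"
    and connected: "x \<in> verts \<Gamma> \<Longrightarrow> y \<in> verts \<Gamma> \<Longrightarrow> (x, y) \<in> (arcs_ends \<Gamma> \<union> (arcs_ends \<Gamma>)\<inverse>)\<^sup>*"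
begin

sublocale sym_graph "verts \<Gamma>" "arcs_ends \<Gamma> \<union> (arcs_ends \<Gamma>)\<inverse>" "vertex_dist \<Gamma>"
proof
  show "sym (arcs_ends \<Gamma> \<union> (arcs_ends \<Gamma>)\<inverse>)" by (auto simp: sym_def)
  show "arcs_ends \<Gamma> \<union> (arcs_ends \<Gamma>)\<inverse> \<subseteq> verts \<Gamma> \<times> verts \<Gamma>"
    using ends by (auto simp: arcs_ends_def arc_to_ends_def)
qed (use connected in \<open>auto simp: vertex_dist_def\<close>)

abbreviation "\<pi> \<equiv> near_vertex \<Gamma>"

lemma graph_dist_vertex: "graph_dist \<Gamma> (Vertex u) (Vertex v) = vertex_dist \<Gamma> u v"
  by (simp add: graph_dist_def)

lemma near_vertex_verts: "p \<in> realization \<Gamma> \<Longrightarrow> \<pi> p \<in> verts \<Gamma>"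
  using ends by (auto simp: realization_def)

lemma exits_near:
  assumes "p \<in> realization \<Gamma>" "(u, a) \<in> exits \<Gamma> p"
  shows "u \<in> verts \<Gamma> \<and> vertex_dist \<Gamma> (\<pi> p) u \<le> 1 \<and> 0 \<le> a \<and> a \<le> 1"
proof (cases p)
  case (Inner e t)
  then have e: "e \<in> arcs \<Gamma>" "0 < t" "t < 1" using assms by (auto simp: realization_def)
  then have "(tail \<Gamma> e, head \<Gamma> e) \<in> arcs_ends \<Gamma>" by (auto simp: arcs_ends_def arc_to_ends_def)
  then have "vertex_dist \<Gamma> (tail \<Gamma> e) (head \<Gamma> e) \<le> 1" using d_le1_iff ends[OF e(1)] by blast
  then show ?thesis using Inner e ends[OF e(1)] assms by auto
qed (use assms in \<open>auto simp: realization_def\<close>)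

lemma exits_self: "p \<in> realization \<Gamma> \<Longrightarrow> \<exists>a\<le>1. (\<pi> p, a) \<in> exits \<Gamma> p"
  by (cases p) (auto simp: realization_def intro: less_imp_le)

text \<open>Rounding a point to the tail of its edge moves it by at most 1, and two points are
  rounded.\<close>

lemma graph_dist_near:
  assumes p: "p \<in> realization \<Gamma>" and q: "q \<in> realization \<Gamma>"
  shows "\<bar>graph_dist \<Gamma> p q - vertex_dist \<Gamma> (\<pi> p) (\<pi> q)\<bar> \<le> 2"
proof -
  define B where "B = {a + real (vertex_dist \<Gamma> u v) + b | u a v b. (u, a) \<in> exits \<Gamma> p \<and> (v, b) \<in> exits \<Gamma> q}"
  have B: "B = (\<lambda>((u, a), (v, b)). a + real (vertex_dist \<Gamma> u v) + b) ` (exits \<Gamma> p \<times> exits \<Gamma> q)"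
    by (force simp: B_def)
  have fe: "finite (exits \<Gamma> x)" for x by (cases x) auto
  have fd: "finite (direct_lengths p q)" by (cases p; cases q) auto
  have fin: "finite (direct_lengths p q \<union> B)" using fe fd by (simp add: B)
  obtain a where a: "a \<le> 1" "(\<pi> p, a) \<in> exits \<Gamma> p" using exits_self[OF p] by blast
  obtain b where b: "b \<le> 1" "(\<pi> q, b) \<in> exits \<Gamma> q" using exits_self[OF q] by blast
  have mem: "a + real (vertex_dist \<Gamma> (\<pi> p) (\<pi> q)) + b \<in> direct_lengths p q \<union> B" using a b by (auto simp: B_def)
  have up: "graph_dist \<Gamma> p q \<le> real (vertex_dist \<Gamma> (\<pi> p) (\<pi> q)) + 2"
    unfolding graph_dist_def using Min_le[OF fin mem] a b unfolding B_def by linarith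
  have V: "\<pi> p \<in> verts \<Gamma>" "\<pi> q \<in> verts \<Gamma>" using near_vertex_verts p q by auto
  have "real (vertex_dist \<Gamma> (\<pi> p) (\<pi> q)) \<le> z + 2" if z: "z \<in> direct_lengths p q \<union> B" for z
  proof (cases "z \<in> B")
    case True
    then obtain u a v b where uv: "(u, a) \<in> exits \<Gamma> p" "(v, b) \<in> exits \<Gamma> q" "z = a + real (vertex_dist \<Gamma> u v) + b"
      unfolding B_def by blast
    have 1: "u \<in> verts \<Gamma>" "vertex_dist \<Gamma> (\<pi> p) u \<le> 1" "0 \<le> a" "v \<in> verts \<Gamma>" "vertex_dist \<Gamma> v (\<pi> q) \<le> 1" "0 \<le> b"
      using exits_near[OF p uv(1)] exits_near[OF q uv(2)] d_sym[of v "\<pi> q"] V by auto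
    have "vertex_dist \<Gamma> (\<pi> p) (\<pi> q) \<le> vertex_dist \<Gamma> (\<pi> p) u + vertex_dist \<Gamma> u (\<pi> q)"
      "vertex_dist \<Gamma> u (\<pi> q) \<le> vertex_dist \<Gamma> u v + vertex_dist \<Gamma> v (\<pi> q)" using 1 V d_tri by auto
    then have "vertex_dist \<Gamma> (\<pi> p) (\<pi> q) \<le> 2 + vertex_dist \<Gamma> u v" using 1 by linarith
    then show ?thesis using uv(3) 1 by linarith
  next
    case False
    then have z: "z \<in> direct_lengths p q" using that by blast
    obtain e s where e: "p = Inner e s" using z by (cases p) auto
    obtain f t where f: "q = Inner f t" using z e by (cases q) auto
    show ?thesis using V z e f by (auto split: if_splits)
  qed
  then have "real (vertex_dist \<Gamma> (\<pi> p) (\<pi> q)) \<le> graph_dist \<Gamma> p q + 2"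
    unfolding graph_dist_def B_def[symmetric] using Min_in[OF fin] mem by blast
  then show ?thesis using up by linarith
qed

text \<open>A Gromov product is half a sum of three distances, each off by at most 2. So it changes
  by at most 3, once on either side of the inequality.\<close>

lemma hyperbolic_realization:
  assumes "delta_hyperbolic \<delta> (verts \<Gamma>) (\<lambda>x y. real (vertex_dist \<Gamma> x y))"
  shows "delta_hyperbolic (\<delta> + 6) (realization \<Gamma>) (graph_dist \<Gamma>)"
  unfolding delta_hyperbolic_def
proof (intro ballI)
  fix w x y z assume Z: "w \<in> realization \<Gamma>" "x \<in> realization \<Gamma>" "y \<in> realization \<Gamma>" "z \<in> realization \<Gamma>"
  let ?d = "\<lambda>x y. real (vertex_dist \<Gamma> x y)"
  have *: "\<bar>gromov_product (graph_dist \<Gamma>) w p q - gromov_product ?d (\<pi> w) (\<pi> p) (\<pi> q)\<bar> \<le> 3"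
    if "p \<in> realization \<Gamma>" "q \<in> realization \<Gamma>" for p q
    using graph_dist_near[OF that(1) Z(1)] graph_dist_near[OF that(2) Z(1)] graph_dist_near[OF that]
    unfolding gromov_product_def by argo
  have "min (gromov_product ?d (\<pi> w) (\<pi> x) (\<pi> y)) (gromov_product ?d (\<pi> w) (\<pi> y) (\<pi> z)) - \<delta>
      \<le> gromov_product ?d (\<pi> w) (\<pi> x) (\<pi> z)"
    using assms Z near_vertex_verts unfolding delta_hyperbolic_def by blast
  then show "min (gromov_product (graph_dist \<Gamma>) w x y) (gromov_product (graph_dist \<Gamma>) w y z) - (\<delta> + 6)
      \<le> gromov_product (graph_dist \<Gamma>) w x z"
    using *[OF Z(2,3)] *[OF Z(3,4)] *[OF Z(2,4)] by linarith
qed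

lemma hyperbolic_verts:
  assumes "delta_hyperbolic \<delta> (realization \<Gamma>) (graph_dist \<Gamma>)"
  shows "delta_hyperbolic \<delta> (verts \<Gamma>) (\<lambda>x y. real (vertex_dist \<Gamma> x y))"
proof -
  have "Vertex v \<in> realization \<Gamma>" if "v \<in> verts \<Gamma>" for v using that by (auto simp: realization_def)
  moreover have "gromov_product (\<lambda>x y. real (vertex_dist \<Gamma> x y)) w x y =
      gromov_product (graph_dist \<Gamma>) (Vertex w) (Vertex x) (Vertex y)" for w x y
    by (simp add: gromov_product_def graph_dist_vertex)
  ultimately show ?thesis using assms unfolding delta_hyperbolic_def by simp
qed

end

locale cayley = group G for G (structure) +
  fixes Y
  assumes gen: "generating_set G Y"
begin

lemma Y_closed: "Y \<subseteq> carrier G" using gen by (simp add: generating_set_def)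

abbreviation "CG \<equiv> cayley_graph G Y"

lemma arcs_ends_cayley: "arcs_ends CG = {(g, g \<otimes> y) | g y. g \<in> carrier G \<and> y \<in> Y}"
  by (force simp: arcs_ends_def arc_to_ends_def cayley_graph_def)

lemma cayley_conn:
  assumes "y \<in> carrier G"
  shows "\<forall>x\<in>carrier G. (x, x \<otimes> y) \<in> (arcs_ends CG \<union> (arcs_ends CG)\<inverse>)\<^sup>*"
proof -
  have "y \<in> generate G Y" using assms gen by (simp add: generating_set_def)
  then show ?thesis
  proof induction
    case (inv h)
    have "(x, x \<otimes> inv h) \<in> (arcs_ends CG)\<inverse>" if "x \<in> carrier G" for x
      using that inv Y_closed
      by (auto simp: arcs_ends_cayley m_assoc intro!: exI[of _ "x \<otimes> inv h"] exI[of _ h])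
    then show ?case by blast
  next
    case (eng h1 h2)
    have c: "h1 \<in> carrier G" "h2 \<in> carrier G" using eng.hyps generate_in_carrier[OF Y_closed] by auto
    show ?case
    proof
      fix x assume x: "x \<in> carrier G"
      have "(x, x \<otimes> h1) \<in> (arcs_ends CG \<union> (arcs_ends CG)\<inverse>)\<^sup>*" using eng x by blast
      moreover have "(x \<otimes> h1, x \<otimes> h1 \<otimes> h2) \<in> (arcs_ends CG \<union> (arcs_ends CG)\<inverse>)\<^sup>*" using eng x c by blast
      ultimately show "(x, x \<otimes> (h1 \<otimes> h2)) \<in> (arcs_ends CG \<union> (arcs_ends CG)\<inverse>)\<^sup>*"
        using x c by (simp add: m_assoc)
    qed
  qed (auto simp: arcs_ends_cayley)
qed

sublocale conn_graph CG
proof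
  fix x y assume "x \<in> verts CG" "y \<in> verts CG"
  then have xy: "x \<in> carrier G" "y \<in> carrier G" by (auto simp: cayley_graph_def)
  then have "x \<otimes> (inv x \<otimes> y) = y" by (simp add: m_assoc[symmetric])
  then show "(x, y) \<in> (arcs_ends CG \<union> (arcs_ends CG)\<inverse>)\<^sup>*"
    using cayley_conn[of "inv x \<otimes> y"] xy by (metis inv_closed m_closed)
qed (use Y_closed in \<open>auto simp: cayley_graph_def\<close>)

lemma verts_cayley [simp]: "verts CG = carrier G" by (simp add: cayley_graph_def)

lemma dist_le1_iff:
  assumes "g \<in> carrier G" "h \<in> carrier G"
  shows "vertex_dist CG g h \<le> 1 \<longleftrightarrow> g = h \<or> (\<exists>y\<in>Y. h = g \<otimes> y \<or> g = h \<otimes> y)"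
  using d_le1_iff[of g h] assms Y_closed by (auto simp: arcs_ends_cayley)

lemma dist_left:
  assumes "a \<in> carrier G" "g \<in> carrier G" "h \<in> carrier G"
  shows "vertex_dist CG (a \<otimes> g) (a \<otimes> h) = vertex_dist CG g h"
proof -
  let ?T = "arcs_ends CG \<union> (arcs_ends CG)\<inverse>"
  have T: "(a \<otimes> g, a \<otimes> h) \<in> ?T" if ag: "a \<in> carrier G" "(g, h) \<in> ?T" for a g h
  proof -
    obtain y where "y \<in> Y" "g \<in> carrier G" "h \<in> carrier G" "h = g \<otimes> y \<or> g = h \<otimes> y"
      using ag Y_closed by (auto simp: arcs_ends_cayley)
    then have "a \<otimes> h = (a \<otimes> g) \<otimes> y \<or> a \<otimes> g = (a \<otimes> h) \<otimes> y" "y \<in> Y" "a \<otimes> g \<in> carrier G" "a \<otimes> h \<in> carrier G"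
      using ag(1) Y_closed by (auto simp: m_assoc)
    then show ?thesis unfolding arcs_ends_cayley by blast
  qed
  have Tn: "(a \<otimes> g, a \<otimes> h) \<in> ?T ^^ n" if "a \<in> carrier G" "(g, h) \<in> ?T ^^ n" for a g h n
    using that(2)
  proof (induction n arbitrary: h)
    case (Suc n)
    then show ?case using T[OF that(1)] by (metis relpow_Suc_E relpow_Suc_I)
  qed simp
  have le: "vertex_dist CG (a \<otimes> g) (a \<otimes> h) \<le> vertex_dist CG g h"
    if "a \<in> carrier G" "g \<in> carrier G" "h \<in> carrier G" for a g h
    using Tn[OF that(1) d_mem[of g h]] that by (intro d_le) simp
  have "inv a \<otimes> (a \<otimes> g) = g" "inv a \<otimes> (a \<otimes> h) = h" using assms by (simp_all add: m_assoc[symmetric])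
  then have "vertex_dist CG g h \<le> vertex_dist CG (a \<otimes> g) (a \<otimes> h)"
    using le[of "inv a" "a \<otimes> g" "a \<otimes> h"] assms by simp
  then show ?thesis using le[OF assms] by simp
qed

lemma near_vertex_action:
  "p \<in> realization CG \<Longrightarrow> near_vertex CG (cayley_action G g p) = g \<otimes> near_vertex CG p"
  by (cases p) (auto simp: cayley_graph_def)

lemma action_realization:
  "p \<in> realization CG \<Longrightarrow> g \<in> carrier G \<Longrightarrow> cayley_action G g p \<in> realization CG"
  by (cases p) (auto simp: realization_def cayley_graph_def)

lemma acylindrical_vertices:
  assumes "\<And>\<epsilon>::nat. \<exists>M N::nat. \<forall>x\<in>carrier G. \<forall>y\<in>carrier G. M \<le> vertex_dist CG x y \<longrightarrow>
      finite {g \<in> carrier G. vertex_dist CG x (g \<otimes> x) \<le> \<epsilon> \<and> vertex_dist CG y (g \<otimes> y) \<le> \<epsilon>} \<and>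
      card {g \<in> carrier G. vertex_dist CG x (g \<otimes> x) \<le> \<epsilon> \<and> vertex_dist CG y (g \<otimes> y) \<le> \<epsilon>} \<le> N"
  shows "acylindrical_cayley G Y"
  unfolding acylindrical_cayley_def acylindrical_def
proof (intro allI impI)
  fix \<epsilon> :: real assume "0 < \<epsilon>"
  define k where "k = nat \<lceil>\<epsilon> + 2\<rceil>"
  define A where "A x y = {g \<in> carrier G. vertex_dist CG x (g \<otimes> x) \<le> k \<and> vertex_dist CG y (g \<otimes> y) \<le> k}" for x y
  define B where "B x y = {g \<in> carrier G. graph_dist CG x (cayley_action G g x) \<le> \<epsilon> \<and>
      graph_dist CG y (cayley_action G g y) \<le> \<epsilon>}" for x y
  obtain M N where MN: "\<And>x y. x \<in> carrier G \<Longrightarrow> y \<in> carrier G \<Longrightarrow> M \<le> vertex_dist CG x y \<Longrightarrow>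
      finite (A x y) \<and> card (A x y) \<le> N"
    using assms[of k] unfolding A_def by blast
  have "finite (B x y) \<and> card (B x y) \<le> N"
    if xy: "x \<in> realization CG" "y \<in> realization CG" and M: "real M + 2 \<le> graph_dist CG x y" for x y
  proof -
    have V: "\<pi> x \<in> carrier G" "\<pi> y \<in> carrier G" using near_vertex_verts xy by auto
    have "real M \<le> vertex_dist CG (\<pi> x) (\<pi> y)" using graph_dist_near[OF xy] M by linarith
    then have *: "finite (A (\<pi> x) (\<pi> y)) \<and> card (A (\<pi> x) (\<pi> y)) \<le> N" using MN V by simp
    have "vertex_dist CG (\<pi> p) (g \<otimes> \<pi> p) \<le> k" if "p \<in> realization CG" "g \<in> carrier G"
      "graph_dist CG p (cayley_action G g p) \<le> \<epsilon>" for p g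
      using graph_dist_near[OF that(1) action_realization[OF that(1,2)]] that
      unfolding k_def by (simp add: near_vertex_action) linarith
    then have "B x y \<subseteq> A (\<pi> x) (\<pi> y)" using xy by (auto simp: A_def B_def)
    then show ?thesis using * by (meson card_mono finite_subset le_trans)
  qed
  then show "\<exists>M\<ge>0. \<exists>N. \<forall>x\<in>realization CG. \<forall>y\<in>realization CG. M \<le> graph_dist CG x y \<longrightarrow>
      finite {g \<in> carrier G. graph_dist CG x (cayley_action G g x) \<le> \<epsilon> \<and> graph_dist CG y (cayley_action G g y) \<le> \<epsilon>} \<and>
      card {g \<in> carrier G. graph_dist CG x (cayley_action G g x) \<le> \<epsilon> \<and> graph_dist CG y (cayley_action G g y) \<le> \<epsilon>} \<le> N"
    unfolding B_def by (intro exI[of _ "real M + 2"]) auto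
qed

end

section \<open>Hyperbolicity\<close>

context scg_rel
begin

text \<open>This makes relator cycles embed in the Cayley graph. A trivial prefix of at most half of
  \<open>r\<close> would contain more than 7/8 of some \<open>\<rho>\<close>: its length excludes a
  rotation of \<open>r\<close>, the cancellation hypothesis any other relator. A longer prefix is
  replaced by its complement.\<close>

lemma e_take_neq_one:
  assumes r: "r \<in> Q" and n: "0 < n" "n < length r"
  shows "e (take n r) \<noteq> \<one>"
proof -
  have half: "e (take n r) \<noteq> \<one>" if r: "r \<in> Q" and n: "0 < n" "2 * n \<le> length r" for r n
  proof
    assume e1: "e (take n r) = \<one>"
    have "reduced (take n r)" using red[OF r] reduced_append[of "take n r" "drop n r"] by simp
    moreover have "fst ` set (take n r) \<subseteq> S" using Q_S[OF r] set_take_subset[of n r] by blast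
    moreover have "take n r \<noteq> []" using n ne[OF r] by simp
    ultimately obtain \<rho> m where m: "\<rho> \<in> Q" "sublist (take m \<rho>) (take n r)" "m \<le> length \<rho>" "7 * length \<rho> < 8 * m"
      using GL e1 by blast
    obtain x y where xy: "take n r = x @ take m \<rho> @ y" using m(2) by (auto simp: sublist_def)
    define r' where "r' = take m \<rho> @ y @ drop n r @ x"
    have "r = x @ take m \<rho> @ y @ drop n r" using xy by (metis append_take_drop_id append_assoc)
    then have r': "r' \<in> Q" using rot_split[of x "take m \<rho> @ y @ drop n r"] r by (simp add: r'_def)
    have len: "length (take n r) = length x + m + length y" using arg_cong[OF xy, of length] m(3) by simp
    then have ml: "2 * m \<le> length r" using n by simp
    have "length r' = length r" unfolding r'_def using len n m(3) by simp
    show False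
    proof (cases "r' = \<rho>")
      case True
      then show False using ml m \<open>length r' = length r\<close> by simp
    next
      case False
      have "24 * m < length \<rho>"
        by (rule sc[OF m(1) r' False[symmetric] m(3)]) (use m(3) in \<open>auto simp: r'_def\<close>)
      then show False using m by simp
    qed
  qed
  show ?thesis
  proof (cases "2 * n \<le> length r")
    case True
    then show ?thesis using half r n by blast
  next
    case False
    then show ?thesis
      using half[of "winv r" "length r - n"] winv_mem[OF r] n e_take_compl[OF r, of n] by simp
  qed
qed

lemma e_take_inj:
  assumes r: "r \<in> Q" and ij: "i < length r" "j < length r" and eq: "e (take i r) = e (take j r)"
  shows "i = j"
proof -
  have *: "\<not> i < j" if ij: "i < j" "j < length r" and eq: "e (take i r) = e (take j r)" for i j
  proof
    have "take j r = take i r @ take (j - i) (drop i r)" using ij by (metis add_diff_inverse_nat less_imp_not_less take_add)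
    then have "e (take (j - i) (drop i r)) = \<one>" using eq by simp
    moreover have "take (j - i) (drop i r @ take i r) = take (j - i) (drop i r)" using ij by simp
    ultimately have "e (take (j - i) (drop i r @ take i r)) = \<one>" by (simp only:)
    moreover have "0 < j - i" "j - i < length (drop i r @ take i r)" using ij by auto
    ultimately show False using e_take_neq_one[OF rot_take[OF r, of i], of "j - i"] by blast
  qed
  show ?thesis using *[of i j] *[of j i] assms by (metis linorder_neqE_nat)
qed

end

lemma dirty_le: "dirty us \<le> length us"
  by (induction us rule: dirty.induct) auto

section \<open>Cone graphs and their chords in the Cayley graph\<close>

lemma subpath_append: "subpath r j (x @ y) k \<longleftrightarrow> (\<exists>l. subpath r j x l \<and> subpath r l y k)"
proof (induction x arbitrary: j)
  case Nil
  show ?case by (cases y) (auto simp: cycle_step_def)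
qed auto

lemma subpath_verts: "subpath r j x k \<Longrightarrow> j < length r \<and> k < length r"
  by (induction x arbitrary: j) (auto simp: cycle_step_def)

lemma subpath_forward:
  assumes "j < length r" "m \<le> length r"
  shows "subpath r j (take m (rotate j r)) ((j + m) mod length r)"
  using assms(2)
proof (induction m)
  case (Suc m)
  have "take (Suc m) (rotate j r) = take m (rotate j r) @ [r ! ((j + m) mod length r)]"
    using Suc.prems by (simp add: take_Suc_conv_app_nth nth_rotate add.commute)
  moreover have "(j + m) mod length r < length r" using assms(1) by (intro mod_less_divisor) linarith
  moreover have "(j + Suc m) mod length r = Suc ((j + m) mod length r) mod length r" by (simp add: mod_Suc_eq)
  moreover have "(j + Suc m) mod length r < length r" using assms(1) by (intro mod_less_divisor) linarith
  ultimately show ?case using Suc by (auto simp: subpath_append cycle_step_def)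
qed (use assms in simp)

lemma cone_conn_graph: "conn_graph (cone_graph X r)"
proof
  fix a assume "a \<in> arcs (cone_graph X r)"
  then show "tail (cone_graph X r) a \<in> verts (cone_graph X r) \<and> head (cone_graph X r) a \<in> verts (cone_graph X r)"
    by (auto simp: cone_graph_def dest: subpath_verts intro!: mod_less_divisor)
next
  let ?T = "arcs_ends (cone_graph X r) \<union> (arcs_ends (cone_graph X r))\<inverse>"
  have step: "(j, Suc j) \<in> arcs_ends (cone_graph X r)" if "Suc j < length r" for j
    using that by (auto simp: arcs_ends_def arc_to_ends_def cone_graph_def image_Un image_image intro!: image_eqI[of _ _ j])
  have fwd: "(0, j) \<in> (arcs_ends (cone_graph X r))\<^sup>*" if "j < length r" for j
    using that
  proof (induction j)
    case (Suc j)
    then show ?case using step[of j] by (simp add: rtrancl.rtrancl_into_rtrancl)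
  qed simp
  then have bwd: "(j, 0) \<in> ((arcs_ends (cone_graph X r))\<inverse>)\<^sup>*" if "j < length r" for j
    using that by (simp add: rtrancl_converse)
  fix x y assume "x \<in> verts (cone_graph X r)" "y \<in> verts (cone_graph X r)"
  then have xy: "x < length r" "y < length r" by (auto simp: cone_graph_def)
  have "(x, 0) \<in> ?T\<^sup>*" "(0, y) \<in> ?T\<^sup>*"
    using bwd[OF xy(1)] fwd[OF xy(2)] by (meson rtrancl_mono sup_ge1 sup_ge2 subsetD)+
  then show "(x, y) \<in> ?T\<^sup>*" by simp
qed

lemma cone_verts [simp]: "verts (cone_graph X r) = {..<length r}"
  by (simp add: cone_graph_def)

locale cones = scg_rel Q G el S + cayley G Y
  for Q :: "'s word set" and G (structure) and el :: "'s \<times> bool \<Rightarrow> 'g" and S Y +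
  fixes X :: "'s word set"
  assumes Y: "Y = e ` X"
    and X_prefix: "x \<in> X \<Longrightarrow> x = [] \<or> (\<exists>r\<in>Q. prefix x r)"
    and X_piece: "r \<in> Q \<Longrightarrow> r' \<in> Q \<Longrightarrow> r \<noteq> r' \<Longrightarrow> prefix u r \<Longrightarrow> prefix u r' \<Longrightarrow> u \<in> X"
    and X_letter: "fst a \<in> S \<Longrightarrow> [a] \<in> X \<union> winv ` X"
begin

definition "Xs = X \<union> winv ` X"

lemma Xs_winv: "x \<in> Xs \<Longrightarrow> winv x \<in> Xs"
  by (auto simp: Xs_def)

definition chord :: "('g \<times> 's word) set \<Rightarrow> 'g \<Rightarrow> 'g \<Rightarrow> bool" where
  "chord c p q \<longleftrightarrow> p = q \<or> p \<in> carrier G \<and> (\<exists>\<rho>\<in>Q. \<exists>x\<in>Xs. cyc p \<rho> = c \<and> prefix x \<rho> \<and> q = p \<otimes> e x)"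

lemma chord_sym:
  assumes "chord c p q" shows "chord c q p"
proof (cases "p = q")
  case False
  then obtain \<rho> x where x: "p \<in> carrier G" "\<rho> \<in> Q" "x \<in> Xs" "cyc p \<rho> = c" "prefix x \<rho>" "q = p \<otimes> e x"
    using assms by (auto simp: chord_def)
  obtain y where y: "\<rho> = x @ y" using x by (auto simp: prefix_def)
  have "cyc q (winv (y @ x)) = c" using cyc_split[of p x y] cyc_winv[of q "y @ x"] x y by simp
  moreover have "winv (y @ x) \<in> Q" using rot_split winv_mem x y by simp
  moreover have "prefix (winv x) (winv (y @ x))" by (simp add: winv_append)
  moreover have "q \<in> carrier G" "p = q \<otimes> e (winv x)" using x by (simp_all add: m_assoc)
  ultimately show ?thesis unfolding chord_def using x Xs_winv[OF x(3)] by blast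
qed (simp add: chord_def)

abbreviation "dX \<equiv> vertex_dist CG"

lemma dX_le1_iff:
  assumes "p \<in> carrier G" "q \<in> carrier G"
  shows "dX p q \<le> 1 \<longleftrightarrow> p = q \<or> (\<exists>x\<in>Xs. q = p \<otimes> e x)"
proof -
  have "(\<exists>x\<in>X. q = p \<otimes> e x \<or> p = q \<otimes> e x) \<longleftrightarrow> (\<exists>x\<in>Xs. q = p \<otimes> e x)"
  proof
    assume "\<exists>x\<in>X. q = p \<otimes> e x \<or> p = q \<otimes> e x"
    then obtain x where x: "x \<in> X" "q = p \<otimes> e x \<or> p = q \<otimes> e x" by blast
    show "\<exists>x\<in>Xs. q = p \<otimes> e x"
    proof (cases "q = p \<otimes> e x")
      case False
      then have "q = p \<otimes> e (winv x)" using x assms by (simp add: m_assoc)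
      then show ?thesis using x(1) unfolding Xs_def by blast
    qed (use x in \<open>auto simp: Xs_def\<close>)
  next
    assume "\<exists>x\<in>Xs. q = p \<otimes> e x"
    then obtain x where x: "x \<in> X" "q = p \<otimes> e x \<or> q = p \<otimes> inv (e x)" by (auto simp: Xs_def)
    moreover have "p = q \<otimes> e x" if "q = p \<otimes> inv (e x)" using that assms by (simp add: m_assoc)
    ultimately show "\<exists>x\<in>X. q = p \<otimes> e x \<or> p = q \<otimes> e x" by blast
  qed
  then show ?thesis using dist_le1_iff[OF assms] by (auto simp: Y)
qed

lemma Xs_prefix: "x \<in> Xs \<Longrightarrow> x = [] \<or> (\<exists>r\<in>Q. prefix x r)"
proof -
  have "\<exists>r\<in>Q. prefix (winv x) r" if xr: "r \<in> Q" "prefix x r" for x r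
  proof -
    obtain y where "r = x @ y" using xr by (auto simp: prefix_def)
    then have "winv x @ winv y \<in> Q" using xr winv_mem rot_split winv_append by metis
    then show ?thesis by (rule bexI[rotated]) simp
  qed
  then show "x \<in> Xs \<Longrightarrow> x = [] \<or> (\<exists>r\<in>Q. prefix x r)"
    using X_prefix unfolding Xs_def by (metis (no_types, lifting) Un_iff image_iff winv_Nil)
qed

text \<open>A generator labels a part of some relator cycle, so its ends are also joined by an arc
  of that cycle. The arc and the generator agree in the group but may be different words.\<close>

lemma edge_arc:
  assumes "p \<in> carrier G" "q \<in> carrier G" "dX p q \<le> 1" "p \<noteq> q"
  obtains u r where "r \<in> Q" "u = take (length u) r" "2 * length u \<le> length r" "q = p \<otimes> e u" "chord (cyc p r) p q"
proof -
  obtain x where x: "x \<in> Xs" "q = p \<otimes> e x" using dX_le1_iff assms by blast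
  then have "x \<noteq> []" using assms by auto
  then obtain \<rho> where \<rho>: "\<rho> \<in> Q" "prefix x \<rho>" using Xs_prefix x by blast
  then obtain y where y: "\<rho> = x @ y" by (auto simp: prefix_def)
  have "cyc p \<rho> = cyc q (y @ x)" using cyc_split[of p x y] x assms y by simp
  then obtain u r where "r \<in> Q" "u = take (length u) r" "2 * length u \<le> length r" "q = p \<otimes> e u" "cyc p r = cyc p \<rho>"
    using short_arc[OF assms(1,2) \<rho>(1)] by metis
  moreover have "chord (cyc p \<rho>) p q" using x \<rho> assms by (auto simp: chord_def)
  ultimately show thesis using that by metis
qed

lemma filling_chord:
  assumes "\<And>c p q. \<omega> c p q = - \<omega> c q p"
    and "\<And>r r' p u. r \<in> Q \<Longrightarrow> r' \<in> Q \<Longrightarrow> p \<in> carrier G \<Longrightarrow> cyc p r \<noteq> cyc p r' \<Longrightarrow> u \<in> Xs \<Longrightarrow>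
      prefix u r \<Longrightarrow> prefix u r' \<Longrightarrow> \<omega> (cyc p r) p (p \<otimes> e u) = \<omega> (cyc p r') p (p \<otimes> e u)"
    and "\<And>p r t l. p \<in> carrier G \<Longrightarrow> r \<in> Q \<Longrightarrow> seq \<omega> chord (cyc p r) p p t l \<Longrightarrow> \<bar>t\<bar> \<le> K * real l"
    and "0 \<le> K"
  shows "filling Q G el S \<omega> chord K"
proof
  show "chord c q p" if "chord c p q" for c p q using chord_sym[OF that] .
  show "\<omega> c p q = - \<omega> c q p" for c p q by (rule assms(1))
  show "\<bar>t\<bar> \<le> K * real l" if "p \<in> carrier G" "r \<in> Q" "seq \<omega> chord (cyc p r) p p t l" for p r t l
    by (rule assms(3)) fact+
  show "0 \<le> K" by fact
next
  fix r1 r2 p u assume a: "r1 \<in> Q" "r2 \<in> Q" "p \<in> carrier G" "cyc p r1 \<noteq> cyc p r2" "prefix u r1" "prefix u r2"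
  then have "u \<in> Xs" using X_piece[of r1 r2 u] by (auto simp: Xs_def)
  then have "chord (cyc p r1) p (p \<otimes> e u)" "chord (cyc p r2) p (p \<otimes> e u)"
    unfolding chord_def using a by blast+
  moreover have "\<omega> (cyc p r1) p (p \<otimes> e u) = \<omega> (cyc p r2) p (p \<otimes> e u)"
    by (rule assms(2)) fact+
  ultimately show "chord (cyc p r1) p (p \<otimes> e u) \<and> chord (cyc p r2) p (p \<otimes> e u) \<and>
      \<omega> (cyc p r1) p (p \<otimes> e u) = \<omega> (cyc p r2) p (p \<otimes> e u)" by blast
qed

text \<open>Each edge of a walk becomes a record with one step. For \<open>n\<close> records the
  steps number \<open>n\<close> and the potential is at most \<open>8 * n + 2 * n\<close>, hence
  11.\<close>

lemma isoperimetric_cayley: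
  assumes cells: "\<forall>\<omega>. (\<forall>u v. \<omega> u v = - \<omega> v u) \<longrightarrow>
      (\<forall>x t n. wk \<omega> (\<lambda>_. True) x x t n \<longrightarrow> n \<le> b \<longrightarrow> \<bar>t\<bar> \<le> 1) \<longrightarrow>
      (\<forall>p\<in>carrier G. \<forall>r\<in>Q. \<forall>t l. seq (\<lambda>_. \<omega>) chord (cyc p r) p p t l \<longrightarrow> \<bar>t\<bar> \<le> real l)"
  shows "isoperimetric b 11"
  unfolding isoperimetric_def
proof (intro allI impI)
  fix \<omega> :: "'g \<Rightarrow> 'g \<Rightarrow> real" and x t n
  assume anti: "\<forall>u v. \<omega> u v = - \<omega> v u" and
    short: "\<forall>x t n. wk \<omega> (\<lambda>_. True) x x t n \<longrightarrow> n \<le> b \<longrightarrow> \<bar>t\<bar> \<le> 1" and w: "wk \<omega> (\<lambda>_. True) x x t n"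
  have c: "\<forall>p\<in>carrier G. \<forall>r\<in>Q. \<forall>t l. seq (\<lambda>_. \<omega>) chord (cyc p r) p p t l \<longrightarrow> \<bar>t\<bar> \<le> real l"
    using cells anti short by blast
  interpret fl: filling Q G el S "\<lambda>_. \<omega>" chord 1
  proof (rule filling_chord)
    show "\<omega> p q = - \<omega> q p" for p q using anti by blast
    show "\<bar>t\<bar> \<le> 1 * real l" if "p \<in> carrier G" "r \<in> Q" "seq (\<lambda>_. \<omega>) chord (cyc p r) p p t l" for p r t l
      using c that by simp
  qed simp_all
  have "\<exists>xs. fl.valid x xs \<and> y = x \<otimes> e (label xs) \<and> sum_list (map fl.val xs) = t \<and>
      sum_list (map fl.len xs) = length xs \<and> length xs \<le> n \<and> x \<in> carrier G \<and> y \<in> carrier G" if "wk \<omega> (\<lambda>_. True) x y t n" for y t n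
    using that
  proof (induction rule: walk.induct)
    case refl
    then show ?case by (intro exI[of _ "[]"]) auto
  next
    case (step y t n z)
    then obtain xs where xs: "fl.valid x xs" "y = x \<otimes> e (label xs)" "sum_list (map fl.val xs) = t"
      "sum_list (map fl.len xs) = length xs" "length xs \<le> n" "x \<in> carrier G" "y \<in> carrier G" by blast
    have z: "z \<in> carrier G" "dX y z \<le> 1" using step(2) unfolding adj_def by auto
    show ?case
    proof (cases "y = z")
      case True
      have "\<omega> y z = 0" using anti True by (metis add.inverse_neutral equal_neg_zero)
      then show ?thesis using xs True by (intro exI[of _ xs]) auto
    next
      case False
      then obtain u r where u: "r \<in> Q" "u = take (length u) r" "2 * length u \<le> length r" "z = y \<otimes> e u" "chord (cyc y r) y z"
        using edge_arc xs(7) z by metis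
      have "seq (\<lambda>_. \<omega>) chord (cyc y r) y (y \<otimes> e u) (\<omega> y z) 1" using seq_single[of chord "cyc y r" y z "\<lambda>_. \<omega>"] u by simp
      then have "fl.valid y [(u, r, \<omega> y z, 1)]" using u by (simp add: arc_def)
      then show ?thesis using xs u by (intro exI[of _ "xs @ [(u, r, \<omega> y z, 1)]"]) (auto simp: fl.valid_append m_assoc)
    qed
  qed
  then obtain xs where xs: "fl.valid x xs" "x = x \<otimes> e (label xs)" "sum_list (map fl.val xs) = t"
      "sum_list (map fl.len xs) = length xs" "length xs \<le> n" "x \<in> carrier G" using w by blast
  have "e (label xs) = \<one>" using xs(2,6) by simp
  then have "\<bar>t\<bar> \<le> real (length xs) + real (fl.potential xs)" using fl.filling[OF xs(6,1)] xs(3,4) by simp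
  moreover have "fl.potential xs \<le> 10 * length xs"
    unfolding fl.potential_def using dirty_le[of "map fst xs"] by simp
  ultimately show "\<bar>t\<bar> \<le> 11 * real n" using xs(5) by linarith
qed

end

section \<open>Cones of the presentation\<close>

locale cone_pres = small_pres S R for S :: "'s set" and R +
  fixes X :: "'s word set" and \<delta> :: real
  assumes X_ge: "basis_words S \<union> four_pieces S R \<subseteq> X" and X_le: "X \<subseteq> rel_prefixes S R"
    and cone_hyp: "r \<in> R \<Longrightarrow> delta_hyperbolic \<delta> (realization (cone_graph X r)) (graph_dist (cone_graph X r))"
begin

abbreviation "G \<equiv> presented_group S R"

lemma rel_prefixes_iff: "x \<in> rel_prefixes S R \<longleftrightarrow> x \<in> basis_words S \<or> (\<exists>r\<in>sym_relators R. prefix x r)"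
  unfolding rel_prefixes_def using initial_subword_iff[OF sym_F] by blast

lemma letter_prefix:
  assumes "fst a \<in> S" shows "\<exists>r\<in>Q. prefix [a] r"
proof -
  obtain r where r: "r \<in> Q" "a \<in> set r" using letters assms by blast
  then obtain u v where "r = u @ a # v" by (meson split_list)
  then have "(a # v) @ u \<in> Q" using rot_split[of u "a # v"] r by simp
  then show ?thesis by (rule bexI[rotated]) simp
qed

lemma X_prefix: "x \<in> X \<Longrightarrow> x = [] \<or> (\<exists>r\<in>Q. prefix x r)"
proof -
  assume "x \<in> X"
  then have "x \<in> rel_prefixes S R" using X_le by blast
  then consider s where "s \<in> S" "x = [(s, True)]" | r where "r \<in> sym_relators R" "prefix x r"
    unfolding rel_prefixes_iff basis_words_def by blast
  then show ?thesis
  proof cases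
    case 1
    then show ?thesis using letter_prefix[of "(s, True)"] by simp
  next
    case 2
    then show ?thesis by (cases "r = []") (auto simp: Q_def)
  qed
qed

lemma X_carrier: "x \<in> X \<Longrightarrow> x \<in> carrier F"
proof -
  assume "x \<in> X"
  then consider "x = []" | r where "r \<in> Q" "prefix x r" using X_prefix by blast
  then show ?thesis
  proof cases
    case 2
    then obtain y where y: "r = x @ y" by (auto simp: prefix_def)
    then show ?thesis using red[OF 2(1)] Q_S[OF 2(1)] by (auto simp: free_group_def reduced_append)
  qed (simp add: free_group_def)
qed

lemma image_X: "word_image S R ` X = e ` X"
  using e_carrier X_carrier by (auto intro!: image_cong)

lemma X_letter:
  assumes "fst a \<in> S" shows "[a] \<in> X \<union> winv ` X"
proof -
  obtain s b where a: "a = (s, b)" by force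
  have s: "[(s, True)] \<in> X" using X_ge assms a by (auto simp: basis_words_def)
  then have "winv [(s, True)] \<in> winv ` X" by blast
  then show ?thesis using s a by (cases b) (auto simp: winv_def)
qed

lemma piece_X:
  assumes "r \<in> Q" "r' \<in> Q" "r \<noteq> r'" "prefix u r" "prefix u r'"
  shows "u \<in> X"
proof -
  have p: "piece S R u" using piece_prefix assms by (auto simp: Q_def)
  obtain y where "r = u @ y" using assms by (auto simp: prefix_def)
  then have "reduce u = u" using red[OF assms(1)] reduce_reduced[of u] by (simp add: reduced_append)
  then have "u = foldr (\<otimes>\<^bsub>F\<^esub>) [u] \<one>\<^bsub>F\<^esub>" by (simp add: free_group_def)
  moreover have "u \<in> rel_prefixes S R" unfolding rel_prefixes_iff using assms by (auto simp: Q_def)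
  ultimately have "u \<in> four_pieces S R"
    unfolding four_pieces_def using p by (auto intro!: exI[of _ "[u]"])
  then show ?thesis using X_ge by blast
qed

lemma e_generate: "fst ` set w \<subseteq> S \<Longrightarrow> e w \<in> generate G (e ` X)"
proof (induction w)
  case (Cons a w)
  have "[a] \<in> X \<or> (\<exists>x\<in>X. [a] = winv x)" using X_letter[of a] Cons.prems by auto
  then have "e [a] \<in> generate G (e ` X)"
  proof (elim disjE bexE)
    fix x assume "x \<in> X" "[a] = winv x"
    then have "e [a] = inv\<^bsub>G\<^esub> (e x)" using e_winv by presburger
    then show ?thesis using \<open>x \<in> X\<close> by (simp add: generate.inv)
  qed (intro generate.incl imageI)
  then show ?case using Cons generate.eng[of "e [a]" G "e ` X" "e w"] by simp
qed (simp add: generate.one)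

lemma generating: "generating_set G (e ` X)"
proof -
  have "carrier G \<subseteq> generate G (e ` X)"
    unfolding carrier_e using e_generate by (auto simp: free_group_def)
  moreover have "e ` X \<subseteq> carrier G" by auto
  ultimately show ?thesis using generate_incl[of "e ` X"] by (auto simp: generating_set_def)
qed

sublocale cones Q G el S "e ` X" X
proof -
  interpret cayley G "e ` X" by unfold_locales (rule generating)
  show "cones Q G el S (e ` X) X"
    by unfold_locales (use X_prefix piece_X X_letter in auto)
qed

text \<open>The cones are hyperbolic by assumption for the elements of \<open>R\<close> only, so a
  cycle with arbitrary base point and direction has to be rewritten with some
  \<open>r0 \<in> R\<close>.\<close>

lemma base_cyc:
  assumes "p \<in> carrier G" "r \<in> Q"
  obtains r0 g j where "r0 \<in> R" "r0 \<in> Q" "g \<in> carrier G" "cyc p r = cyc g r0" "j < length r0" "p = g \<otimes>\<^bsub>G\<^esub> e (take j r0)"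
proof -
  have "r \<in> sym_relators R" using assms by (simp add: Q_def)
  then obtain r0 k where r0: "r0 \<in> R" "r = rotate k r0 \<or> r = rotate k (winv r0)"
    unfolding sym_relators_iff by blast
  have nz: "r0 \<noteq> []" using r0 ne[OF assms(2)] by auto
  then have r0Q: "r0 \<in> Q" using r0 R_sym by (auto simp: Q_def)
  have *: "\<exists>i. w = drop i r @ take i r" if w: "r = rotate k w" for w
  proof (intro exI)
    let ?m = "k mod length w"
    have "r = drop ?m w @ take ?m w" using w by (simp add: rotate_drop_take)
    then show "w = drop (length w - ?m) r @ take (length w - ?m) r" by simp
  qed
  have "\<exists>i w. w = drop i r @ take i r \<and> (r0 = w \<or> r0 = winv w)" using r0(2)
  proof
    assume "r = rotate k (winv r0)"
    then show ?thesis using *[of "winv r0"] by (metis winv_winv)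
  qed (use * in blast)
  then obtain i w where w: "w = drop i r @ take i r" "r0 = w \<or> r0 = winv w" by blast
  define g where "g = p \<otimes>\<^bsub>G\<^esub> e (take i r)"
  have g: "g \<in> carrier G" using assms by (simp add: g_def)
  have "cyc g w = cyc p r" using cyc_take[OF assms(1)] w by (simp add: g_def)
  then have c: "cyc p r = cyc g r0" using w cyc_winv[OF g] by auto
  then have "same g r0 p r" using cyc_eq_iff[OF g assms(1), THEN iffD1, OF sym] by blast
  then obtain j where "j < length r0" "p = g \<otimes>\<^bsub>G\<^esub> e (take j r0)" using same_normal g r0Q by blast
  then show thesis using that r0 r0Q g c by blast
qed

lemma pos_mod:
  assumes "r \<in> Q" "j < length r" "m \<le> length r"
  shows "e (take ((j + m) mod length r) r) = e (take j r) \<otimes>\<^bsub>G\<^esub> e (take m (rotate j r))"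
proof -
  have rj: "rotate j r = drop j r @ take j r" using assms by (simp add: rotate_drop_take)
  show ?thesis
  proof (cases "j + m < length r")
    case True
    then have "take (j + m) r = take j r @ take m (rotate j r)" using rj by (simp add: take_add)
    then show ?thesis using True by simp
  next
    case False
    then have m: "(j + m) mod length r = j + m - length r" using le_mod_geq[of "length r" "j + m"] assms by simp
    have "take m (drop j r) = drop j r" "m - (length r - j) = j + m - length r" "min (j + m - length r) j = j + m - length r"
      using False assms by auto
    then have "take m (rotate j r) = drop j r @ take (j + m - length r) r"
      unfolding rj take_append length_drop by (simp only: take_take)
    then have "e (take j r) \<otimes>\<^bsub>G\<^esub> e (take m (rotate j r)) = e (take j r @ drop j r) \<otimes>\<^bsub>G\<^esub> e (take (j + m - length r) r)"
      by (simp only: e_append) (simp add: m_assoc)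
    then show ?thesis using m e_rel[OF assms(1)] by (simp only: append_take_drop_id) simp
  qed
qed

lemma pos_step:
  assumes "r \<in> Q" "cycle_step r j a k"
  shows "e (take k r) = e (take j r) \<otimes>\<^bsub>G\<^esub> el a"
proof -
  have *: "e (take (Suc j mod length r) r) = e (take j r) \<otimes>\<^bsub>G\<^esub> el (r ! j)" if "j < length r" for j
  proof -
    have "0 < length r" using that by linarith
    then have "1 \<le> length r" "rotate j r ! 0 = r ! j" "rotate j r \<noteq> []" using nth_rotate[of 0 r j] that by auto
    then have "take 1 (rotate j r) = [r ! j]" by (cases "rotate j r") auto
    then show ?thesis using pos_mod[OF assms(1) that, of 1] that by simp
  qed
  from assms(2) consider "j < length r" "k = Suc j mod length r" "a = r ! j"
    | "k < length r" "j = Suc k mod length r" "a = linv (r ! k)" by (auto simp: cycle_step_def)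
  then show ?thesis
  proof cases
    case 2
    then have "e (take j r) = e (take k r) \<otimes>\<^bsub>G\<^esub> el (r ! k)" using * by blast
    then show ?thesis using 2 by (simp add: el_linv m_assoc)
  qed (use * in blast)
qed

lemma pos_subpath: "r \<in> Q \<Longrightarrow> subpath r j x k \<Longrightarrow> e (take k r) = e (take j r) \<otimes>\<^bsub>G\<^esub> e x"
proof (induction x arbitrary: j)
  case (Cons a x)
  then obtain l where l: "cycle_step r j a l" "subpath r l x k" by auto
  then show ?case using Cons.IH[OF Cons.prems(1) l(2)] pos_step[OF Cons.prems(1) l(1)] by (simp add: m_assoc)
qed simp

context
  fixes r g assumes r: "r \<in> Q" and g: "g \<in> carrier G"
begin

interpretation cn: conn_graph "cone_graph X r" by (rule cone_conn_graph)

definition "pos j = g \<otimes>\<^bsub>G\<^esub> e (take j r)"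

lemma pos_closed: "pos j \<in> carrier G" using g by (simp add: pos_def)

lemma cone_adj_dX: "cn.adj j k \<Longrightarrow> dX (pos j) (pos k) \<le> 1"
proof -
  assume a: "cn.adj j k"
  then have jk: "j < length r" "k < length r" "vertex_dist (cone_graph X r) j k \<le> 1" unfolding cn.adj_def by auto
  have *: "dX (pos j) (pos k) \<le> 1" if ar: "a \<in> arcs (cone_graph X r)"
    "j = tail (cone_graph X r) a" "k = head (cone_graph X r) a" for a j k
  proof -
    have "\<exists>x\<in>Xs. e (take k r) = e (take j r) \<otimes>\<^bsub>G\<^esub> e x"
    proof (cases a)
      case (Inl i)
      then have i: "i < length r" "j = i" "k = Suc i mod length r" using that by (auto simp: cone_graph_def)
      then have "Suc i mod length r < length r" by (intro mod_less_divisor) linarith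
      then have "cycle_step r j (r ! j) k" using i by (simp add: cycle_step_def)
      then have "e (take k r) = e (take j r) \<otimes>\<^bsub>G\<^esub> e [r ! j]" using pos_step[OF r] by simp
      moreover have "[r ! j] \<in> Xs" using X_letter[of "r ! j"] Q_S[OF r] i nth_mem[of i r] unfolding Xs_def by blast
      ultimately show ?thesis by blast
    next
      case (Inr b)
      then obtain x where "b = (j, x, k)" "x \<in> relator_subwords X r \<union> winv ` relator_subwords X r" "subpath r j x k"
        using ar by (auto simp: cone_graph_def)
      moreover then have "x \<in> Xs" by (auto simp: Xs_def relator_subwords_def)
      ultimately show ?thesis using pos_subpath[OF r] by blast
    qed
    then have "\<exists>x\<in>Xs. pos k = pos j \<otimes>\<^bsub>G\<^esub> e x" using g by (auto simp: pos_def m_assoc)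
    then show ?thesis using dX_le1_iff[OF pos_closed pos_closed] by blast
  qed
  have "j = k \<or> (j, k) \<in> arcs_ends (cone_graph X r) \<or> (k, j) \<in> arcs_ends (cone_graph X r)"
    using cn.d_le1_iff[of j k] jk by auto
  then show ?thesis
  proof (elim disjE)
    assume "j = k"
    then show ?thesis using dX_le1_iff[OF pos_closed pos_closed] by blast
  next
    assume "(j, k) \<in> arcs_ends (cone_graph X r)"
    then show ?thesis using * by (auto simp: arcs_ends_def arc_to_ends_def)
  next
    assume "(k, j) \<in> arcs_ends (cone_graph X r)"
    then have "dX (pos k) (pos j) \<le> 1" using * by (auto simp: arcs_ends_def arc_to_ends_def)
    then show ?thesis using d_sym[of "pos k" "pos j"] pos_closed by simp
  qed
qed

lemma pos_inj: "i < length r \<Longrightarrow> j < length r \<Longrightarrow> pos i = pos j \<Longrightarrow> i = j"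
  using e_take_inj[OF r] g by (simp add: pos_def)

lemma chord_forward:
  assumes "x \<in> Xs" "prefix x (rotate j r)" "j < length r"
  shows "\<exists>k<length r. pos k = pos j \<otimes>\<^bsub>G\<^esub> e x \<and> (j, k) \<in> arcs_ends (cone_graph X r)"
proof -
  define m where "m = length x"
  have m: "m \<le> length r" "take m (rotate j r) = x"
    using assms(2) prefix_length_le[OF assms(2)] by (auto simp: m_def prefix_def)
  let ?k = "(j + m) mod length r"
  have k: "?k < length r" using assms(3) by (intro mod_less_divisor) linarith
  have "x \<in> relator_subwords X r \<union> winv ` relator_subwords X r"
  proof (cases "x \<in> X")
    case True
    then show ?thesis using assms(2) by (auto simp: relator_subwords_def intro: prefix_imp_sublist)
  next
    case False
    then obtain x' where x': "x' \<in> X" "x = winv x'" using assms(1) by (auto simp: Xs_def)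
    obtain y where "rotate j r = winv x' @ y" using assms(2) x' by (auto simp: prefix_def)
    then have "winv (rotate j r) = winv y @ x'" by (simp add: winv_append)
    moreover obtain i where "winv (rotate j r) = rotate i (winv r)" using winv_rotate by blast
    ultimately have "sublist x' (rotate i (winv r))" by (metis sublist_append_leftI)
    then have "x' \<in> relator_subwords X r" using x' by (auto simp: relator_subwords_def)
    then show ?thesis using x' by blast
  qed
  moreover have "subpath r j x ?k" using subpath_forward[OF assms(3) m(1)] m(2) by simp
  ultimately have "Inr (j, x, ?k) \<in> arcs (cone_graph X r)" by (auto simp: cone_graph_def)
  then have "(j, ?k) \<in> arcs_ends (cone_graph X r)"
    unfolding arcs_ends_def by (rule rev_image_eqI) (simp add: arc_to_ends_def cone_graph_def)
  moreover have "pos ?k = pos j \<otimes>\<^bsub>G\<^esub> e x" using pos_mod[OF r assms(3) m(1)] m(2) g by (simp add: pos_def m_assoc)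
  ultimately show ?thesis using k by blast
qed

text \<open>The cycle embeds, so the starting point determines the index \<open>j\<close>, and the
  relator of the chord is the rotated \<open>r\<close> or its inverse. A backward chord is a forward
  chord from its other end.\<close>

lemma chord_pos:
  assumes "chord (cyc g r) (pos j) q" "j < length r"
  shows "\<exists>k<length r. q = pos k \<and> cn.adj j k"
proof (cases "q = pos j")
  case True
  then show ?thesis using assms(2) by (intro exI[of _ j]) (simp add: cn.adj_def[unfolded cone_verts])
next
  case False
  then obtain \<rho> x where x: "\<rho> \<in> Q" "x \<in> Xs" "cyc (pos j) \<rho> = cyc g r" "prefix x \<rho>" "q = pos j \<otimes>\<^bsub>G\<^esub> e x"
    using assms(1) by (auto simp: chord_def)
  have "same g r (pos j) \<rho>" using cyc_eq_iff[OF g pos_closed, THEN iffD1, OF x(3)[symmetric]] .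
  then obtain i where i: "i < length r" "pos j = g \<otimes>\<^bsub>G\<^esub> e (take i r)"
    "\<rho> = drop i r @ take i r \<or> \<rho> = winv (drop i r @ take i r)" using same_normal[OF _ g r] by blast
  then have "i = j" using pos_inj assms(2) by (simp add: pos_def)
  then have \<rho>: "\<rho> = rotate j r \<or> \<rho> = winv (rotate j r)" using i assms(2) by (simp add: rotate_drop_take)
  have "\<exists>k<length r. q = pos k \<and> ((j, k) \<in> arcs_ends (cone_graph X r) \<or> (k, j) \<in> arcs_ends (cone_graph X r))"
    using \<rho>
  proof
    assume "\<rho> = rotate j r"
    then show ?thesis using chord_forward[of x j] x assms(2) by auto
  next
    assume w: "\<rho> = winv (rotate j r)"
    obtain y where y: "\<rho> = x @ y" using x(4) by (auto simp: prefix_def)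
    have rj: "rotate j r = winv y @ winv x" using y w by (metis winv_append winv_winv)
    let ?k = "(j + length y) mod length r"
    have k: "?k < length r" using assms(2) by (intro mod_less_divisor) linarith
    have "length y \<le> length r" using arg_cong[OF rj, of length] by simp
    have "rotate ?k r = rotate (length y) (rotate j r)" by (simp add: rotate_rotate rotate_conv_mod[symmetric] add.commute)
    also have "\<dots> = winv x @ winv y" unfolding rj using rotate_append[of "winv y" "winv x"] by simp
    finally have "prefix (winv x) (rotate ?k r)" by simp
    then obtain l where l: "l < length r" "pos l = pos ?k \<otimes>\<^bsub>G\<^esub> e (winv x)" "(?k, l) \<in> arcs_ends (cone_graph X r)"
      using chord_forward[OF Xs_winv[OF x(2)] _ k] by blast
    have "pos ?k = pos j \<otimes>\<^bsub>G\<^esub> e (winv y)"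
      using pos_mod[OF r assms(2) \<open>length y \<le> length r\<close>] g rj by (simp add: pos_def m_assoc)
    moreover have "e x \<otimes>\<^bsub>G\<^esub> e y = \<one>\<^bsub>G\<^esub>" using e_rel[OF x(1)] y by simp
    then have "inv\<^bsub>G\<^esub> (e y) = e x" by (simp add: inv_equality)
    ultimately have q: "pos ?k = q" using x(5) by simp
    then have "pos l = pos j" using l(2) x(5) pos_closed[of j] by (simp add: m_assoc)
    then have "l = j" using pos_inj l(1) assms(2) by blast
    then show ?thesis using k q l(3) by blast
  qed
  then obtain k where "k < length r" "q = pos k" "vertex_dist (cone_graph X r) j k \<le> 1"
    using cn.d_le1_iff[of j] assms(2) by auto
  then show ?thesis unfolding cn.adj_def using assms(2) by auto
qed

text \<open>Lift the chords to a walk in the cone graph, which is closed because positions are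
  injective, and apply \<open>loop_bound\<close> to the cochain pulled back from the Cayley graph.
  Short loops of the cone map to short loops there.\<close>

lemma cell_loop:
  assumes k: "2 * \<delta>' < real k" and hyp: "delta_hyperbolic \<delta>' {..<length r} (\<lambda>i j. real (vertex_dist (cone_graph X r) i j))"
    and anti: "\<forall>u v. \<omega> u v = - \<omega> v u"
    and short: "\<forall>x t n. wk \<omega> (\<lambda>_. True) x x t n \<longrightarrow> n \<le> 4 * k \<longrightarrow> \<bar>t\<bar> \<le> 1"
    and s: "seq (\<lambda>_. \<omega>) chord (cyc g r) (pos j) (pos j) t l" and j: "j < length r"
  shows "\<bar>t\<bar> \<le> real l"
proof -
  let ?\<omega> = "\<lambda>i j. \<omega> (pos i) (pos j)"
  have lift: "seq (\<lambda>_. \<omega>) chord (cyc g r) (pos j) q t l \<Longrightarrow> \<exists>i<length r. q = pos i \<and> cn.wk ?\<omega> (\<lambda>_. True) j i t l" for q t l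
  proof (induction rule: seq.induct)
    case refl
    then show ?case using j by (intro exI[of _ j]) (auto intro: walk.refl)
  next
    case (step q t l q')
    then obtain i where i: "i < length r" "q = pos i" "cn.wk ?\<omega> (\<lambda>_. True) j i t l" by blast
    then obtain m where m: "m < length r" "q' = pos m" "cn.adj i m" using chord_pos step.hyps(2) by blast
    have "cn.wk ?\<omega> (\<lambda>_. True) j m (t + ?\<omega> i m) (Suc l)"
      by (rule walk.step[OF i(3) m(3)]) (use m in simp)
    then show ?case using m i by blast
  qed
  have down: "cn.wk ?\<omega> (\<lambda>_. True) i m t n \<Longrightarrow> wk \<omega> (\<lambda>_. True) (pos i) (pos m) t n" for i m t n
  proof (induction rule: walk.induct)
    case (step u t n v)
    have "adj (pos u) (pos v)" unfolding adj_def using cone_adj_dX[OF step.hyps(2)] pos_closed by simp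
    then show ?case using step by (intro walk.step) (auto simp: pos_closed)
  qed (auto intro: walk.refl simp: pos_closed)
  obtain i where i: "i < length r" "pos j = pos i" "cn.wk ?\<omega> (\<lambda>_. True) j i t l" using lift[OF s] by blast
  then have w: "cn.wk ?\<omega> (\<lambda>_. True) j j t l" using pos_inj[OF j i(1,2)] by simp
  show ?thesis
  proof (rule cn.loop_bound[OF _ k _ _ w])
    show "?\<omega> u v = - ?\<omega> v u" for u v using anti by blast
    show "\<bar>t\<bar> \<le> 1" if "cn.wk ?\<omega> (\<lambda>_. True) x x t n" "n \<le> 4 * k" for x t n
      using short down[OF that(1)] that(2) by blast
  qed (use hyp in simp)
qed

end

theorem hyperbolic_cone: "hyperbolic_cayley G (e ` X)"
proof -
  \<comment> \<open>One \<open>k\<close> serves all cones because \<open>\<delta>\<close> is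
    uniform; \<open>4 * k\<close> is the length of loops that \<open>loop_bound\<close> has to
    control.\<close>
  define k where "k = nat \<lceil>2 * \<delta>\<rceil> + 1"
  have k: "2 * \<delta> < real k" unfolding k_def by linarith
  have "isoperimetric (4 * k) 11"
  proof (rule isoperimetric_cayley, intro allI impI ballI)
    fix \<omega> p r t l
    assume anti: "\<forall>u v. \<omega> u v = - \<omega> v u" and short: "\<forall>x t n. wk \<omega> (\<lambda>_. True) x x t n \<longrightarrow> n \<le> 4 * k \<longrightarrow> \<bar>t\<bar> \<le> 1"
      and p: "p \<in> carrier G" and r: "r \<in> Q" and s: "seq (\<lambda>_. \<omega>) chord (cyc p r) p p t l"
    obtain r0 g j where *: "r0 \<in> R" "r0 \<in> Q" "g \<in> carrier G" "cyc p r = cyc g r0" "j < length r0"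
      "p = g \<otimes>\<^bsub>G\<^esub> e (take j r0)" using base_cyc[OF p r] by blast
    interpret cn: conn_graph "cone_graph X r0" by (rule cone_conn_graph)
    have pj: "p = pos r0 g j" using * by (simp add: pos_def)
    have "delta_hyperbolic \<delta> {..<length r0} (\<lambda>i j. real (vertex_dist (cone_graph X r0) i j))"
      using cn.hyperbolic_verts[OF cone_hyp[OF *(1)]] by simp
    then show "\<bar>t\<bar> \<le> real l"
      using cell_loop[OF *(2,3) k _ anti short _ *(5), of t l] s[unfolded *(4)] pj by blast
  qed
  then obtain d where "thin d" using isoperimetric_thin[of "4 * k" 11] by (auto simp: k_def)
  then have "delta_hyperbolic (3 * real d + 1) (verts CG) (\<lambda>x y. real (dX x y))" by (rule thin_delta_hyperbolic)
  then have "delta_hyperbolic (3 * real d + 1 + 6) (realization CG) (graph_dist CG)" by (rule hyperbolic_realization)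
  then show ?thesis unfolding hyperbolic_cayley_def hyperbolic_def
    by (intro exI[of _ "3 * real d + 1 + 6"]) auto
qed

end

section \<open>Tight words\<close>

context scg_rel
begin

definition arc_list :: "('s word \<times> 's word) list \<Rightarrow> bool" where
  "arc_list xs \<longleftrightarrow> (\<forall>(u, r)\<in>set xs. arc u r)"

lemma arc_list_simps [simp]: "arc_list []" "arc_list ((u, r) # xs) \<longleftrightarrow> arc u r \<and> arc_list xs" "arc_list (xs @ ys) \<longleftrightarrow> arc_list xs \<and> arc_list ys"
  by (auto simp: arc_list_def)

text \<open>The reversed arc. Rotating its relator first brings \<open>u\<close> to the end, so that
  inversion puts \<open>winv u\<close> in front.\<close>

definition inv_arc :: "'s word \<times> 's word \<Rightarrow> 's word \<times> 's word" where
  "inv_arc x = (winv (fst x), winv (drop (length (fst x)) (snd x) @ take (length (fst x)) (snd x)))"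

definition inv_arcs :: "('s word \<times> 's word) list \<Rightarrow> ('s word \<times> 's word) list" where
  "inv_arcs xs = rev (map inv_arc xs)"

lemma inv_arcs_simps [simp]: "inv_arcs [] = []" "inv_arcs (x # xs) = inv_arcs xs @ [inv_arc x]" "length (inv_arcs xs) = length xs"
  by (simp_all add: inv_arcs_def)

lemma arc_iarc: "arc u r \<Longrightarrow> arc (winv u) (winv (drop (length u) r @ take (length u) r))"
proof -
  assume a: "arc u r"
  then have "winv (drop (length u) r @ take (length u) r) \<in> Q" using rot_take winv_mem arc_Q by blast
  moreover have "take (length u) r = u" "2 * length u \<le> length r" using a by (simp_all add: arc_def)
  ultimately show ?thesis by (simp add: arc_def winv_append)
qed

lemma arc_list_inva [simp]: "arc_list xs \<Longrightarrow> arc_list (inv_arcs xs)"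
  by (induction xs) (auto simp: inv_arc_def arc_iarc)

lemma label_inva [simp]: "label (inv_arcs xs) = winv (label xs)"
  by (induction xs) (auto simp: inv_arc_def winv_append)

text \<open>Word length over the set of all arcs. In the locale \<open>arcgen\<close> the minimum
  exists for every element of the group.\<close>

definition arc_len :: "'g \<Rightarrow> nat" where
  "arc_len g = (LEAST k. \<exists>xs. arc_list xs \<and> length xs = k \<and> e (label xs) = g)"

lemma arc_len_le: "arc_list xs \<Longrightarrow> arc_len (e (label xs)) \<le> length xs"
  unfolding arc_len_def by (rule Least_le) blast

lemma arc_len_one [simp]: "arc_len \<one> = 0"
  using arc_len_le[of "[]"] by simp

lemma cyc_arc:
  assumes "p \<in> carrier G" "r \<in> Q" "c = cyc p r" "c = cyc (p \<otimes> g) r'" "g \<in> carrier G"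
  shows "\<exists>u r. arc u r \<and> g = e u \<and> cyc p r = c"
proof -
  obtain u r1 where u: "r1 \<in> Q" "u = take (length u) r1" "2 * length u \<le> length r1" "p \<otimes> g = p \<otimes> e u" "cyc p r1 = cyc p r"
    by (rule short_arc[of p "p \<otimes> g" r r']) (use assms in auto)
  then have "arc u r1" by (simp add: arc_def)
  moreover have "g = e u" using u(4) assms by simp
  ultimately show ?thesis using u(5) assms(3) by blast
qed

text \<open>Even if \<open>z\<close> is longer than half a relator its ends lie on one cycle, and
  the shorter way between them is an arc.\<close>

lemma arc_len_prefix:
  assumes "\<rho> \<in> Q" "prefix z \<rho>" shows "arc_len (e z) \<le> 1"
proof -
  obtain y where y: "\<rho> = z @ y" using assms by (auto simp: prefix_def)
  have "cyc \<one> \<rho> = cyc (\<one> \<otimes> e z) (y @ z)" using cyc_split[of \<one> z y] y by simp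
  then have "\<exists>u r. arc u r \<and> e z = e u \<and> cyc \<one> r = cyc \<one> \<rho>"
    by (intro cyc_arc[OF one_closed assms(1) HOL.refl]) simp_all
  then obtain u r where "arc u r" "e z = e u" by blast
  then show ?thesis using arc_len_le[of "[(u, r)]"] by simp
qed

lemma on_cycle_arc:
  assumes "p \<in> carrier G" "on_cycle c p ys" "ys \<noteq> []" "arc_list ys"
  shows "\<exists>u r. arc u r \<and> e (label ys) = e u \<and> cyc p r = c"
proof -
  obtain r x where "r \<in> Q" "c = cyc p r" "c = cyc (p \<otimes> e (label ys)) x"
    using on_cycle_ends_on[OF assms(1-3)] assms(4) unfolding arc_list_def by blast
  then show ?thesis by (rule cyc_arc[OF assms(1)]) simp
qed

text \<open>The 14/24 of \<open>single_bound\<close>, whereas \<open>nochunk\<close> below excludes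
  just what Greendlinger's lemma produces.\<close>

definition tame :: "'s word \<Rightarrow> bool" where
  "tame w \<longleftrightarrow> (\<forall>\<rho>\<in>Q. \<forall>n\<le>length \<rho>. sublist (take n \<rho>) w \<longrightarrow> 24 * n < 14 * length \<rho>)"

definition nochunk :: "'s word \<Rightarrow> bool" where
  "nochunk w \<longleftrightarrow> (\<forall>\<rho>\<in>Q. \<forall>n\<le>length \<rho>. sublist (take n \<rho>) w \<longrightarrow> 8 * n \<le> 7 * length \<rho>)"

lemma sublist_winv: "sublist u w \<Longrightarrow> sublist (winv u) (winv w)"
  unfolding sublist_def by (metis winv_append append_assoc)

lemma chunk_winv:
  assumes "\<rho> \<in> Q" "n \<le> length \<rho>"
  obtains \<rho>' where "\<rho>' \<in> Q" "length \<rho>' = length \<rho>" "take n \<rho>' = winv (take n \<rho>)"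
proof -
  have "winv (drop n \<rho> @ take n \<rho>) \<in> Q" using rot_take winv_mem assms by blast
  moreover have "take n (winv (drop n \<rho> @ take n \<rho>)) = winv (take n \<rho>)" using assms by (simp add: winv_append)
  ultimately show thesis using that[of "winv (drop n \<rho> @ take n \<rho>)"] assms by simp
qed

lemma tame_winv: "tame w \<Longrightarrow> tame (winv w)"
  unfolding tame_def
proof (intro ballI allI impI)
  fix \<rho> n assume t: "\<forall>\<rho>\<in>Q. \<forall>n\<le>length \<rho>. sublist (take n \<rho>) w \<longrightarrow> 24 * n < 14 * length \<rho>"
    and r: "\<rho> \<in> Q" "n \<le> length \<rho>" "sublist (take n \<rho>) (winv w)"
  obtain \<rho>' where "\<rho>' \<in> Q" "length \<rho>' = length \<rho>" "take n \<rho>' = winv (take n \<rho>)" using chunk_winv r by metis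
  then show "24 * n < 14 * length \<rho>" using t r sublist_winv[OF r(3)] by (metis winv_winv)
qed

lemma nochunk_winv: "nochunk w \<Longrightarrow> nochunk (winv w)"
  unfolding nochunk_def
proof (intro ballI allI impI)
  fix \<rho> n assume t: "\<forall>\<rho>\<in>Q. \<forall>n\<le>length \<rho>. sublist (take n \<rho>) w \<longrightarrow> 8 * n \<le> 7 * length \<rho>"
    and r: "\<rho> \<in> Q" "n \<le> length \<rho>" "sublist (take n \<rho>) (winv w)"
  obtain \<rho>' where "\<rho>' \<in> Q" "length \<rho>' = length \<rho>" "take n \<rho>' = winv (take n \<rho>)" using chunk_winv r by metis
  then show "8 * n \<le> 7 * length \<rho>" using t r sublist_winv[OF r(3)] by (metis winv_winv)
qed

lemma tame_sublist: "tame w \<Longrightarrow> sublist u w \<Longrightarrow> tame u"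
  unfolding tame_def by (meson sublist_order.order.trans)

lemma nochunk_sublist: "nochunk w \<Longrightarrow> sublist u w \<Longrightarrow> nochunk u"
  unfolding nochunk_def by (meson sublist_order.order.trans)

lemma tame_prefix: "tame w \<Longrightarrow> \<rho> \<in> Q \<Longrightarrow> prefix z \<rho> \<Longrightarrow> sublist z w \<Longrightarrow> 24 * length z < 14 * length \<rho>"
  unfolding tame_def by (metis append_eq_conv_conj prefix_def prefix_length_le)

end

locale arcgen = scg_rel Q G el S
  for Q :: "'s word set" and G (structure) and el :: "'s \<times> bool \<Rightarrow> 'g" and S +
  assumes arcs_gen: "g \<in> carrier G \<Longrightarrow> \<exists>xs. arc_list xs \<and> e (label xs) = g"
begin

lemma arc_len_ex: "g \<in> carrier G \<Longrightarrow> \<exists>xs. arc_list xs \<and> length xs = arc_len g \<and> e (label xs) = g"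
  unfolding arc_len_def by (rule LeastI_ex) (use arcs_gen in blast)

lemma arc_len_mult: "g \<in> carrier G \<Longrightarrow> h \<in> carrier G \<Longrightarrow> arc_len (g \<otimes> h) \<le> arc_len g + arc_len h"
proof -
  assume "g \<in> carrier G" "h \<in> carrier G"
  then obtain xs ys where "arc_list xs" "length xs = arc_len g" "e (label xs) = g" "arc_list ys" "length ys = arc_len h" "e (label ys) = h"
    using arc_len_ex by metis
  then show ?thesis using arc_len_le[of "xs @ ys"] by simp
qed

lemma arc_len_inv [simp]: "g \<in> carrier G \<Longrightarrow> arc_len (inv g) = arc_len g"
proof -
  have *: "arc_len (inv g) \<le> arc_len g" if g: "g \<in> carrier G" for g
  proof -
    obtain xs where "arc_list xs" "length xs = arc_len g" "e (label xs) = g" using g arc_len_ex by metis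
    then show ?thesis using arc_len_le[of "inv_arcs xs"] by simp
  qed
  then show "g \<in> carrier G \<Longrightarrow> arc_len (inv g) = arc_len g" using *[of "inv g"] *[of g] by (simp add: le_antisym)
qed

text \<open>The second minimality, of the total length among products of equally many arcs, rules
  out cancellation between neighbouring arcs.\<close>

definition tight :: "('s word \<times> 's word) list \<Rightarrow> bool" where
  "tight xs \<longleftrightarrow> arc_list xs \<and> length xs = arc_len (e (label xs)) \<and>
     (\<forall>ys. arc_list ys \<longrightarrow> e (label ys) = e (label xs) \<longrightarrow> length ys = length xs \<longrightarrow> length (label xs) \<le> length (label ys))"

lemma tight_ex:
  assumes "g \<in> carrier G" shows "\<exists>xs. tight xs \<and> e (label xs) = g"
proof -
  let ?P = "\<lambda>xs. arc_list xs \<and> length xs = arc_len g \<and> e (label xs) = g"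
  obtain xs where "?P xs" "\<forall>ys. ?P ys \<longrightarrow> length (label xs) \<le> length (label ys)"
    using arc_len_ex[OF assms] ex_has_least_nat[of ?P _ "\<lambda>xs. length (label xs)"] by blast
  then show ?thesis by (intro exI[of _ xs]) (auto simp: tight_def)
qed

lemma tight_min: "tight xs \<Longrightarrow> arc_list ys \<Longrightarrow> e (label ys) = e (label xs) \<Longrightarrow> length xs \<le> length ys"
  using arc_len_le[of ys] by (simp add: tight_def)

lemma tight_no_block:
  assumes t: "tight (as @ ys @ bs)" and "2 \<le> length ys" and c: "on_cycle c (e (label as)) ys"
  shows False
proof -
  have a: "arc_list as" "arc_list ys" "arc_list bs" using t by (auto simp: tight_def)
  have "ys \<noteq> []" using assms(2) by auto
  then obtain u r where u: "arc u r" "e (label ys) = e u" using on_cycle_arc[OF _ c] a by auto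
  have "length (as @ ys @ bs) \<le> length (as @ [(u, r)] @ bs)"
    by (rule tight_min[OF t]) (use a u in auto)
  then show False using assms(2) by simp
qed

lemma tight_reduced:
  assumes t: "tight xs" shows "reduced (label xs)"
proof -
  have arc_list: "arc_list xs" using t by (simp add: tight_def)
  have mem: "reduced u \<and> u \<noteq> []" if "u \<in> set (map fst xs)" for u
  proof -
    obtain r as bs where xs: "xs = as @ (u, r) # bs" using \<open>u \<in> set (map fst xs)\<close>
      by (metis (no_types, lifting) in_set_conv_decomp list.set_map imageE prod.collapse)
    then have a: "arc u r" using arc_list by simp
    then have "reduced r" "prefix u r" using red arc_Q arc_prefix by auto
    then have "reduced u" by (auto simp: prefix_def reduced_append)
    moreover have "u \<noteq> []"
    proof
      assume "u = []"
      then have "length xs \<le> length (as @ bs)" using tight_min[OF t, of "as @ bs"] xs arc_list by simp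
      then show False using xs by simp
    qed
    ultimately show ?thesis by simp
  qed
  have "dirty (map fst xs) = 0"
  proof (rule ccontr)
    assume "dirty (map fst xs) \<noteq> 0"
    then obtain as0 u v bs0 where d: "map fst xs = as0 @ u # v # bs0" "u \<noteq> []" "v \<noteq> []" "hd v = linv (last u)"
      using dirty_pos by blast
    obtain as ru ts where ts: "xs = as @ (u, ru) # ts" "map fst ts = v # bs0"
      using d(1) map_fst_split by metis
    obtain rv bs where bs: "ts = (v, rv) # bs" using ts(2) by (cases ts) auto
    obtain u' a where u': "u = u' @ [a]" using d(2) by (metis append_butlast_last_id)
    obtain v' where v': "v = linv a # v'" using d(3,4) u' by (cases v) auto
    have a: "arc u ru" "arc v rv" using arc_list ts bs by auto
    have "arc u' ru" using a(1) u' unfolding arc_def by (simp add: take_butlast) (metis append_eq_conv_conj append_take_drop_id append_assoc length_append_singleton)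
    moreover have "arc v' (drop 1 rv @ take 1 rv)"
    proof -
      obtain y where y: "rv = v @ y" using arc_prefix[OF a(2)] by (auto simp: prefix_def)
      then show ?thesis using a(2) v' rot_take[OF arc_Q[OF a(2)], of 1] by (simp add: arc_def)
    qed
    moreover have "e (label (as @ [(u', ru), (v', drop 1 rv @ take 1 rv)] @ bs)) = e (label xs)"
      using ts bs u' v' by (simp add: m_assoc el_linv)
    ultimately have "length (label xs) \<le> length (label (as @ [(u', ru), (v', drop 1 rv @ take 1 rv)] @ bs))"
      by (intro t[unfolded tight_def, THEN conjunct2, THEN conjunct2, rule_format]) (use arc_list ts bs in simp_all)
    then show False using ts bs u' v' by simp
  qed
  then show ?thesis using reduced_concat[of "map fst xs"] mem by blast
qed

text \<open>A block could be merged into one arc. What remains of \<open>chunk_cases\<close> is at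
  most half a relator or falls under \<open>single_bound\<close>.\<close>

lemma tight_tame:
  assumes t: "tight xs" shows "tame (label xs)"
  unfolding tame_def
proof (intro ballI allI impI)
  fix \<rho> n assume \<rho>: "\<rho> \<in> Q" "n \<le> length \<rho>" and s: "sublist (take n \<rho>) (label xs)"
  have arcs: "\<forall>(u, r)\<in>set xs. arc u r" using t by (simp add: tight_def arc_list_def)
  show "24 * n < 14 * length \<rho>"
  proof (cases "n = 0")
    case True
    then show ?thesis using ne[OF \<rho>(1)] by simp
  next
    case False
    obtain x y where xy: "label xs = x @ take n \<rho> @ y" using s by (auto simp: sublist_def)
    have n0: "0 < n" using False by simp
    show ?thesis
    proof (cases rule: chunk_cases[OF arcs xy \<rho>(1) n0 \<rho>(2) one_closed])
      case 1
      then show ?thesis using n0 by linarith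
    next
      case (2 as ys bs \<rho>')
      then show ?thesis using tight_no_block[of as ys bs "cyc (e (label as)) \<rho>'"] t by simp
    next
      case (3 as u r bs x' w y' z0 z1)
      have "arc u r" using arcs 3(1) by auto
      moreover have "length r = length \<rho>" using arg_cong[OF 3(10), of length] by simp
      ultimately show ?thesis using single_bound 3(2,3,8,9) \<rho>(2) by blast
    qed
  qed
qed

end

section \<open>Overlaps of a tight word with its translates\<close>

context scg_rel
begin

definition big :: "'s word \<times> 's word \<Rightarrow> bool" where
  "big x \<longleftrightarrow> length (snd x) < 6 * length (fst x)"

text \<open>A path that goes almost once around a cycle, or slightly more than once, ends near its
  start. The word \<open>r @ r\<close> covers both possibilities, and \<open>k\<close> bounds the
  arc that is left over.\<close>

lemma wrap_arc:
  assumes r: "r \<in> Q" and y: "prefix y (r @ r)"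
  obtains u r' where "arc u r'" "e u = e y"
    "(length r \<le> length y + k \<and> length y \<le> length r + k \<and> 2 * k \<le> length r) \<Longrightarrow> length u \<le> k \<and> length r' = length r"
proof (cases "length r \<le> length y + k \<and> length y \<le> length r + k \<and> 2 * k \<le> length r")
  case True
  show thesis
  proof (cases "length y \<le> length r")
    case le: True
    define u where "u = take (length r - length y) (winv r)"
    have "y = take (length y) r" using y le by (metis prefix_def append_eq_conv_conj take_append take_is_prefix prefix_length_prefix prefixI)
    then have "e u = e y" using e_take_compl[OF r le] by (simp add: u_def)
    moreover have "arc u (winv r)" "length u \<le> k" using True le winv_mem[OF r] by (auto simp: arc_def u_def)
    ultimately show thesis using that by simp
  next
    case False
    define s where "s = drop (length r) y"
    have ys: "y = r @ s" "prefix s r"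
    proof -
      obtain t where t: "r @ r = y @ t" using y by (auto simp: prefix_def)
      then show "y = r @ s" using False by (metis append_eq_append_conv_if append_take_drop_id nat_le_linear s_def take_all_iff append_eq_conv_conj)
      then show "prefix s r" using t by simp
    qed
    then have "e s = e y" using e_rel[OF r] by simp
    moreover have "s = take (length s) r" using ys(2) by (auto simp: prefix_def)
    moreover have "length s \<le> k" using True ys(1) by simp
    ultimately show thesis using that[of s r] True r by (simp add: arc_def)
  qed
next
  case False
  have "\<exists>z. prefix z r \<and> e z = e y"
  proof (cases "length y \<le> length r")
    case True
    then have "prefix y r" using y prefix_length_prefix[of y "r @ r" r] by simp
    then show ?thesis by blast
  next
    case False
    then obtain s where s: "y = r @ s" using y prefix_length_prefix[of r "r @ r" y] by (auto simp: prefix_def)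
    then have "prefix s r" using y by simp
    then show ?thesis using s e_rel[OF r] by auto
  qed
  then obtain z where z: "prefix z r" "e z = e y" by blast
  then obtain t where t: "r = z @ t" by (auto simp: prefix_def)
  have "cyc \<one> r = cyc (\<one> \<otimes> e z) (t @ z)" using cyc_split[of \<one> z t] t by simp
  then have "\<exists>u r'. arc u r' \<and> e z = e u \<and> cyc \<one> r' = cyc \<one> r" by (intro cyc_arc[OF one_closed r HOL.refl]) simp_all
  then show thesis using that False z by metis
qed

text \<open>Rotate the relator of the arc so that it starts with \<open>z0\<close>: either it
  differs from \<open>z0 @ t\<close> and \<open>z0\<close> is a piece, or both describe the same
  cycle.\<close>

lemma left_end:
  assumes \<rho>: "z0 @ t \<in> Q" and u: "arc (x @ z0) r"
  shows "24 * length z0 < length (z0 @ t) \<or>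
    r \<in> Q \<and> length r = length (z0 @ t) \<and> cyc \<one> r = cyc (e (x @ z0)) (t @ z0) \<and>
      (\<forall>y. prefix y (t @ z0) \<longrightarrow> prefix ((x @ z0) @ y) (r @ r))"
proof -
  obtain s where s: "r = x @ z0 @ s" using arc_prefix[OF u] by (auto simp: prefix_def)
  have rot: "z0 @ s @ x \<in> Q" using rot_split[of x "z0 @ s"] arc_Q[OF u] s by simp
  show ?thesis
  proof (cases "z0 @ s @ x = z0 @ t")
    case False
    then show ?thesis using sc_prefix[OF rot \<rho> False, of z0] by simp
  next
    case True
    then have t: "t = s @ x" by simp
    have "cyc \<one> r = cyc (\<one> \<otimes> e (x @ z0)) (s @ x @ z0)" using cyc_split[of \<one> "x @ z0" s] s by simp
    moreover have "prefix ((x @ z0) @ y) (r @ r)" if "prefix y (t @ z0)" for y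
    proof -
      have "r @ r = (x @ z0) @ (t @ z0) @ s" using s t by simp
      then show ?thesis using that by (metis prefix_prefix same_prefix_prefix)
    qed
    ultimately show ?thesis using s t arc_Q[OF u] by simp
  qed
qed

lemma right_end:
  assumes \<rho>: "\<rho> \<in> Q" "prefix z1 \<rho>" and v: "arc (z1 @ y) r"
  shows "24 * length z1 < length \<rho> \<or> r = \<rho>"
  using sc_prefix[OF arc_Q[OF v] \<rho>(1) _ _ \<rho>(2)] arc_prefix[OF v] by (metis append_prefixD)

text \<open>A chunk across \<open>\<gamma>\<close> reaches far into both tame words
  (\<open>fat\<close>), or its arcs together with the ends \<open>zU\<close> and \<open>zV\<close>
  can be replaced by one arc. If only one arc is replaced, it is big while the new one is not,
  because the chunk goes almost once around the cycle.\<close>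

lemma chunk_tip:
  assumes arc_list: "arc_list \<gamma>" and \<gamma>: "\<gamma> \<noteq> []" and tame: "tame U" "tame V"
    and \<rho>: "\<rho> \<in> Q" "n \<le> length \<rho>" "7 * length \<rho> < 8 * n" and c: "sublist (take n \<rho>) (U @ label \<gamma> @ V)"
  obtains (fat) U' z0 z1 V' t where "U = U' @ z0" "V = z1 @ V'" "\<rho> = z0 @ label \<gamma> @ z1 @ t"
      "length \<rho> \<le> 8 * length z0" "length \<rho> \<le> 8 * length z1"
  | (contract) U' zU \<gamma>l ys \<gamma>r zV V' u r where "U = U' @ zU" "\<gamma> = \<gamma>l @ ys @ \<gamma>r" "V = zV @ V'"
      "zU = [] \<or> \<gamma>l = []" "zV = [] \<or> \<gamma>r = []" "arc_len (e zU) \<le> 1" "arc_len (e zV) \<le> 1"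
      "arc u r" "e u = e (zU @ label ys @ zV)"
      "2 \<le> length ys \<or> length ys = 1 \<and> list_all big ys \<and> \<not> big (u, r)"
proof -
  define L where "L = length \<rho>"
  obtain x y where xy: "U @ label \<gamma> @ V = x @ take n \<rho> @ y" using c by (auto simp: sublist_def)
  have n0: "take n \<rho> \<noteq> []" using \<rho> by auto
  have small: "24 * length z < 14 * L" if "prefix z \<rho>'" "\<rho>' \<in> Q" "length \<rho>' = L" "sublist z U \<or> sublist z V" for z \<rho>'
    using tame_prefix that tame unfolding L_def by metis
  have "concat (U # map fst \<gamma> @ [V]) = x @ take n \<rho> @ y" using xy by simp
  then show thesis using n0
  proof (cases rule: concat_overlap)
    case (one as u bs x' y')
    have s: "sublist (take n \<rho>) u" using one(2) by (simp add: sublist_append_leftI sublist_append_rightI)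
    have pr: "prefix (take n \<rho>) \<rho>" "length (take n \<rho>) = n" using \<rho>(2) by (simp_all add: take_is_prefix)
    have "u \<in> set (U # map fst \<gamma> @ [V])" using one(1) by simp
    then consider "u = U \<or> u = V" | r where "(u, r) \<in> set \<gamma>" by auto
    then show thesis
    proof cases
      case 1
      then have "24 * n < 14 * L" using small[OF pr(1) \<rho>(1)] s pr(2) L_def by auto
      then show thesis using \<rho>(3) L_def by linarith
    next
      case 2
      then have a: "arc u r" using arc_list by (auto simp: arc_list_def)
      obtain s where r: "r = x' @ take n \<rho> @ y' @ s" using arc_prefix[OF a] one(2) by (auto simp: prefix_def)
      have rot: "take n \<rho> @ y' @ s @ x' \<in> Q" using rot_split[of x' "take n \<rho> @ y' @ s"] arc_Q[OF a] r by simp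
      show thesis
      proof (cases "take n \<rho> @ y' @ s @ x' = \<rho>")
        case True
        have "length r = L" using arg_cong[OF True, of length] unfolding r L_def by simp
        moreover have "n \<le> length u" using one(2) pr(2) by simp
        ultimately show thesis using a \<rho>(3) unfolding arc_def L_def by linarith
      next
        case False
        have "24 * length (take n \<rho>) < length \<rho>" by (rule sc_prefix[OF rot \<rho>(1) False _ pr(1)]) simp
        then show thesis using pr(2) \<rho>(3) by linarith
      qed
    qed
  next
    case (many as u ms v bs x' z0 z1 y')
    obtain t where \<rho>e: "\<rho> = z0 @ concat ms @ z1 @ t"
      using many(4) by (metis append_take_drop_id append_assoc)
    have n: "n = length z0 + length (concat ms) + length z1"
      using arg_cong[OF many(4), of length] \<rho>(2) by simp
    define \<rho>1 where "\<rho>1 = concat ms @ z1 @ t @ z0"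
    define \<rho>2 where "\<rho>2 = z1 @ t @ z0 @ concat ms"
    have Q12: "\<rho>1 \<in> Q" "\<rho>2 \<in> Q"
      using rot_split[of z0 "concat ms @ z1 @ t"] rot_split[of "z0 @ concat ms" "z1 @ t"] \<rho>(1) \<rho>e
      by (simp_all add: \<rho>1_def \<rho>2_def)
    have L12: "length \<rho>1 = L" "length \<rho>2 = L" by (simp_all add: \<rho>1_def \<rho>2_def L_def \<rho>e)
    \<comment> \<open>Locates the chunk in the list: \<open>\<mu>\<close> is the part strictly
      between the outermost factors, each of which is an arc of \<open>\<gamma>\<close> or one of
      the words \<open>U\<close> and \<open>V\<close>.\<close>
    have dec: "\<exists>\<gamma>1 \<mu> \<gamma>2. \<gamma> = \<gamma>1 @ \<mu> @ \<gamma>2 \<and> map fst \<mu> = ms \<and>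
        (\<gamma>1 = [] \<and> u = U \<or> (\<exists>g1 ru. \<gamma>1 = g1 @ [(u, ru)])) \<and> (\<gamma>2 = [] \<and> v = V \<or> (\<exists>g2 rv. \<gamma>2 = (v, rv) # g2))"
    proof -
      have R: "\<exists>\<mu> \<gamma>2. \<gamma>' = \<mu> @ \<gamma>2 \<and> map fst \<mu> = ms \<and> (\<gamma>2 = [] \<and> v = V \<or> (\<exists>g2 rv. \<gamma>2 = (v, rv) # g2))"
        if e: "map fst \<gamma>' @ [V] = ms @ [v] @ bs" for \<gamma>' :: "('s word \<times> 's word) list"
      proof (cases bs rule: rev_cases)
        case Nil
        then show ?thesis using e by (intro exI[of _ \<gamma>'] exI[of _ "[]"]) simp
      next
        case (snoc bs' b)
        then have "map fst \<gamma>' = ms @ v # bs'" using e by simp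
        then obtain as0 r0 bs0 where "\<gamma>' = as0 @ (v, r0) # bs0" "map fst as0 = ms" "map fst bs0 = bs'" by (rule map_fst_split)
        then show ?thesis by (intro exI[of _ as0] exI[of _ "(v, r0) # bs0"]) auto
      qed
      show ?thesis
      proof (cases as)
        case Nil
        then have u: "u = U" and e: "map fst \<gamma> @ [V] = ms @ [v] @ bs" using many(1) by auto
        from R[OF e] obtain \<mu> \<gamma>2 where "\<gamma> = \<mu> @ \<gamma>2" "map fst \<mu> = ms" "\<gamma>2 = [] \<and> v = V \<or> (\<exists>g2 rv. \<gamma>2 = (v, rv) # g2)" by blast
        then show ?thesis using u by (intro exI[of _ "[]"] exI[of _ \<mu>] exI[of _ \<gamma>2]) auto
      next
        case (Cons a as')
        have e: "map fst \<gamma> @ [V] = as' @ [u] @ ms @ [v] @ bs" using many(1) Cons by simp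
        define bb where "bb = butlast ([v] @ bs)"
        have "map fst \<gamma> = butlast (map fst \<gamma> @ [V])" by simp
        also have "\<dots> = as' @ u # ms @ bb" unfolding e bb_def by (simp add: butlast_append)
        finally have "map fst \<gamma> = as' @ u # (ms @ bb)" .
        then obtain g1 ru \<gamma>' where g: "\<gamma> = g1 @ (u, ru) # \<gamma>'" "map fst g1 = as'" "map fst \<gamma>' = ms @ bb" by (rule map_fst_split)
        then have "map fst \<gamma>' @ [V] = ms @ [v] @ bs" using e by simp
        from R[OF this] obtain \<mu> \<gamma>2 where "\<gamma>' = \<mu> @ \<gamma>2" "map fst \<mu> = ms" "\<gamma>2 = [] \<and> v = V \<or> (\<exists>g2 rv. \<gamma>2 = (v, rv) # g2)" by blast
        then show ?thesis using g by (intro exI[of _ "g1 @ [(u, ru)]"] exI[of _ \<mu>] exI[of _ \<gamma>2]) auto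
      qed
    qed
    then obtain \<gamma>1 \<mu> \<gamma>2 where G: "\<gamma> = \<gamma>1 @ \<mu> @ \<gamma>2" "map fst \<mu> = ms"
      and G1: "\<gamma>1 = [] \<and> u = U \<or> (\<exists>g1 ru. \<gamma>1 = g1 @ [(u, ru)])"
      and G2: "\<gamma>2 = [] \<and> v = V \<or> (\<exists>g2 rv. \<gamma>2 = (v, rv) # g2)" by blast
    have wm: "concat ms = label \<mu>" using G(2) by simp
    \<comment> \<open>At the left end a final part of \<open>U\<close> is absorbed, or the arc
      \<open>u\<close> is included because it lies on the cycle, or a piece is given up. The right
      end is treated likewise.\<close>
    have left: "\<exists>U' zU \<gamma>l yl \<rho>A. U = U' @ zU \<and> \<gamma>1 = \<gamma>l @ yl \<and> (zU = [] \<or> \<gamma>l = []) \<and> \<rho>A \<in> Q \<and> length \<rho>A = L \<and>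
        prefix zU \<rho> \<and> cyc \<one> \<rho>A = cyc (e (zU @ label yl)) \<rho>1 \<and>
        (\<forall>y. prefix y \<rho>1 \<longrightarrow> prefix ((zU @ label yl) @ y) (\<rho>A @ \<rho>A)) \<and>
        (\<gamma>1 = [] \<and> zU = z0 \<and> yl = [] \<and> 24 * length z0 < 14 * L \<or>
         zU = [] \<and> (\<exists>u r. yl = [(u, r)] \<and> length r = L \<and> length z0 \<le> length u) \<or>
         zU = [] \<and> yl = [] \<and> 24 * length z0 < L)"
      using G1
    proof (elim disjE exE conjE)
      assume g: "\<gamma>1 = []" "u = U"
      have "24 * length z0 < 14 * L"
        by (rule small[of _ \<rho>]) (use \<rho>e \<rho> L_def many(2) g in \<open>auto intro: sublist_append_leftI\<close>)
      moreover have "cyc \<one> \<rho> = cyc (e z0) \<rho>1"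
        using cyc_split[of \<one> z0 "concat ms @ z1 @ t"] \<rho>e by (simp add: \<rho>1_def)
      moreover have "prefix (z0 @ y) (\<rho> @ \<rho>)" if "prefix y \<rho>1" for y
      proof -
        have "\<rho> @ \<rho> = z0 @ \<rho>1 @ concat ms @ z1 @ t" by (simp add: \<rho>e \<rho>1_def)
        then show ?thesis using that by (metis prefix_prefix same_prefix_prefix)
      qed
      ultimately show ?thesis using g many(2) \<rho> L_def \<rho>e
        by (intro exI[of _ x'] exI[of _ z0] exI[of _ "[]"] exI[of _ "[] :: ('s word \<times> 's word) list"] exI[of _ \<rho>]) simp
    next
      fix g1 ru assume g: "\<gamma>1 = g1 @ [(u, ru)]"
      have a: "arc (x' @ z0) ru" using arc_list G(1) g many(2) by (auto simp: arc_list_def)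
      have l: "24 * length z0 < L \<or> ru \<in> Q \<and> length ru = L \<and> cyc \<one> ru = cyc (e u) \<rho>1 \<and>
          (\<forall>y. prefix y \<rho>1 \<longrightarrow> prefix (u @ y) (ru @ ru))"
        using left_end[of z0 "concat ms @ z1 @ t", OF _ a] \<rho>(1) \<rho>e many(2) by (simp add: \<rho>1_def L_def)
      show ?thesis
      proof (cases "24 * length z0 < L")
        case True
        have "prefix y (\<rho>1 @ \<rho>1)" if "prefix y \<rho>1" for y using that by simp
        then show ?thesis using True g Q12 L12
          by (intro exI[of _ U] exI[of _ "[]"] exI[of _ \<gamma>1] exI[of _ "[]"] exI[of _ \<rho>1]) simp
      next
        case False
        then show ?thesis using l g many(2)
          by (intro exI[of _ U] exI[of _ "[]"] exI[of _ g1] exI[of _ "[(u, ru)]"] exI[of _ ru]) simp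
      qed
    qed
    have right: "\<exists>V' zV \<gamma>r yr. V = zV @ V' \<and> \<gamma>2 = yr @ \<gamma>r \<and> (zV = [] \<or> \<gamma>r = []) \<and>
        prefix zV \<rho>2 \<and> (\<exists>x. \<forall>q\<in>carrier G. cyc q \<rho>2 = cyc (q \<otimes> e (label yr @ zV)) x) \<and> prefix (label yr @ zV) \<rho>2 \<and>
        (\<gamma>2 = [] \<and> zV = z1 \<and> yr = [] \<and> 24 * length z1 < 14 * L \<or>
         zV = [] \<and> (\<exists>u r. yr = [(u, r)] \<and> length r = L \<and> length z1 \<le> length u) \<or>
         zV = [] \<and> yr = [] \<and> 24 * length z1 < L)"
      using G2
    proof (elim disjE exE conjE)
      assume g: "\<gamma>2 = []" "v = V"
      have p: "prefix z1 \<rho>2" by (simp add: \<rho>2_def)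
      have "24 * length z1 < 14 * L"
        by (rule small[OF p Q12(2) L12(2)]) (use many(3) g in \<open>auto intro: sublist_append_rightI\<close>)
      moreover have "\<forall>q\<in>carrier G. cyc q \<rho>2 = cyc (q \<otimes> e z1) ((t @ z0 @ concat ms) @ z1)"
        using cyc_split[of _ z1 "t @ z0 @ concat ms"] by (simp add: \<rho>2_def)
      ultimately show ?thesis using g many(3) p
        by (intro exI[of _ y'] exI[of _ z1] exI[of _ "[]"] exI[of _ "[]"]) auto
    next
      fix g2 rv assume g: "\<gamma>2 = (v, rv) # g2"
      have a: "arc (z1 @ y') rv" using arc_list G(1) g many(3) by (auto simp: arc_list_def)
      show ?thesis
      proof (cases "24 * length z1 < L")
        case True
        then show ?thesis using g by (intro exI[of _ V] exI[of _ "[]"] exI[of _ \<gamma>2] exI[of _ "[]"]) auto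
      next
        case False
        then have rv: "rv = \<rho>2" using right_end[OF Q12(2) _ a] L12(2) by (simp add: \<rho>2_def)
        obtain s where s: "rv = v @ s" using arc_prefix[OF a] many(3) by (auto simp: prefix_def)
        then have "\<forall>q\<in>carrier G. cyc q \<rho>2 = cyc (q \<otimes> e v) (s @ v)" using rv cyc_split by simp
        moreover have "prefix v \<rho>2" using s rv by simp
        ultimately show ?thesis using g rv L12(2) many(3)
          by (intro exI[of _ V] exI[of _ "[]"] exI[of _ g2] exI[of _ "[(v, rv)]"]) auto
      qed
    qed
    obtain U' zU \<gamma>l yl \<rho>A where l: "U = U' @ zU" "\<gamma>1 = \<gamma>l @ yl" "zU = [] \<or> \<gamma>l = []" "\<rho>A \<in> Q" "length \<rho>A = L"
        "prefix zU \<rho>" "cyc \<one> \<rho>A = cyc (e (zU @ label yl)) \<rho>1"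
        "\<forall>y. prefix y \<rho>1 \<longrightarrow> prefix ((zU @ label yl) @ y) (\<rho>A @ \<rho>A)"
      and lt: "\<gamma>1 = [] \<and> zU = z0 \<and> yl = [] \<and> 24 * length z0 < 14 * L \<or>
         zU = [] \<and> (\<exists>u r. yl = [(u, r)] \<and> length r = L \<and> length z0 \<le> length u) \<or>
         zU = [] \<and> yl = [] \<and> 24 * length z0 < L" using left by (elim exE conjE) (rule that)
    obtain V' zV \<gamma>r yr x'' where r: "V = zV @ V'" "\<gamma>2 = yr @ \<gamma>r" "zV = [] \<or> \<gamma>r = []"
        "prefix zV \<rho>2" "\<forall>q\<in>carrier G. cyc q \<rho>2 = cyc (q \<otimes> e (label yr @ zV)) x''" "prefix (label yr @ zV) \<rho>2"
      and rt: "\<gamma>2 = [] \<and> zV = z1 \<and> yr = [] \<and> 24 * length z1 < 14 * L \<or>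
         zV = [] \<and> (\<exists>u r. yr = [(u, r)] \<and> length r = L \<and> length z1 \<le> length u) \<or>
         zV = [] \<and> yr = [] \<and> 24 * length z1 < L" using right by (elim exE conjE) (rule that)
    define ys where "ys = yl @ \<mu> @ yr"
    have gy: "\<gamma> = \<gamma>l @ ys @ \<gamma>r" using G(1) l(2) r(2) by (simp add: ys_def)
    have Ln1: "arc_len (e zU) \<le> 1" "arc_len (e zV) \<le> 1" using arc_len_prefix l(6) r(4) \<rho>(1) Q12 by auto
    let ?w = "zU @ label ys @ zV"
    show thesis
    proof (cases "2 \<le> length ys")
      case True
      have "cyc (e (zU @ label yl)) \<rho>1 = cyc (e (zU @ label yl) \<otimes> e (concat ms)) \<rho>2"
        using cyc_split[of "e (zU @ label yl)" "concat ms" "z1 @ t @ z0"] by (simp add: \<rho>1_def \<rho>2_def)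
      also have "\<dots> = cyc (e (zU @ label yl) \<otimes> e (concat ms) \<otimes> e (label yr @ zV)) x''" using r(5) by simp
      also have "e (zU @ label yl) \<otimes> e (concat ms) \<otimes> e (label yr @ zV) = \<one> \<otimes> e ?w" using wm by (simp add: ys_def m_assoc)
      finally have "cyc \<one> \<rho>A = cyc (\<one> \<otimes> e ?w) x''" using l(7) by simp
      then have "\<exists>u r. arc u r \<and> e ?w = e u \<and> cyc \<one> r = cyc \<one> \<rho>A"
        by (intro cyc_arc[OF one_closed l(4) HOL.refl]) simp_all
      then obtain u' r' where "arc u' r'" "e u' = e ?w" by metis
      then show thesis by (intro contract[OF l(1) gy r(1) l(3) r(3) Ln1]) (use True in auto)
    next
      case short: False
      have ay: "arc a b" if "(a, b) \<in> set ys" for a b using that arc_list gy by (auto simp: arc_list_def)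
      have mid: "24 * length m < L \<or> length rm = L" if "\<mu> = [(m, rm)]" for m rm
      proof -
        have a: "arc (m @ []) rm" using ay[of m rm] that by (simp add: ys_def)
        have "prefix m \<rho>1" using that wm by (simp add: \<rho>1_def)
        then show ?thesis using right_end[OF Q12(1) _ a] L12 by auto
      qed
      \<comment> \<open>The path \<open>?w\<close> has between 5/6 and 7/6 of the length of the
        relator, so \<open>wrap_arc\<close> leaves an arc of at most 1/6.\<close>
      have fin: thesis if *: "length ys = 1" "list_all big ys" "prefix (label \<mu> @ label yr @ zV) \<rho>1"
        and w: "5 * L \<le> 6 * length ?w" "6 * length ?w \<le> 7 * L"
      proof -
        define k where "k = (L - length ?w) + (length ?w - L)"
        have k: "L \<le> length ?w + k" "length ?w \<le> L + k" "6 * k \<le> L"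
          by (cases "L \<le> length ?w"; use w in \<open>simp add: k_def\<close>)+
        have "prefix ?w (\<rho>A @ \<rho>A)" using l(8) *(3) by (simp add: ys_def)
        then obtain u' r' where u': "arc u' r'" "e u' = e ?w"
          "(length \<rho>A \<le> length ?w + k \<and> length ?w \<le> length \<rho>A + k \<and> 2 * k \<le> length \<rho>A) \<Longrightarrow> length u' \<le> k \<and> length r' = length \<rho>A"
          using wrap_arc[OF l(4)] by blast
        have "length u' \<le> k" "length r' = L" using u'(3) k l(5) by auto
        then have "\<not> big (u', r')" using k(3) by (simp add: big_def)
        then show thesis by (intro contract[OF l(1) gy r(1) l(3) r(3) Ln1 u'(1,2)]) (use * in auto)
      qed
      define a b where "a = length z0" and "b = length z1"
      have N: "7 * L < 8 * (a + length (label \<mu>) + b)" "a + length (label \<mu>) + b \<le> L" "0 < L"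
        using n \<rho> wm unfolding a_def b_def L_def by auto
      have one: "\<exists>m rm. \<mu> = [(m, rm)]" if "yl = []" "yr = []" "\<mu> \<noteq> []"
        using short that by (cases \<mu>; cases "tl \<mu>") (auto simp: ys_def)
      have p1: "prefix (label \<mu> @ z1) \<rho>1" "prefix (label \<mu>) \<rho>1" using wm by (simp_all add: \<rho>1_def)
      have emp: "\<mu> = [] \<and> yr = []" if "yl \<noteq> []" using short that by (cases yl; cases \<mu>; cases yr) (auto simp: ys_def)
      have emp': "\<mu> = [] \<and> yl = []" if "yr \<noteq> []" using short that by (cases yl; cases \<mu>; cases yr) (auto simp: ys_def)
      from lt show thesis
      proof (elim disjE exE conjE)
        assume l1: "\<gamma>1 = []" "zU = z0" "yl = []" "24 * length z0 < 14 * L"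
        from rt show thesis
        proof (elim disjE exE conjE)
          assume r1: "\<gamma>2 = []" "zV = z1" "yr = []" "24 * length z1 < 14 * L"
          have g: "\<gamma> = \<mu>" using G(1) l1 r1 by simp
          obtain m rm where m: "\<mu> = [(m, rm)]" using one l1 r1 g \<gamma> by blast
          show thesis
          proof (cases "L \<le> 8 * a \<and> L \<le> 8 * b")
            case True
            then show thesis by (intro fat[of U' z0 z1 V' t]) (use l r l1 r1 g wm \<rho>e in \<open>auto simp: a_def b_def L_def\<close>)
          next
            case False
            \<comment> \<open>One end is below 3/24 and the other below 14/24 of the relator, so the
              arc between them exceeds 21/24 - 3/24 - 14/24 = 4/24. This is the threshold 1/6 in
              \<open>big\<close>.\<close>
            then have mm: "24 * length m > 4 * L" using N m l1(4) r1(4) unfolding a_def b_def by auto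
            then have "length rm = L" using mid[OF m] N(3) by linarith
            then have "list_all big ys" using mm m l1 r1 by (simp add: ys_def big_def)
            then show thesis by (rule fin[rotated]) (use p1 m l1 r1 N in \<open>auto simp: ys_def a_def b_def\<close>)
          qed
        next
          fix v rv assume r2: "zV = []" "yr = [(v, rv)]" "length rv = L" "length z1 \<le> length v"
          have m: "\<mu> = []" using emp' r2 by simp
          have v: "2 * length v \<le> L" using ay[of v rv] r2 by (simp add: ys_def arc_def)
          have "list_all big ys" using r2 m l1 N unfolding a_def b_def by (simp add: ys_def big_def)
          moreover have "prefix v \<rho>1" using r(6) r2 m wm unfolding \<rho>1_def \<rho>2_def by (simp del: concat_eq_Nil_conv)
          ultimately show thesis by (intro fin) (use m l1 r2 N v in \<open>auto simp: ys_def a_def b_def\<close>)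
        next
          assume r3: "zV = []" "yr = []" "24 * length z1 < L"
          have "\<mu> \<noteq> []" using N l1 r3 unfolding a_def b_def by auto
          then obtain m rm where m: "\<mu> = [(m, rm)]" using one l1 r3 by blast
          have mm: "24 * length m > 4 * L" using N m l1(4) r3(3) unfolding a_def b_def by auto
          then have "length rm = L" using mid[OF m] N(3) by linarith
          then have "list_all big ys" using mm m l1 r3 by (simp add: ys_def big_def)
          then show thesis by (rule fin[rotated]) (use p1 m l1 r3 N in \<open>auto simp: ys_def a_def b_def\<close>)
        qed
      next
        fix u ru assume l2: "zU = []" "yl = [(u, ru)]" "length ru = L" "length z0 \<le> length u"
        have m: "\<mu> = []" "yr = []" using emp l2 by auto
        have u: "2 * length u \<le> L" using ay[of u ru] l2 by (simp add: ys_def arc_def)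
        from rt show thesis
        proof (elim disjE exE conjE)
          assume r1: "\<gamma>2 = []" "zV = z1" "yr = []" "24 * length z1 < 14 * L"
          have "list_all big ys" using l2 m r1 N unfolding a_def b_def by (simp add: ys_def big_def)
          then show thesis by (rule fin[rotated]) (use p1 m l2 r1 N u in \<open>auto simp: ys_def a_def b_def\<close>)
        next
          assume "zV = []" "yr = []" "24 * length z1 < L"
          then show thesis using N m l2 u unfolding a_def b_def by auto
        qed (use m in simp)
      next
        assume l3: "zU = []" "yl = []" "24 * length z0 < L"
        from rt show thesis
        proof (elim disjE exE conjE)
          assume r1: "\<gamma>2 = []" "zV = z1" "yr = []" "24 * length z1 < 14 * L"
          have "\<mu> \<noteq> []" using N l3 r1 unfolding a_def b_def by auto
          then obtain m rm where m: "\<mu> = [(m, rm)]" using one l3 r1 by blast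
          have mm: "24 * length m > 4 * L" using N m l3(3) r1(4) unfolding a_def b_def by auto
          then have "length rm = L" using mid[OF m] N(3) by linarith
          then have "list_all big ys" using mm m l3 r1 by (simp add: ys_def big_def)
          then show thesis by (rule fin[rotated]) (use p1 m l3 r1 N in \<open>auto simp: ys_def a_def b_def\<close>)
        next
          fix v rv assume r2: "zV = []" "yr = [(v, rv)]" "length rv = L" "length z1 \<le> length v"
          have m: "\<mu> = []" using emp' r2 by simp
          have v: "2 * length v \<le> L" using ay[of v rv] r2 by (simp add: ys_def arc_def)
          show thesis using N m l3 r2 v unfolding a_def b_def by auto
        next
          assume r3: "zV = []" "yr = []" "24 * length z1 < L"
          have "\<mu> \<noteq> []" using N l3 r3 unfolding a_def b_def by auto
          then obtain m rm where m: "\<mu> = [(m, rm)]" using one l3 r3 by blast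
          have mm: "24 * length m > 19 * L" using N m l3(3) r3(3) unfolding a_def b_def by auto
          then have "length rm = L" using mid[OF m] N(3) by linarith
          then have "2 * length m \<le> L" using ay[of m rm] m by (simp add: ys_def arc_def)
          then show thesis using mm N(3) by linarith
        qed
      qed
    qed
  qed
qed

end

lemma dirty_remove: "dirty (xs @ zs) \<le> dirty (xs @ ms @ zs) + 1"
  using dirty_append[of xs zs] dirty_append[of xs "ms @ zs"] dirty_append[of ms zs] by linarith

context scg_rel
begin

lemma arc_pre: "arc (u @ z) r \<Longrightarrow> arc u r"
proof -
  assume a: "arc (u @ z) r"
  then obtain s where "r = u @ z @ s" using arc_prefix by (force simp: prefix_def)
  then show ?thesis using a by (simp add: arc_def)
qed

lemma arc_suf: "arc (z @ v) r \<Longrightarrow> arc v (drop (length z) r @ take (length z) r)"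
proof -
  assume a: "arc (z @ v) r"
  then obtain s where "r = z @ v @ s" using arc_prefix by (force simp: prefix_def)
  then show ?thesis using a rot_take[OF arc_Q[OF a], of "length z"] by (simp add: arc_def)
qed

text \<open>The path \<open>w\<close> and its translate by \<open>g\<close> both run along at least
  1/8 of one common cycle.\<close>

definition fat :: "'s word \<Rightarrow> 'g \<Rightarrow> bool" where
  "fat w g \<longleftrightarrow> (\<exists>x1 z1 y1 \<rho>1 x2 z2 y2 \<rho>2. \<rho>1 \<in> Q \<and> w = x1 @ z1 @ y1 \<and> prefix z1 \<rho>1 \<and> length \<rho>1 \<le> 8 * length z1 \<and>
     \<rho>2 \<in> Q \<and> w = x2 @ z2 @ y2 \<and> prefix z2 \<rho>2 \<and> length \<rho>2 \<le> 8 * length z2 \<and>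
     cyc (e x1) \<rho>1 = cyc (g \<otimes> e x2) \<rho>2)"

definition num_big :: "('s word \<times> 's word) list \<Rightarrow> nat" where
  "num_big \<gamma> = length (filter big \<gamma>)"

lemma num_big_simps [simp]: "num_big [] = 0" "num_big (x # xs) = (if big x then 1 else 0) + num_big xs" "num_big (xs @ ys) = num_big xs + num_big ys"
  by (simp_all add: num_big_def)

text \<open>\<open>\<gamma>\<close> is a bridge from the point \<open>U\<close> of the path
  \<open>w\<close> to the point \<open>winv V\<close> of its translate by \<open>g\<close>;
  \<open>D\<close> and \<open>D'\<close> are the parts of \<open>w\<close> beyond it.
  \<open>V\<close> is stored inverted so that \<open>U @ label \<gamma> @ V\<close> is the word in
  which cancellation and chunks are sought.\<close>

definition config :: "'s word \<Rightarrow> 'g \<Rightarrow> 's word \<times> 's word \<times> 's word \<times> 's word \<times> ('s word \<times> 's word) list \<Rightarrow> bool" where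
  "config w g = (\<lambda>(U, D, V, D', \<gamma>). w = U @ D \<and> w = winv V @ D' \<and> arc_list \<gamma> \<and> e U \<otimes> e (label \<gamma>) = g \<otimes> inv (e V))"

lemma confI:
  "w = U @ D \<Longrightarrow> w = winv V @ D' \<Longrightarrow> arc_list \<gamma> \<Longrightarrow> e U \<otimes> e (label \<gamma>) = g \<otimes> inv (e V) \<Longrightarrow> config w g (U, D, V, D', \<gamma>)"
  unfolding config_def prod.case by blast

text \<open>Contracting \<open>k\<close> arcs to one creates at most two dirty junctions and moves the ends of \<open>U\<close> and \<open>V\<close> by
  one arc each, which is outweighed by the arcs saved if \<open>k \<ge> 2\<close>; for \<open>k = 1\<close> a big arc is replaced by one
  which is not big.\<close>

definition cost :: "'s word \<times> 's word \<times> 's word \<times> 's word \<times> ('s word \<times> 's word) list \<Rightarrow> nat" where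
  "cost = (\<lambda>(U, D, V, D', \<gamma>). 14 * length \<gamma> + 7 * num_big \<gamma> + 2 * dirty (U # map fst \<gamma> @ [V]) + arc_len (e D) + arc_len (e D'))"

end

context arcgen
begin

lemma config_contract:
  assumes c: "config w g (U, D, V, D', \<gamma>)" and g: "g \<in> carrier G"
    and dec: "U = U' @ zU" "\<gamma> = \<gamma>l @ ys @ \<gamma>r" "V = zV @ V'" "zU = [] \<or> \<gamma>l = []" "zV = [] \<or> \<gamma>r = []"
    and u: "arc u r" "e u = e (zU @ label ys @ zV)"
  shows "config w g (U', zU @ D, V', winv zV @ D', \<gamma>l @ [(u, r)] @ \<gamma>r)"
proof -
  have "e U \<otimes> e (label \<gamma>) = g \<otimes> inv (e V)" using c by (simp add: config_def)
  then have "e U' \<otimes> (e (zU @ label \<gamma>l) \<otimes> (e (label ys) \<otimes> e (label \<gamma>r))) = g \<otimes> inv (e V') \<otimes> inv (e zV)"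
    using dec(1-3) g by (simp add: m_assoc inv_mult_group)
  then have "e U' \<otimes> (e (zU @ label \<gamma>l) \<otimes> (e (label ys) \<otimes> e (label \<gamma>r))) \<otimes> e zV = g \<otimes> inv (e V')"
    using g by (simp add: m_assoc)
  moreover have "e zU \<otimes> (e (label \<gamma>l) \<otimes> k) = e (label \<gamma>l) \<otimes> (e zU \<otimes> k)" if "k \<in> carrier G" for k
    using dec(4) that by auto
  moreover have "e (label \<gamma>r) \<otimes> e zV = e zV \<otimes> e (label \<gamma>r)" using dec(5) by auto
  ultimately have *: "e U' \<otimes> e (label (\<gamma>l @ [(u, r)] @ \<gamma>r)) = g \<otimes> inv (e V')"
    using u(2) by (simp add: m_assoc)
  have "w = U' @ zU @ D" using c dec(1) by (simp add: config_def)
  moreover have "w = winv V @ D'" using c unfolding config_def prod.case by blast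
  then have "w = winv V' @ winv zV @ D'" unfolding dec(3) winv_append append_assoc .
  moreover have "arc_list (\<gamma>l @ [(u, r)] @ \<gamma>r)" using c dec(2) u(1) by (simp add: config_def)
  ultimately show ?thesis unfolding config_def prod.case using * by blast
qed

text \<open>The cycle of \<open>\<rho>\<close> runs along the end of \<open>U\<close>, crosses by
  \<open>m\<close>, and returns along the end of the translate of \<open>winv V\<close>.\<close>

lemma fat_tip:
  assumes g: "g \<in> carrier G" and w: "w = U @ D" "w = winv V @ D'" and eq: "e U \<otimes> e m = g \<otimes> inv (e V)"
    and z: "U = U1 @ z0" "V = z1 @ V1" and \<rho>: "\<rho> = z0 @ m @ z1 @ t" "\<rho> \<in> Q"
    and len: "length \<rho> \<le> 8 * length z0" "length \<rho> \<le> 8 * length z1"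
  shows "fat w g"
proof -
  let ?\<rho>2 = "z1 @ t @ z0 @ m"
  have Q2: "?\<rho>2 \<in> Q" using rot_split[of "z0 @ m" "z1 @ t"] \<rho> by simp
  have Q3: "winv ((t @ z0 @ m) @ z1) \<in> Q" using rot_split[OF Q2] winv_mem by simp
  have "cyc (e U1) \<rho> = cyc (e U1 \<otimes> e (z0 @ m)) ?\<rho>2"
    using cyc_split[of "e U1" "z0 @ m" "z1 @ t"] \<rho> by simp
  also have "e U1 \<otimes> e (z0 @ m) = g \<otimes> inv (e V)" using eq z by (simp add: m_assoc)
  also have "cyc (g \<otimes> inv (e V)) ?\<rho>2 = cyc (g \<otimes> inv (e V) \<otimes> e z1) ((t @ z0 @ m) @ z1)"
    using cyc_split[of "g \<otimes> inv (e V)" z1 "t @ z0 @ m"] g by simp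
  also have "g \<otimes> inv (e V) \<otimes> e z1 = g \<otimes> e (winv V1)" using z(2) g by (simp add: m_assoc inv_mult_group)
  also have "cyc (g \<otimes> e (winv V1)) ((t @ z0 @ m) @ z1) = cyc (g \<otimes> e (winv V1)) (winv ((t @ z0 @ m) @ z1))"
    using cyc_winv[of "g \<otimes> e (winv V1)"] g by simp
  finally have cc: "cyc (e U1) \<rho> = cyc (g \<otimes> e (winv V1)) (winv ((t @ z0 @ m) @ z1))" .
  show ?thesis
    unfolding fat_def
  proof (rule exI[of _ U1], rule exI[of _ z0], rule exI[of _ D], rule exI[of _ \<rho>], rule exI[of _ "winv V1"],
      rule exI[of _ "winv z1"], rule exI[of _ D'], rule exI[of _ "winv ((t @ z0 @ m) @ z1)"], intro conjI)
    show "length (winv ((t @ z0 @ m) @ z1)) \<le> 8 * length (winv z1)" using len \<rho> by simp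
    show "w = U1 @ z0 @ D" using w(1) z(1) by simp
    show "w = winv V1 @ winv z1 @ D'" using w(2) unfolding z(2) winv_append append_assoc .
  qed (use \<rho> len Q3 cc in \<open>auto simp: winv_append\<close>)
qed

text \<open>Choose a bridge of least cost. Cancellation or a chunk across it gives a cheaper bridge,
  unless the chunk makes \<open>g\<close> fat. The bound is the cost of the initial bridge: 14 + 7 +
  2 for each arc, and 4 for the two outer factors in the list of junctions.\<close>

lemma tip:
  assumes w: "reduced w" "tame w" and g: "g \<in> carrier G" and \<gamma>0: "arc_list \<gamma>0" "e w \<otimes> e (label \<gamma>0) = g \<otimes> e w"
    and nf: "\<not> fat w g"
  obtains U D U' D' \<gamma> where "w = U @ D" "w = U' @ D'" "arc_list \<gamma>" "e U \<otimes> e (label \<gamma>) = g \<otimes> e U'"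
    "arc_len (e D) \<le> 23 * length \<gamma>0 + 4" "arc_len (e D') \<le> 23 * length \<gamma>0 + 4"
    "\<gamma> = [] \<or> reduced (U @ label \<gamma> @ winv U') \<and> nochunk (U @ label \<gamma> @ winv U')"
proof -
  let ?c0 = "(w, [], winv w, [], \<gamma>0)"
  have c0: "config w g ?c0" using \<gamma>0 by (simp add: config_def)
  have nb: "num_big \<gamma>0 \<le> length \<gamma>0" by (simp add: num_big_def)
  have "cost ?c0 \<le> 23 * length \<gamma>0 + 4"
    using dirty_le[of "w # map fst \<gamma>0 @ [winv w]"] nb by (simp add: cost_def)
  obtain s where s: "config w g s" "\<forall>s'. config w g s' \<longrightarrow> cost s \<le> cost s'"
    using ex_has_least_nat[of "config w g" ?c0 cost] c0 by blast
  obtain U D V D' \<gamma> where sU: "s = (U, D, V, D', \<gamma>)" by (cases s) auto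
  note c = s(1)[unfolded sU]
  have min: "cost (U, D, V, D', \<gamma>) \<le> cost s'" if "config w g s'" for s' using s that sU by blast
  have cw: "w = U @ D" "w = winv V @ D'" "arc_list \<gamma>" "e U \<otimes> e (label \<gamma>) = g \<otimes> inv (e V)" using c unfolding config_def prod.case by blast+
  have "cost (U, D, V, D', \<gamma>) \<le> 23 * length \<gamma>0 + 4" using min[OF c0] \<open>cost ?c0 \<le> _\<close> by linarith
  then have arc_len: "arc_len (e D) \<le> 23 * length \<gamma>0 + 4" "arc_len (e D') \<le> 23 * length \<gamma>0 + 4" by (simp_all add: cost_def)
  have "reduced (U @ label \<gamma> @ V) \<and> nochunk (U @ label \<gamma> @ V)" if \<gamma>: "\<gamma> \<noteq> []"
  proof -
    let ?us = "U # map fst \<gamma> @ [V]"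
    have nonempty: "u \<noteq> []" if ur: "(u, r) \<in> set \<gamma>" for u r
    proof
      assume u: "u = []"
      obtain \<gamma>1 \<gamma>2 where d: "\<gamma> = \<gamma>1 @ (u, r) # \<gamma>2" using ur by (meson split_list)
      have "config w g (U, D, V, D', \<gamma>1 @ \<gamma>2)"
        by (rule confI[OF cw(1,2)]) (use cw(3,4) d u in simp_all)
      from min[OF this] have "14 + 2 * dirty ?us \<le> 2 * dirty (U # map fst (\<gamma>1 @ \<gamma>2) @ [V])"
        by (simp add: cost_def d)
      moreover have "dirty (U # map fst (\<gamma>1 @ \<gamma>2) @ [V]) \<le> dirty ?us + 1"
        using dirty_remove[of "U # map fst \<gamma>1" "map fst \<gamma>2 @ [V]" "[u]"] d by simp
      ultimately show False by linarith
    qed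
    \<comment> \<open>Trimming a dirty junction saves 2, while moving \<open>z\<close> into
      \<open>D\<close> or \<open>D'\<close> costs at most one arc.\<close>
    have clean: "dirty ?us = 0"
    proof (rule ccontr)
      assume "dirty ?us \<noteq> 0"
      then obtain xs u v ys where d: "?us = xs @ u # v # ys" "u \<noteq> []" "v \<noteq> []" "hd v = linv (last u)"
        using dirty_pos by blast
      obtain u' z v' where z: "u = u' @ z" "v = winv z @ v'" "z \<noteq> []" "u' = [] \<or> v' = [] \<or> hd v' \<noteq> linv (last u')"
        using max_cancel[OF d(2-4)] by blast
      have less: "dirty (xs @ u' # v' # ys) < dirty ?us" unfolding d(1) by (rule dirty_trim[OF d(2-4) z])
      have bu: "big (u', r) \<Longrightarrow> big (u, r)" and bv: "big (v', drop k r @ take k r) \<Longrightarrow> big (v, r)" for r k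
        using z by (auto simp: big_def)
      show False
      proof (cases xs)
        case Nil
        then have "u = U" "v # ys = map fst \<gamma> @ [V]" using d(1) by auto
        then obtain rv \<gamma>' where g: "\<gamma> = (v, rv) # \<gamma>'" "ys = map fst \<gamma>' @ [V]" using \<gamma> by (cases \<gamma>) auto
        let ?r = "drop (length (winv z)) rv @ take (length (winv z)) rv"
        let ?s = "(u', z @ D, V, D', (v', ?r) # \<gamma>')"
        have a: "arc (winv z @ v') rv" using cw(3) g z by simp
        have Lz: "arc_len (e z) \<le> 1" using arc_len_prefix[OF arc_Q[OF a], of "winv z"] arc_prefix[OF a] by (simp add: prefix_append append_prefixD)
        have "w = u' @ z @ D" using cw(1) z(1) \<open>u = U\<close> by (metis append_assoc)
        moreover have "e u' \<otimes> e (label ((v', ?r) # \<gamma>')) = g \<otimes> inv (e V)"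
          using cw(4) g z(1,2) unfolding \<open>u = U\<close>[symmetric] by (simp add: m_assoc)
        ultimately have "config w g ?s" by (intro confI cw(2)) (use cw(3) g arc_suf[OF a] in simp_all)
        from min[OF this] have "7 * num_big \<gamma> + 2 * dirty ?us + arc_len (e D) \<le> 7 * num_big ((v', ?r) # \<gamma>') + 2 * dirty (u' # v' # map fst \<gamma>' @ [V]) + arc_len (e (z @ D))"
          by (simp add: cost_def g)
        moreover have "num_big ((v', ?r) # \<gamma>') \<le> num_big \<gamma>" using bv g by auto
        moreover have "dirty (u' # v' # map fst \<gamma>' @ [V]) < dirty ?us" using less Nil g by simp
        moreover have "arc_len (e (z @ D)) \<le> 1 + arc_len (e D)" using arc_len_mult[of "e z" "e D"] Lz by simp
        ultimately show False by linarith
      next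
        case (Cons x xs')
        then have x: "x = U" and e: "map fst \<gamma> @ [V] = xs' @ u # v # ys" using d(1) by auto
        show False
        proof (cases ys rule: rev_cases)
          case Nil
          then have "v = V" "map fst \<gamma> = xs' @ u # []" using e by auto
          then obtain \<gamma>1 ru where g: "\<gamma> = \<gamma>1 @ [(u, ru)]" "map fst \<gamma>1 = xs'"
            using map_fst_split[of \<gamma> xs' u "[]"] by (metis map_is_Nil_conv)
          let ?s = "(U, D, v', z @ D', \<gamma>1 @ [(u', ru)])"
          have a: "arc (u' @ z) ru" using cw(3) g z by simp
          have "prefix z (drop (length u') ru @ take (length u') ru)" using arc_split[OF a] .
          then have Lz: "arc_len (e z) \<le> 1" using arc_len_prefix rot_take[OF arc_Q[OF a]] by blast
          have "e U \<otimes> (e (label \<gamma>1) \<otimes> e u') \<otimes> e z = g \<otimes> inv (e v') \<otimes> e z"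
          proof -
            have "e (label \<gamma>) = e (label \<gamma>1) \<otimes> (e u' \<otimes> e z)" using g(1) z(1) by simp
            moreover have "inv (e V) = inv (e v') \<otimes> e z"
              unfolding \<open>v = V\<close>[symmetric] z(2) by (simp add: inv_mult_group)
            ultimately show ?thesis using cw(4) assms(3) by (simp add: m_assoc)
          qed
          then have "e U \<otimes> (e (label \<gamma>1) \<otimes> e u') = g \<otimes> inv (e v')" using assms(3) by simp
          moreover have "w = winv v' @ z @ D'" using cw(2) unfolding \<open>v = V\<close>[symmetric] z(2) winv_append winv_winv append_assoc .
          ultimately have "config w g ?s" by (intro confI cw(1)) (use cw(3) g arc_pre[OF a] in simp_all)
          from min[OF this] have "7 * num_big \<gamma> + 2 * dirty ?us + arc_len (e D') \<le> 7 * num_big (\<gamma>1 @ [(u', ru)]) + 2 * dirty (U # map fst \<gamma>1 @ [u', v']) + arc_len (e (z @ D'))"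
            by (simp add: cost_def g)
          moreover have "num_big (\<gamma>1 @ [(u', ru)]) \<le> num_big \<gamma>" using bu g by auto
          moreover have "dirty (U # map fst \<gamma>1 @ [u', v']) < dirty ?us" using less Nil Cons x g by simp
          moreover have "arc_len (e (z @ D')) \<le> 1 + arc_len (e D')" using arc_len_mult[of "e z" "e D'"] Lz by simp
          ultimately show False by linarith
        next
          case (snoc ys' y)
          then have y: "y = V" and "map fst \<gamma> = xs' @ u # (v # ys')" using e by auto
          then obtain \<gamma>1 ru ts where g1: "\<gamma> = \<gamma>1 @ (u, ru) # ts" "map fst \<gamma>1 = xs'" "map fst ts = v # ys'"
            by (elim map_fst_split)
          then obtain rv \<gamma>2 where g: "ts = (v, rv) # \<gamma>2" "map fst \<gamma>2 = ys'" by (cases ts) auto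
          let ?r = "drop (length (winv z)) rv @ take (length (winv z)) rv"
          let ?\<gamma> = "\<gamma>1 @ (u', ru) # (v', ?r) # \<gamma>2"
          let ?s = "(U, D, V, D', ?\<gamma>)"
          have a: "arc (u' @ z) ru" "arc (winv z @ v') rv" using cw(3) g1 g z by simp_all
          have "config w g ?s"
            by (rule confI[OF cw(1,2)]) (use cw(3,4) g1 g z arc_pre[OF a(1)] arc_suf[OF a(2)] in \<open>simp_all add: m_assoc\<close>)
          from min[OF this] have "7 * num_big \<gamma> + 2 * dirty ?us \<le> 7 * num_big ?\<gamma> + 2 * dirty (U # map fst \<gamma>1 @ u' # v' # map fst \<gamma>2 @ [V])"
            by (simp add: cost_def g g1)
          moreover have "num_big ?\<gamma> \<le> num_big \<gamma>" using bu bv g1 g by auto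
          moreover have "dirty (U # map fst \<gamma>1 @ u' # v' # map fst \<gamma>2 @ [V]) < dirty ?us" using less snoc Cons x y g1 g by simp
          ultimately show False by linarith
        qed
      qed
    qed
    have rU: "reduced U" "reduced V"
      using w(1) cw(1) reduced_append[of U D] reduced_append[of "winv V" D'] reduced_winv[of "winv V"] cw(2) by auto
    have "reduced (U @ label \<gamma> @ V)"
    proof -
      define us where "us = (if U = [] then [] else [U]) @ map fst \<gamma> @ (if V = [] then [] else [V])"
      have "dirty us \<le> dirty ?us"
        using dirty_append[of "[U]" "map fst \<gamma>"] dirty_append[of "[U]" "map fst \<gamma> @ [V]"] dirty_append[of "map fst \<gamma>" "[V]"]
          dirty_append[of "U # map fst \<gamma>" "[V]"]
        by (auto simp: us_def)
      moreover have "reduced u \<and> u \<noteq> []" if "u \<in> set us" for u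
      proof -
        from that consider "u = U \<and> u \<noteq> []" | "u = V \<and> u \<noteq> []" | r where "(u, r) \<in> set \<gamma>"
          by (auto simp: us_def split: if_splits)
        then show ?thesis
        proof cases
          case 3
          then have a: "arc u r" using cw(3) by (auto simp: arc_list_def)
          then have "reduced r" "prefix u r" using red arc_Q arc_prefix by auto
          then show ?thesis using nonempty[OF 3] by (auto simp: prefix_def reduced_append)
        qed (use rU in auto)
      qed
      ultimately have "reduced (concat us)" using reduced_concat[of us] clean by simp
      moreover have "concat us = U @ label \<gamma> @ V" by (simp add: us_def)
      ultimately show ?thesis by simp
    qed
    moreover have "nochunk (U @ label \<gamma> @ V)"
      unfolding nochunk_def
    proof (intro ballI allI impI, rule ccontr)
      fix \<rho> n assume \<rho>: "\<rho> \<in> Q" "n \<le> length \<rho>" "sublist (take n \<rho>) (U @ label \<gamma> @ V)" "\<not> 8 * n \<le> 7 * length \<rho>"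
      then have n7: "7 * length \<rho> < 8 * n" by simp
      have "tame U" using tame_sublist[OF w(2)] cw(1) by simp
      moreover have "tame V" using tame_winv[OF tame_sublist[OF w(2), of "winv V"]] cw(2) by simp
      ultimately show False
      proof (cases rule: chunk_tip[OF cw(3) \<gamma> _ _ \<rho>(1,2) n7 \<rho>(3)])
        case (3 U1 z0 z1 V1 t)
        have "\<rho> = z0 @ label \<gamma> @ z1 @ t" "length \<rho> \<le> 8 * length z0" "length \<rho> \<le> 8 * length z1" using 3 by auto
        then have "fat w g" using fat_tip[OF g cw(1,2,4) 3(1,2)] \<rho>(1) by blast
        then show False using nf by simp
      next
        case (4 U1 zU \<gamma>l ys \<gamma>r zV V1 u r)
        let ?\<gamma> = "\<gamma>l @ [(u, r)] @ \<gamma>r"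
        have c': "config w g (U1, zU @ D, V1, winv zV @ D', ?\<gamma>)"
          using config_contract[OF c g 4(1-5,8,9)] .
        have d0: "dirty (map fst \<gamma>l) = 0" "dirty (map fst \<gamma>r) = 0"
          "zU = [] \<Longrightarrow> dirty (U1 # map fst \<gamma>l) = 0" "zV = [] \<Longrightarrow> dirty (map fst \<gamma>r @ [V1]) = 0"
          using clean 4(1-3) dirty_append[of "U # map fst \<gamma>l" "map fst ys @ map fst \<gamma>r @ [V]"]
            dirty_append[of "map fst ys" "map fst \<gamma>r @ [V]"] dirty_append[of "[U]" "map fst \<gamma>l"] dirty_append[of "map fst \<gamma>r" "[V]"] by auto
        have "dirty (U1 # map fst \<gamma>l) = 0" using d0 4(4) by (cases "zU = []") auto
        moreover have "dirty (map fst \<gamma>r @ [V1]) = 0" using d0 4(5) by (cases "zV = []") auto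
        ultimately have "dirty (U1 # map fst ?\<gamma> @ [V1]) \<le> 2"
          using dirty_append[of "U1 # map fst \<gamma>l" "u # map fst \<gamma>r @ [V1]"] dirty_append[of "[u]" "map fst \<gamma>r @ [V1]"] by simp
        moreover have "arc_len (e (zU @ D)) \<le> 1 + arc_len (e D)" using arc_len_mult[of "e zU" "e D"] 4(6) by simp
        moreover have "arc_len (e (winv zV @ D')) \<le> 1 + arc_len (e D')" using arc_len_mult[of "e (winv zV)" "e D'"] 4(7) by simp
        moreover have "14 * length \<gamma> + 7 * num_big \<gamma> + 2 * dirty ?us + arc_len (e D) + arc_len (e D') \<le>
            14 * length ?\<gamma> + 7 * num_big ?\<gamma> + 2 * dirty (U1 # map fst ?\<gamma> @ [V1]) + arc_len (e (zU @ D)) + arc_len (e (winv zV @ D'))"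
          using min[OF c'] by (simp only: cost_def split)
        ultimately have *: "14 * length ys + 7 * num_big ys \<le> 20 + 7 * num_big [(u, r)]" using 4(2) by simp
        from 4(10) show False
        proof
          assume "2 \<le> length ys"
          moreover have "num_big [(u, r)] \<le> 1" by simp
          ultimately show False using * by linarith
        next
          assume a: "length ys = 1 \<and> list_all big ys \<and> \<not> big (u, r)"
          then have "num_big ys = 1" by (cases ys) auto
          then show False using * a by simp
        qed
      qed
    qed
    ultimately show ?thesis by blast
  qed
  then show thesis using that[of U D "winv V" D' \<gamma>] cw arc_len by auto
qed

end

section \<open>Gluing words without chunks, and the overlap theorem\<close>

lemma append_cases:
  assumes "a @ b = c @ d"
  obtains us where "a = c @ us" "us @ b = d" | us where "c = a @ us" "b = us @ d"
  using assms by (auto simp: append_eq_append_conv2)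

lemma sublist_glue:
  assumes "sublist c (A @ M @ C)"
  shows "sublist c (A @ M) \<or> sublist c (M @ C) \<or> sublist M c"
proof -
  obtain x y where "A @ (M @ C) = x @ (c @ y)" using assms by (auto simp: sublist_def)
  then show ?thesis
  proof (cases rule: append_cases)
    case (1 us)
    from 1(2) have "(us @ M) @ C = c @ y" by simp
    then show ?thesis
    proof (cases rule: append_cases)
      case (1 vs)
      then have "A @ M = x @ c @ vs" using \<open>A = x @ us\<close> by simp
      then show ?thesis by (metis sublist_appendI)
    next
      case (2 vs)
      then show ?thesis by (metis sublist_appendI append_assoc)
    qed
  next
    case 2
    then show ?thesis by (metis sublist_appendI)
  qed
qed

lemma reduced_glue: "reduced (A @ M) \<Longrightarrow> reduced (M @ C) \<Longrightarrow> M \<noteq> [] \<Longrightarrow> reduced (A @ M @ C)"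
  by (auto simp: reduced_append hd_append)

lemma reduced_sublist: "reduced w \<Longrightarrow> sublist u w \<Longrightarrow> reduced u"
  by (auto simp: sublist_def reduced_append)

lemma sublist_mid: "sublist (u @ v) (a @ u @ v @ b)"
  by (metis sublist_appendI append_assoc)

lemma common_suffix:
  obtains u' v' z where "u = u' @ z" "v = v' @ z" "u' = [] \<or> v' = [] \<or> last u' \<noteq> last v'"
proof (induction u arbitrary: v thesis rule: rev_induct)
  case (snoc a u)
  show ?case
  proof (cases v rule: rev_cases)
    case Nil
    then show ?thesis using snoc.prems[of "u @ [a]" "[]" "[]"] by simp
  next
    case (snoc v' b)
    show ?thesis
    proof (cases "a = b")
      case True
      obtain u1 v1 z where "u = u1 @ z" "v' = v1 @ z" "u1 = [] \<or> v1 = [] \<or> last u1 \<noteq> last v1" using snoc.IH by blast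
      then show ?thesis using snoc True snoc.prems[of u1 "z @ [a]" v1] by simp
    next
      case False
      then show ?thesis using snoc snoc.prems[of "u @ [a]" "[]" v] by simp
    qed
  qed
qed (metis append_Nil append_Nil2)

context scg_rel
begin

lemma same_left: "same p r q s \<Longrightarrow> a \<in> carrier G \<Longrightarrow> p \<in> carrier G \<Longrightarrow> same (a \<otimes> p) r (a \<otimes> q) s"
proof (induction rule: same.induct)
  case (rot h b x)
  then have "h \<in> carrier G" using same_closed by blast
  then show ?case using same.rot[OF rot.IH] rot.prems by (simp add: m_assoc)
qed (auto intro: same.intros)

lemma cyc_left:
  assumes "cyc p r = cyc q s" "a \<in> carrier G" "p \<in> carrier G" "q \<in> carrier G"
  shows "cyc (a \<otimes> p) r = cyc (a \<otimes> q) s"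
  using assms cyc_eq_iff same_left by (metis m_closed)

lemma arc_list_letters: "arc_list xs \<Longrightarrow> fst ` set (label xs) \<subseteq> S"
proof (induction xs)
  case (Cons x xs)
  obtain u r where x: "x = (u, r)" by force
  then have "prefix u r" "r \<in> Q" using Cons.prems arc_prefix arc_Q by auto
  then have "fst ` set u \<subseteq> S" using Q_S[of r] set_mono_prefix[of u r] by blast
  then show ?case using Cons x by (simp add: image_Un)
qed simp

lemma letters_winv: "fst ` set (winv w) = fst ` set w"
  by (simp add: set_winv image_image)

lemma arc_len_sub:
  assumes "\<rho> \<in> Q" "sublist M (take n \<rho>)" shows "arc_len (e M) \<le> 1"
proof -
  obtain a b where "take n \<rho> = a @ M @ b" using assms(2) by (auto simp: sublist_def)
  then have "\<rho> = a @ (M @ b @ drop n \<rho>)" by (metis append_take_drop_id append_assoc)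
  then have "(M @ b @ drop n \<rho>) @ a \<in> Q" using rot_split assms(1) by metis
  then show ?thesis using arc_len_prefix[of _ M] by simp
qed

text \<open>A chunk contained in neither of two overlapping words contains their overlap
  \<open>M\<close>, which would then be a subword of a relator and have arc length at most
  1.\<close>

lemma nochunk_glue:
  assumes "nochunk (A @ M)" "nochunk (M @ C)" "2 \<le> arc_len (e M)"
  shows "nochunk (A @ M @ C)"
  unfolding nochunk_def
proof (intro ballI allI impI)
  fix \<rho> n assume \<rho>: "\<rho> \<in> Q" "n \<le> length \<rho>" "sublist (take n \<rho>) (A @ M @ C)"
  have "\<not> sublist M (take n \<rho>)" using arc_len_sub[OF \<rho>(1)] assms(3) by fastforce
  then show "8 * n \<le> 7 * length \<rho>"
    using sublist_glue[OF \<rho>(3)] assms(1,2) \<rho> unfolding nochunk_def by blast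
qed

lemma nochunk_trivial:
  assumes "reduced w" "nochunk w" "e w = \<one>" "fst ` set w \<subseteq> S"
  shows "w = []"
proof (rule ccontr)
  assume "w \<noteq> []"
  then obtain r n where "r \<in> Q" "sublist (take n r) w" "n \<le> length r" "7 * length r < 8 * n"
    using GL assms by blast
  then show False using assms(2) unfolding nochunk_def by fastforce
qed

lemma arc_len_pre:
  assumes "arc_list ys" "label ys = P @ C" shows "arc_len (e P) \<le> length ys"
proof (cases "C = []")
  case True
  then show ?thesis using arc_len_le[OF assms(1)] assms(2) by simp
next
  case False
  then obtain as0 u bs0 x' u' where d: "map fst ys = as0 @ [u] @ bs0" "u = x' @ u'" "P = concat as0 @ x'"
    using concat_split_left[OF assms(2)] by blast
  then obtain as r bs where ys: "ys = as @ (u, r) # bs" "map fst as = as0" by (metis append_Cons append_Nil map_fst_split)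
  then have "arc_list (as @ [(x', r)])" using assms(1) d(2) arc_pre by auto
  moreover have "P = label (as @ [(x', r)])" using d ys by simp
  ultimately show ?thesis using arc_len_le[of "as @ [(x', r)]"] ys by simp
qed

end

context arcgen
begin

lemma arc_len_suf:
  assumes "arc_list ys" "label ys = P @ C" shows "arc_len (e C) \<le> length ys"
  using arc_len_pre[of "inv_arcs ys" "winv C" "winv P"] assms by (simp add: winv_append)

text \<open>\<open>A\<close> ends inside some arc. It needs at most the arcs up to that one, and
  \<open>C\<close> at most the arcs from that one on, so minimality of the whole bounds
  \<open>A @ B\<close> from below.\<close>

lemma tight_split:
  assumes t: "tight xs" and w: "label xs = A @ B @ C" shows "arc_len (e A) \<le> arc_len (e (A @ B)) + 1"
proof (cases "B @ C = []")
  case False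
  have arc_list: "arc_list xs" "length xs = arc_len (e (label xs))" using t by (auto simp: tight_def)
  obtain as0 u bs0 x' u' where d: "map fst xs = as0 @ [u] @ bs0" "u = x' @ u'" "A = concat as0 @ x'" "B @ C = u' @ concat bs0"
    using concat_split_left[of "map fst xs" A "B @ C"] w False by auto
  then obtain as r bs where xs: "xs = as @ (u, r) # bs" "map fst as = as0" "map fst bs = bs0"
    by (metis append_Cons append_Nil map_fst_split)
  have a: "arc u r" "arc_list as" "arc_list bs" using arc_list xs by auto
  have "arc_len (e A) \<le> length as + 1" using arc_len_pre[of "as @ [(u, r)]" A u'] a d xs by simp
  moreover have "arc_len (e C) \<le> length bs + 1" using arc_len_suf[of "(u, r) # bs" "x' @ B" C] a d xs by simp
  moreover have "length xs \<le> arc_len (e (A @ B)) + arc_len (e C)" using arc_list(2) w arc_len_mult[of "e (A @ B)" "e C"] by (simp add: m_assoc)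
  ultimately show ?thesis using xs by simp
qed simp

text \<open>Read from the other end of \<open>w\<close>, the translation becomes the conjugate of
  \<open>g\<close> by \<open>e w\<close>. This transfers \<open>tip\<close> to the beginning of
  \<open>w\<close>.\<close>

lemma fat_winv:
  assumes f: "fat (winv w) (inv (e w) \<otimes> g \<otimes> e w)" and g: "g \<in> carrier G"
  shows "fat w g"
proof -
  obtain x1 z1 y1 \<rho>1 x2 z2 y2 \<rho>2 where
    1: "\<rho>1 \<in> Q" "winv w = x1 @ z1 @ y1" "prefix z1 \<rho>1" "length \<rho>1 \<le> 8 * length z1" and
    2: "\<rho>2 \<in> Q" "winv w = x2 @ z2 @ y2" "prefix z2 \<rho>2" "length \<rho>2 \<le> 8 * length z2" and
    c: "cyc (e x1) \<rho>1 = cyc (inv (e w) \<otimes> g \<otimes> e w \<otimes> e x2) \<rho>2" using f unfolding fat_def by blast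
  have *: "\<exists>\<rho>'\<in>Q. w = winv y @ winv z @ winv x \<and> prefix (winv z) \<rho>' \<and> length \<rho>' = length \<rho> \<and>
      (\<forall>h\<in>carrier G. cyc (h \<otimes> e x) \<rho> = cyc (h \<otimes> inv (e w) \<otimes> e (winv y)) \<rho>')"
    if \<rho>: "\<rho> \<in> Q" "winv w = x @ z @ y" "prefix z \<rho>" for x z y \<rho>
  proof -
    obtain t where t: "\<rho> = z @ t" using \<rho>(3) by (auto simp: prefix_def)
    have w: "w = winv y @ winv z @ winv x" using \<rho>(2) by (metis winv_append winv_winv append_assoc)
    have "cyc (h \<otimes> e x) \<rho> = cyc (h \<otimes> inv (e w) \<otimes> e (winv y)) (winv (t @ z))" if h: "h \<in> carrier G" for h
    proof -
      have "cyc (h \<otimes> e x) \<rho> = cyc (h \<otimes> e x \<otimes> e z) (t @ z)" using cyc_split[of "h \<otimes> e x" z t] t h by simp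
      moreover have "h \<otimes> e x \<otimes> e z = h \<otimes> inv (e w) \<otimes> e (winv y)"
        unfolding w using h by (simp add: m_assoc inv_mult_group)
      ultimately show ?thesis using cyc_winv[of "h \<otimes> e x \<otimes> e z" "t @ z"] h by simp
    qed
    moreover have "winv (t @ z) \<in> Q" using rot_split \<rho>(1) winv_mem t by simp
    ultimately show ?thesis using w t by (intro bexI[of _ "winv (t @ z)"]) (auto simp: winv_append)
  qed
  obtain \<rho>1' where 3: "\<rho>1' \<in> Q" "w = winv y1 @ winv z1 @ winv x1" "prefix (winv z1) \<rho>1'" "length \<rho>1' = length \<rho>1"
    "\<forall>h\<in>carrier G. cyc (h \<otimes> e x1) \<rho>1 = cyc (h \<otimes> inv (e w) \<otimes> e (winv y1)) \<rho>1'" using *[OF 1(1-3)] by blast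
  obtain \<rho>2' where 4: "\<rho>2' \<in> Q" "w = winv y2 @ winv z2 @ winv x2" "prefix (winv z2) \<rho>2'" "length \<rho>2' = length \<rho>2"
    "\<forall>h\<in>carrier G. cyc (h \<otimes> e x2) \<rho>2 = cyc (h \<otimes> inv (e w) \<otimes> e (winv y2)) \<rho>2'" using *[OF 2(1-3)] by blast
  have "cyc (e w \<otimes> e x1) \<rho>1 = cyc (e w \<otimes> (inv (e w) \<otimes> g \<otimes> e w \<otimes> e x2)) \<rho>2"
    using cyc_left[OF c] g by simp
  also have "e w \<otimes> (inv (e w) \<otimes> g \<otimes> e w \<otimes> e x2) = g \<otimes> e w \<otimes> e x2" using g by (simp add: m_assoc)
  finally have "cyc (e w \<otimes> inv (e w) \<otimes> e (winv y1)) \<rho>1' = cyc (g \<otimes> e w \<otimes> inv (e w) \<otimes> e (winv y2)) \<rho>2'"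
    using 3(5) 4(5) g by simp
  then have "cyc (e (winv y1)) \<rho>1' = cyc (g \<otimes> e (winv y2)) \<rho>2'" using g by (simp add: m_assoc)
  then show ?thesis unfolding fat_def using 1(4) 2(4) 3(1-4) 4(1-4) by (metis length_winv)
qed

text \<open>On either side of the meeting point a chunk has less than 14/24 of the relator, hence
  more than 21/24 - 14/24 > 1/8 on both, and then \<open>g\<close> is fat.\<close>

lemma straddle:
  assumes g: "g \<in> carrier G" and w: "w = U @ D" "w = U' @ D'" "tame w" and eq: "e U = g \<otimes> e U'"
    and B: "U = A @ B" "U' = A' @ B'" and nf: "\<not> fat w g"
  shows "nochunk (B @ winv B')"
  unfolding nochunk_def
proof (intro ballI allI impI, rule ccontr)
  fix \<rho> n assume \<rho>: "\<rho> \<in> Q" "n \<le> length \<rho>" "sublist (take n \<rho>) (B @ winv B')" and "\<not> 8 * n \<le> 7 * length \<rho>"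
  then have n: "7 * length \<rho> < 8 * n" by simp
  have "w = A @ B @ D" using w(1) B(1) by simp
  moreover have "w = A' @ B' @ D'" using w(2) B(2) by simp
  ultimately have "sublist B w" "sublist B' w" by (metis sublist_appendI)+
  then have t: "tame B" "tame (winv B')" using tame_sublist[OF w(3)] tame_winv by blast+
  let ?c = "take n \<rho>"
  obtain x y where "B @ winv B' = x @ ?c @ y" using \<rho>(3) by (auto simp: sublist_def)
  then show False
  proof (cases rule: append_cases)
    case 2
    then have "sublist ?c (winv B')" by (metis sublist_appendI)
    then show False using t(2) \<rho>(1,2) n unfolding tame_def by fastforce
  next
    case (1 us)
    from 1(2) show False
    proof (cases rule: append_cases)
      case (1 vs)
      then have "sublist ?c B" using \<open>B = x @ us\<close> by (metis sublist_appendI)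
      then show False using t(1) \<rho>(1,2) n unfolding tame_def by fastforce
    next
      case (2 vs)
      have \<rho>e: "\<rho> = us @ [] @ vs @ drop n \<rho>" using 2(1) by (metis append_take_drop_id append_assoc append_Nil)
      have len: "n = length us + length vs" using arg_cong[OF 2(1), of length] \<rho>(2) by simp
      have p1: "prefix us \<rho>" using \<rho>e by (metis prefixI)
      have "24 * length us < 14 * length \<rho>"
        by (rule tame_prefix[OF t(1) \<rho>(1) p1]) (simp add: 1(1))
      moreover have "24 * length vs < 14 * length \<rho>"
      proof -
        have "vs @ drop n \<rho> @ us \<in> Q" using rot_split[of us "vs @ drop n \<rho>"] \<rho>(1) \<rho>e by simp
        from tame_prefix[OF t(2) this, of vs] have "24 * length vs < 14 * length (vs @ drop n \<rho> @ us)" using 2(2) by simp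
        moreover have "length (vs @ drop n \<rho> @ us) = length \<rho>" using \<rho>e by (metis (no_types, opaque_lifting) append_Nil append_assoc length_rotate rotate_append)
        ultimately show ?thesis by simp
      qed
      ultimately have l: "length \<rho> \<le> 8 * length us" "length \<rho> \<le> 8 * length vs" using n len by linarith+
      have eV: "e U \<otimes> e [] = g \<otimes> inv (e (winv U'))" using eq g by simp
      have wU: "w = winv (winv U') @ D'" using w(2) by simp
      have VU: "winv U' = vs @ (y @ winv A')" using B(2) 2(2) by (simp add: winv_append)
      have UU: "U = (A @ x) @ us" using B(1) 1(1) by simp
      have "fat w g" by (rule fat_tip[OF g w(1) wU eV UU VU \<rho>e \<rho>(1) l])
      then show False using nf by simp
    qed
  qed
qed

text \<open>Apply \<open>tip\<close> at the end of \<open>w\<close>, and to the reversed word at its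
  beginning. The two bridges and the parts of \<open>w\<close> and its translate between them form a
  closed path, which is reduced and without chunks if the bridge at the end is nonempty; this
  contradicts Greendlinger's lemma. Once the two paths meet, the same argument bounds the part
  before their common suffix by one arc.\<close>

theorem overlap:
  assumes t: "tight xs" and g: "g \<in> carrier G" and k: "arc_len g \<le> k" "arc_len (inv (e (label xs)) \<otimes> g \<otimes> e (label xs)) \<le> k"
    and nf: "\<not> fat (label xs) g" and big: "2 * (23 * k + 4) + 2 \<le> length xs"
  obtains A \<mu> C A' C' where "label xs = A @ \<mu> @ C" "label xs = A' @ \<mu> @ C'" "e A = g \<otimes> e A'"
    "arc_len (e A) \<le> 24 * k + 5" "arc_len (e C) \<le> 23 * k + 4"
proof -
  define w where "w = label xs"
  define h where "h = e w"
  define K where "K = 23 * k + 4"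
  have h: "h \<in> carrier G" by (simp add: h_def)
  have m: "length xs = arc_len h" "arc_list xs" using t by (simp_all add: tight_def h_def w_def)
  have w: "reduced w" "tame w" using tight_reduced[OF t] tight_tame[OF t] by (simp_all add: w_def)
  have Sw: "fst ` set w \<subseteq> S" using arc_list_letters[OF m(2)] by (simp add: w_def)
  have mono: "arc_len (e A) \<le> arc_len (e (A @ B)) + 1" if "w = A @ B @ C" for A B C
    using tight_split[OF t] that by (simp add: w_def)
  obtain \<gamma>1 where \<gamma>1: "arc_list \<gamma>1" "length \<gamma>1 = arc_len (inv h \<otimes> g \<otimes> h)" "e (label \<gamma>1) = inv h \<otimes> g \<otimes> h" using arc_len_ex h g by (metis m_closed inv_closed)
  obtain \<gamma>2 where \<gamma>2: "arc_list \<gamma>2" "length \<gamma>2 = arc_len g" "e (label \<gamma>2) = g" using arc_len_ex[OF g] by blast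
  have K1: "23 * length \<gamma>1 + 4 \<le> K" "23 * length \<gamma>2 + 4 \<le> K" using k \<gamma>1 \<gamma>2 by (simp_all add: K_def h_def w_def)
  have 1: "e w \<otimes> e (label \<gamma>1) = g \<otimes> e w" using \<gamma>1(3) g h by (simp add: h_def m_assoc)
  obtain U D U' D' \<gamma>t where T: "w = U @ D" "w = U' @ D'" "arc_list \<gamma>t" "e U \<otimes> e (label \<gamma>t) = g \<otimes> e U'"
    "arc_len (e D) \<le> 23 * length \<gamma>1 + 4" "arc_len (e D') \<le> 23 * length \<gamma>1 + 4"
    "\<gamma>t = [] \<or> reduced (U @ label \<gamma>t @ winv U') \<and> nochunk (U @ label \<gamma>t @ winv U')"
    by (rule tip[OF w g \<gamma>1(1) 1 nf[folded w_def]])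
  have TK: "arc_len (e D) \<le> K" "arc_len (e D') \<le> K" using T(5,6) K1(1) by linarith+
  have g': "inv h \<otimes> g \<otimes> h \<in> carrier G" using g h by simp
  have 2: "e (winv w) \<otimes> e (label \<gamma>2) = (inv h \<otimes> g \<otimes> h) \<otimes> e (winv w)" using \<gamma>2(3) g h by (simp add: m_assoc flip: h_def)
  have nf': "\<not> fat (winv w) (inv h \<otimes> g \<otimes> h)" using nf fat_winv[of w g] g by (auto simp: w_def h_def)
  obtain P E P' E' \<gamma>b where B: "winv w = P @ E" "winv w = P' @ E'" "arc_list \<gamma>b" "e P \<otimes> e (label \<gamma>b) = (inv h \<otimes> g \<otimes> h) \<otimes> e P'"
    "arc_len (e E) \<le> 23 * length \<gamma>2 + 4" "arc_len (e E') \<le> 23 * length \<gamma>2 + 4"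
    "\<gamma>b = [] \<or> reduced (P @ label \<gamma>b @ winv P') \<and> nochunk (P @ label \<gamma>b @ winv P')"
    by (rule tip[OF reduced_winv[OF w(1)] tame_winv[OF w(2)] g' \<gamma>2(1) 2 nf'])
  define A0 A0' where "A0 = winv E" and "A0' = winv E'"
  have A0: "w = A0 @ winv P" "w = A0' @ winv P'" using B(1,2) unfolding A0_def A0'_def by (metis winv_append winv_winv)+
  have LA: "arc_len (e A0) \<le> K" "arc_len (e A0') \<le> K" using B(5,6) K1(2) by (simp_all add: A0_def A0'_def)
  \<comment> \<open>The parts cut off at the two ends do not overlap: each has arc length at most
    \<open>K\<close>, and \<open>w\<close> needs more than \<open>2 * K + 1\<close> arcs.\<close>
  have pre: "\<exists>B. U = A @ B \<and> V = B @ D" if d: "w = A @ V" "w = U @ D" "arc_len (e A) \<le> K" "arc_len (e D) \<le> K" for A V U D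
  proof -
    have "U @ D = A @ V" using d(1,2) by metis
    then show ?thesis
    proof (cases rule: append_cases)
      case (2 us)
      have "w = U @ us @ V" using d(1) 2(1) by simp
      have "arc_len (e U) \<le> arc_len (e (U @ us)) + 1" by (rule mono[of _ _ V]) (use d(2) 2 in simp)
      then have "arc_len (e U) \<le> K + 1" using d(3) 2 by simp
      moreover have "arc_len h \<le> arc_len (e U) + arc_len (e D)" using arc_len_mult[of "e U" "e D"] d(2) by (simp add: h_def)
      ultimately have "arc_len h \<le> 2 * K + 1" using d(4) by linarith
      then show ?thesis using big m(1) by (simp add: K_def)
    qed blast
  qed
  obtain B where Bd: "U = A0 @ B" "winv P = B @ D" using pre[OF A0(1) T(1) LA(1) TK(1)] by blast
  obtain B' where Bd': "U' = A0' @ B'" "winv P' = B' @ D'" using pre[OF A0(2) T(2) LA(2) TK(2)] by blast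
  have LB: "2 \<le> arc_len (e B')"
  proof -
    have "arc_len h \<le> arc_len (e A0') + arc_len (e B' \<otimes> e D')" using arc_len_mult[of "e A0'" "e B' \<otimes> e D'"] T(2) Bd' by (simp add: h_def m_assoc)
    moreover have "arc_len (e B' \<otimes> e D') \<le> arc_len (e B') + arc_len (e D')" by (simp add: arc_len_mult)
    ultimately show ?thesis using LA(2) TK(2) big m(1) by (simp add: K_def)
  qed
  have inv_h: "e P = inv h \<otimes> e A" if "w = A @ winv P" for A P
    using arg_cong[OF that, of e] by (simp add: h_def inv_mult_group m_assoc)
  note eP = inv_h[OF A0(1)] inv_h[OF A0(2)]
  have b: "e A0 \<otimes> e (label \<gamma>b) = g \<otimes> e A0'"
  proof -
    have "inv h \<otimes> (e A0 \<otimes> e (label \<gamma>b)) = inv h \<otimes> (g \<otimes> e A0')" using B(4) g h by (simp add: eP m_assoc)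
    then show ?thesis using g h by simp
  qed
  have loop: "e B \<otimes> e (label \<gamma>t) = e (label \<gamma>b) \<otimes> e B'"
  proof -
    have "e A0 \<otimes> (e B \<otimes> e (label \<gamma>t)) = g \<otimes> e A0' \<otimes> e B'" using T(4) g Bd Bd' by (simp add: m_assoc)
    also have "\<dots> = e A0 \<otimes> (e (label \<gamma>b) \<otimes> e B')" using b[symmetric] by (simp add: m_assoc)
    finally show ?thesis by simp
  qed
  have P: "P = winv D @ winv B" using Bd(2) by (metis winv_append winv_winv)
  have bot: "reduced (winv B' @ winv (label \<gamma>b)) \<and> nochunk (winv B' @ winv (label \<gamma>b))" if nb: "\<gamma>b \<noteq> []"
  proof -
    have "reduced (P @ label \<gamma>b @ B' @ D')" "nochunk (P @ label \<gamma>b @ B' @ D')" using B(7) nb Bd'(2) by auto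
    then have "reduced (label \<gamma>b @ B')" "nochunk (label \<gamma>b @ B')"
      using reduced_sublist nochunk_sublist sublist_mid by blast+
    then show ?thesis using reduced_winv nochunk_winv winv_append by metis
  qed
  have sB: "sublist B w" unfolding T(1) Bd(1) append_assoc by (rule sublist_appendI)
  have sB': "sublist B' w" unfolding T(2) Bd'(1) append_assoc by (rule sublist_appendI)
  have SB: "fst ` set B \<subseteq> S" "fst ` set B' \<subseteq> S" using Sw set_mono_sublist sB sB' by blast+
  have Sg: "fst ` set (label \<gamma>t) \<subseteq> S" "fst ` set (label \<gamma>b) \<subseteq> S" using arc_list_letters T(3) B(3) by auto
  \<comment> \<open>The words around the two bridges are glued along \<open>winv B'\<close>, which
    is too long to lie in a relator.\<close>
  have "\<gamma>t = []"
  proof (rule ccontr)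
    assume nt: "\<gamma>t \<noteq> []"
    have "reduced (A0 @ (B @ label \<gamma>t) @ winv B' @ winv A0')" "nochunk (A0 @ (B @ label \<gamma>t) @ winv B' @ winv A0')"
      using T(7) nt Bd(1) Bd'(1) by (auto simp: winv_append)
    then have top: "reduced ((B @ label \<gamma>t) @ winv B')" "nochunk ((B @ label \<gamma>t) @ winv B')"
      using reduced_sublist nochunk_sublist sublist_mid by blast+
    let ?Z = "(B @ label \<gamma>t) @ winv B' @ winv (label \<gamma>b)"
    have B'n: "winv B' \<noteq> []" "2 \<le> arc_len (e (winv B'))" using LB by (auto)
    have "reduced ?Z \<and> nochunk ?Z"
    proof (cases "\<gamma>b = []")
      case False
      then show ?thesis using reduced_glue[OF top(1)] nochunk_glue[OF top(2)] bot B'n by blast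
    qed (use top in simp)
    moreover have "e ?Z = \<one>"
    proof -
      have "e ?Z = e B \<otimes> e (label \<gamma>t) \<otimes> inv (e (label \<gamma>b) \<otimes> e B')" by (simp add: m_assoc inv_mult_group)
      then show ?thesis using loop by simp
    qed
    moreover have "fst ` set ?Z \<subseteq> S" unfolding set_append image_Un letters_winv using SB Sg by blast
    ultimately have "?Z = []" using nochunk_trivial by blast
    then show False using B'n by simp
  qed
  then have eU: "e U = g \<otimes> e U'" and eB: "e B = e (label \<gamma>b) \<otimes> e B'" using T(4) loop by simp_all
  obtain B1 B1' \<mu> where cs: "B = B1 @ \<mu>" "B' = B1' @ \<mu>" "B1 = [] \<or> B1' = [] \<or> last B1 \<noteq> last B1'"
    by (rule common_suffix)
  let ?A = "A0 @ B1" and ?A' = "A0' @ B1'"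
  have wA: "w = ?A @ \<mu> @ D" "w = ?A' @ \<mu> @ D'" using T(1,2) Bd(1) Bd'(1) cs by simp_all
  have eA: "e ?A = g \<otimes> e ?A'"
  proof -
    have "e ?A \<otimes> e \<mu> = g \<otimes> e ?A' \<otimes> e \<mu>" using eU Bd(1) Bd'(1) cs g by (simp add: m_assoc)
    then show ?thesis using g by (simp del: e_append)
  qed
  \<comment> \<open>\<open>B1 @ winv B1'\<close> is reduced because \<open>\<mu>\<close> is the
    longest common suffix, and has no chunk by \<open>straddle\<close>; the bridge at the beginning
    is glued along \<open>winv B1'\<close>.\<close>
  have "arc_len (e B1') \<le> 1"
  proof (rule ccontr)
    assume "\<not> arc_len (e B1') \<le> 1"
    then have L: "2 \<le> arc_len (e (winv B1'))" "winv B1' \<noteq> []" by auto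
    have r: "reduced B1" "reduced B1'"
      using reduced_sublist[OF w(1) sB] reduced_sublist[OF w(1) sB'] unfolding cs(1,2) reduced_append by blast+
    have "B1 \<noteq> [] \<Longrightarrow> hd (winv B1') \<noteq> linv (last B1)"
      using cs(3) L(2) hd_winv[of B1'] by (metis linv_linv winv_eq_Nil)
    then have rB: "reduced (B1 @ winv B1')" using r(1) reduced_winv[OF r(2)] by (auto simp: reduced_append)
    have nB: "nochunk (B1 @ winv B1')"
      by (rule straddle[OF g wA w(2)  eA HOL.refl HOL.refl]) (use nf in \<open>simp add: w_def\<close>)
    let ?Z = "B1 @ winv B1' @ winv (label \<gamma>b)"
    have "reduced ?Z \<and> nochunk ?Z"
    proof (cases "\<gamma>b = []")
      case False
      have "winv B' @ winv (label \<gamma>b) = winv \<mu> @ winv B1' @ winv (label \<gamma>b)" using cs(2) by (simp add: winv_append)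
      then have "reduced (winv B1' @ winv (label \<gamma>b))" "nochunk (winv B1' @ winv (label \<gamma>b))"
        using bot[OF False] reduced_append[of "winv \<mu>"] nochunk_sublist sublist_append_leftI by (metis, metis)
      then show ?thesis using reduced_glue[OF rB] nochunk_glue[OF nB] L by blast
    qed (use rB nB in simp)
    moreover have "e ?Z = \<one>"
    proof -
      have "e B1 \<otimes> e \<mu> = e (label \<gamma>b) \<otimes> e B1' \<otimes> e \<mu>" using eB cs by (simp add: m_assoc)
      then have "e B1 = e (label \<gamma>b) \<otimes> e B1'" by simp
      moreover have "e ?Z = e B1 \<otimes> inv (e (label \<gamma>b) \<otimes> e B1')" by (simp add: inv_mult_group)
      ultimately show ?thesis by simp
    qed
    moreover have "fst ` set ?Z \<subseteq> S" using SB Sg(2) unfolding cs(1,2) set_append image_Un letters_winv by blast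
    ultimately have "?Z = []" using nochunk_trivial by blast
    then show False using L by simp
  qed
  then have "arc_len (e ?A') \<le> K + 1" using arc_len_mult[of "e A0'" "e B1'"] LA(2) by simp
  \<comment> \<open>This is the \<open>24 * k + 5\<close> of the conclusion.\<close>
  then have "arc_len (e ?A) \<le> k + K + 1" using eA arc_len_mult[OF g, of "e ?A'"] k(1) by simp
  then show thesis using that[of ?A \<mu> D ?A' D'] wA eA TK(1) by (simp add: w_def K_def)
qed

end

section \<open>Counting translations\<close>

lemma append_longer:
  assumes "a @ b = c @ d" "length c \<le> length a"
  obtains us where "a = c @ us" "us @ b = d"
  using assms(1)
proof (cases rule: append_cases)
  case (2 us)
  then show thesis using assms that[of "[]"] by simp
qed (use that in blast)

lemma power_period:
  assumes "take m (drop d w) = take m w" "m + d \<le> length w"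
  shows "n * d \<le> m + d \<Longrightarrow> take (n * d) w = concat (replicate n (take d w))"
proof (induction n)
  case (Suc n)
  then have n: "n * d \<le> m" by simp
  have "take (Suc n * d) w = take d w @ take (n * d) (drop d w)" by (simp add: take_add)
  also have "take (n * d) (drop d w) = take (n * d) (take m (drop d w))" using n by simp
  also have "\<dots> = take (n * d) w" using n assms(1) by simp
  finally show ?case using Suc.IH n by simp
qed simp

lemma gap_sum:
  fixes K :: "nat set"
  assumes "finite K" "K \<noteq> {}" "\<And>k k'. k \<in> K \<Longrightarrow> k' \<in> K \<Longrightarrow> k < k' \<Longrightarrow> k + g \<le> k'"
  shows "Min K + g * (card K - 1) \<le> Max K"
  using assms
proof (induction K rule: finite_linorder_max_induct)
  case (insert b A)
  show ?case
  proof (cases "A = {}")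
    case False
    have "Max A \<in> A" using False insert by simp
    then have "Max A + g \<le> b" using insert.prems(2)[of "Max A" b] insert.hyps(2) by simp
    moreover have "Min A + g * (card A - 1) \<le> Max A" using insert.IH[OF False] insert.prems(2) by blast
    moreover have "Min (insert b A) \<le> Min A" using False insert by simp
    moreover have "Max (insert b A) = b" using insert by (intro Max_eqI) (auto intro: less_imp_le)
    moreover have "card (insert b A) = Suc (card A)" "card A \<noteq> 0" using insert False by auto
    ultimately show ?thesis by (cases "card A") auto
  qed simp
qed simp

text \<open>The least difference of two elements fits between any two neighbours, and more than
  \<open>n\<close> elements have at least \<open>n\<close> such gaps.\<close>

lemma small_gap:
  fixes K :: "nat set"
  assumes K: "finite K" "n < card K" and n: "0 < n"
  shows "\<exists>k\<in>K. \<exists>k'\<in>K. k < k' \<and> Min K + n * (k' - k) \<le> Max K"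
proof -
  let ?D = "{d. \<exists>k\<in>K. \<exists>k'\<in>K. k < k' \<and> d = k' - k}"
  have "card K \<noteq> 0" using assms by linarith
  then have ne: "K \<noteq> {}" by auto
  have "Min K \<noteq> Max K"
  proof
    assume e: "Min K = Max K"
    have "x = Min K" if "x \<in> K" for x using Min_le[OF K(1) that] Max_ge[OF K(1) that] e by simp
    then have "K \<subseteq> {Min K}" by blast
    then have "card K \<le> 1" using card_mono[of "{Min K}" K] by simp
    then show False using assms by simp
  qed
  moreover have "Min K \<le> Max K" using K ne by simp
  ultimately have "Min K < Max K" by simp
  then have "Max K - Min K \<in> ?D" using Min_in[OF K(1) ne] Max_in[OF K(1) ne] by blast
  then have d: "(LEAST d. d \<in> ?D) \<in> ?D" by (rule LeastI)
  define g where "g = (LEAST d. d \<in> ?D)"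
  obtain k k' where k: "k \<in> K" "k' \<in> K" "k < k'" "g = k' - k" using d unfolding g_def by blast
  have "a + g \<le> b" if "a \<in> K" "b \<in> K" "a < b" for a b
  proof -
    have "g \<le> b - a" unfolding g_def by (rule Least_le) (use that in blast)
    then show ?thesis using that by simp
  qed
  then have "Min K + g * (card K - 1) \<le> Max K" using gap_sum[OF K(1) ne] by blast
  moreover have "n \<le> card K - 1" using K(2) by linarith
  then have "n * g \<le> g * (card K - 1)" by (simp add: mult.commute)
  ultimately have "Min K + n * g \<le> Max K" by linarith
  then show ?thesis using k by blast
qed

context scg_rel
begin

text \<open>Since \<open>Q\<close> is closed under rotation, excluding powers at the start of a
  relator excludes them everywhere in a cyclic relator.\<close>

definition power_free :: "nat \<Rightarrow> bool" where
  "power_free n \<longleftrightarrow> (\<forall>r\<in>Q. \<forall>z. z \<noteq> [] \<longrightarrow> \<not> prefix (concat (replicate n z)) r)"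

lemma power_free_pos: "power_free n \<Longrightarrow> r \<in> Q \<Longrightarrow> 0 < n"
  using ne[of r] unfolding power_free_def by (cases n) auto

lemma power_free_period:
  assumes pf: "power_free n" and r: "r \<in> Q" "prefix t r" and d: "0 < d" "n * d \<le> length t"
    and per: "take (length t - d) (drop d t) = take (length t - d) t"
  shows False
proof -
  have n: "0 < n" using power_free_pos[OF pf r(1)] .
  then have dt: "d \<le> length t" using d(2) by (metis One_nat_def Suc_leI le_trans mult.left_neutral mult_le_mono1)
  have "take (n * d) t = concat (replicate n (take d t))"
    by (rule power_period[OF per]) (use d dt in auto)
  then have "prefix (concat (replicate n (take d t))) t" by (metis take_is_prefix)
  then have "prefix (concat (replicate n (take d t))) r" using r(2) by (rule prefix_order.trans)
  moreover have "take d t \<noteq> []" using d dt by auto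
  ultimately show False using pf r(1) unfolding power_free_def by blast
qed

text \<open>More than \<open>n\<close> coinciding rotations include two whose difference
  \<open>d\<close> is at most 1/n of the length, and \<open>t\<close> then has the period
  \<open>d\<close>.\<close>

lemma card_rotations:
  assumes pf: "power_free n" and t: "t \<in> Q" and L: "length r = length t"
  shows "card {k. k < length r \<and> rotate k r = t} \<le> n"
proof (rule ccontr)
  define K where "K = {k. k < length r \<and> rotate k r = t}"
  assume "\<not> ?thesis"
  then have K: "finite K" "n < card K" by (auto simp: K_def)
  obtain k k' where k: "k \<in> K" "k' \<in> K" "k < k'" "Min K + n * (k' - k) \<le> Max K"
    using small_gap[OF K power_free_pos[OF pf t]] by blast
  have "K \<noteq> {}" using k by blast
  then have "Max K \<in> K" by (rule Max_in[OF K(1)])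
  then have M: "Max K < length r" by (simp add: K_def)
  have kr: "rotate k r = t" "rotate k' r = t" "k' < length r" using k by (auto simp: K_def)
  define d where "d = k' - k"
  have "n * d \<le> Max K" using k(4) unfolding d_def by linarith
  then have d: "0 < d" "d < length t" "n * d \<le> length t" using k(3) kr(3) M L unfolding d_def by linarith+
  have "rotate d t = t" using kr k(3) rotate_rotate[of d k r] by (simp add: d_def)
  then have "drop d t @ take d t = t" using d(2) by (simp add: rotate_drop_take)
  then have "take (length t - d) (drop d t) = take (length t - d) t"
    by (metis append_eq_conv_conj length_drop order_refl take_all)
  then show False using power_free_period[OF pf t _ d(1,3)] by simp
qed

text \<open>\<open>g\<close> is determined by the position of \<open>g \<otimes> p2\<close> on the
  cycle. For either direction in which \<open>r2\<close> may be read there are at most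
  \<open>n\<close> positions.\<close>

lemma card_same_cycle:
  assumes pf: "power_free n" and r: "r1 \<in> Q" "r2 \<in> Q" and p: "p1 \<in> carrier G" "p2 \<in> carrier G"
  shows "finite {g \<in> carrier G. cyc p1 r1 = cyc (g \<otimes> p2) r2} \<and>
    card {g \<in> carrier G. cyc p1 r1 = cyc (g \<otimes> p2) r2} \<le> 2 * n"
proof -
  let ?K = "\<lambda>t. {k. k < length r1 \<and> rotate k r1 = t}"
  let ?f = "\<lambda>k. p1 \<otimes> e (take k r1) \<otimes> inv p2"
  let ?A = "{g \<in> carrier G. cyc p1 r1 = cyc (g \<otimes> p2) r2}"
  have sub: "?A \<subseteq> ?f ` (?K r2 \<union> ?K (winv r2))"
  proof
    fix g assume "g \<in> ?A"
    then have g: "g \<in> carrier G" "same p1 r1 (g \<otimes> p2) r2" using cyc_eq_iff p by auto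
    obtain k where k: "k < length r1" "g \<otimes> p2 = p1 \<otimes> e (take k r1)"
      "r2 = drop k r1 @ take k r1 \<or> r2 = winv (drop k r1 @ take k r1)"
      using same_normal[OF g(2) p(1) r(1)] by blast
    have "g = g \<otimes> p2 \<otimes> inv p2" using g(1) p by (simp add: m_assoc)
    then have "g = ?f k" using k(2) by simp
    moreover have "k \<in> ?K r2 \<union> ?K (winv r2)" using k(1,3) by (auto simp: rotate_drop_take)
    ultimately show "g \<in> ?f ` (?K r2 \<union> ?K (winv r2))" by blast
  qed
  have fin: "finite (?K r2 \<union> ?K (winv r2))" by simp
  have *: "card (?K t) \<le> n" if "t \<in> Q" for t
  proof (cases "length r1 = length t")
    case False
    then have "?K t = {}" by auto
    then show ?thesis by (simp only: card.empty)
  qed (use card_rotations[OF pf that] in simp)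
  have "card ?A \<le> card (?f ` (?K r2 \<union> ?K (winv r2)))" using card_mono[OF finite_imageI[OF fin] sub] .
  also have "\<dots> \<le> card (?K r2 \<union> ?K (winv r2))" using card_image_le[OF fin] .
  also have "\<dots> \<le> card (?K r2) + card (?K (winv r2))" by (rule card_Un_le)
  also have "\<dots> \<le> 2 * n" using *[OF r(2)] *[OF winv_mem[OF r(2)]] by simp
  finally show ?thesis using finite_subset[OF sub finite_imageI[OF fin]] by blast
qed

end

context arcgen
begin

text \<open>Two arcs strictly inside \<open>z\<close> would form a block, so at most three arcs meet
  \<open>z\<close>. One of them has at least a third of 1/8, that is 1/24, of the relator, too much
  for a piece.\<close>

lemma fat_arc:
  assumes t: "tight xs" and w: "label xs = x @ z @ y" and \<rho>: "\<rho> \<in> Q" "prefix z \<rho>" "length \<rho> \<le> 8 * length z"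
  shows "\<exists>i<length xs. cyc (e x) \<rho> = cyc (e (label (take i xs))) (snd (xs ! i))"
proof -
  have arc_list: "arc_list xs" using t by (simp add: tight_def)
  have idx: "\<exists>i<length xs. c = cyc (e (label (take i xs))) (snd (xs ! i))"
    if "xs = as @ (u, r) # bs" "c = cyc (e (label as)) r" for as u r bs c
    using that by (intro exI[of _ "length as"]) simp
  obtain \<tau> where tl: "\<rho> = z @ \<tau>" using \<rho>(2) by (auto simp: prefix_def)
  have L0: "0 < length \<rho>" using ne[OF \<rho>(1)] by simp
  then have z: "z \<noteq> []" using \<rho>(3) by auto
  have "concat (map fst xs) = x @ z @ y" using w .
  then show ?thesis using z
  proof (cases rule: concat_overlap)
    case (one as0 u bs0 x' y')
    obtain as r ts where xs: "xs = as @ (u, r) # ts" "map fst as = as0" using one(1) map_fst_split by (metis append_Cons append_Nil)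
    have "arc u r" using arc_list xs by simp
    then have a: "arc (x' @ z) r" using one(2) arc_pre[of "x' @ z" y'] by simp
    have "24 * length z \<ge> length (z @ \<tau>)" using \<rho>(3) tl by simp
    then have "cyc \<one> r = cyc (e (x' @ z)) (\<tau> @ z)" using left_end[OF _ a, of \<tau>] \<rho>(1) tl by auto
    then have "cyc (e (label as) \<otimes> \<one>) r = cyc (e (label as) \<otimes> e (x' @ z)) (\<tau> @ z)" by (rule cyc_left) simp_all
    also have "e (label as) \<otimes> e (x' @ z) = e x \<otimes> e z" using one(3) xs(2) by (simp add: m_assoc)
    also have "cyc (e x \<otimes> e z) (\<tau> @ z) = cyc (e x) \<rho>" using cyc_split[of "e x" z \<tau>] tl by simp
    finally have "cyc (e x) \<rho> = cyc (e (label as)) r" by simp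
    then show ?thesis by (rule idx[OF xs(1)])
  next
    case (many as0 u ms0 v bs0 x' z0 z1 y')
    obtain as r ts where xs: "xs = as @ (u, r) # ts" "map fst as = as0" "map fst ts = ms0 @ v # bs0"
      using many(1) map_fst_split by (metis append_Cons append_Nil)
    obtain ms rv bs where ts: "ts = ms @ (v, rv) # bs" "map fst ms = ms0" using xs(3) map_fst_split by metis
    have a: "arc (x' @ z0) r" "arc (z1 @ y') rv" "arc_list ms" using arc_list xs ts many(2,3) by auto
    have \<rho>e: "\<rho> = z0 @ label ms @ z1 @ \<tau>" using tl many(4) ts(2) by simp
    let ?\<rho>1 = "label ms @ z1 @ \<tau> @ z0" and ?\<rho>2 = "z1 @ \<tau> @ z0 @ label ms"
    have Q12: "?\<rho>1 \<in> Q" "?\<rho>2 \<in> Q"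
      using rot_split[of z0 "label ms @ z1 @ \<tau>"] rot_split[of "z0 @ label ms" "z1 @ \<tau>"] \<rho>(1) \<rho>e by simp_all
    have is_exit: "e x \<otimes> e z0 = e (label (as @ [(u, r)]))" using many(2,7) xs(2) by (simp add: m_assoc)
    have c1: "cyc (e x) \<rho> = cyc (e x \<otimes> e z0) ?\<rho>1" using cyc_split[of "e x" z0 "label ms @ z1 @ \<tau>"] \<rho>e by simp
    have c2: "cyc (e x \<otimes> e z0) ?\<rho>1 = cyc (e x \<otimes> e z0 \<otimes> e (label ms)) ?\<rho>2"
      using cyc_split[of "e x \<otimes> e z0" "label ms" "z1 @ \<tau> @ z0"] by simp
    have lms: "length ms \<le> 1"
    proof (rule ccontr)
      assume "\<not> length ms \<le> 1"
      then have "2 \<le> length ms" by simp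
      moreover have "on_cycle (cyc (e (label (as @ [(u, r)]))) ?\<rho>1) (e (label (as @ [(u, r)]))) ms"
        by (rule on_cycle_sub[OF _ Q12(1)]) simp_all
      moreover have "tight ((as @ [(u, r)]) @ ms @ ((v, rv) # bs))" using t xs ts by simp
      ultimately show False using tight_no_block by blast
    qed
    have len: "length z = length z0 + length (label ms) + length z1" using many(4) ts(2) by simp
    have L: "length ?\<rho>1 = length \<rho>" "length ?\<rho>2 = length \<rho>" using \<rho>e by simp_all
    consider "length \<rho> \<le> 24 * length z0" | "length \<rho> \<le> 24 * length (label ms)" | "length \<rho> \<le> 24 * length z1"
      using len \<rho>(3) by linarith
    then show ?thesis
    proof cases
      case 1
      have "cyc \<one> r = cyc (e (x' @ z0)) ((label ms @ z1 @ \<tau>) @ z0)"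
        using left_end[OF _ a(1), of "label ms @ z1 @ \<tau>"] \<rho>(1) \<rho>e 1 by auto
      then have "cyc (e (label as) \<otimes> \<one>) r = cyc (e (label as) \<otimes> e (x' @ z0)) ((label ms @ z1 @ \<tau>) @ z0)" by (rule cyc_left) simp_all
      also have "e (label as) \<otimes> e (x' @ z0) = e x \<otimes> e z0" using is_exit many(2) by simp
      finally have "cyc (e x) \<rho> = cyc (e (label as)) r" using c1 by simp
      then show ?thesis by (rule idx[OF xs(1)])
    next
      case 2
      then have "ms \<noteq> []" using L0 by auto
      then obtain m rm where m: "ms = [(m, rm)]" using lms by (cases ms; cases "tl ms") auto
      have am: "arc (m @ []) rm" using a(3) m by simp
      have "prefix m ?\<rho>1" using m by simp
      then have "rm = ?\<rho>1" using right_end[OF Q12(1) _ am] 2 L m by auto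
      then have "cyc (e x) \<rho> = cyc (e (label (as @ [(u, r)]))) rm" using c1 is_exit by simp
      moreover have "xs = (as @ [(u, r)]) @ (m, rm) # ((v, rv) # bs)" using xs ts m by simp
      ultimately show ?thesis by (rule idx[rotated])
    next
      case 3
      have "rv = ?\<rho>2" using right_end[OF Q12(2) _ a(2)] 3 L by auto
      moreover have "xs = (as @ (u, r) # ms) @ (v, rv) # bs" using xs ts by simp
      moreover have "e x \<otimes> e z0 \<otimes> e (label ms) = e (label (as @ (u, r) # ms))" using is_exit by (simp add: m_assoc)
      ultimately have "cyc (e x) \<rho> = cyc (e (label (as @ (u, r) # ms))) rv" "xs = (as @ (u, r) # ms) @ (v, rv) # bs"
        using c1 c2 by simp_all
      then show ?thesis by (rule idx[rotated])
    qed
  qed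
qed

definition shared :: "('s word \<times> 's word) list \<Rightarrow> nat \<Rightarrow> nat \<Rightarrow> 'g set" where
  "shared xs i j = {g \<in> carrier G. cyc (e (label (take i xs))) (snd (xs ! i)) = cyc (g \<otimes> e (label (take j xs))) (snd (xs ! j))}"

lemma fat_shared:
  assumes t: "tight xs" and g: "g \<in> carrier G" "fat (label xs) g"
  shows "\<exists>i<length xs. \<exists>j<length xs. g \<in> shared xs i j"
proof -
  obtain x1 z1 y1 \<rho>1 x2 z2 y2 \<rho>2 where
    1: "\<rho>1 \<in> Q" "label xs = x1 @ z1 @ y1" "prefix z1 \<rho>1" "length \<rho>1 \<le> 8 * length z1" and
    2: "\<rho>2 \<in> Q" "label xs = x2 @ z2 @ y2" "prefix z2 \<rho>2" "length \<rho>2 \<le> 8 * length z2" and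
    c: "cyc (e x1) \<rho>1 = cyc (g \<otimes> e x2) \<rho>2" using g(2) unfolding fat_def by blast
  obtain i where i: "i < length xs" "cyc (e x1) \<rho>1 = cyc (e (label (take i xs))) (snd (xs ! i))"
    using fat_arc[OF t 1(2,1,3,4)] by blast
  obtain j where j: "j < length xs" "cyc (e x2) \<rho>2 = cyc (e (label (take j xs))) (snd (xs ! j))"
    using fat_arc[OF t 2(2,1,3,4)] by blast
  have "cyc (g \<otimes> e x2) \<rho>2 = cyc (g \<otimes> e (label (take j xs))) (snd (xs ! j))" using cyc_left[OF j(2)] g(1) by simp
  then have "g \<in> shared xs i j" using c i g(1) by (simp add: shared_def)
  then show ?thesis using i j by blast
qed

lemma card_shared:
  assumes pf: "power_free n" and arc_list: "arc_list xs" and ij: "i < length xs" "j < length xs"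
  shows "finite (shared xs i j) \<and> card (shared xs i j) \<le> 2 * n"
proof -
  have "snd (xs ! k) \<in> Q" if "k < length xs" for k
  proof -
    have "(fst (xs ! k), snd (xs ! k)) \<in> set xs" using that by simp
    then show ?thesis using arc_list arc_Q by (fastforce simp: arc_list_def)
  qed
  then show ?thesis unfolding shared_def using card_same_cycle[OF pf] ij by simp
qed

lemma card_shared_all:
  assumes pf: "power_free n" and arc_list: "arc_list xs"
  shows "finite (\<Union>i<length xs. \<Union>j<length xs. shared xs i j) \<and>
    card (\<Union>i<length xs. \<Union>j<length xs. shared xs i j) \<le> length xs * length xs * (2 * n)"
proof -
  have *: "finite (\<Union>i<m. A i) \<and> card (\<Union>i<m. A i) \<le> m * c"
    if "\<forall>i<m. finite (A i) \<and> card (A i) \<le> c" for A :: "nat \<Rightarrow> 'g set" and m c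
  proof -
    have "card (\<Union>i<m. A i) \<le> (\<Sum>i<m. card (A i))" by (rule card_UN_le) simp
    also have "\<dots> \<le> (\<Sum>i<m. c)" by (rule sum_mono) (use that in simp)
    finally show ?thesis using that by auto
  qed
  let ?m = "length xs"
  have "\<forall>i<?m. finite (\<Union>j<?m. shared xs i j) \<and> card (\<Union>j<?m. shared xs i j) \<le> ?m * (2 * n)"
    using *[of ?m "shared xs _" "2 * n"] card_shared[OF pf arc_list] by blast
  from *[OF this] show ?thesis by (simp add: mult.assoc)
qed

lemma tight_take:
  assumes t: "tight xs" and i: "i \<le> length xs"
  shows "arc_len (e (label (take i xs))) = i"
proof -
  have arc_list: "arc_list xs" "length xs = arc_len (e (label xs))" using t by (simp_all add: tight_def)
  have a: "arc_list (take i xs)" "arc_list (drop i xs)" using arc_list(1) by (metis append_take_drop_id arc_list_simps(3))+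
  have "label xs = label (take i xs) @ label (drop i xs)" by (metis append_take_drop_id concat_append map_append)
  then have "e (label xs) = e (label (take i xs)) \<otimes> e (label (drop i xs))" by (metis e_append)
  then have "length xs \<le> arc_len (e (label (take i xs))) + arc_len (e (label (drop i xs)))"
    unfolding arc_list(2) by (metis arc_len_mult e_closed)
  moreover have "arc_len (e (label (take i xs))) \<le> i" "arc_len (e (label (drop i xs))) \<le> length xs - i"
    using arc_len_le[OF a(1)] arc_len_le[OF a(2)] i by simp_all
  ultimately show ?thesis using i by linarith
qed

lemma tight_position:
  assumes t: "tight xs" and i: "i \<le> length xs" and A: "label xs = A @ C" "arc_len (e A) + 1 < i"
  shows "length A < length (label (take i xs))"
proof (rule ccontr)
  let ?B = "label (take i xs)"
  assume n: "\<not> ?thesis"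
  have w: "label xs = ?B @ label (drop i xs)" by (metis append_take_drop_id concat_append map_append)
  then have "A @ C = ?B @ label (drop i xs)" using A(1) by simp
  then obtain us where "A = ?B @ us" using n append_longer by (metis not_less)
  then have "arc_len (e ?B) \<le> arc_len (e A) + 1" using tight_split[OF t, of ?B us C] A(1) by simp
  then show False using tight_take[OF t i] A(2) by simp
qed

text \<open>An element with an overlap is determined by the position \<open>q\<close> of \<open>w\<close> that it moves to the end of \<open>w0\<close>.
  More than \<open>n\<close> such positions on one arc force a period of at most \<open>1/n\<close> of the rest of that arc.\<close>

lemma card_overlap:
  assumes pf: "power_free n" and t: "tight xs" and m: "47 * k + 15 \<le> length xs"
  defines "Ov \<equiv> {g \<in> carrier G. arc_len g \<le> k \<and> arc_len (inv (e (label xs)) \<otimes> g \<otimes> e (label xs)) \<le> k \<and> \<not> fat (label xs) g}"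
  shows "finite Ov \<and> card Ov \<le> (25 * k + 9) * n"
proof -
  define w where "w = label xs"
  define P where "P i = length (label (take i xs))" for i
  \<comment> \<open>\<open>overlap\<close> bounds the arc length of \<open>A\<close> by
    \<open>24 * k + 5\<close>, and \<open>tight_position\<close> needs a margin of 2 for
    \<open>A\<close> to end before the arc number \<open>i0\<close>.\<close>
  define i0 where "i0 = 24 * k + 7"
  have arc_list: "arc_list xs" "length xs = arc_len (e w)" using t by (simp_all add: tight_def w_def)
  \<comment> \<open>Three further arcs: their word \<open>\<nu>\<close> is too long to lie in a
    relator, yet it has to fit into the overlap. This is why \<open>47 * k + 15\<close> exceeds
    \<open>i0 + 3 + (23 * k + 4)\<close>.\<close>
  define xs3 where "xs3 = take 3 (drop i0 xs)"
  define \<nu> where "\<nu> = label xs3"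
  define w0 where "w0 = label (take i0 xs)"
  have xs_split: "xs = take i0 xs @ xs3 @ drop (i0 + 3) xs"
    unfolding xs3_def by (metis append_take_drop_id drop_drop add.commute)
  have w_split: "w = w0 @ \<nu> @ label (drop (i0 + 3) xs)"
    unfolding w_def w0_def \<nu>_def using arg_cong[OF xs_split, of label] by simp
  have t3: "take (i0 + 3) xs = take i0 xs @ xs3" unfolding xs3_def by (simp add: take_add)
  have P3: "P (i0 + 3) = P i0 + length \<nu>" by (simp add: P_def t3 \<nu>_def)
  have arc_len\<nu>: "3 \<le> arc_len (e \<nu>)"
  proof -
    have "arc_len (e (w0 @ \<nu>)) = i0 + 3" using tight_take[OF t, of "i0 + 3"] m t3 by (simp add: i0_def w0_def \<nu>_def)
    moreover have "arc_len (e w0) = i0" using tight_take[OF t, of i0] m by (simp add: i0_def w0_def)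
    ultimately show ?thesis using arc_len_mult[of "e w0" "e \<nu>"] by simp
  qed
  define Qs where "Qs = {q. q \<le> length w \<and> arc_len (e (take q w)) \<le> i0 + k \<and> prefix \<nu> (drop q w)}"
  have "Ov \<subseteq> (\<lambda>q. e w0 \<otimes> inv (e (take q w))) ` Qs"
  proof
    fix g assume "g \<in> Ov"
    then have g: "g \<in> carrier G" "arc_len g \<le> k" "arc_len (inv (e (label xs)) \<otimes> g \<otimes> e (label xs)) \<le> k" "\<not> fat (label xs) g" by (auto simp: Ov_def)
    obtain A \<mu> C A' C' where o: "label xs = A @ \<mu> @ C" "label xs = A' @ \<mu> @ C'" "e A = g \<otimes> e A'"
      "arc_len (e A) \<le> 24 * k + 5" "arc_len (e C) \<le> 23 * k + 4"
      by (rule overlap[OF t g]) (use m in simp)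
    have A: "length A < P i0"
      unfolding P_def by (rule tight_position[OF t _ o(1)]) (use o m in \<open>simp_all add: i0_def\<close>)
    obtain s where s: "w0 = A @ s"
    proof -
      have "A @ \<mu> @ C = w0 @ \<nu> @ label (drop (i0 + 3) xs)" using o(1) w_split w_def by simp
      then have "w0 @ (\<nu> @ label (drop (i0 + 3) xs)) = A @ (\<mu> @ C)" by simp
      then show thesis using A append_longer that unfolding P_def w0_def by (metis less_imp_le)
    qed
    have \<mu>: "\<mu> @ C = s @ \<nu> @ label (drop (i0 + 3) xs)" using o(1) w_split w_def s by simp
    have "length (s @ \<nu>) \<le> length \<mu>"
    proof (rule ccontr)
      assume n: "\<not> ?thesis"
      have "\<mu> @ C = (s @ \<nu>) @ label (drop (i0 + 3) xs)" using \<mu> by simp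
      then obtain us where "s @ \<nu> = \<mu> @ us" using n append_longer by (metis linorder_le_cases)
      then have "label (take (i0 + 3) xs) = (A @ \<mu>) @ us" using s t3 by (simp add: w0_def \<nu>_def)
      moreover have "arc_list (take (i0 + 3) xs)" using arc_list(1) by (metis append_take_drop_id arc_list_simps(3))
      ultimately have "arc_len (e (A @ \<mu>)) \<le> length (take (i0 + 3) xs)" using arc_len_pre by blast
      moreover have "length xs \<le> arc_len (e (A @ \<mu>)) + arc_len (e C)"
        using arc_list(2) o(1) arc_len_mult[of "e (A @ \<mu>)" "e C"] by (simp add: w_def m_assoc)
      ultimately show False using m o(5) by (simp add: i0_def)
    qed
    then obtain us where us: "\<mu> = s @ \<nu> @ us"
    proof -
      assume l: "length (s @ \<nu>) \<le> length \<mu>" and that: "\<And>us. \<mu> = s @ \<nu> @ us \<Longrightarrow> thesis"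
      have "\<mu> @ C = (s @ \<nu>) @ label (drop (i0 + 3) xs)" using \<mu> by simp
      then obtain us where "\<mu> = (s @ \<nu>) @ us" using l append_longer by metis
      then show thesis using that by simp
    qed
    define q where "q = length (A' @ s)"
    have w': "w = (A' @ s) @ \<nu> @ us @ C'" using o(2) us by (simp add: w_def)
    have tq: "take q w = A' @ s" "drop q w = \<nu> @ us @ C'" unfolding w' q_def by simp_all
    have eq: "e w0 = g \<otimes> e (take q w)" using s o(3) g(1) by (simp add: tq m_assoc)
    have "inv g \<otimes> e w0 = e (take q w)" using eq g(1) by simp
    then have "arc_len (e (take q w)) \<le> arc_len g + arc_len (e w0)" using arc_len_mult[of "inv g" "e w0"] g(1) by simp
    moreover have "arc_len (e w0) \<le> i0" using tight_take[OF t, of i0] m by (simp add: w0_def i0_def)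
    ultimately have "q \<in> Qs" using g(2) w' unfolding Qs_def tq q_def by simp
    moreover have "g = e w0 \<otimes> inv (e (take q w))" using eq g(1) by (simp add: m_assoc)
    ultimately show "g \<in> (\<lambda>q. e w0 \<otimes> inv (e (take q w))) ` Qs" by blast
  qed
  moreover have "finite Qs" unfolding Qs_def by (rule finite_subset[of _ "{..length w}"]) auto
  moreover have "card Qs \<le> (25 * k + 9) * n"
  proof -
    \<comment> \<open>\<open>i0 + k = 25 * k + 7\<close>, again with a margin of 2.\<close>
    let ?J = "25 * k + 9"
    let ?B = "\<lambda>i. {q \<in> Qs. P i \<le> q \<and> q < P (Suc i)}"
    have Pm: "\<exists>i<j. P i \<le> q \<and> q < P (Suc i)" if "q < P j" for q j
      using that
    proof (induction j)
      case (Suc j)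
      then show ?case by (cases "q < P j") (auto intro: less_SucI)
    qed (simp add: P_def)
    have cov: "Qs \<subseteq> (\<Union>i<?J. ?B i)"
    proof
      fix q assume q: "q \<in> Qs"
      have "length (take q w) < length (label (take ?J xs))"
        by (rule tight_position[OF t, of _ _ "drop q w"]) (use m q in \<open>auto simp: Qs_def i0_def w_def\<close>)
      then have "q < P ?J" using q by (simp add: P_def Qs_def)
      then show "q \<in> (\<Union>i<?J. ?B i)" using Pm q by blast
    qed
    have one: "card (?B i) \<le> n" if i: "i < ?J" for i
    proof (rule ccontr)
      assume "\<not> ?thesis"
      then have K: "n < card (?B i)" by simp
      then have fin: "finite (?B i)" using card.infinite by fastforce
      have il: "i < length xs" using i m by simp
      obtain u r where ur: "xs ! i = (u, r)" by force
      have a: "arc u r" using arc_list(1) il ur nth_mem[OF il] by (auto simp: arc_list_def)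
      have n0: "0 < n" using power_free_pos[OF pf arc_Q[OF a]] .
      obtain q q' where q: "q \<in> ?B i" "q' \<in> ?B i" "q < q'" "Min (?B i) + n * (q' - q) \<le> Max (?B i)"
        using small_gap[OF fin K n0] by blast
      define q0 where "q0 = Min (?B i)"
      have ne: "?B i \<noteq> {}" using q by blast
      have q0: "q0 \<in> ?B i" unfolding q0_def by (rule Min_in[OF fin ne])
      have "Max (?B i) \<in> ?B i" by (rule Max_in[OF fin ne])
      define d where "d = q' - q"
      have d: "0 < d" "q0 + n * d < P (Suc i)" using q(3,4) \<open>Max (?B i) \<in> ?B i\<close> by (auto simp: d_def q0_def)
      have xs_i: "xs = take i xs @ (u, r) # drop (Suc i) xs" using id_take_nth_drop[OF il] ur by simp
      have ti: "take (Suc i) xs = take i xs @ [(u, r)]" using il ur by (simp add: take_Suc_conv_app_nth)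
      have Pi: "P (Suc i) = P i + length u" by (simp add: P_def ti)
      define x where "x = take (q0 - P i) u"
      define s where "s = drop (q0 - P i) u"
      have us: "u = x @ s" by (simp add: x_def s_def)
      have q0i: "P i \<le> q0" "q0 < P i + length u" using q0 Pi by auto
      have ls: "length s = P (Suc i) - q0" using q0i Pi by (simp add: s_def)
      have w_i: "w = (label (take i xs) @ x) @ s @ label (drop (Suc i) xs)"
        unfolding w_def using arg_cong[OF xs_i, of label] us by simp
      have "length (label (take i xs) @ x) = q0" using q0i by (simp add: x_def P_def)
      then have dr: "drop q0 w = s @ label (drop (Suc i) xs)" using w_i by simp
      have sQ: "prefix s (drop (length x) r @ take (length x) r)" "drop (length x) r @ take (length x) r \<in> Q"
        using arc_split[of x s r] a us rot_take[OF arc_Q[OF a]] by simp_all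
      have p: "prefix \<nu> (drop q0 w)" "prefix s (drop q0 w)" using q0 dr by (auto simp: Qs_def)
      \<comment> \<open>If \<open>\<nu>\<close> ended within the arc it would be part of a relator.
        So the rest \<open>s\<close> of the arc is a prefix of \<open>\<nu>\<close>; as
        \<open>\<nu>\<close> recurs after \<open>d\<close> letters, \<open>s\<close> has the period
        \<open>d\<close>.\<close>
      show False
      proof (cases "length \<nu> < length s")
        case True
        then have "prefix \<nu> s" using p prefix_length_prefix by (metis less_imp_le)
        then have "prefix \<nu> (drop (length x) r @ take (length x) r)" using sQ(1) by (rule prefix_order.trans)
        then show False using arc_len_prefix[OF sQ(2)] arc_len\<nu> by fastforce
      next
        case False
        then have s\<nu>: "prefix s \<nu>" using p prefix_length_prefix by (metis not_less)
        obtain y where y: "\<nu> = s @ y" using s\<nu> by (auto simp: prefix_def)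
        obtain z1 z2 where z: "drop q w = \<nu> @ z1" "drop q' w = \<nu> @ z2" using q(1,2) by (auto simp: Qs_def prefix_def)
        have "drop q' w = drop d (drop q w)" using q(3) by (simp add: d_def)
        then have dz: "\<nu> @ z2 = drop d \<nu> @ drop (d - length \<nu>) z1" using z by simp
        have nd: "n * d \<le> length s" "d \<le> length s"
        proof -
          show "n * d \<le> length s" using ls d(2) by simp
          moreover have "d \<le> n * d" using n0 by simp
          ultimately show "d \<le> length s" by (rule le_trans[rotated])
        qed
        let ?m = "length s - d"
        have "take ?m (drop d s) = drop d s" by simp
        moreover have "take ?m s = drop d s"
        proof -
          have "drop d \<nu> @ drop (d - length \<nu>) z1 = drop d s @ (y @ drop (d - length \<nu>) z1)" using y nd(2) by simp
          then have "s @ (y @ z2) = drop d s @ (y @ drop (d - length \<nu>) z1)" using dz y by simp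
          then show ?thesis by (metis append_eq_append_conv_if append_eq_conv_conj diff_le_self length_drop take_append)
        qed
        ultimately have "take ?m (drop d s) = take ?m s" by simp
        then show False using power_free_period[OF pf sQ(2,1) d(1) nd(1)] by simp
      qed
    qed
    have "card Qs \<le> card (\<Union>i<?J. ?B i)" by (rule card_mono[OF _ cov]) (use \<open>finite Qs\<close> in auto)
    also have "\<dots> \<le> (\<Sum>i<?J. card (?B i))" by (rule card_UN_le) simp
    also have "\<dots> \<le> (\<Sum>i<?J. n)" by (rule sum_mono) (use one in simp)
    finally show ?thesis by simp
  qed
  ultimately show ?thesis by (meson card_image_le card_mono finite_imageI finite_subset le_trans)
qed

end

section \<open>Values of cochains along products of arcs\<close>

context scg_rel
begin

fun path_value :: "(('g \<times> 's word) set \<Rightarrow> 'g \<Rightarrow> 'g \<Rightarrow> real) \<Rightarrow> 'g \<Rightarrow> ('s word \<times> 's word) list \<Rightarrow> real" where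
  "path_value \<omega> p [] = 0"
| "path_value \<omega> p ((u, r) # xs) = \<omega> (cyc p r) p (p \<otimes> e u) + path_value \<omega> (p \<otimes> e u) xs"

lemma path_value_append: "p \<in> carrier G \<Longrightarrow> path_value \<omega> p (xs @ ys) = path_value \<omega> p xs + path_value \<omega> (p \<otimes> e (label xs)) ys"
  by (induction xs arbitrary: p) (auto simp: m_assoc)

lemma path_value_inva:
  assumes anti: "\<forall>c p q. \<omega> c p q = - \<omega> c q p"
  shows "arc_list xs \<Longrightarrow> p \<in> carrier G \<Longrightarrow> path_value \<omega> (p \<otimes> e (label xs)) (inv_arcs xs) = - path_value \<omega> p xs"
proof (induction xs arbitrary: p)
  case (Cons x xs)
  obtain u r where x: "x = (u, r)" by force
  have a: "arc u r" using Cons.prems x by simp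
  let ?q = "p \<otimes> e u" and ?r = "drop (length u) r @ take (length u) r"
  have q: "?q \<in> carrier G" using Cons.prems by simp
  have u: "take (length u) r = u" using a by (simp add: arc_def)
  have c: "cyc ?q (winv ?r) = cyc p r"
    using cyc_winv[OF q, of ?r] cyc_take[OF Cons.prems(2), of "length u" r] u by simp
  have undo: "?q \<otimes> inv (e u) = p" using Cons.prems by (simp add: m_assoc)
  have "path_value \<omega> (?q \<otimes> e (label xs)) (inv_arcs xs @ [inv_arc x]) =
      path_value \<omega> (?q \<otimes> e (label xs)) (inv_arcs xs) + path_value \<omega> (?q \<otimes> e (label xs) \<otimes> e (label (inv_arcs xs))) [inv_arc x]"
    using path_value_append q by simp
  also have "?q \<otimes> e (label xs) \<otimes> e (label (inv_arcs xs)) = ?q" using q by (simp add: m_assoc)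
  also have "path_value \<omega> (?q \<otimes> e (label xs)) (inv_arcs xs) = - path_value \<omega> ?q xs" using Cons x q by simp
  also have "path_value \<omega> ?q [inv_arc x] = \<omega> (cyc p r) ?q p" using x c undo by (simp add: inv_arc_def)
  also have "\<omega> (cyc p r) ?q p = - \<omega> (cyc p r) p ?q" using anti by blast
  finally show ?case using x Cons.prems by (simp add: m_assoc)
qed simp

lemma path_value_bound:
  assumes "p \<in> carrier G"
    and "\<forall>as u r bs. xs = as @ (u, r) # bs \<longrightarrow>
      \<bar>\<omega> (cyc (p \<otimes> e (label as)) r) (p \<otimes> e (label as)) (p \<otimes> e (label as) \<otimes> e u)\<bar> \<le> 1"
  shows "\<bar>path_value \<omega> p xs\<bar> \<le> real (length xs)"
  using assms
proof (induction xs arbitrary: p)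
  case (Cons x xs)
  obtain u r where x: "x = (u, r)" by force
  have "\<bar>\<omega> (cyc p r) p (p \<otimes> e u)\<bar> \<le> 1"
    using Cons.prems(2)[rule_format, of "[]" u r xs] Cons.prems(1) x by simp
  moreover have "\<bar>path_value \<omega> (p \<otimes> e u) xs\<bar> \<le> real (length xs)"
  proof (rule Cons.IH)
    show "\<forall>as v s bs. xs = as @ (v, s) # bs \<longrightarrow>
        \<bar>\<omega> (cyc (p \<otimes> e u \<otimes> e (label as)) s) (p \<otimes> e u \<otimes> e (label as)) (p \<otimes> e u \<otimes> e (label as) \<otimes> e v)\<bar> \<le> 1"
    proof (intro allI impI)
      fix as v s bs assume "xs = as @ (v, s) # bs"
      then show "\<bar>\<omega> (cyc (p \<otimes> e u \<otimes> e (label as)) s) (p \<otimes> e u \<otimes> e (label as)) (p \<otimes> e u \<otimes> e (label as) \<otimes> e v)\<bar> \<le> 1"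
        using Cons.prems(2)[rule_format, of "(u, r) # as" v s bs] Cons.prems(1) x by (simp add: m_assoc)
    qed
  qed (use Cons.prems in simp)
  ultimately show ?case using x by simp
qed simp

end

text \<open>All steps being admissible, each arc is a record with a single step; 11 arises as in
  \<open>isoperimetric_cayley\<close>.\<close>

lemma (in filling) loop_sv:
  assumes "\<forall>c p q. A c p q" "p \<in> carrier G" "arc_list xs" "e (label xs) = \<one>"
  shows "\<bar>path_value \<omega> p xs\<bar> \<le> 11 * K * real (length xs)"
proof -
  have "\<exists>ys. valid p ys \<and> map fst ys = map fst xs \<and> sum_list (map val ys) = path_value \<omega> p xs \<and> sum_list (map len ys) = length xs"
    using assms(2,3)
  proof (induction xs arbitrary: p)
    case (Cons x xs)
    obtain u r where x: "x = (u, r)" by force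
    obtain ys where ys: "valid (p \<otimes> e u) ys" "map fst ys = map fst xs" "sum_list (map val ys) = path_value \<omega> (p \<otimes> e u) xs"
      "sum_list (map len ys) = length xs" using Cons.IH[of "p \<otimes> e u"] Cons.prems x by auto
    have "sq (cyc p r) p (p \<otimes> e u) (\<omega> (cyc p r) p (p \<otimes> e u)) 1" using seq_single assms(1) by metis
    then show ?case using ys x Cons.prems
      by (intro exI[of _ "(u, r, \<omega> (cyc p r) p (p \<otimes> e u), 1) # ys"]) simp
  qed simp
  then obtain ys where ys: "valid p ys" "map fst ys = map fst xs" "sum_list (map val ys) = path_value \<omega> p xs"
    "sum_list (map len ys) = length xs" by blast
  have l: "length ys = length xs" using arg_cong[OF ys(2), of length] by simp
  have "\<bar>path_value \<omega> p xs\<bar> \<le> K * (real (length xs) + real (potential ys))"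
    using filling[OF assms(2) ys(1)] ys(2-4) assms(4) by simp
  also have "potential ys \<le> 10 * length xs" unfolding potential_def using dirty_le[of "map fst ys"] l by simp
  then have "K * (real (length xs) + real (potential ys)) \<le> K * (11 * real (length xs))"
    using K by (intro mult_left_mono) simp_all
  finally show ?thesis by (simp add: mult.commute mult.left_commute)
qed

text \<open>Two arcs on one cycle, together with everything between them, could be replaced by one
  arc from the start of the first to the end of the second.\<close>

lemma (in arcgen) tight_distinct_cycles:
  assumes t: "tight (as @ (u, r) # ms @ (v, s) # bs)"
    and c: "cyc (e (label as)) r = cyc (e (label (as @ (u, r) # ms))) s"
  shows False
proof -
  let ?xs = "as @ (u, r) # ms @ (v, s) # bs"
  let ?q = "e (label (as @ (u, r) # ms))" and ?g = "e (label ((u, r) # ms @ [(v, s)]))"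
  have a: "arc_list as" "arc u r" "arc_list ms" "arc v s" "arc_list bs" using t by (auto simp: tight_def)
  have "take (length v) s = v" using a(4) by (simp add: arc_def)
  then have "cyc ?q s = cyc (?q \<otimes> e v) (drop (length v) s @ v)" using cyc_take[of ?q "length v" s] by simp
  then have "cyc (e (label as)) r = cyc (e (label as) \<otimes> ?g) (drop (length v) s @ v)" using c by (simp add: m_assoc)
  then have "\<exists>u' r'. arc u' r' \<and> ?g = e u' \<and> cyc (e (label as)) r' = cyc (e (label as)) r"
    by (intro cyc_arc[OF e_closed arc_Q[OF a(2)] HOL.refl]) simp_all
  then obtain u' r' where u': "arc u' r'" "?g = e u'" by blast
  have "e (label ?xs) = e (label as) \<otimes> ?g \<otimes> e (label bs)" by (simp add: m_assoc)
  then have "e (label (as @ [(u', r')] @ bs)) = e (label ?xs)" unfolding u'(2) by (simp add: m_assoc)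
  then have "length ?xs \<le> length (as @ [(u', r')] @ bs)"
    by (intro tight_min[OF t]) (use a u' in simp_all)
  then show False by simp
qed

section \<open>Long arcs and the number of translations\<close>

context cones
begin

fun light :: "'g \<Rightarrow> ('s word \<times> 's word) list \<Rightarrow> bool" where
  "light p [] \<longleftrightarrow> True"
| "light p ((u, r) # xs) \<longleftrightarrow> dX p (p \<otimes> e u) \<le> 1 \<and> light (p \<otimes> e u) xs"

lemma light_append: "p \<in> carrier G \<Longrightarrow> light p (xs @ ys) \<longleftrightarrow> light p xs \<and> light (p \<otimes> e (label xs)) ys"
  by (induction xs arbitrary: p) (auto simp: m_assoc)

lemma light_path:
  "p \<in> carrier G \<Longrightarrow> q \<in> carrier G \<Longrightarrow> \<exists>xs. arc_list xs \<and> light p xs \<and> length xs \<le> dX p q \<and> q = p \<otimes> e (label xs)"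
proof (induction "dX p q" arbitrary: q)
  case 0
  then have "p = q" using d_eq by simp
  then show ?case using 0 by (intro exI[of _ "[]"]) simp
next
  case (Suc n)
  then obtain z where z: "z \<in> carrier G" "dX p z = n" "dX z q = 1" using d_step[of p q n] by auto
  then obtain xs where xs: "arc_list xs" "light p xs" "length xs \<le> n" "z = p \<otimes> e (label xs)" using Suc.hyps(1)[of z] Suc.prems by auto
  have "z \<noteq> q" using z Suc.prems by auto
  then obtain u r where u: "r \<in> Q" "u = take (length u) r" "2 * length u \<le> length r" "q = z \<otimes> e u" "chord (cyc z r) z q"
    using edge_arc z Suc.prems by (metis order_refl)
  then have "arc u r" by (simp add: arc_def)
  moreover have "light z [(u, r)]" using z u(4) by simp
  ultimately show ?case using xs u(4) Suc z
    by (intro exI[of _ "xs @ [(u, r)]"]) (auto simp: light_append m_assoc)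
qed

sublocale arcgen Q G el S
proof
  fix g assume "g \<in> carrier G"
  then show "\<exists>xs. arc_list xs \<and> e (label xs) = g" using light_path[of \<one> g] by auto
qed

lemma arc_len_dX: "p \<in> carrier G \<Longrightarrow> q \<in> carrier G \<Longrightarrow> arc_len (inv p \<otimes> q) \<le> dX p q"
proof -
  assume pq: "p \<in> carrier G" "q \<in> carrier G"
  then obtain xs where xs: "arc_list xs" "length xs \<le> dX p q" "q = p \<otimes> e (label xs)" using light_path by blast
  then have "inv p \<otimes> q = e (label xs)" using pq by simp
  then show ?thesis using arc_len_le[OF xs(1)] xs(2) by simp
qed

lemma light_split: "light p (as @ (u, r) # bs) \<Longrightarrow> p \<in> carrier G \<Longrightarrow> dX (p \<otimes> e (label as)) (p \<otimes> e (label as) \<otimes> e u) \<le> 1"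
  by (simp add: light_append)

lemma dX_lip:
  assumes "c \<in> carrier G" "p \<in> carrier G" "q \<in> carrier G"
  shows "\<bar>real (dX c q) - real (dX c p)\<bar> \<le> real (dX p q)"
  using d_tri[of c p q] d_tri[of c q p] d_sym[of p q] assms by simp

text \<open>On the cycle of the heavy arc the cochain is the differential of the distance from the start of the
  arc, and elsewhere it only sees steps of length at most 1.  Hence the large value of the heavy arc can
  only be compensated by another arc on the same cycle.\<close>

theorem heavy:
  assumes t: "tight xs" and i: "i < length xs" and g: "g \<in> carrier G"
    and k: "dX \<one> g \<le> k" "dX (e (label xs)) (g \<otimes> e (label xs)) \<le> k"
    and far: "24 * (length xs + k) < dX (e (label (take i xs))) (e (label (take (Suc i) xs)))"
  shows "\<exists>j<length xs. g \<in> shared xs i j"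
proof (rule ccontr)
  assume none: "\<not> ?thesis"
  define h where "h = e (label xs)"
  define c0 where "c0 = e (label (take i xs))"
  obtain u r where ur: "xs ! i = (u, r)" by force
  define C0 where "C0 = cyc c0 r"
  define f where "f q = real (dX c0 q)" for q
  define near where "near p q \<longleftrightarrow> p \<in> carrier G \<and> q \<in> carrier G \<and> dX p q \<le> 1" for p q
  \<comment> \<open>Pieces are labels of generators, so a step along a piece is \<open>near\<close>
    and has the same value on every cycle, as a filling cochain must.\<close>
  define \<omega> where "\<omega> c p q = (if c = C0 \<or> near p q then f q - f p else 0)" for c p q
  have near_sym: "near p q \<longleftrightarrow> near q p" for p q using d_sym[of p q] by (auto simp: near_def)
  have anti: "\<omega> c p q = - \<omega> c q p" for c p q using near_sym[of p q] by (simp add: \<omega>_def)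
  have cc: "c0 \<in> carrier G" by (simp add: c0_def)
  have nb: "\<bar>f q - f p\<bar> \<le> 1" if "near p q" for p q
    using dX_lip[OF cc, of p q] that by (simp add: near_def f_def)
  have small: "\<bar>\<omega> c p q\<bar> \<le> 1" if "c \<noteq> C0 \<or> near p q" for c p q
    using that nb[of p q] by (auto simp: \<omega>_def)
  interpret fl: filling Q G el S \<omega> "\<lambda>_ _ _. True" 1
  proof
    fix r1 r2 p u assume a: "r1 \<in> Q" "r2 \<in> Q" "p \<in> carrier G" "cyc p r1 \<noteq> cyc p r2" "prefix u r1" "prefix u r2"
    then have "u \<in> Xs" using X_piece[of r1 r2 u] by (auto simp: Xs_def)
    then have "near p (p \<otimes> e u)" unfolding near_def using dX_le1_iff[of p "p \<otimes> e u"] a(3) by auto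
    then show "True \<and> True \<and> \<omega> (cyc p r1) p (p \<otimes> e u) = \<omega> (cyc p r2) p (p \<otimes> e u)" by (simp add: \<omega>_def)
  next
    fix p r t l assume s: "seq \<omega> (\<lambda>_ _ _. True) (cyc p r) p p t l"
    have other: "seq \<omega> (\<lambda>_ _ _. True) c p q t l \<Longrightarrow> c \<noteq> C0 \<Longrightarrow> \<bar>t\<bar> \<le> real l" for c q t l
    proof (induction rule: seq.induct)
      case (step q t l q')
      then show ?case using small[of c q q'] by simp
    qed simp
    have main: "seq \<omega> (\<lambda>_ _ _. True) c p q t l \<Longrightarrow> c = C0 \<Longrightarrow> t = f q - f p" for c q t l
      by (induction rule: seq.induct) (simp_all add: \<omega>_def)
    show "\<bar>t\<bar> \<le> 1 * real l"
    proof (cases "cyc p r = C0")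
      case True
      then show ?thesis using main[OF s] by simp
    next
      case False
      then show ?thesis using other[OF s] by simp
    qed
  next
    show "\<omega> c p q = - \<omega> c q p" for c p q by (rule anti)
  qed simp_all
  have arc_list: "arc_list xs" using t by (simp add: tight_def)
  have h: "h \<in> carrier G" by (simp add: h_def)
  obtain \<beta>1 where b1: "arc_list \<beta>1" "light h \<beta>1" "length \<beta>1 \<le> dX h (g \<otimes> h)" "g \<otimes> h = h \<otimes> e (label \<beta>1)"
    using light_path[OF h m_closed[OF g h]] by blast
  obtain \<beta>2 where b2: "arc_list \<beta>2" "light g \<beta>2" "length \<beta>2 \<le> dX g \<one>" "\<one> = g \<otimes> e (label \<beta>2)"
    using light_path[OF g one_closed] by blast
  have len: "length \<beta>1 \<le> k" "length \<beta>2 \<le> k"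
    using b1(3) b2(3) k d_sym[of g \<one>] g unfolding h_def by simp_all
  have lb: "\<bar>path_value \<omega> p \<beta>\<bar> \<le> real (length \<beta>)" if "light p \<beta>" "p \<in> carrier G" for p \<beta>
  proof (rule path_value_bound[OF that(2)], intro allI impI)
    fix as u r bs assume "\<beta> = as @ (u, r) # bs"
    then have "near (p \<otimes> e (label as)) (p \<otimes> e (label as) \<otimes> e u)" using light_split that by (simp add: near_def)
    then show "\<bar>\<omega> (cyc (p \<otimes> e (label as)) r) (p \<otimes> e (label as)) (p \<otimes> e (label as) \<otimes> e u)\<bar> \<le> 1" using small by blast
  qed
  \<comment> \<open>From 1 along \<open>xs\<close> to \<open>h\<close>, across to its translate,
    back along the translated path to \<open>g\<close>, and home to 1.\<close>
  let ?loop = "xs @ \<beta>1 @ inv_arcs xs @ \<beta>2"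
  have "e (label ?loop) = h \<otimes> e (label \<beta>1) \<otimes> inv h \<otimes> e (label \<beta>2)" by (simp add: h_def m_assoc)
  also have "\<dots> = g \<otimes> e (label \<beta>2)" using h g by (simp add: b1(4)[symmetric] m_assoc)
  finally have e1: "e (label ?loop) = \<one>" using b2(4) by simp
  have "\<bar>path_value \<omega> \<one> ?loop\<bar> \<le> 11 * 1 * real (length ?loop)"
    by (rule fl.loop_sv[OF _ one_closed _ e1]) (use arc_list b1 b2 in simp_all)
  moreover have "path_value \<omega> \<one> ?loop = path_value \<omega> \<one> xs + path_value \<omega> h \<beta>1 + path_value \<omega> (g \<otimes> h) (inv_arcs xs) + path_value \<omega> g \<beta>2"
  proof -
    have "g \<otimes> h \<otimes> inv h = g" using g h by (simp add: m_assoc)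
    then show ?thesis using g h by (simp add: path_value_append m_assoc h_def b1(4)[unfolded h_def, symmetric])
  qed
  moreover have "path_value \<omega> (g \<otimes> h) (inv_arcs xs) = - path_value \<omega> g xs" unfolding h_def by (rule path_value_inva[OF _ arc_list g], intro allI, rule anti)
  moreover have "\<bar>path_value \<omega> g xs\<bar> \<le> real (length xs)"
  proof (rule path_value_bound[OF g], intro allI impI)
    fix as v s bs assume xs: "xs = as @ (v, s) # bs"
    have "cyc (g \<otimes> e (label as)) s \<noteq> C0"
    proof
      assume "cyc (g \<otimes> e (label as)) s = C0"
      then have "g \<in> shared xs i (length as)" using xs ur g by (simp add: shared_def C0_def c0_def)
      then show False using none xs by auto
    qed
    then show "\<bar>\<omega> (cyc (g \<otimes> e (label as)) s) (g \<otimes> e (label as)) (g \<otimes> e (label as) \<otimes> e v)\<bar> \<le> 1" using small by blast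
  qed
  moreover have "real (dX c0 (e (label (take (Suc i) xs)))) - real (length xs) \<le> path_value \<omega> \<one> xs"
  proof -
    have x: "xs = take i xs @ (u, r) # drop (Suc i) xs" using id_take_nth_drop[OF i] ur by simp
    define as bs where "as = take i xs" and "bs = drop (Suc i) xs"
    have c0as: "c0 = e (label as)" by (simp add: c0_def as_def)
    have xs: "xs = as @ (u, r) # bs" using x by (simp add: as_def bs_def)
    have ti: "take (Suc i) xs = as @ [(u, r)]" using i ur by (simp add: as_def take_Suc_conv_app_nth)
    have c1: "e (label (take (Suc i) xs)) = c0 \<otimes> e u" by (simp add: ti c0_def as_def)
    have "\<bar>path_value \<omega> \<one> as\<bar> \<le> real (length as)"
    proof (rule path_value_bound[OF one_closed], intro allI impI)
      fix as1 v s bs1 assume a: "as = as1 @ (v, s) # bs1"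
      have "cyc (e (label as1)) s \<noteq> C0"
      proof
        assume c: "cyc (e (label as1)) s = C0"
        have "tight (as1 @ (v, s) # bs1 @ (u, r) # bs)" using t unfolding xs a by simp
        moreover have "cyc (e (label as1)) s = cyc (e (label (as1 @ (v, s) # bs1))) r" using c unfolding C0_def c0as a .
        ultimately show False by (rule tight_distinct_cycles)
      qed
      then show "\<bar>\<omega> (cyc (\<one> \<otimes> e (label as1)) s) (\<one> \<otimes> e (label as1)) (\<one> \<otimes> e (label as1) \<otimes> e v)\<bar> \<le> 1" using small by simp
    qed
    moreover have "\<bar>path_value \<omega> (c0 \<otimes> e u) bs\<bar> \<le> real (length bs)"
    proof (rule path_value_bound, simp add: cc, intro allI impI)
      fix as1 v s bs1 assume a: "bs = as1 @ (v, s) # bs1"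
      have "cyc (c0 \<otimes> e u \<otimes> e (label as1)) s \<noteq> C0"
      proof
        assume c: "cyc (c0 \<otimes> e u \<otimes> e (label as1)) s = C0"
        have "c0 \<otimes> e u \<otimes> e (label as1) = e (label (as @ (u, r) # as1))" by (simp add: c0as m_assoc)
        then have "cyc (e (label (as @ (u, r) # as1))) s = cyc (e (label as)) r" using c unfolding C0_def c0as by (simp only:)
        then have "cyc (e (label as)) r = cyc (e (label (as @ (u, r) # as1))) s" by (rule sym)
        moreover have "tight (as @ (u, r) # as1 @ (v, s) # bs1)" using t unfolding xs a .
        ultimately show False by (rule tight_distinct_cycles[rotated])
      qed
      then show "\<bar>\<omega> (cyc (c0 \<otimes> e u \<otimes> e (label as1)) s) (c0 \<otimes> e u \<otimes> e (label as1)) (c0 \<otimes> e u \<otimes> e (label as1) \<otimes> e v)\<bar> \<le> 1"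
        using small by blast
    qed
    moreover have "path_value \<omega> \<one> xs = path_value \<omega> \<one> as + \<omega> C0 c0 (c0 \<otimes> e u) + path_value \<omega> (c0 \<otimes> e u) bs"
      unfolding xs by (simp add: path_value_append C0_def c0_def as_def[symmetric])
    moreover have "\<omega> C0 c0 (c0 \<otimes> e u) = real (dX c0 (c0 \<otimes> e u))" using cc by (simp add: \<omega>_def f_def)
    moreover have "length xs = length as + length bs + 1" using xs by simp
    ultimately show ?thesis using c1 by simp
  qed
  moreover have "\<bar>path_value \<omega> h \<beta>1\<bar> \<le> real k" "\<bar>path_value \<omega> g \<beta>2\<bar> \<le> real k" using lb[OF b1(2) h] lb[OF b2(2) g] len by linarith+
  moreover have "real (length ?loop) \<le> 2 * real (length xs) + 2 * real k" using len by simp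
  \<comment> \<open>11 times the loop of \<open>2 * length xs + 2 * k\<close> arcs, and once more as
    much for the other arcs of both paths and the two bridges: 22 + 2 = 24.\<close>
  ultimately have "real (dX c0 (e (label (take (Suc i) xs)))) \<le> 24 * (real (length xs) + real k)"
    unfolding abs_le_iff mult_1_right distrib_left by linarith
  moreover have "real (24 * (length xs + k)) < real (dX c0 (e (label (take (Suc i) xs))))"
    using far unfolding c0_def of_nat_less_iff .
  ultimately show False by simp
qed

lemma heavy_arc:
  assumes "length xs * B < dX \<one> (e (label xs))"
  shows "\<exists>i<length xs. B < dX (e (label (take i xs))) (e (label (take (Suc i) xs)))"
proof (rule ccontr)
  assume n: "\<not> ?thesis"
  have "dX \<one> (e (label (take i xs))) \<le> i * B" if "i \<le> length xs" for i
    using that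
  proof (induction i)
    case (Suc i)
    have "dX (e (label (take i xs))) (e (label (take (Suc i) xs))) \<le> B" using n Suc.prems by (meson Suc_le_lessD not_less)
    moreover have "dX \<one> (e (label (take (Suc i) xs))) \<le> dX \<one> (e (label (take i xs))) + dX (e (label (take i xs))) (e (label (take (Suc i) xs)))"
      by (rule d_tri) simp_all
    ultimately show ?case using Suc by simp
  qed simp
  from this[of "length xs"] show False using assms by simp
qed

text \<open>If \<open>h\<close> needs at least \<open>m0\<close> arcs, an element is fat and hence
  shared, or it is counted by \<open>card_overlap\<close>. With fewer arcs one of them is long, as
  \<open>M\<close> exceeds \<open>m0 * B\<close>, and \<open>heavy\<close> makes every element
  shared. Fixing the distance to be exactly \<open>M\<close> bounds the number of arcs, and with it
  the number of shared elements.\<close>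

theorem few_translations:
  assumes pf: "power_free n"
  shows "\<exists>M N. \<forall>h\<in>carrier G. dX \<one> h = M \<longrightarrow>
    finite {g \<in> carrier G. dX \<one> g \<le> k \<and> dX h (g \<otimes> h) \<le> k} \<and> card {g \<in> carrier G. dX \<one> g \<le> k \<and> dX h (g \<otimes> h) \<le> k} \<le> N"
proof -
  define m0 where "m0 = 47 * k + 15"
  define B where "B = 24 * (m0 + k)"
  define M where "M = m0 * B + 1"
  define N where "N = M * M * (2 * n) + (25 * k + 9) * n"
  have "finite A \<and> card A \<le> N" if h: "h \<in> carrier G" "dX \<one> h = M"
    and A: "A = {g \<in> carrier G. dX \<one> g \<le> k \<and> dX h (g \<otimes> h) \<le> k}" for h A
  proof -
    obtain xs where xs: "tight xs" "e (label xs) = h" using tight_ex[OF h(1)] by blast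
    have arc_list: "arc_list xs" "length xs = arc_len h" using xs by (auto simp: tight_def)
    have mM: "length xs \<le> M" using arc_len_dX[of \<one> h] h arc_list(2) by simp
    let ?S = "\<Union>i<length xs. \<Union>j<length xs. shared xs i j"
    have S: "finite ?S" "card ?S \<le> M * M * (2 * n)"
    proof -
      have "length xs * length xs * (2 * n) \<le> M * M * (2 * n)" using mM by (intro mult_le_mono) simp_all
      then show "card ?S \<le> M * M * (2 * n)" using card_shared_all[OF pf arc_list(1)] by (meson le_trans)
      show "finite ?S" using card_shared_all[OF pf arc_list(1)] by blast
    qed
    show ?thesis
    proof (cases "length xs < m0")
      case True
      have "length xs * B < dX \<one> (e (label xs))"
      proof -
        have "length xs * B \<le> m0 * B" using True by (intro mult_le_mono1) simp
        then have "length xs * B < M" unfolding M_def by linarith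
        then show ?thesis using xs(2) h(2) by simp
      qed
      then obtain i where i: "i < length xs" "B < dX (e (label (take i xs))) (e (label (take (Suc i) xs)))" using heavy_arc by blast
      have far: "24 * (length xs + k) < dX (e (label (take i xs))) (e (label (take (Suc i) xs)))"
        using i(2) True by (simp add: B_def)
      have "A \<subseteq> ?S"
      proof
        fix g assume "g \<in> A"
        then have g: "g \<in> carrier G" "dX \<one> g \<le> k" "dX h (g \<otimes> h) \<le> k" using A by auto
        have "\<exists>j<length xs. g \<in> shared xs i j" by (rule heavy[OF xs(1) i(1) g(1,2) _ far]) (use xs(2) g(3) in simp)
        then show "g \<in> ?S" using i(1) by blast
      qed
      then have "finite A" "card A \<le> card ?S" using S(1) finite_subset card_mono by blast+
      then show ?thesis using S(2) by (simp add: N_def)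
    next
      case False
      let ?O = "{g \<in> carrier G. arc_len g \<le> k \<and> arc_len (inv (e (label xs)) \<otimes> g \<otimes> e (label xs)) \<le> k \<and> \<not> fat (label xs) g}"
      have O: "finite ?O \<and> card ?O \<le> (25 * k + 9) * n" by (rule card_overlap[OF pf xs(1)]) (use False in \<open>simp add: m0_def\<close>)
      have "A \<subseteq> ?S \<union> ?O"
      proof
        fix g assume "g \<in> A"
        then have g: "g \<in> carrier G" "dX \<one> g \<le> k" "dX h (g \<otimes> h) \<le> k" using A by auto
        have "arc_len g \<le> k" using arc_len_dX[of \<one> g] g by simp
        moreover have "arc_len (inv h \<otimes> g \<otimes> h) \<le> k" using arc_len_dX[of h "g \<otimes> h"] g h by (simp add: m_assoc)
        ultimately show "g \<in> ?S \<union> ?O" using fat_shared[OF xs(1) g(1)] xs(2) g(1) by blast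
      qed
      moreover have "finite (?S \<union> ?O)" using S O by simp
      moreover have "card (?S \<union> ?O) \<le> N" using card_Un_le[of ?S ?O] S(2) O by (simp add: N_def)
      ultimately show ?thesis using finite_subset card_mono by (meson le_trans)
    qed
  qed
  then show ?thesis by blast
qed

end

section \<open>Power-freeness and acylindricity for thin cones\<close>

context cone_pres
begin

lemma free_pow: "z [^]\<^bsub>F\<^esub> (k::nat) = reduce (concat (replicate k z))"
proof (induction k)
  case 0
  then show ?case by (simp add: free_group_def reduce_def)
next
  case (Suc k)
  have "z [^]\<^bsub>F\<^esub> Suc k = reduce (concat (replicate k z) @ z)"
    using Suc by (simp add: free_group_def reduce_append_reduce)
  also have "concat (replicate k z) @ z = concat (replicate (Suc k) z)"
    using arg_cong[OF replicate_append_same[of k z], of concat] by simp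
  finally show ?case .
qed

lemma uniformly_power_free_power_free:
  assumes "uniformly_power_free S R" shows "\<exists>n. power_free n"
proof -
  obtain n :: nat where n: "\<forall>x\<in>carrier F - {\<one>\<^bsub>F\<^esub>}. x [^]\<^bsub>F\<^esub> n \<notin> rel_prefixes S R"
    using assms unfolding uniformly_power_free_def by blast
  have one: "\<one>\<^bsub>F\<^esub> = []" by (simp add: free_group_def)
  have "power_free n"
    unfolding power_free_def
  proof (intro ballI allI impI notI)
    fix r z assume r: "r \<in> Q" and z: "z \<noteq> []" and p: "prefix (concat (replicate n z)) r"
    have sub: "u \<in> carrier F" if "prefix u r" for u
      using red[OF r] Q_S[OF r] that set_mono_prefix[OF that] by (auto simp: free_group_def prefix_def reduced_append image_Un)
    have rp: "u \<in> rel_prefixes S R" if "prefix u r" for u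
      unfolding rel_prefixes_iff using r that by (auto simp: Q_def)
    show False
    proof (cases n)
      case 0
      have "prefix [hd r] r" using ne[OF r] by (cases r) auto
      then have "[hd r] \<in> carrier F - {\<one>\<^bsub>F\<^esub>}" using sub one by simp
      from n[rule_format, OF this] have "[] \<notin> rel_prefixes S R" using 0 by (simp add: one)
      then show False using rp[of "[]"] by simp
    next
      case (Suc m)
      then have "prefix z (concat (replicate n z))" by simp
      then have "prefix z r" using p by (rule prefix_order.trans)
      then have zF: "z \<in> carrier F - {\<one>\<^bsub>F\<^esub>}" using sub z one by simp
      \<comment> \<open>As a prefix of a relator the plain power is already reduced, so it equals
        the power in the free group.\<close>
      have "reduced (concat (replicate n z))" using sub[OF p] by (simp add: free_group_def)
      then have "z [^]\<^bsub>F\<^esub> n = concat (replicate n z)" by (simp add: free_pow reduce_reduced)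
      then show False using n[rule_format, OF zF] rp[OF p] by simp
    qed
  qed
  then show ?thesis by blast
qed

text \<open>The translate of \<open>u\<close> is almost as close to \<open>x\<close> and to
  \<open>y\<close> as \<open>u\<close> itself. The four-point condition based at \<open>u\<close>,
  where the product of \<open>x\<close> and \<open>y\<close> is 0, therefore bounds the
  displacement.\<close>

lemma translate_middle:
  assumes hyp: "delta_hyperbolic \<delta>' (carrier G) rd" and xy: "x \<in> carrier G" "y \<in> carrier G" and u: "u \<in> carrier G"
    and mid: "dX x y = dX x u + dX u y" and g: "g \<in> carrier G"
    and near: "dX x (g \<otimes>\<^bsub>G\<^esub> x) \<le> \<epsilon>" "dX y (g \<otimes>\<^bsub>G\<^esub> y) \<le> \<epsilon>"
  shows "rd u (g \<otimes>\<^bsub>G\<^esub> u) \<le> real \<epsilon> + 2 * \<delta>'"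
proof -
  let ?v = "g \<otimes>\<^bsub>G\<^esub> u"
  have v: "?v \<in> carrier G" using g u by simp
  have "gromov_product rd u x y \<ge> min (gromov_product rd u x ?v) (gromov_product rd u ?v y) - \<delta>'"
    using hyp xy u v unfolding delta_hyperbolic_def by blast
  moreover have "gromov_product rd u x y = 0" using mid d_sym[of y u] xy u by (simp add: gromov_product_def)
  moreover have "rd x ?v \<le> real \<epsilon> + rd x u"
    using d_tri[of x "g \<otimes>\<^bsub>G\<^esub> x" ?v] dist_left[of g x u] near(1) xy u g v by simp
  moreover have "rd ?v y \<le> real \<epsilon> + rd u y"
    using d_tri[of ?v "g \<otimes>\<^bsub>G\<^esub> y" y] dist_left[of g u y] d_sym[of "g \<otimes>\<^bsub>G\<^esub> y" y] near(2) xy u g v by simp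
  moreover have "rd ?v u = rd u ?v" "rd y u = rd u y" using d_sym u v xy by simp_all
  ultimately show ?thesis unfolding gromov_product_def min_def by (auto split: if_splits)
qed

text \<open>Replace \<open>y\<close> by the point at distance \<open>M\<close> from \<open>x\<close>
  on a geodesic, which \<open>g\<close> also moves by a bounded amount. Conjugation by
  \<open>x\<close> then brings the base point to 1, where \<open>few_translations\<close>
  applies.\<close>

theorem acylindrical_cone:
  assumes "uniformly_power_free S R"
  shows "acylindrical_cayley G (e ` X)"
proof (rule acylindrical_vertices)
  fix \<epsilon> :: nat
  obtain n where pf: "power_free n" using uniformly_power_free_power_free[OF assms] by blast
  obtain \<delta>' where hyp: "delta_hyperbolic \<delta>' (carrier G) rd"
    using hyperbolic_cone hyperbolic_verts unfolding hyperbolic_cayley_def hyperbolic_def by auto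
  define k where "k = \<epsilon> + nat \<lceil>2 * \<delta>'\<rceil>"
  have k: "real \<epsilon> + 2 * \<delta>' \<le> real k" "\<epsilon> \<le> k" unfolding k_def by linarith+
  let ?B = "\<lambda>h. {g \<in> carrier G. dX \<one>\<^bsub>G\<^esub> g \<le> k \<and> dX h (g \<otimes>\<^bsub>G\<^esub> h) \<le> k}"
  obtain M N where MN: "\<forall>h\<in>carrier G. dX \<one>\<^bsub>G\<^esub> h = M \<longrightarrow> finite (?B h) \<and> card (?B h) \<le> N"
    using few_translations[OF pf] by blast
  let ?A = "\<lambda>x y. {g \<in> carrier G. dX x (g \<otimes>\<^bsub>G\<^esub> x) \<le> \<epsilon> \<and> dX y (g \<otimes>\<^bsub>G\<^esub> y) \<le> \<epsilon>}"
  have "finite (?A x y) \<and> card (?A x y) \<le> N" if xy: "x \<in> carrier G" "y \<in> carrier G" "M \<le> dX x y" for x y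
  proof -
    obtain p where p: "geodesic p (dX x y)" "p 0 = x" "p (dX x y) = y" using geodesic_exists[of x y] xy by auto
    define u where "u = p M"
    have u: "u \<in> carrier G" "dX x u = M" "dX u y = dX x y - M"
    proof -
      show "u \<in> carrier G" using p(1) xy(3) unfolding geodesic_def u_def by auto
      have "dX (p 0) (p M) = M" "dX (p M) (p (dX x y)) = dX x y - M" using p(1) xy(3) unfolding geodesic_def by auto
      then show "dX x u = M" "dX u y = dX x y - M" using p(2,3) by (simp_all add: u_def)
    qed
    define h where "h = inv\<^bsub>G\<^esub> x \<otimes>\<^bsub>G\<^esub> u"
    have h: "h \<in> carrier G" "x \<otimes>\<^bsub>G\<^esub> h = u" using xy u by (simp_all add: h_def)
    have hM: "dX \<one>\<^bsub>G\<^esub> h = M" using dist_left[of x "\<one>\<^bsub>G\<^esub>" h] h u(2) xy by simp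
    let ?\<phi> = "\<lambda>g. inv\<^bsub>G\<^esub> x \<otimes>\<^bsub>G\<^esub> g \<otimes>\<^bsub>G\<^esub> x"
    have inj: "inj_on ?\<phi> (?A x y)"
      by (rule inj_onI) (use xy in \<open>simp add: m_assoc\<close>)
    have "?\<phi> ` ?A x y \<subseteq> ?B h"
    proof
      fix g' assume "g' \<in> ?\<phi> ` ?A x y"
      then obtain g where g: "g \<in> carrier G" "dX x (g \<otimes>\<^bsub>G\<^esub> x) \<le> \<epsilon>" "dX y (g \<otimes>\<^bsub>G\<^esub> y) \<le> \<epsilon>" "g' = ?\<phi> g" by blast
      have "dX \<one>\<^bsub>G\<^esub> g' = dX x (g \<otimes>\<^bsub>G\<^esub> x)"
        using dist_left[of x "\<one>\<^bsub>G\<^esub>" g'] g xy by (simp add: m_assoc)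
      moreover have "dX h (g' \<otimes>\<^bsub>G\<^esub> h) = dX u (g \<otimes>\<^bsub>G\<^esub> u)"
      proof -
        have "x \<otimes>\<^bsub>G\<^esub> (g' \<otimes>\<^bsub>G\<^esub> h) = g \<otimes>\<^bsub>G\<^esub> u" using g xy h by (simp add: m_assoc flip: h(2))
        then show ?thesis using dist_left[of x h "g' \<otimes>\<^bsub>G\<^esub> h"] g xy h by simp
      qed
      moreover have "rd u (g \<otimes>\<^bsub>G\<^esub> u) \<le> real \<epsilon> + 2 * \<delta>'"
        by (rule translate_middle[OF hyp xy(1,2) u(1) _ g(1-3)]) (use u xy(3) in simp)
      then have "dX u (g \<otimes>\<^bsub>G\<^esub> u) \<le> k" using k(1) by linarith
      ultimately show "g' \<in> ?B h" using g k(2) xy by simp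
    qed
    moreover have "finite (?B h) \<and> card (?B h) \<le> N" using MN h(1) hM by blast
    ultimately show ?thesis using inj inj_on_finite card_inj_on_le by (meson le_trans)
  qed
  then show "\<exists>M N. \<forall>x\<in>carrier G. \<forall>y\<in>carrier G. M \<le> dX x y \<longrightarrow> finite (?A x y) \<and> card (?A x y) \<le> N" by blast
qed

end

theorem theorem1:
  fixes S :: "'s set" and R :: "'s word set"
  assumes "presentation S R"
    and "small_cancellation S R (1 / 24)"
  shows "thin_cones S R \<subseteq> hyperbolic_structures (presented_group S R) \<and>
    (uniformly_power_free S R \<longrightarrow>
       thin_cones S R \<subseteq> acyl_hyperbolic_structures (presented_group S R))"
proof -
  let ?G = "presented_group S R"
  have "\<exists>Y. A = gen_class ?G Y \<and> generating_set ?G Y \<and> hyperbolic_cayley ?G Y \<and>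
      (uniformly_power_free S R \<longrightarrow> acylindrical_cayley ?G Y)" if "A \<in> thin_cones S R" for A
  proof -
    obtain X \<delta> where X: "A = gen_class ?G (word_image S R ` X)" "basis_words S \<union> four_pieces S R \<subseteq> X"
      "X \<subseteq> rel_prefixes S R" "\<forall>r\<in>R. delta_hyperbolic \<delta> (realization (cone_graph X r)) (graph_dist (cone_graph X r))"
      using \<open>A \<in> thin_cones S R\<close> unfolding thin_cones_def by blast
    interpret cone_pres S R X \<delta> using assms X by unfold_locales auto
    show ?thesis using X(1) generating hyperbolic_cone acylindrical_cone unfolding image_X by blast
  qed
  then show ?thesis unfolding hyperbolic_structures_def acyl_hyperbolic_structures_def by blast
qed

end
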